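(* Let $N\ge1$, $\Gamma=\Gamma(N)$, let $k\ge2$ and $w=k-2$. Let $\lambda,\mu,\nu\in N^{-1}\mathbb{Z}^2$ satisfy $\lambda+\mu+\nu\equiv(0,0)\pmod{\mathbb{Z}^2}$, and let $a,b,c\in\mathbb{C}$ satisfy $a+b+c=0$. Then for every holomorphic cusp form $f$ of weight $k$ on $\Gamma$ and every $s\in\mathbb{C}$, $$\langle f(z),\,L_{\lambda,\mu,a,b}(z,s)+L_{\mu,\nu,b,c}(z,s)+L_{\nu,\lambda,c,a}(z,s)\rangle_\Gamma=0.$$ In particular, the function $$\sum_{\substack{\ell+m=k\\ \ell,m\ge1}}\bar a^{\ell-1}\bar b^{m-1}E_{\ell,\lambda}(z)E_{m,\mu}(z)+\sum_{\substack{\ell+m=k\\ \ell,m\ge1}}\bar b^{\ell-1}\bar c^{m-1}E_{\ell,\mu}(z)E_{m,\nu}(z)+\sum_{\substack{\ell+m=k\\ \ell,m\ge1}}\bar c^{\ell-1}\bar a^{m-1}E_{\ell,\nu}(z)E_{m,\lambda}(z)$$ is orthogonal (with respect to $\langle\cdot,\cdot\rangle_\Gamma$) to all holomorphic cusp forms of weight $k$ on $\Gamma$.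
   Context: $\mathcal{H}$ is the upper half-plane, $z=x+iy$. For $\lambda\in\mathbb{Q}^2$, an integer $\ell\ge1$ and $s\in\mathbb{C}$, $E_{\ell,\lambda}(z,s)=\sum_{(a,b)\equiv\lambda\bmod\mathbb{Z}^2,\ (a,b)\neq(0,0)}(az+b)^{-\ell}|az+b|^{-s}y^{s/2}$ (absolutely convergent for $\operatorname{Re}s+\ell>2$, and $\Gamma(s/2+\ell)E_{\ell,\lambda}(z,s)$ extends to an entire function of $s$); $E_{\ell,\lambda}(z)=E_{\ell,\lambda}(z,0)$. Petersson inner product: $\langle f,g\rangle_\Gamma=\int_{\Gamma\backslash\mathcal{H}}f(z)\overline{g(z)}y^k\,y^{-2}dx\,dy$. For $w\ge0$ and integers $\ell',m'\ge0$ with $\ell'+m'=w$, $G_{w,\ell',m'}(s)=\Gamma(s+w+1)/(\Gamma(s/2+\ell'+1)\Gamma(s/2+m'+1))$. For $\lambda,\mu\in N^{-1}\mathbb{Z}^2$, $a,b\in\mathbb{C}$, $$L_{\lambda,\mu,a,b}(z,s)=\sum_{\substack{\ell'+m'=w\\ \ell',m'\ge0}}\binom{w}{\ell'}\bigl(G_{w,\ell',m'}(\bar s)\bigr)^{-1}\bar a^{\ell'}\bar b^{m'}E_{\ell'+1,\lambda}(z,\bar s)E_{m'+1,\mu}(z,\bar s),$$ which is defined (anti-holomorphic in $s$) for all $s\in\mathbb{C}$. Convention $0^0=1$. *)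

theory Defs
  imports "HOL-Complex_Analysis.Complex_Analysis" "HOL-Number_Theory.Cong"
begin

definition upper_half_plane :: "complex set" where
  "upper_half_plane = {z. Im z > 0}"


subsection \<open>The group \<open>\<Gamma>(N)\<close> and its cusp forms\<close>

definition SL2Z :: "(int ^ 2 ^ 2) set" where
  "SL2Z = {A. det A = 1}"

definition principal_congruence_subgroup :: "nat \<Rightarrow> (int ^ 2 ^ 2) set" where
  "principal_congruence_subgroup N =
     {A \<in> SL2Z. \<forall>i j. [A $ i $ j = (mat 1 :: int ^ 2 ^ 2) $ i $ j] (mod int N)}"

definition automorphy_factor :: "int ^ 2 ^ 2 \<Rightarrow> complex \<Rightarrow> complex" where
  "automorphy_factor A z = of_int (A $ 2 $ 1) * z + of_int (A $ 2 $ 2)"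

definition moebius :: "int ^ 2 ^ 2 \<Rightarrow> complex \<Rightarrow> complex" where
  "moebius A z = (of_int (A $ 1 $ 1) * z + of_int (A $ 1 $ 2)) / automorphy_factor A z"

definition slash :: "nat \<Rightarrow> int ^ 2 ^ 2 \<Rightarrow> (complex \<Rightarrow> complex) \<Rightarrow> complex \<Rightarrow> complex" where
  "slash k A f z = f (moebius A z) / automorphy_factor A z ^ k"

text \<open>
  Since \<open>\<Gamma>(N)\<close> is normal in \<open>SL\<^sub>2(\<int>)\<close> and contains the translation by \<open>N\<close>, every
  \<open>slash k A f\<close> has period \<open>N\<close>. Vanishing at the cusps says that each of them has a
  Fourier expansion in \<open>exp (2\<pi>iz/N)\<close> with terms of positive index only. The values of
  \<open>f\<close> outside the upper half-plane are irrelevant.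
\<close>

definition cusp_form :: "nat \<Rightarrow> nat \<Rightarrow> (complex \<Rightarrow> complex) \<Rightarrow> bool" where
  "cusp_form N k f \<longleftrightarrow>
     f holomorphic_on upper_half_plane \<and>
     (\<forall>A \<in> principal_congruence_subgroup N. \<forall>z \<in> upper_half_plane. slash k A f z = f z) \<and>
     (\<forall>A \<in> SL2Z. \<exists>q :: nat \<Rightarrow> complex. q 0 = 0 \<and>
        (\<forall>z \<in> upper_half_plane.
           (\<lambda>n. q n * exp (2 * of_real pi * \<i> * of_nat n * z / of_nat N)) sums slash k A f z))"


subsection \<open>The Petersson inner product\<close>

text \<open>
  The elements \<open>1\<close> and \<open>-1\<close> are the only ones acting trivially. A null overlap of translates
  is allowed, so both closed domains and exact sets of representatives qualify.
\<close>

definition fundamental_domain :: "(int ^ 2 ^ 2) set \<Rightarrow> complex set \<Rightarrow> bool" where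
  "fundamental_domain G F \<longleftrightarrow>
     F \<in> sets borel \<and> F \<subseteq> upper_half_plane \<and>
     (\<forall>z \<in> upper_half_plane. \<exists>A \<in> G. moebius A z \<in> F) \<and>
     (\<forall>A \<in> G. A \<noteq> mat 1 \<and> A \<noteq> - mat 1 \<longrightarrow> F \<inter> moebius A ` F \<in> null_sets lborel)"

text \<open>
  The integral over \<open>\<Gamma>\<setminus>\<H>\<close> is computed on a fundamental domain \<open>F\<close> of \<open>\<Gamma>\<close>. The measure
  \<open>lborel\<close> on \<^typ>\<open>complex\<close> is \<open>dx dy\<close>. As the library integral of a non-integrable function
  is \<open>0\<close>, absolute convergence is recorded in a predicate of its own.
\<close>

definition petersson_integrand ::
    "nat \<Rightarrow> (complex \<Rightarrow> complex) \<Rightarrow> (complex \<Rightarrow> complex) \<Rightarrow> complex \<Rightarrow> complex" where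
  "petersson_integrand k f g z = f z * cnj (g z) * of_real (Im z ^ k / Im z ^ 2)"

definition petersson_converges ::
    "complex set \<Rightarrow> nat \<Rightarrow> (complex \<Rightarrow> complex) \<Rightarrow> (complex \<Rightarrow> complex) \<Rightarrow> bool" where
  "petersson_converges F k f g \<longleftrightarrow> set_integrable lborel F (petersson_integrand k f g)"

definition petersson ::
    "complex set \<Rightarrow> nat \<Rightarrow> (complex \<Rightarrow> complex) \<Rightarrow> (complex \<Rightarrow> complex) \<Rightarrow> complex" where
  "petersson F k f g = (LINT z:F|lborel. petersson_integrand k f g z)"


subsection \<open>Eisenstein series\<close>

definition integral_vector :: "rat \<times> rat \<Rightarrow> bool" where
  "integral_vector v \<longleftrightarrow> fst v \<in> \<int> \<and> snd v \<in> \<int>"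

text \<open>The lattice \<open>N\<^sup>-\<^sup>1\<int>\<^sup>2\<close>.\<close>

definition torsion_vectors :: "nat \<Rightarrow> (rat \<times> rat) set" where
  "torsion_vectors N = {v. integral_vector (of_nat N * fst v, of_nat N * snd v)}"

definition eisenstein_series :: "nat \<Rightarrow> rat \<times> rat \<Rightarrow> complex \<Rightarrow> complex \<Rightarrow> complex" where
  "eisenstein_series l v z s =
     (\<Sum>\<^sub>\<infinity>(a, b) \<in> {p. integral_vector (p - v) \<and> p \<noteq> (0, 0)}.
        inverse ((of_rat a * z + of_rat b) ^ l) *
        of_real (cmod (of_rat a * z + of_rat b)) powr (- s) *
        of_real (Im z) powr (s / 2))"

text \<open>
  The series converges absolutely only for \<open>Re s + l > 2\<close>; \<open>E\<^sub>l\<^sub>,\<^sub>v(z, s)\<close> denotes its entire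
  continuation in \<open>s\<close>, which is unique by the identity theorem.
\<close>

definition eisenstein :: "nat \<Rightarrow> rat \<times> rat \<Rightarrow> complex \<Rightarrow> complex \<Rightarrow> complex" where
  "eisenstein l v z = (THE g. g holomorphic_on UNIV \<and>
     (\<forall>s. Re s + real l > 2 \<longrightarrow> g s = eisenstein_series l v z s))"

abbreviation eisenstein0 :: "nat \<Rightarrow> rat \<times> rat \<Rightarrow> complex \<Rightarrow> complex" where
  "eisenstein0 l v z \<equiv> eisenstein l v z 0"


subsection \<open>The functions \<open>L\<close>\<close>

definition G_factor :: "nat \<Rightarrow> nat \<Rightarrow> nat \<Rightarrow> complex \<Rightarrow> complex" where
  "G_factor w l m s =
     Gamma (s + of_nat w + 1) / (Gamma (s / 2 + of_nat l + 1) * Gamma (s / 2 + of_nat m + 1))"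

text \<open>
  The sum below is written in the variable \<open>t\<close>, the complex conjugate of \<open>s\<close>. At poles of
  the Gamma factors, where the library sets \<open>Gamma\<close> to \<open>0\<close>, the formula does not make literal
  sense. These singularities are removable because \<open>\<Gamma>(t/2 + l) E\<^sub>l\<^sub>,\<^sub>v(z, t)\<close> extends to an
  entire function of \<open>t\<close>, and \<^const>\<open>remove_sings\<close> supplies the value of the extension there.
\<close>

definition L_fun ::
    "nat \<Rightarrow> rat \<times> rat \<Rightarrow> rat \<times> rat \<Rightarrow> complex \<Rightarrow> complex \<Rightarrow> complex \<Rightarrow> complex \<Rightarrow> complex" where
  "L_fun w u v a b z s =
     remove_sings (\<lambda>t. \<Sum>(l, m) | l + m = w.
        of_nat (w choose l) * inverse (G_factor w l m t) * cnj a ^ l * cnj b ^ m *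
        eisenstein (l + 1) u z t * eisenstein (m + 1) v z t) (cnj s)"

definition L_fun0 ::
    "nat \<Rightarrow> rat \<times> rat \<Rightarrow> rat \<times> rat \<Rightarrow> complex \<Rightarrow> complex \<Rightarrow> complex \<Rightarrow> complex" where
  "L_fun0 k u v a b z =
     (\<Sum>(l, m) | l + m = k \<and> l \<ge> 1 \<and> m \<ge> 1.
        cnj a ^ (l - 1) * cnj b ^ (m - 1) * eisenstein0 l u z * eisenstein0 m v z)"

end

theory Submission
  imports Defs "HOL-Real_Asymp.Real_Asymp"
begin

text \<open>
  For real \<open>t > 2\<close> the cyclic sum of products of Eisenstein series is an absolutely convergent
  sum over pairs \<open>(p, q)\<close> of vectors congruent to \<open>\<lambda>\<close> and \<open>\<mu>\<close>: with \<open>r = - p - q\<close> the three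
  products run over \<open>(p, q)\<close>, \<open>(q, r)\<close> and \<open>(r, p)\<close>. The Petersson product is unfolded along the
  \<open>\<Gamma>(N)\<close>-orbits of these pairs.

  If \<open>p\<close> and \<open>q\<close> are independent, the orbit contributes an integral over the whole half-plane.
  In coordinates adapted to the cusps of \<open>p\<close> and \<open>q\<close> it separates into a beta integral and a line
  integral of \<open>f\<close> times a polynomial of degree \<open>w\<close>, from the cusp of \<open>q\<close> to the cusp of \<open>p\<close>. After
  multiplication by the Gamma factors the beta integrals agree up to sign, so the binomial theorem
  assembles a fixed multiple of \<open>\<integral> f(z) (b p(z) - a q(z))\<^sup>w dz\<close>, where \<open>p(z)\<close> is the linear form of \<open>p\<close>.
  This integrand is invariant under the cyclic shift because \<open>a + b + c = 0\<close> and \<open>p + q + r = 0\<close>;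
  the three integrals form a closed path and cancel. If \<open>p\<close> and \<open>q\<close> are collinear, the orbit
  contributes the constant term of \<open>f\<close> at a cusp, which is zero.

  The Eisenstein series, completed by their Gamma factors, are Mellin transforms of theta series,
  hence entire in \<open>t\<close> and of moderate growth at the cusps. The Petersson product is therefore entire
  in \<open>t\<close> and vanishes identically.
\<close>

section \<open>Integrals and infinite sums\<close>

text \<open>At \<open>s = 0\<close> the series of weight 1 and 2 exist by continuation only, so no
  sum over pairs can be unfolded there; a real \<open>t\<close> in the range of absolute convergence
  regularizes them, as in Hecke's method. The regularization is harmless because of where
  \<open>t\<close> ends up. In the coordinates of two cusps
  \<open>(|p(z)| |q(z)|) powr -t * y powr t\<close> depends only on the transversal coordinate
  \<open>u\<close> and on the determinant of \<open>(p, q)\<close>. The line integral between the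
  cusps does not see \<open>t\<close>, and the determinant is the same for \<open>(p, q)\<close>,
  \<open>(q, r)\<close> and \<open>(r, p)\<close>. For \<open>l + m = w\<close> the transversal
  integrals differ by signs and by the Gamma factors that \<open>G\<close> contains. The same
  factors complete the Eisenstein series, so no poles remain after multiplication. Triples with a
  zero vector cannot simply be dropped: \<open>(0, q, -q)\<close> is absent from two of the three
  double sums but present in the third. It is collinear and disappears with the constant term of
  \<open>f\<close>.\<close>

lemma norm_deriv_le_of_bound:
  fixes f :: "complex \<Rightarrow> complex"
  assumes "f holomorphic_on ball s0 r" "r > 0" "\<And>s. s \<in> ball s0 r \<Longrightarrow> norm (f s) \<le> B"
    and "s \<in> ball s0 (r / 2)"
  shows "norm (deriv f s) \<le> 4 * B / r"
proof -
  have sub: "cball s (r / 4) \<subseteq> ball s0 r"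
  proof
    fix x assume "x \<in> cball s (r/4)"
    then have "dist s x \<le> r/4" by simp
    moreover have "dist s0 s < r/2" using assms(4) by simp
    ultimately show "x \<in> ball s0 r"
      using dist_triangle[of s0 x s] assms(2) by simp
  qed
  then have "norm ((deriv ^^ 1) f s) \<le> fact 1 * B / (r / 4) ^ 1"
  proof (intro Cauchy_inequality)
    show "f holomorphic_on ball s (r/4)"
      using sub ball_subset_cball holomorphic_on_subset[OF assms(1)] by blast
    show "continuous_on (cball s (r/4)) f"
      using sub holomorphic_on_subset[OF assms(1)] holomorphic_on_imp_continuous_on by blast
    show "0 < r/4" using assms(2) by simp
    fix x assume "norm (s - x) = r / 4"
    then have "x \<in> cball s (r/4)" by (simp add: dist_norm)
    then show "norm (f x) \<le> B" using sub assms(3) by blast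
  qed
  then show ?thesis by (simp add: mult.commute)
qed

text \<open>Holomorphy under the integral sign from a majorant of the functions alone: Cauchy's
  estimate turns \<open>B\<close> into the majorant \<open>4 * B / r\<close> of the difference
  quotients on the half ball, and dominated convergence along sequences does the rest.\<close>

lemma
  fixes \<phi> :: "complex \<Rightarrow> 'a \<Rightarrow> complex"
  assumes r: "r > 0"
    and meas: "\<And>s. s \<in> ball s0 r \<Longrightarrow> \<phi> s \<in> borel_measurable M"
    and holo: "\<And>x. x \<in> space M \<Longrightarrow> (\<lambda>s. \<phi> s x) holomorphic_on ball s0 r"
    and bound: "\<And>s x. s \<in> ball s0 r \<Longrightarrow> x \<in> space M \<Longrightarrow> norm (\<phi> s x) \<le> B x"
    and int: "integrable M B"
  shows has_field_derivative_lebesgue_integral: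
      "((\<lambda>s. \<integral>x. \<phi> s x \<partial>M) has_field_derivative (\<integral>x. deriv (\<lambda>s. \<phi> s x) s0 \<partial>M)) (at s0)"
    and integrable_deriv: "integrable M (\<lambda>x. deriv (\<lambda>s. \<phi> s x) s0)"
proof -
  have B0: "0 \<le> B x" if "x \<in> space M" for x
    using bound[of s0 x] that r by (meson centre_in_ball norm_ge_zero order_trans)
  have intphi: "integrable M (\<phi> s)" if "s \<in> ball s0 r" for s
    using that by (intro Bochner_Integration.integrable_bound[OF int meas])
      (auto intro!: AE_I2 order_trans[OF bound] simp: B0)
  have quot: "norm ((\<phi> s x - \<phi> s0 x) / (s - s0)) \<le> 4 * B x / r"
    if "s \<in> ball s0 (r/2)" "s \<noteq> s0" "x \<in> space M" for s x
  proof -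
    have "norm (\<phi> s x - \<phi> s0 x) \<le> 4 * B x / r * norm (s - s0)"
    proof (rule field_differentiable_bound[where S = "ball s0 (r/2)" and f' = "\<lambda>s. deriv (\<lambda>s. \<phi> s x) s"])
      fix z assume z: "z \<in> ball s0 (r/2)"
      have "z \<in> ball s0 r" using z r by auto
      then show "((\<lambda>s. \<phi> s x) has_field_derivative deriv (\<lambda>s. \<phi> s x) z) (at z within ball s0 (r/2))"
        using holomorphic_derivI[OF holo[OF that(3)] open_ball] by simp
      show "norm (deriv (\<lambda>s. \<phi> s x) z) \<le> 4 * B x / r"
        using norm_deriv_le_of_bound[OF holo[OF that(3)] r bound[OF _ that(3)] z] .
    qed (use that r in auto)
    then show ?thesis using that(2) by (simp add: norm_divide field_simps)
  qed
  have main: "(\<lambda>n. \<integral>x. (\<phi> (S n) x - \<phi> s0 x) / (S n - s0) \<partial>M) \<longlonglongrightarrow> (\<integral>x. deriv (\<lambda>s. \<phi> s x) s0 \<partial>M)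
      \<and> integrable M (\<lambda>x. deriv (\<lambda>s. \<phi> s x) s0)"
    if S: "S \<longlonglongrightarrow> s0" "\<And>n. S n \<noteq> s0" "\<And>n. S n \<in> ball s0 (r/2)" for S
  proof -
    have Sr: "S n \<in> ball s0 r" for n using S(3)[of n] r by auto
    have lim: "(\<lambda>n. (\<phi> (S n) x - \<phi> s0 x) / (S n - s0)) \<longlonglongrightarrow> deriv (\<lambda>s. \<phi> s x) s0"
      if "x \<in> space M" for x
    proof -
      have "((\<lambda>s. \<phi> s x) has_field_derivative deriv (\<lambda>s. \<phi> s x) s0) (at s0)"
        using holomorphic_derivI[OF holo[OF that] open_ball] r by simp
      then have "((\<lambda>s. (\<phi> s x - \<phi> s0 x) / (s - s0)) \<longlongrightarrow> deriv (\<lambda>s. \<phi> s x) s0) (at s0)"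
        by (simp add: has_field_derivative_iff)
      then show ?thesis using S(1,2)
        unfolding tendsto_at_iff_sequentially comp_def by auto
    qed
    have m1: "(\<lambda>x. (\<phi> (S n) x - \<phi> s0 x) / (S n - s0)) \<in> borel_measurable M" for n
      using meas[OF Sr[of n]] meas[of s0] r by (intro borel_measurable_divide borel_measurable_diff) auto
    have m2: "(\<lambda>x. deriv (\<lambda>s. \<phi> s x) s0) \<in> borel_measurable M"
      by (rule borel_measurable_LIMSEQ_metric[OF m1 lim])
    note dc = m2 m1
    have w: "integrable M (\<lambda>x. 4 * B x / r)" using int by simp
    show ?thesis
      using integral_dominated_convergence[OF m2 m1 w AE_I2[OF lim]]
        integrable_dominated_convergence[OF m2 m1 w AE_I2[OF lim]] quot[OF S(3) S(2)]
      by auto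
  qed
  \<comment> \<open>Integrability of the derivative is a by-product of \<open>main\<close>, which
    needs some sequence that tends to \<open>s0\<close> without meeting it.\<close>
  define S0 where "S0 n = s0 + of_real (r / 4 / (real n + 1))" for n
  have "(\<lambda>n. r / 4 / (real n + 1)) \<longlonglongrightarrow> 0"
    by (rule real_tendsto_divide_at_top[OF tendsto_const])
      (auto intro!: filterlim_tendsto_add_at_top filterlim_real_sequentially simp: add.commute[of _ 1])
  then have "S0 \<longlonglongrightarrow> s0 + of_real 0"
    unfolding S0_def by (intro tendsto_intros)
  moreover have "S0 n \<noteq> s0" for n
  proof -
    have "r / 4 / (real n + 1) \<noteq> 0" using r by simp
    then show ?thesis unfolding S0_def by (metis add_cancel_right_right of_real_eq_0_iff)
  qed
  moreover have "S0 n \<in> ball s0 (r/2)" for n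
  proof -
    have "r / 4 / (real n + 1) < r / 2" using r by (simp add: field_simps add_pos_nonneg)
    moreover have "norm (complex_of_real (r / 4 / (real n + 1))) = r / 4 / (real n + 1)"
      using r by (simp only: norm_of_real) simp
    ultimately show ?thesis unfolding S0_def by (simp add: dist_norm del: of_real_divide of_real_add)
  qed
  ultimately show "integrable M (\<lambda>x. deriv (\<lambda>s. \<phi> s x) s0)"
    using main[of S0] by simp
  show "((\<lambda>s. \<integral>x. \<phi> s x \<partial>M) has_field_derivative (\<integral>x. deriv (\<lambda>s. \<phi> s x) s0 \<partial>M)) (at s0)"
    unfolding has_field_derivative_iff tendsto_at_iff_sequentially
  proof (intro allI impI)
    fix X :: "nat \<Rightarrow> complex"
    assume X: "\<forall>i. X i \<in> UNIV - {s0}" "X \<longlonglongrightarrow> s0"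
    have "eventually (\<lambda>n. X n \<in> ball s0 (r/2)) sequentially"
      using tendstoD[OF X(2), of "r/2"] r by (simp add: dist_commute)
    then obtain n0 where n0: "\<And>n. n \<ge> n0 \<Longrightarrow> X n \<in> ball s0 (r/2)"
      unfolding eventually_sequentially by blast
    have "(\<lambda>n. \<integral>x. (\<phi> (X (n + n0)) x - \<phi> s0 x) / (X (n + n0) - s0) \<partial>M)
        \<longlonglongrightarrow> (\<integral>x. deriv (\<lambda>s. \<phi> s x) s0 \<partial>M)"
      using X n0 LIMSEQ_ignore_initial_segment[OF X(2), of n0] by (intro conjunct1[OF main]) auto
    moreover have eq: "(\<integral>x. (\<phi> (X (n + n0)) x - \<phi> s0 x) / (X (n + n0) - s0) \<partial>M)
        = ((\<integral>x. \<phi> (X (n + n0)) x \<partial>M) - (\<integral>x. \<phi> s0 x \<partial>M)) / (X (n + n0) - s0)" for n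
    proof -
      have "X (n + n0) \<in> ball s0 r" using n0[of "n+n0"] r by auto
      then show ?thesis
        using intphi[of s0] intphi[of "X (n+n0)"] r by simp
    qed
    ultimately have "(\<lambda>n. ((\<integral>x. \<phi> (X (n + n0)) x \<partial>M) - (\<integral>x. \<phi> s0 x \<partial>M)) / (X (n + n0) - s0))
        \<longlonglongrightarrow> (\<integral>x. deriv (\<lambda>s. \<phi> s x) s0 \<partial>M)" by (simp only: eq)
    then show "((\<lambda>s. ((\<integral>x. \<phi> s x \<partial>M) - (\<integral>x. \<phi> s0 x \<partial>M)) / (s - s0)) \<circ> X)
        \<longlonglongrightarrow> (\<integral>x. deriv (\<lambda>s. \<phi> s x) s0 \<partial>M)"
      unfolding comp_def by (rule LIMSEQ_offset)
  qed
qed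

text \<open>For complex terms unconditional and absolute summability coincide, and in the divergent
  case both sides take the default value 0. The identity therefore holds for every
  \<open>f\<close>.\<close>

lemma infsum_eq_integral_count_space:
  fixes f :: "'a \<Rightarrow> complex"
  shows "infsum f A = (\<integral>x. f x \<partial>count_space A)"
proof (cases "Infinite_Sum.abs_summable_on f A")
  case True
  then have "Infinite_Set_Sum.abs_summable_on f A"
    using abs_summable_equivalent by blast
  then have "infsetsum f A = infsum f A" by (rule infsetsum_infsum)
  then show ?thesis by (simp add: infsetsum_def)
next
  case False
  then have "\<not> integrable (count_space A) f"
    using abs_summable_equivalent[of f A] by (simp add: abs_summable_on_def)
  moreover have "\<not> f summable_on A"
    using False summable_on_iff_abs_summable_on_complex by blast
  ultimately show ?thesis
    by (simp add: not_integrable_integral_eq infsum_not_exists)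
qed

lemma abs_summable_iff_integrable_count_space:
  fixes f :: "'a \<Rightarrow> complex"
  shows "Infinite_Sum.abs_summable_on f A \<longleftrightarrow> integrable (count_space A) f"
  using abs_summable_equivalent[of f A] by (simp add: abs_summable_on_def)

lemma
  fixes \<phi> :: "'i \<Rightarrow> 'a \<Rightarrow> complex"
  assumes sf: "sigma_finite_measure M" and cI: "countable I"
    and meas: "\<And>i. i \<in> I \<Longrightarrow> \<phi> i \<in> borel_measurable M"
    and fin: "(\<integral>\<^sup>+x. (\<integral>\<^sup>+i. ennreal (norm (\<phi> i x)) \<partial>count_space I) \<partial>M) < \<infinity>"
  shows integral_infsum_fubini: "(\<integral>x. (\<Sum>\<^sub>\<infinity>i\<in>I. \<phi> i x) \<partial>M) = (\<Sum>\<^sub>\<infinity>i\<in>I. \<integral>x. \<phi> i x \<partial>M)"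
    and abs_summable_integrals_fubini: "Infinite_Sum.abs_summable_on (\<lambda>i. \<integral>x. \<phi> i x \<partial>M) I"
proof -
  interpret M: sigma_finite_measure M by (rule sf)
  interpret CI: sigma_finite_measure "count_space I"
    by (rule sigma_finite_measure_count_space_countable[OF cI])
  interpret P: pair_sigma_finite "count_space I" M by unfold_locales
  have jm: "(\<lambda>(i, x). \<phi> i x) \<in> borel_measurable (count_space I \<Otimes>\<^sub>M M)"
    by (rule measurable_pair_measure_countable1[OF cI]) (simp add: meas)
  then have jm': "(\<lambda>p. ennreal (norm ((\<lambda>(i, x). \<phi> i x) p))) \<in> borel_measurable (count_space I \<Otimes>\<^sub>M M)"
    by measurable
  have nn: "(\<integral>\<^sup>+i. (\<integral>\<^sup>+x. ennreal (norm (\<phi> i x)) \<partial>M) \<partial>count_space I) < \<infinity>"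
    using P.Fubini'[of "\<lambda>i x. ennreal (norm (\<phi> i x))"] jm' fin by (simp add: case_prod_unfold)
  have joint: "integrable (count_space I \<Otimes>\<^sub>M M) (\<lambda>(i, x). \<phi> i x)"
    unfolding integrable_iff_bounded
    using jm nn M.nn_integral_fst[OF jm'] by (simp add: case_prod_unfold)
  show "(\<integral>x. (\<Sum>\<^sub>\<infinity>i\<in>I. \<phi> i x) \<partial>M) = (\<Sum>\<^sub>\<infinity>i\<in>I. \<integral>x. \<phi> i x \<partial>M)"
    unfolding infsum_eq_integral_count_space by (rule P.Fubini_integral[OF joint])
  have "integrable (count_space I) (\<lambda>i. \<integral>x. \<phi> i x \<partial>M)"
    by (rule P.integrable_fst[OF joint])
  then show "Infinite_Sum.abs_summable_on (\<lambda>i. \<integral>x. \<phi> i x \<partial>M) I"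
    by (simp add: abs_summable_iff_integrable_count_space)
qed

text \<open>Over one period the increment of \<open>Q\<close> is 0, so \<open>deriv Q\<close> is
  bounded by its own variation over a unit segment, hence by a bound for the second derivative. The
  derivative of a periodic function is periodic, so the step iterates and any higher derivative
  controls the first.\<close>

lemma norm_deriv_periodic_le:
  fixes Q :: "complex \<Rightarrow> complex"
  assumes "Q holomorphic_on UNIV" "\<And>z. Q (z + 1) = Q z"
    and "\<And>x. norm ((deriv ^^ Suc k) Q (of_real x)) \<le> B"
  shows "norm (deriv Q (of_real x)) \<le> B"
  using assms
proof (induction k arbitrary: Q x)
  case 0 then show ?case by simp
next
  case (Suc k)
  have hd: "deriv Q holomorphic_on UNIV" using Suc.prems(1) by (simp add: holomorphic_deriv)
  have dQ: "(Q has_field_derivative deriv Q z) (at z)" for z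
    using Suc.prems(1) holomorphic_derivI by blast
  have ddQ: "(deriv Q has_field_derivative deriv (deriv Q) z) (at z)" for z
    using hd holomorphic_derivI by blast
  have per: "deriv Q (z + 1) = deriv Q z" for z
  proof -
    have "((\<lambda>w. Q (w + 1)) has_field_derivative deriv Q (z + 1)) (at z)"
      using DERIV_shift[of Q "deriv Q (z+1)" z 1] dQ by simp
    then have "(Q has_field_derivative deriv Q (z+1)) (at z)"
      using Suc.prems(2) by simp
    then show ?thesis using dQ DERIV_unique by blast
  qed
  have b2: "norm (deriv (deriv Q) (of_real x)) \<le> B" for x
  proof (rule Suc.IH[OF hd per])
    fix x show "norm ((deriv ^^ Suc k) (deriv Q) (of_real x)) \<le> B"
      using Suc.prems(3)[of x] by (simp add: funpow_swap1)
  qed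
  let ?S = "closed_segment (of_real x) (of_real x + 1 :: complex)"
  have seg: "\<exists>t. z = of_real t \<and> x \<le> t \<and> t \<le> x + 1" if z: "z \<in> ?S" for z
  proof -
    have "?S = of_real ` closed_segment x (x + 1)"
      using closed_segment_of_real[of x "x+1"] by simp
    then show ?thesis using z by (auto simp: closed_segment_eq_real_ivl)
  qed
  have lip: "norm (deriv Q z - deriv Q (of_real x)) \<le> B * norm (z - of_real x)" if "z \<in> ?S" for z
    by (rule field_differentiable_bound[where S = ?S and f' = "deriv (deriv Q)"])
      (use that seg b2 ddQ in \<open>auto intro: has_field_derivative_at_within\<close>)
  have B0: "0 \<le> B" using b2[of 0] norm_ge_zero order_trans by blast
  \<comment> \<open>Removing the linear function of slope \<open>deriv Q (of_real x)\<close> leaves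
    a derivative of size at most \<open>B\<close> on the segment, while the increment of
    \<open>R\<close> over the period is exactly minus that slope.\<close>
  define R where "R z = Q z - deriv Q (of_real x) * z" for z
  have "norm (R (of_real x + 1) - R (of_real x)) \<le> B * norm ((of_real x + 1 :: complex) - of_real x)"
  proof (rule field_differentiable_bound[where S = ?S and f' = "\<lambda>z. deriv Q z - deriv Q (of_real x)"])
    fix z assume z: "z \<in> ?S"
    show "(R has_field_derivative deriv Q z - deriv Q (of_real x)) (at z within ?S)"
      unfolding R_def by (auto intro!: derivative_eq_intros has_field_derivative_at_within[OF dQ])
    obtain t where t: "z = of_real t" "x \<le> t" "t \<le> x + 1" using seg[OF z] by blast
    have "norm (z - of_real x) = \<bar>t - x\<bar>" using t by (metis norm_of_real of_real_diff)
    also have "\<dots> \<le> 1" using t by simp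
    finally show "norm (deriv Q z - deriv Q (of_real x)) \<le> B"
      using lip[OF z] mult_left_le[OF _ B0, of "norm (z - of_real x)"] by linarith
  qed auto
  moreover have "R (of_real x + 1) - R (of_real x) = - deriv Q (of_real x)"
    by (simp add: R_def Suc.prems(2) ring_distribs)
  ultimately show ?case by simp
qed

text \<open>Cauchy's inequality of order \<open>k + 1\<close> on a disc of radius \<open>R\<close>
  inside the strip, brought down to the first derivative by periodicity. For large \<open>R\<close>
  the free parameter \<open>k\<close> yields decay of any order in \<open>R\<close>.\<close>

lemma norm_deriv_periodic_strip_le:
  fixes Q :: "complex \<Rightarrow> complex"
  assumes Q: "Q holomorphic_on UNIV" and per: "\<And>z. Q (z + 1) = Q z" and R: "R > 0"
    and bound: "\<And>z. \<bar>Im z\<bar> \<le> R \<Longrightarrow> norm (Q z) \<le> M"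
  shows "norm (deriv Q (of_real x)) \<le> fact (Suc k) * M / R ^ Suc k"
proof (rule norm_deriv_periodic_le[OF Q per])
  fix x
  show "norm ((deriv ^^ Suc k) Q (of_real x)) \<le> fact (Suc k) * M / R ^ Suc k"
  proof (rule Cauchy_inequality)
    fix z :: complex assume "norm (of_real x - z) = R"
    then have "\<bar>Im z\<bar> \<le> R" using abs_Im_le_cmod[of "of_real x - z"] by simp
    then show "norm (Q z) \<le> M" by (rule bound)
  qed (use Q R in \<open>auto intro: holomorphic_on_subset holomorphic_on_imp_continuous_on\<close>)
qed

section \<open>Lattice sums\<close>

definition lin :: "rat \<times> rat \<Rightarrow> complex \<Rightarrow> complex" where
  "lin p z = of_rat (fst p) * z + of_rat (snd p)"

definition vec_coset :: "rat \<times> rat \<Rightarrow> (rat \<times> rat) set" where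
  "vec_coset v = {p. integral_vector (p - v)}"

text \<open>
  Every bound for an Eisenstein series is polynomial in this quantity, and on Siegel sets the decay of a cusp form dominates all its powers.
\<close>

definition height :: "complex \<Rightarrow> real" where
  "height z = 1 + cmod z + 1 / Im z"

lemma height_ge:
  assumes "Im z > 0"
  shows "1 \<le> height z" "cmod z \<le> height z" "1 / Im z \<le> height z" "Im z \<le> height z"
proof -
  have "0 < 1 / Im z" using assms by simp
  then show "1 \<le> height z" "cmod z \<le> height z" "1 / Im z \<le> height z" "Im z \<le> height z"
    unfolding height_def using norm_ge_zero[of z] abs_Im_le_cmod[of z] by linarith+
qed

text \<open>For \<open>w = a z + b\<close> the imaginary part of \<open>w\<close> controls
  \<open>a\<close> at the cost of one factor \<open>height z\<close>; the difference
  \<open>w - a z\<close> then controls \<open>b\<close> at the cost of one more.\<close>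

lemma norm_lin_ge:
  assumes "Im z > 0"
  shows "\<bar>a\<bar> + \<bar>b\<bar> \<le> 2 * height z ^ 2 * cmod (of_real a * z + of_real b)"
proof -
  define w where "w = of_real a * z + of_real b"
  note H = height_ge[OF assms]
  have "Im w = a * Im z" by (simp add: w_def)
  then have a: "\<bar>a\<bar> = \<bar>Im w\<bar> * (1 / Im z)" using assms by (simp add: abs_mult)
  also have "\<dots> \<le> cmod w * height z"
    using H assms by (intro mult_mono abs_Im_le_cmod) auto
  finally have a: "\<bar>a\<bar> \<le> cmod w * height z" .
  have "\<bar>b\<bar> = cmod (w - of_real a * z)" by (simp add: w_def)
  also have "\<dots> \<le> cmod w + \<bar>a\<bar> * cmod z"
    using norm_triangle_ineq4[of w "of_real a * z"] by (simp add: norm_mult)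
  also have "\<dots> \<le> cmod w + cmod w * height z * cmod z"
    using a by (intro add_left_mono mult_right_mono) auto
  finally have b: "\<bar>b\<bar> \<le> cmod w + cmod w * height z * cmod z" .
  have "\<bar>a\<bar> + \<bar>b\<bar> \<le> cmod w * (1 + height z * (1 + cmod z))"
    using a b by (simp add: algebra_simps)
  also have "\<dots> \<le> cmod w * (2 * height z ^ 2)"
  proof (rule mult_left_mono)
    have "1 + cmod z \<le> height z" using assms by (simp add: height_def)
    then have "height z * (1 + cmod z) \<le> height z * height z" using H by (intro mult_left_mono) auto
    moreover have "1 \<le> height z * height z" using H mult_mono[of 1 "height z" 1 "height z"] by simp
    ultimately show "1 + height z * (1 + cmod z) \<le> 2 * height z ^ 2"
      by (simp add: power2_eq_square)
  qed simp
  finally show ?thesis by (simp add: w_def mult.commute)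
qed

lemma of_rat_eq_of_real_of_rat: "(of_rat q :: complex) = of_real (of_rat q)"
  by (cases q) (simp add: of_rat_rat)

lemma norm_lin_ge':
  assumes "Im z > 0"
  shows "\<bar>of_rat (fst p)\<bar> + \<bar>of_rat (snd p)\<bar> \<le> 2 * height z ^ 2 * cmod (lin p z)"
  using norm_lin_ge[OF assms, of "of_rat (fst p)" "of_rat (snd p)"]
  by (simp add: lin_def of_rat_eq_of_real_of_rat)

lemma summable_on_int_powr:
  assumes "s > 1"
  shows "(\<lambda>m::int. (1 + real_of_int \<bar>m\<bar>) powr - s) summable_on UNIV"
proof -
  have "summable (\<lambda>n. real n powr - s)" using assms by (simp add: summable_real_powr_iff)
  then have "summable (\<lambda>n. real (Suc n) powr - s)" by (subst summable_Suc_iff)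
  then have nat: "(\<lambda>n::nat. (1 + real n) powr - s) summable_on UNIV"
    by (intro norm_summable_imp_summable_on) (simp add: add.commute)
  have "(\<lambda>m::int. (1 + real_of_int \<bar>m\<bar>) powr - s) summable_on range int"
    using nat by (subst summable_on_reindex) (auto simp: o_def)
  moreover have "(\<lambda>m::int. (1 + real_of_int \<bar>m\<bar>) powr - s) summable_on range (\<lambda>n. - int n)"
    using nat by (subst summable_on_reindex) (auto simp: o_def inj_def)
  ultimately have "(\<lambda>m::int. (1 + real_of_int \<bar>m\<bar>) powr - s) summable_on range int \<union> range (\<lambda>n. - int n)"
    by (intro summable_on_union)
  moreover have "range int \<union> range (\<lambda>n. - int n) = UNIV"
    by (auto simp: image_iff) (metis int_cases2)
  ultimately show ?thesis by simp
qed

text \<open>Half of the exponent goes to each variable: \<open>1 + |m| + |n|\<close> is at least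
  \<open>1 + |m|\<close> and at least \<open>1 + |n|\<close>, and \<open>s / 2 > 1\<close> makes
  both one-dimensional sums converge.\<close>

lemma summable_on_int_pair_powr:
  assumes "s > 2"
  shows "(\<lambda>(m::int, n::int). (1 + real_of_int \<bar>m\<bar> + real_of_int \<bar>n\<bar>) powr - s) summable_on UNIV"
proof -
  let ?g = "\<lambda>m::int. (1 + real_of_int \<bar>m\<bar>) powr - (s / 2)"
  have g: "Infinite_Sum.abs_summable_on ?g UNIV"
    using summable_on_int_powr[of "s/2"] assms by simp
  have "(\<lambda>(m, n). ?g m * ?g n) summable_on UNIV \<times> UNIV"
  proof (rule summable_on_SigmaI)
    show "((\<lambda>n. case (m, n) of (m, n) \<Rightarrow> ?g m * ?g n) has_sum ?g m * infsum ?g UNIV) UNIV" for m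
      using g by (auto intro!: has_sum_cmult_right has_sum_infsum)
    show "(\<lambda>m. ?g m * infsum ?g UNIV) summable_on UNIV"
      using g by (auto intro!: summable_on_cmult_left)
  qed auto
  then have "(\<lambda>(m, n). ?g m * ?g n) summable_on UNIV" by simp
  then show ?thesis
  proof (rule summable_on_comparison_test)
    fix x :: "int \<times> int"
    obtain m n where x: "x = (m, n)" by (cases x)
    let ?a = "real_of_int \<bar>m\<bar>" and ?b = "real_of_int \<bar>n\<bar>"
    have "(1 + ?a + ?b) powr - s = (1 + ?a + ?b) powr - (s/2) * (1 + ?a + ?b) powr - (s/2)"
      by (simp add: powr_add[symmetric])
    also have "\<dots> \<le> ?g m * ?g n"
      using assms by (intro mult_mono powr_mono2') auto
    finally show "(case x of (m, n) \<Rightarrow> (1 + real_of_int \<bar>m\<bar> + real_of_int \<bar>n\<bar>) powr - s)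
        \<le> (case x of (m, n) \<Rightarrow> ?g m * ?g n)"
      by (simp add: x)
  qed auto
qed

definition shift_pair :: "rat \<times> rat \<Rightarrow> int \<times> int \<Rightarrow> rat \<times> rat" where
  "shift_pair v p = (fst v + of_int (fst p), snd v + of_int (snd p))"

lemma bij_betw_shift_pair: "bij_betw (shift_pair v) UNIV (vec_coset v)"
proof -
  have "inj (shift_pair v)" by (auto simp: inj_def shift_pair_def prod_eq_iff)
  moreover have "range (shift_pair v) = vec_coset v"
  proof (intro set_eqI iffI)
    fix p assume "p \<in> vec_coset v"
    then obtain m n where "fst p - fst v = of_int m" "snd p - snd v = of_int n"
      by (auto simp: vec_coset_def integral_vector_def elim!: Ints_cases)
    then have "p = shift_pair v (m, n)" by (simp add: shift_pair_def prod_eq_iff algebra_simps)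
    then show "p \<in> range (shift_pair v)" by blast
  qed (auto simp: shift_pair_def vec_coset_def integral_vector_def)
  ultimately show ?thesis by (simp add: bij_betw_def)
qed

lemma countable_vec_coset [simp]: "countable (vec_coset v)"
  using bij_betw_shift_pair[of v] by (metis bij_betw_def countable_image countableI_type)

text \<open>The coordinates in a coset of a rational vector have a common denominator, so its
  nonzero vectors stay away from the origin. This lets additive constants be absorbed into a
  multiple of the size of \<open>p\<close> when a coset is compared with the integer
  lattice.\<close>

lemma vec_coset_gap:
  obtains \<epsilon> :: real where "\<epsilon> > 0" "\<epsilon> \<le> 1"
    "\<And>p. p \<in> vec_coset v \<Longrightarrow> p \<noteq> (0, 0) \<Longrightarrow> \<epsilon> \<le> \<bar>of_rat (fst p)\<bar> + \<bar>of_rat (snd p)\<bar>"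
proof -
  obtain a1 b1 where v1: "fst v = Rat.Fract a1 b1" "b1 > 0" by (cases "fst v") auto
  obtain a2 b2 where v2: "snd v = Rat.Fract a2 b2" "b2 > 0" by (cases "snd v") auto
  define N where "N = real_of_int (b1 * b2)"
  have "0 < b1 * b2" using v1(2) v2(2) by simp
  then have "1 \<le> b1 * b2" by linarith
  then have N: "N \<ge> 1" unfolding N_def by (simp only: of_int_1_le_iff)
  have int: "N * of_rat (fst p) \<in> \<int> \<and> N * of_rat (snd p) \<in> \<int>" if p: "p \<in> vec_coset v" for p
  proof -
    obtain m n where mn: "fst p = fst v + of_int m" "snd p = snd v + of_int n"
      using p bij_betw_imp_surj_on[OF bij_betw_shift_pair[of v]] unfolding shift_pair_def
      by (smt (verit) fst_conv imageE snd_conv)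
    have e1: "(of_rat (fst p)::real) = of_int a1 / of_int b1 + of_int m"
      using mn v1 by (simp add: of_rat_add of_rat_rat)
    have e2: "(of_rat (snd p)::real) = of_int a2 / of_int b2 + of_int n"
      using mn v2 by (simp add: of_rat_add of_rat_rat)
    have "N * of_rat (fst p) = of_int (b2 * (a1 + b1 * m))"
         "N * of_rat (snd p) = of_int (b1 * (a2 + b2 * n))"
      unfolding e1 e2 N_def using v1(2) v2(2) by (simp_all add: field_simps)
    then show ?thesis by (metis Ints_of_int)
  qed
  show ?thesis
  proof
    show "1 / N > 0" "1 / N \<le> 1" using N by auto
    fix p assume p: "p \<in> vec_coset v" "p \<noteq> (0, 0)"
    have big: "1 / N \<le> \<bar>x\<bar>" if "N * x \<in> \<int>" "x \<noteq> 0" for x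
    proof -
      have "1 \<le> \<bar>N * x\<bar>" using that N by (intro Ints_nonzero_abs_ge1) auto
      then show ?thesis using N by (simp add: abs_mult field_simps)
    qed
    show "1 / N \<le> \<bar>of_rat (fst p)\<bar> + \<bar>of_rat (snd p)\<bar>"
    proof (cases "fst p = 0")
      case True
      then have "snd p \<noteq> 0" using p(2) by (auto simp: prod_eq_iff)
      then show ?thesis using big[of "of_rat (snd p)"] int[OF p(1)] True by simp
    next
      case False
      then show ?thesis using big[of "of_rat (fst p)"] int[OF p(1)] by (smt (verit) of_rat_eq_0_iff)
    qed
  qed
qed

lemma lin_power_sum_bound:
  assumes s: "s > 2"
  obtains C where "C \<ge> 0"
    "\<And>z. Im z > 0 \<Longrightarrow> (\<lambda>p. cmod (lin p z) powr - s) summable_on (vec_coset v - {(0,0)})"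
    "\<And>z. Im z > 0 \<Longrightarrow> (\<Sum>\<^sub>\<infinity>p\<in>vec_coset v - {(0,0)}. cmod (lin p z) powr - s) \<le> C * height z powr (2 * s)"
proof -
  obtain \<epsilon> where eps: "\<epsilon> > 0" "\<epsilon> \<le> 1"
    and gap: "\<And>p. p \<in> vec_coset v \<Longrightarrow> p \<noteq> (0, 0) \<Longrightarrow> \<epsilon> \<le> \<bar>of_rat (fst p)\<bar> + \<bar>of_rat (snd p) :: real\<bar>"
    using vec_coset_gap by blast
  \<comment> \<open>Chosen so that \<open>1 + |m| + |n|\<close> is at most \<open>K\<close> times
    the l1-norm of the vector with integer offset \<open>(m, n)\<close>: by the gap this norm
    divided by \<open>\<epsilon>\<close> is at least 1, which absorbs the offset by \<open>v\<close>
    and the summand 1.\<close>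
  define K where "K = 1 + (1 + \<bar>of_rat (fst v)\<bar> + \<bar>of_rat (snd v) :: real\<bar>) / \<epsilon>"
  have K1: "K \<ge> 1" using eps by (simp add: K_def)
  let ?h = "\<lambda>(m::int, n::int). (1 + real_of_int \<bar>m\<bar> + real_of_int \<bar>n\<bar>) powr - s"
  define h where "h p = ?h (inv_into UNIV (shift_pair v) p)" for p
  have hs: "h summable_on vec_coset v"
  proof -
    have "(\<lambda>x. h (shift_pair v x)) summable_on UNIV"
      using summable_on_int_pair_powr[OF s] bij_betw_shift_pair[of v]
      by (simp add: h_def bij_betw_def)
    then show ?thesis using summable_on_reindex_bij_betw[OF bij_betw_shift_pair[of v], of h] by simp
  qed
  have h0: "h p \<ge> 0" for p by (auto simp: h_def split: prod.split)
  have hs': "h summable_on vec_coset v - {(0,0)}"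
    by (rule summable_on_subset_banach[OF hs]) auto
  have bnd: "cmod (lin p z) powr - s \<le> (2 * K) powr s * height z powr (2 * s) * h p"
    if z: "Im z > 0" and p: "p \<in> vec_coset v - {(0,0)}" for p z
  proof -
    obtain x where "p = shift_pair v x"
      using p bij_betw_imp_surj_on[OF bij_betw_shift_pair[of v]] by blast
    then obtain m n where mn: "p = shift_pair v (m, n)" by (cases x) auto
    have hp: "h p = (1 + real_of_int \<bar>m\<bar> + real_of_int \<bar>n\<bar>) powr - s"
      using bij_betw_shift_pair[of v] by (simp add: h_def mn bij_betw_def)
    define P where "P = \<bar>of_rat (fst p)\<bar> + \<bar>of_rat (snd p) :: real\<bar>"
    have P: "\<epsilon> \<le> P" using gap[of p] p by (auto simp: P_def)
    have "real_of_int \<bar>m\<bar> + real_of_int \<bar>n\<bar> \<le> P + (\<bar>of_rat (fst v)\<bar> + \<bar>of_rat (snd v) :: real\<bar>)"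
      unfolding P_def mn shift_pair_def fst_conv snd_conv of_rat_add of_rat_of_int_eq of_int_abs by linarith
    then have "1 + real_of_int \<bar>m\<bar> + real_of_int \<bar>n\<bar> \<le> P + (1 + \<bar>of_rat (fst v)\<bar> + \<bar>of_rat (snd v) :: real\<bar>)"
      by simp
    also have "\<dots> \<le> P + (1 + \<bar>of_rat (fst v)\<bar> + \<bar>of_rat (snd v) :: real\<bar>) * (P / \<epsilon>)"
    proof -
      have "1 \<le> P / \<epsilon>" using P eps by simp
      moreover have "1 + \<bar>of_rat (fst v)\<bar> + \<bar>of_rat (snd v) :: real\<bar> \<ge> 0"
        by (smt (verit) abs_ge_zero)
      ultimately show ?thesis
        using mult_left_mono[of 1 "P / \<epsilon>" "1 + \<bar>of_rat (fst v)\<bar> + \<bar>of_rat (snd v) :: real\<bar>"]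
        by (simp only: mult_1_right add_le_cancel_left)
    qed
    also have "\<dots> = K * P" using eps by (simp add: K_def field_simps)
    also have "\<dots> \<le> K * (2 * height z ^ 2 * cmod (lin p z))"
      using norm_lin_ge'[OF z, of p] K1 by (intro mult_left_mono) (auto simp: P_def)
    finally have le: "1 + real_of_int \<bar>m\<bar> + real_of_int \<bar>n\<bar> \<le> (2 * K) * height z ^ 2 * cmod (lin p z)"
      by (simp add: mult_ac)
    have pos: "0 < 1 + real_of_int \<bar>m\<bar> + real_of_int \<bar>n\<bar>" by simp
    have H: "height z > 0" using height_ge[OF z] by simp
    have "lin p z \<noteq> 0" using le pos by auto
    then have c: "cmod (lin p z) > 0" by simp
    have "((2 * K) * height z ^ 2 * cmod (lin p z)) powr - s \<le> h p"
      unfolding hp using le s pos by (intro powr_mono2') auto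
    then have "(2 * K) powr s * height z powr (2 * s) * (((2 * K) * height z ^ 2 * cmod (lin p z)) powr - s)
       \<le> (2 * K) powr s * height z powr (2 * s) * h p" by (intro mult_left_mono) auto
    moreover have "((2 * K) * height z ^ 2 * cmod (lin p z)) powr - s
        = (2 * K) powr - s * height z powr - (2 * s) * cmod (lin p z) powr - s"
    proof -
      have "height z ^ 2 = height z powr 2" using H by (simp add: powr_numeral)
      then have "(height z ^ 2) powr - s = height z powr - (2 * s)"
        by (simp only: powr_powr) simp
      then show ?thesis using K1 H c by (simp add: powr_mult del: powr_numeral)
    qed
    moreover have "(2 * K) powr s * (2 * K) powr - s = 1" "height z powr (2 * s) * height z powr - (2 * s) = 1"
      using K1 H by (simp_all add: powr_add[symmetric])
    moreover have "A * B * (A' * B' * c) = (A * A') * (B * B') * c" for A B A' B' c :: real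
      by (simp only: mult_ac)
    ultimately show ?thesis by (simp only: mult_1)
  qed
  show ?thesis
  proof
    let ?C = "(2 * K) powr s * infsum h (vec_coset v - {(0,0)})"
    show "?C \<ge> 0" using h0 by (intro mult_nonneg_nonneg infsum_nonneg) auto
    fix z :: complex assume z: "Im z > 0"
    have hh: "(\<lambda>p. (2 * K) powr s * height z powr (2 * s) * h p) summable_on vec_coset v - {(0,0)}"
      by (rule summable_on_cmult_right[OF hs'])
    show sm: "(\<lambda>p. cmod (lin p z) powr - s) summable_on (vec_coset v - {(0,0)})"
      by (rule summable_on_comparison_test[OF hh bnd[OF z]]) auto
    show "(\<Sum>\<^sub>\<infinity>p\<in>vec_coset v - {(0,0)}. cmod (lin p z) powr - s) \<le> ?C * height z powr (2 * s)"
      using infsum_mono[OF sm hh bnd[OF z]] infsum_cmult_right'[of "(2 * K) powr s * height z powr (2 * s)" h]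
      by (simp add: mult_ac)
  qed
qed

section \<open>Theta series\<close>

lemma power_le_power_exp:
  fixes X :: real
  assumes "X \<ge> 0" "j > 0"
  shows "X ^ j \<le> real j ^ j * exp X"
proof -
  have "(X / real j) ^ j \<le> (1 + X / real j) ^ j"
    using assms by (intro power_mono) auto
  also have "\<dots> \<le> exp X" using assms by (intro exp_ge_one_plus_x_over_n_power_n) auto
  finally show ?thesis using assms by (simp add: power_divide field_simps)
qed

text \<open>The summand of the theta series continued to complex coordinates: for real
  \<open>a\<close>, \<open>b\<close> the factor \<open>a * cnj z + b\<close> is the conjugate of
  \<open>a * z + b\<close>, and the product in the exponent is \<open>|a z + b|^2\<close>. Written
  without conjugating \<open>a\<close> and \<open>b\<close> it is entire in both, as Cauchy's
  estimates require.\<close>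

definition theta_term :: "nat \<Rightarrow> real \<Rightarrow> complex \<Rightarrow> complex \<Rightarrow> complex \<Rightarrow> complex" where
  "theta_term l \<tau> z a b =
     (a * cnj z + b) ^ l * exp (- (of_real (\<tau> / Im z) * ((a * z + b) * (a * cnj z + b))))"

definition theta_shift :: "nat \<Rightarrow> real \<Rightarrow> complex \<Rightarrow> complex \<Rightarrow> complex \<Rightarrow> complex" where
  "theta_shift l \<tau> z \<alpha> \<beta> =
     (\<Sum>\<^sub>\<infinity>p\<in>(UNIV :: (int \<times> int) set). theta_term l \<tau> z (\<alpha> + of_int (fst p)) (\<beta> + of_int (snd p)))"

definition theta :: "nat \<Rightarrow> rat \<times> rat \<Rightarrow> complex \<Rightarrow> real \<Rightarrow> complex" where
  "theta l v z \<tau> =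
     (\<Sum>\<^sub>\<infinity>p\<in>vec_coset v. cnj (lin p z) ^ l * exp (- of_real (\<tau> / Im z * cmod (lin p z) ^ 2)))"

lemma theta_eq_theta_shift:
  "theta l v z \<tau> = theta_shift l \<tau> z (of_real (of_rat (fst v))) (of_real (of_rat (snd v)))"
  unfolding theta_def theta_shift_def
proof (subst infsum_reindex_bij_betw[OF bij_betw_shift_pair, symmetric], rule infsum_cong)
  fix p :: "int \<times> int"
  let ?a = "of_real (of_rat (fst v)) + of_int (fst p) :: complex"
  let ?b = "of_real (of_rat (snd v)) + of_int (snd p) :: complex"
  have l: "lin (shift_pair v p) z = ?a * z + ?b"
    by (simp add: lin_def shift_pair_def of_rat_add of_rat_eq_of_real_of_rat)
  have c: "cnj (lin (shift_pair v p) z) = ?a * cnj z + ?b" by (simp add: l)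
  have "complex_of_real (cmod (lin (shift_pair v p) z) ^ 2) = (?a * z + ?b) * (?a * cnj z + ?b)"
    unfolding complex_norm_square unfolding c unfolding l ..
  then show "cnj (lin (shift_pair v p) z) ^ l * exp (- complex_of_real (\<tau> / Im z * (cmod (lin (shift_pair v p) z))\<^sup>2))
      = theta_term l \<tau> z ?a ?b"
    unfolding theta_term_def c of_real_mult by simp
qed

text \<open>Let \<open>w\<close> and \<open>u\<close> be the linear forms built from the real and
  from the imaginary parts of \<open>a\<close>, \<open>b\<close>. The real part of the exponent is
  \<open>- (\<tau> / Im z) * (|w|^2 - |u|^2)\<close>, so \<open>r = sqrt (Im z / \<tau>)\<close> is
  the natural scale: \<open>|u| \<le> \<kappa> * r\<close> costs a factor
  \<open>exp (\<kappa>^2)\<close>, and the Gaussian in \<open>|w| / r\<close> absorbs the polynomial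
  of degree \<open>l\<close> together with the weight \<open>(1 + |w| / r)^4\<close>.\<close>

lemma norm_theta_term_le:
  assumes z: "Im z > 0" and \<tau>: "\<tau> > 0" and \<kappa>: "\<kappa> \<ge> 1" and r: "r = sqrt (Im z / \<tau>)"
    and u: "cmod (of_real (Im a) * z + of_real (Im b)) \<le> \<kappa> * r"
  shows "norm (theta_term l \<tau> z a b) * (1 + cmod (of_real (Re a) * z + of_real (Re b)) / r) ^ 4
     \<le> exp (\<kappa>\<^sup>2 + (real l + 4)\<^sup>2) * (\<kappa> * r) ^ l"
proof -
  define w where "w = of_real (Re a) * z + of_real (Re b)"
  define u where "u = of_real (Im a) * z + of_real (Im b)"
  have r0: "r > 0" and r2: "r\<^sup>2 = Im z / \<tau>" using z \<tau> by (auto simp: r)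
  define X where "X = cmod w / r"
  have X0: "X \<ge> 0" using r0 by (simp add: X_def)
  have ab: "a = of_real (Re a) + \<i> * of_real (Im a)" "b = of_real (Re b) + \<i> * of_real (Im b)"
    by (simp_all add: complex_eq_iff)
  have e1: "a * z + b = w + \<i> * u" by (subst ab(1), subst ab(2)) (simp add: w_def u_def algebra_simps)
  have e2: "a * cnj z + b = cnj w + \<i> * cnj u"
    by (subst ab(1), subst ab(2)) (simp add: w_def u_def algebra_simps)
  have re: "Re ((a * z + b) * (a * cnj z + b)) = (cmod w)\<^sup>2 - (cmod u)\<^sup>2"
    unfolding e1 e2 cmod_power2 by (simp add: power2_eq_square algebra_simps)
  have ur: "cmod u \<le> \<kappa> * r" using assms(5) by (simp add: u_def)
  have "cmod (a * cnj z + b) \<le> cmod w + cmod u"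
    unfolding e2 using norm_triangle_ineq[of "cnj w" "\<i> * cnj u"] by (simp add: norm_mult)
  also have "\<dots> \<le> r * X + \<kappa> * r" using ur r0 by (simp add: X_def)
  also have "\<dots> \<le> \<kappa> * r * (1 + X)"
    using \<kappa> r0 X0 mult_right_mono[of 1 \<kappa> "r * X"] by (simp add: algebra_simps)
  finally have n1: "cmod (a * cnj z + b) ^ l \<le> (\<kappa> * r) ^ l * (1 + X) ^ l"
    by (simp add: power_mono flip: power_mult_distrib)
  have "- (\<tau> / Im z) * ((cmod w)\<^sup>2 - (cmod u)\<^sup>2) = (cmod u)\<^sup>2 / r\<^sup>2 - X\<^sup>2"
    using z \<tau> by (simp add: X_def power_divide r2 field_simps)
  also have "(cmod u)\<^sup>2 / r\<^sup>2 \<le> \<kappa>\<^sup>2"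
    using power_mono[OF ur, of 2] r0 by (simp add: field_simps power_mult_distrib)
  finally have "- (\<tau> / Im z) * ((cmod w)\<^sup>2 - (cmod u)\<^sup>2) \<le> \<kappa>\<^sup>2 - X\<^sup>2" by simp
  then have n2: "norm (exp (- (of_real (\<tau> / Im z) * ((a * z + b) * (a * cnj z + b))))) \<le> exp (\<kappa>\<^sup>2 - X\<^sup>2)"
  proof -
    have "norm (exp (- (of_real (\<tau> / Im z) * Y))) = exp (- (\<tau> / Im z) * Re Y)" for Y :: complex
      unfolding norm_exp_eq_Re by (simp del: of_real_divide)
    then show ?thesis using \<open>- (\<tau> / Im z) * ((cmod w)\<^sup>2 - (cmod u)\<^sup>2) \<le> \<kappa>\<^sup>2 - X\<^sup>2\<close> by (simp only: re exp_le_cancel_iff)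
  qed
  have "norm (theta_term l \<tau> z a b) * (1 + X) ^ 4
      \<le> ((\<kappa> * r) ^ l * (1 + X) ^ l) * exp (\<kappa>\<^sup>2 - X\<^sup>2) * (1 + X) ^ 4"
    unfolding theta_term_def norm_mult norm_power using n1 n2 X0 r0 \<kappa>
    by (intro mult_right_mono mult_mono) auto
  also have "\<dots> = (\<kappa> * r) ^ l * ((1 + X) ^ (l + 4) * exp (\<kappa>\<^sup>2 - X\<^sup>2))"
    by (simp add: power_add mult_ac)
  also have "\<dots> \<le> (\<kappa> * r) ^ l * (exp (real (l + 4) * X) * exp (\<kappa>\<^sup>2 - X\<^sup>2))"
  proof (intro mult_left_mono mult_right_mono)
    have "(1 + X) ^ (l + 4) \<le> exp X ^ (l + 4)" using X0 by (intro power_mono) auto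
    then show "(1 + X) ^ (l + 4) \<le> exp (real (l + 4) * X)" by (simp only: exp_of_nat_mult)
  qed (use r0 \<kappa> in auto)
  also have "\<dots> \<le> (\<kappa> * r) ^ l * exp (\<kappa>\<^sup>2 + (real l + 4)\<^sup>2)"
  proof -
    define n where "n = real l + 4"
    have "n * X - X\<^sup>2 \<le> n\<^sup>2"
    proof -
      have "0 \<le> (n - X / 2)\<^sup>2 + 3 / 4 * X\<^sup>2" by simp
      then show ?thesis by (simp add: power2_eq_square algebra_simps)
    qed
    then have "exp (real (l + 4) * X) * exp (\<kappa>\<^sup>2 - X\<^sup>2) \<le> exp (\<kappa>\<^sup>2 + (real l + 4)\<^sup>2)"
      by (simp add: exp_add[symmetric] n_def algebra_simps)
    then show ?thesis using r0 \<kappa> by (intro mult_left_mono) auto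
  qed
  finally show ?thesis by (simp add: X_def w_def mult.commute)
qed

definition pair_weight :: "int \<times> int \<Rightarrow> real" where
  "pair_weight p = inverse ((1 + real_of_int \<bar>fst p\<bar> + real_of_int \<bar>snd p\<bar>) ^ 4)"

lemma pair_weight_nonneg: "pair_weight p \<ge> 0" by (simp add: pair_weight_def)

lemma summable_pair_weight: "pair_weight summable_on UNIV"
proof -
  have "pair_weight = (\<lambda>(m::int, n::int). (1 + real_of_int \<bar>m\<bar> + real_of_int \<bar>n\<bar>) powr - 4)"
    by (auto simp: pair_weight_def powr_minus powr_realpow fun_eq_iff add_pos_nonneg)
  then show ?thesis using summable_on_int_pair_powr[of 4] by simp
qed

text \<open>Trades decay in \<open>|w| / r\<close> for decay in the lattice point:
  \<open>norm_lin_ge\<close> bounds the real coordinates by a multiple of \<open>|w|\<close>, and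
  \<open>T\<close> accounts for the shift. The fourth power makes the weights summable over the
  two-dimensional lattice.\<close>

lemma norm_theta_term_shift_le:
  assumes z: "Im z > 0" and \<tau>: "\<tau> > 0" and \<kappa>: "\<kappa> \<ge> 1" and r: "r = sqrt (Im z / \<tau>)"
    and u: "cmod (of_real (Im \<alpha>) * z + of_real (Im \<beta>)) \<le> \<kappa> * r"
    and T: "1 + \<bar>Re \<alpha>\<bar> + \<bar>Re \<beta>\<bar> \<le> T"
  shows "norm (theta_term l \<tau> z (\<alpha> + of_int (fst p)) (\<beta> + of_int (snd p)))
     \<le> exp (\<kappa>\<^sup>2 + (real l + 4)\<^sup>2) * (\<kappa> * r) ^ l * ((1 + 2 * height z ^ 2 * r) * T) ^ 4 * pair_weight p"
proof -
  define a where "a = \<alpha> + of_int (fst p)"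
  define b where "b = \<beta> + of_int (snd p)"
  define w where "w = of_real (Re a) * z + of_real (Re b)"
  have r0: "r > 0" using z \<tau> by (auto simp: r)
  define X where "X = cmod w / r"
  have X0: "X \<ge> 0" using r0 by (simp add: X_def)
  define S where "S = 1 + 2 * height z ^ 2 * r"
  have S0: "S \<ge> 1" using r0 by (simp add: S_def)
  have T1: "T \<ge> 1" using T by linarith
  define E where "E = exp (\<kappa>\<^sup>2 + (real l + 4)\<^sup>2) * (\<kappa> * r) ^ l"
  define P where "P = 1 + real_of_int \<bar>fst p\<bar> + real_of_int \<bar>snd p\<bar>"
  have P0: "P > 0" by (simp add: P_def add_pos_nonneg)
  have le: "norm (theta_term l \<tau> z a b) * (1 + X) ^ 4 \<le> E"
    unfolding E_def X_def w_def
    by (rule norm_theta_term_le[OF z \<tau> \<kappa> r]) (use u in \<open>simp add: a_def b_def\<close>)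
  have "P \<le> (1 + (\<bar>Re a\<bar> + \<bar>Re b\<bar>)) + (\<bar>Re \<alpha>\<bar> + \<bar>Re \<beta>\<bar>)"
    unfolding P_def a_def b_def by simp
  also have "\<dots> \<le> (1 + (\<bar>Re a\<bar> + \<bar>Re b\<bar>)) * (1 + \<bar>Re \<alpha>\<bar> + \<bar>Re \<beta>\<bar>)"
    by (simp add: algebra_simps add_nonneg_nonneg)
  also have "\<dots> \<le> (S * (1 + X)) * T"
  proof (rule mult_mono)
    have "1 + (\<bar>Re a\<bar> + \<bar>Re b\<bar>) \<le> 1 + 2 * height z ^ 2 * cmod w"
      using norm_lin_ge[OF z, of "Re a" "Re b"] by (simp add: w_def)
    also have "\<dots> = 1 + 2 * height z ^ 2 * r * X" using r0 by (simp add: X_def)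
    also have "\<dots> \<le> S * (1 + X)" using r0 X0 by (simp add: S_def algebra_simps)
    finally show "1 + (\<bar>Re a\<bar> + \<bar>Re b\<bar>) \<le> S * (1 + X)" .
  qed (use T S0 X0 in auto)
  finally have "P \<le> S * T * (1 + X)" by (simp add: mult_ac)
  then have P4: "P ^ 4 \<le> (S * T) ^ 4 * (1 + X) ^ 4"
    using P0 by (simp add: power_mono flip: power_mult_distrib)
  have "norm (theta_term l \<tau> z a b) * P ^ 4 \<le> norm (theta_term l \<tau> z a b) * ((S * T) ^ 4 * (1 + X) ^ 4)"
    by (intro mult_left_mono P4) auto
  also have "\<dots> = (norm (theta_term l \<tau> z a b) * (1 + X) ^ 4) * (S * T) ^ 4" by (simp add: mult_ac)
  also have "\<dots> \<le> E * (S * T) ^ 4" by (intro mult_right_mono le) auto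
  finally have "norm (theta_term l \<tau> z a b) \<le> E * (S * T) ^ 4 / P ^ 4"
    using P0 by (simp add: pos_le_divide_eq)
  then show ?thesis by (simp add: E_def S_def P_def pair_weight_def a_def b_def divide_inverse)
qed

lemma theta_shift_periodic:
  "theta_shift l \<tau> z (\<alpha> + of_int i) (\<beta> + of_int j) = theta_shift l \<tau> z \<alpha> \<beta>"
proof -
  have bij: "bij_betw (\<lambda>p. (fst p + i, snd p + j)) (UNIV :: (int \<times> int) set) UNIV"
    by (rule bij_betwI[where g = "\<lambda>p. (fst p - i, snd p - j)"]) auto
  show ?thesis
    unfolding theta_shift_def
    by (subst (2) infsum_reindex_bij_betw[OF bij, symmetric]) (simp add: add_ac)
qed

text \<open>The constant of the bound for shifts with \<open>\<kappa> = 1\<close>. The factor 81 is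
  \<open>3^4\<close>, where 3 bounds \<open>1 + |Re \<alpha>| + |Re \<beta>|\<close> for shifts
  reduced to the unit square.\<close>

definition theta_const :: "nat \<Rightarrow> real" where
  "theta_const l = exp (1 + (real l + 4)\<^sup>2) * 81 * infsum pair_weight UNIV"

lemma theta_const_nonneg: "theta_const l \<ge> 0"
  unfolding theta_const_def by (intro mult_nonneg_nonneg infsum_nonneg pair_weight_nonneg) auto

text \<open>Periodicity reduces the real parts of the shifts to \<open>[0, 1)\<close>, which makes
  the bound independent of them. Only the imaginary parts are restricted, so the bound holds on a
  whole strip in each variable.\<close>

lemma norm_theta_shift_le:
  assumes z: "Im z > 0" and \<tau>: "\<tau> > 0" and r: "r = sqrt (Im z / \<tau>)"
    and u: "cmod (of_real (Im \<alpha>) * z + of_real (Im \<beta>)) \<le> r"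
  shows "norm (theta_shift l \<tau> z \<alpha> \<beta>) \<le> theta_const l * r ^ l * (1 + 2 * height z ^ 2 * r) ^ 4"
proof -
  define \<alpha>' where "\<alpha>' = \<alpha> - of_int \<lfloor>Re \<alpha>\<rfloor>"
  define \<beta>' where "\<beta>' = \<beta> - of_int \<lfloor>Re \<beta>\<rfloor>"
  have eq: "theta_shift l \<tau> z \<alpha> \<beta> = theta_shift l \<tau> z \<alpha>' \<beta>'"
    using theta_shift_periodic[of l \<tau> z \<alpha>' "\<lfloor>Re \<alpha>\<rfloor>" \<beta>' "\<lfloor>Re \<beta>\<rfloor>"] by (simp add: \<alpha>'_def \<beta>'_def)
  have "Re \<alpha>' = frac (Re \<alpha>)" "Re \<beta>' = frac (Re \<beta>)" by (simp_all add: \<alpha>'_def \<beta>'_def frac_def)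
  then have T: "1 + \<bar>Re \<alpha>'\<bar> + \<bar>Re \<beta>'\<bar> \<le> 3"
    using frac_lt_1[of "Re \<alpha>"] frac_lt_1[of "Re \<beta>"] frac_ge_0[of "Re \<alpha>"] frac_ge_0[of "Re \<beta>"] by simp
  define K where "K = exp (1\<^sup>2 + (real l + 4)\<^sup>2) * (1 * r) ^ l * ((1 + 2 * height z ^ 2 * r) * 3) ^ 4"
  have b: "norm (theta_term l \<tau> z (\<alpha>' + of_int (fst p)) (\<beta>' + of_int (snd p))) \<le> K * pair_weight p" for p
    unfolding K_def by (rule norm_theta_term_shift_le[OF z \<tau> _ r _ T]) (use u in \<open>auto simp: \<alpha>'_def \<beta>'_def\<close>)
  have s: "(\<lambda>p. K * pair_weight p) summable_on UNIV"
    by (rule summable_on_cmult_right[OF summable_pair_weight])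
  have sn: "(\<lambda>p. norm (theta_term l \<tau> z (\<alpha>' + of_int (fst p)) (\<beta>' + of_int (snd p)))) summable_on UNIV"
    by (rule summable_on_comparison_test[OF s b]) auto
  have "norm (theta_shift l \<tau> z \<alpha>' \<beta>') \<le> (\<Sum>\<^sub>\<infinity>p. norm (theta_term l \<tau> z (\<alpha>' + of_int (fst p)) (\<beta>' + of_int (snd p))))"
    unfolding theta_shift_def by (rule norm_infsum_bound[OF sn])
  also have "\<dots> \<le> (\<Sum>\<^sub>\<infinity>p. K * pair_weight p)" by (rule infsum_mono[OF sn s b])
  also have "\<dots> = K * infsum pair_weight UNIV" by (rule infsum_cmult_right')
  finally have fin: "norm (theta_shift l \<tau> z \<alpha>' \<beta>') \<le> K * infsum pair_weight UNIV" .
  have S4: "(S * 3) ^ 4 = 81 * S ^ 4" for S :: real by (simp add: power_mult_distrib)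
  show ?thesis using fin unfolding eq K_def S4 theta_const_def by (simp only: power_one mult_1 mult_ac)
qed

lemma gauss_term_deriv_aux:
  fixes X Y :: "complex \<Rightarrow> complex"
  assumes X: "(X has_field_derivative x) (at a)" and Y: "(Y has_field_derivative y) (at a)"
  shows "((\<lambda>t. X t ^ l * exp (- (k * (Y t * X t)))) has_field_derivative
      (of_nat l * X a ^ (l - 1) * x - X a ^ l * (k * (y * X a + Y a * x))) * exp (- (k * (Y a * X a)))) (at a)"
proof -
  have 1: "((\<lambda>t. X t ^ l) has_field_derivative of_nat l * X a ^ (l - 1) * x) (at a)"
    using DERIV_power[OF X, of l] by (simp add: mult_ac)
  have "((\<lambda>t. - (k * (Y t * X t))) has_field_derivative - (k * (y * X a + Y a * x))) (at a)"
    using DERIV_minus[OF DERIV_cmult[OF DERIV_mult[OF Y X], of k]] by (simp add: mult_ac add_ac)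
  then have 2: "((\<lambda>t. exp (- (k * (Y t * X t)))) has_field_derivative
      exp (- (k * (Y a * X a))) * - (k * (y * X a + Y a * x))) (at a)"
    by (rule DERIV_fun_exp)
  have "(n * P * x) * E + (E * - (k * (y * A + B * x))) * Q = (n * P * x - Q * (k * (y * A + B * x))) * E"
    for n P E A B Q :: complex by (simp add: algebra_simps)
  then show ?thesis by (rule DERIV_cong[OF DERIV_mult[OF 1 2]])
qed

lemma gauss_term_deriv:
  fixes c k z b :: complex
  shows "((\<lambda>\<alpha>. (\<alpha> * c + b) ^ l * exp (- (k * ((\<alpha> * z + b) * (\<alpha> * c + b))))) has_field_derivative
      (of_nat l * (a * c + b) ^ (l - 1) * c - (a * c + b) ^ l * (k * (z * (a * c + b) + (a * z + b) * c)))
       * exp (- (k * ((a * z + b) * (a * c + b))))) (at a)"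
    and "((\<lambda>\<beta>. (a * c + \<beta>) ^ l * exp (- (k * ((a * z + \<beta>) * (a * c + \<beta>))))) has_field_derivative
      (of_nat l * (a * c + b) ^ (l - 1) * 1 - (a * c + b) ^ l * (k * (1 * (a * c + b) + (a * z + b) * 1)))
       * exp (- (k * ((a * z + b) * (a * c + b))))) (at b)"
  by (rule gauss_term_deriv_aux[where X = "\<lambda>t. t * c + b" and Y = "\<lambda>t. t * z + b"]; auto intro!: derivative_eq_intros)
    (rule gauss_term_deriv_aux[where X = "\<lambda>t. a * c + t" and Y = "\<lambda>t. a * z + t"]; auto intro!: derivative_eq_intros)

lemma deriv_theta_term:
  fixes m n :: complex
  shows "deriv (\<lambda>\<alpha>. theta_term l \<tau> z (\<alpha> + m) b) a = deriv (\<lambda>\<alpha>. theta_term l \<tau> z \<alpha> b) (a + m)"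
    and "deriv (\<lambda>\<beta>. theta_term l \<tau> z a (\<beta> + n)) b = deriv (\<lambda>\<beta>. theta_term l \<tau> z a \<beta>) (b + n)"
    and "(\<lambda>\<alpha>. theta_term l \<tau> z (\<alpha> + m) b) holomorphic_on S"
    and "(\<lambda>\<beta>. theta_term l \<tau> z a (\<beta> + n)) holomorphic_on S"
proof -
  have D: "((\<lambda>\<alpha>. theta_term l \<tau> z \<alpha> b) has_field_derivative deriv (\<lambda>\<alpha>. theta_term l \<tau> z \<alpha> b) x) (at x)"
      "((\<lambda>\<beta>. theta_term l \<tau> z a \<beta>) has_field_derivative deriv (\<lambda>\<beta>. theta_term l \<tau> z a \<beta>) x) (at x)" for x a b
    unfolding theta_term_def
    using gauss_term_deriv(1)[THEN DERIV_imp_deriv] gauss_term_deriv(1)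
      gauss_term_deriv(2)[THEN DERIV_imp_deriv] gauss_term_deriv(2) by (simp_all only:)
  show "deriv (\<lambda>\<alpha>. theta_term l \<tau> z (\<alpha> + m) b) a = deriv (\<lambda>\<alpha>. theta_term l \<tau> z \<alpha> b) (a + m)"
    using DERIV_shift[of "\<lambda>\<alpha>. theta_term l \<tau> z \<alpha> b" _ a m] D(1)[of b "a + m"] by (intro DERIV_imp_deriv) simp
  show "deriv (\<lambda>\<beta>. theta_term l \<tau> z a (\<beta> + n)) b = deriv (\<lambda>\<beta>. theta_term l \<tau> z a \<beta>) (b + n)"
    using DERIV_shift[of "\<lambda>\<beta>. theta_term l \<tau> z a \<beta>" _ b n] D(2)[of a "b + n"] by (intro DERIV_imp_deriv) simp
  show "(\<lambda>\<alpha>. theta_term l \<tau> z (\<alpha> + m) b) holomorphic_on S"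
    "(\<lambda>\<beta>. theta_term l \<tau> z a (\<beta> + n)) holomorphic_on S"
    unfolding theta_term_def by (auto intro!: holomorphic_intros)
qed

text \<open>The operator \<open>d/da - cnj z * d/db\<close> kills the factor
  \<open>a * cnj z + b\<close> and sends \<open>a * z + b\<close> to
  \<open>z - cnj z = 2 i Im z\<close>. Applied to the Gaussian it produces one more factor
  \<open>a * cnj z + b\<close>, so the series of degree \<open>l + 1\<close> is a derivative in the
  shift of the one of degree \<open>l\<close>.\<close>

lemma theta_term_Suc:
  assumes z: "Im z > 0" and \<tau>: "\<tau> > 0"
  shows "theta_term (Suc l) \<tau> z a b = - of_real (Im z / \<tau>) / (2 * \<i> * of_real (Im z)) *
     (deriv (\<lambda>\<alpha>. theta_term l \<tau> z \<alpha> b) a - cnj z * deriv (\<lambda>\<beta>. theta_term l \<tau> z a \<beta>) b)"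
proof -
  define k where "k = complex_of_real (\<tau> / Im z)"
  define X where "X = a * cnj z + b"
  define Y where "Y = a * z + b"
  define E where "E = exp (- (k * (Y * X)))"
  have da: "deriv (\<lambda>\<alpha>. theta_term l \<tau> z \<alpha> b) a = (of_nat l * X ^ (l - 1) * cnj z - X ^ l * (k * (z * X + Y * cnj z))) * E"
    unfolding theta_term_def X_def Y_def E_def k_def by (rule DERIV_imp_deriv[OF gauss_term_deriv(1)])
  have db: "deriv (\<lambda>\<beta>. theta_term l \<tau> z a \<beta>) b = (of_nat l * X ^ (l - 1) - X ^ l * (k * (X + Y))) * E"
    unfolding theta_term_def X_def Y_def E_def k_def
    using DERIV_imp_deriv[OF gauss_term_deriv(2)] by (simp only: mult_1 mult_1_right)
  have "deriv (\<lambda>\<alpha>. theta_term l \<tau> z \<alpha> b) a - cnj z * deriv (\<lambda>\<beta>. theta_term l \<tau> z a \<beta>) b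
      = - (X ^ Suc l * k * (z - cnj z) * E)"
    unfolding da db by (simp add: algebra_simps)
  also have "z - cnj z = 2 * \<i> * of_real (Im z)" by (simp add: complex_eq_iff)
  finally have eq: "deriv (\<lambda>\<alpha>. theta_term l \<tau> z \<alpha> b) a - cnj z * deriv (\<lambda>\<beta>. theta_term l \<tau> z a \<beta>) b
      = - (X ^ Suc l * k * (2 * \<i> * of_real (Im z)) * E)" .
  have k: "of_real (Im z / \<tau>) * k = 1" using z \<tau> by (simp add: k_def)
  have t: "theta_term (Suc l) \<tau> z a b = X ^ Suc l * E"
    by (simp add: theta_term_def X_def Y_def E_def k_def)
  have y: "2 * \<i> * complex_of_real (Im z) \<noteq> 0" using z by simp
  have alg: "- A / B * - (P * k * B * E) = (A * k) * (P * E)" if "B \<noteq> 0" for A B P :: complex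
    using that by (simp add: field_simps)
  show ?thesis unfolding eq t alg[OF y] k by simp
qed

text \<open>Termwise differentiation in each shift: on discs of radius 1 all terms are dominated by
  a multiple of \<open>pair_weight\<close>, with \<open>\<kappa>\<close> and \<open>T\<close> taken
  large enough for the whole disc.\<close>

lemma theta_shift_holomorphic:
  assumes z: "Im z > 0" and \<tau>: "\<tau> > 0"
  shows "((\<lambda>\<alpha>. theta_shift l \<tau> z \<alpha> \<beta>) has_field_derivative
       (\<integral>p. deriv (\<lambda>\<alpha>. theta_term l \<tau> z \<alpha> (\<beta> + of_int (snd p))) (\<alpha> + of_int (fst p)) \<partial>count_space (UNIV :: (int \<times> int) set))) (at \<alpha>)" (is ?A)
    and "integrable (count_space (UNIV :: (int \<times> int) set)) (\<lambda>p. deriv (\<lambda>\<alpha>. theta_term l \<tau> z \<alpha> (\<beta> + of_int (snd p))) (\<alpha> + of_int (fst p)))" (is ?B)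
    and "((\<lambda>\<beta>. theta_shift l \<tau> z \<alpha> \<beta>) has_field_derivative
       (\<integral>p. deriv (\<lambda>\<beta>. theta_term l \<tau> z (\<alpha> + of_int (fst p)) \<beta>) (\<beta> + of_int (snd p)) \<partial>count_space (UNIV :: (int \<times> int) set))) (at \<beta>)" (is ?C)
    and "integrable (count_space (UNIV :: (int \<times> int) set)) (\<lambda>p. deriv (\<lambda>\<beta>. theta_term l \<tau> z (\<alpha> + of_int (fst p)) \<beta>) (\<beta> + of_int (snd p)))" (is ?D)
proof -
  define r where "r = sqrt (Im z / \<tau>)"
  have r0: "r > 0" using z \<tau> by (simp add: r_def)
  define U where "U = (\<bar>Im \<alpha>\<bar> + 1) * cmod z + (\<bar>Im \<beta>\<bar> + 1)"
  define \<kappa> where "\<kappa> = max 1 (U / r)"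
  define T where "T = 1 + (\<bar>Re \<alpha>\<bar> + 1) + (\<bar>Re \<beta>\<bar> + 1)"
  define K where "K = exp (\<kappa>\<^sup>2 + (real l + 4)\<^sup>2) * (\<kappa> * r) ^ l * ((1 + 2 * height z ^ 2 * r) * T) ^ 4"
  have bnd: "norm (theta_term l \<tau> z (a + of_int (fst p)) (b + of_int (snd p))) \<le> K * pair_weight p"
    if a: "a \<in> ball \<alpha> 1" and b: "b \<in> ball \<beta> 1" for a b p
    unfolding K_def
  proof (rule norm_theta_term_shift_le[OF z \<tau>])
    have ia: "\<bar>Im a\<bar> \<le> \<bar>Im \<alpha>\<bar> + 1" and ra: "\<bar>Re a\<bar> \<le> \<bar>Re \<alpha>\<bar> + 1"
      using abs_Im_le_cmod[of "\<alpha> - a"] abs_Re_le_cmod[of "\<alpha> - a"] a by (auto simp: dist_norm)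
    have ib: "\<bar>Im b\<bar> \<le> \<bar>Im \<beta>\<bar> + 1" and rb: "\<bar>Re b\<bar> \<le> \<bar>Re \<beta>\<bar> + 1"
      using abs_Im_le_cmod[of "\<beta> - b"] abs_Re_le_cmod[of "\<beta> - b"] b by (auto simp: dist_norm)
    have "cmod (of_real (Im a) * z + of_real (Im b)) \<le> \<bar>Im a\<bar> * cmod z + \<bar>Im b\<bar>"
      using norm_triangle_ineq[of "of_real (Im a) * z" "of_real (Im b)"] by (simp add: norm_mult)
    also have "\<dots> \<le> U" unfolding U_def using ia ib by (intro add_mono mult_right_mono) auto
    also have "\<dots> \<le> \<kappa> * r" using r0 by (simp add: \<kappa>_def max_def field_simps)
    finally show "cmod (of_real (Im a) * z + of_real (Im b)) \<le> \<kappa> * r" .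
    show "1 + \<bar>Re a\<bar> + \<bar>Re b\<bar> \<le> T" using ra rb by (simp add: T_def)
  qed (auto simp: \<kappa>_def r_def)
  have KI: "integrable (count_space UNIV) (\<lambda>p. K * pair_weight p)"
  proof -
    have "Infinite_Sum.abs_summable_on (\<lambda>p. complex_of_real (pair_weight p)) UNIV"
      using summable_pair_weight pair_weight_nonneg by simp
    then have "integrable (count_space UNIV) (\<lambda>p. norm (complex_of_real (pair_weight p)))"
      unfolding abs_summable_iff_integrable_count_space by (rule integrable_norm)
    then show ?thesis using pair_weight_nonneg by simp
  qed
  have *: "theta_shift l \<tau> z a b = (\<integral>p. theta_term l \<tau> z (a + of_int (fst p)) (b + of_int (snd p)) \<partial>count_space UNIV)" for a b
    unfolding theta_shift_def by (rule infsum_eq_integral_count_space)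
  have c: "\<alpha> \<in> ball \<alpha> 1" "\<beta> \<in> ball \<beta> 1" by auto
  let ?CS = "count_space (UNIV :: (int \<times> int) set)"
  define \<phi> where "\<phi> a p = theta_term l \<tau> z (a + of_int (fst p)) (\<beta> + of_int (snd p))" for a and p :: "int \<times> int"
  have d\<phi>: "deriv (\<lambda>a. \<phi> a p) a = deriv (\<lambda>\<alpha>. theta_term l \<tau> z \<alpha> (\<beta> + of_int (snd p))) (a + of_int (fst p))" for a p
    unfolding \<phi>_def by (rule deriv_theta_term)
  have h\<phi>: "(\<lambda>a. \<phi> a p) holomorphic_on ball \<alpha> 1" for p
    unfolding \<phi>_def by (rule deriv_theta_term)
  have b\<phi>: "norm (\<phi> a p) \<le> K * pair_weight p" if "a \<in> ball \<alpha> 1" for a p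
    unfolding \<phi>_def by (rule bnd[OF that c(2)])
  have m\<phi>: "\<phi> a \<in> borel_measurable ?CS" for a by simp
  define \<psi> where "\<psi> b p = theta_term l \<tau> z (\<alpha> + of_int (fst p)) (b + of_int (snd p))" for b and p :: "int \<times> int"
  have d\<psi>: "deriv (\<lambda>b. \<psi> b p) b = deriv (\<lambda>\<beta>. theta_term l \<tau> z (\<alpha> + of_int (fst p)) \<beta>) (b + of_int (snd p))" for b p
    unfolding \<psi>_def by (rule deriv_theta_term)
  have h\<psi>: "(\<lambda>b. \<psi> b p) holomorphic_on ball \<beta> 1" for p
    unfolding \<psi>_def by (rule deriv_theta_term)
  have b\<psi>: "norm (\<psi> b p) \<le> K * pair_weight p" if "b \<in> ball \<beta> 1" for b p
    unfolding \<psi>_def by (rule bnd[OF c(1) that])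
  have m\<psi>: "\<psi> a \<in> borel_measurable ?CS" for a by simp
  have t\<phi>: "(\<lambda>\<alpha>. theta_shift l \<tau> z \<alpha> \<beta>) = (\<lambda>a. \<integral>p. \<phi> a p \<partial>?CS)"
    unfolding * \<phi>_def ..
  have t\<psi>: "(\<lambda>\<beta>. theta_shift l \<tau> z \<alpha> \<beta>) = (\<lambda>b. \<integral>p. \<psi> b p \<partial>?CS)"
    unfolding * \<psi>_def ..
  show ?A unfolding t\<phi> d\<phi>[symmetric]
    by (rule has_field_derivative_lebesgue_integral[OF zero_less_one m\<phi> h\<phi> b\<phi> KI])
  show ?B unfolding d\<phi>[symmetric]
    by (rule integrable_deriv[OF zero_less_one m\<phi> h\<phi> b\<phi> KI])
  show ?C unfolding t\<psi> d\<psi>[symmetric]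
    by (rule has_field_derivative_lebesgue_integral[OF zero_less_one m\<psi> h\<psi> b\<psi> KI])
  show ?D unfolding d\<psi>[symmetric]
    by (rule integrable_deriv[OF zero_less_one m\<psi> h\<psi> b\<psi> KI])
qed

lemma theta_shift_Suc:
  assumes z: "Im z > 0" and \<tau>: "\<tau> > 0"
  shows "theta_shift (Suc l) \<tau> z \<alpha> \<beta> = - of_real (Im z / \<tau>) / (2 * \<i> * of_real (Im z)) *
     (deriv (\<lambda>\<alpha>. theta_shift l \<tau> z \<alpha> \<beta>) \<alpha> - cnj z * deriv (\<lambda>\<beta>. theta_shift l \<tau> z \<alpha> \<beta>) \<beta>)"
proof -
  let ?CS = "count_space (UNIV :: (int \<times> int) set)"
  define c where "c = - of_real (Im z / \<tau>) / (2 * \<i> * of_real (Im z))"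
  define f where "f p = deriv (\<lambda>\<alpha>. theta_term l \<tau> z \<alpha> (\<beta> + of_int (snd p))) (\<alpha> + of_int (fst p))" for p :: "int \<times> int"
  define g where "g p = deriv (\<lambda>\<beta>. theta_term l \<tau> z (\<alpha> + of_int (fst p)) \<beta>) (\<beta> + of_int (snd p))" for p :: "int \<times> int"
  have f: "deriv (\<lambda>\<alpha>. theta_shift l \<tau> z \<alpha> \<beta>) \<alpha> = integral\<^sup>L ?CS f" "integrable ?CS f"
    unfolding f_def
    by (rule DERIV_imp_deriv[OF theta_shift_holomorphic(1)[OF z \<tau>]], rule theta_shift_holomorphic(2)[OF z \<tau>])
  have g: "deriv (\<lambda>\<beta>. theta_shift l \<tau> z \<alpha> \<beta>) \<beta> = integral\<^sup>L ?CS g" "integrable ?CS g"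
    unfolding g_def
    by (rule DERIV_imp_deriv[OF theta_shift_holomorphic(3)[OF z \<tau>]], rule theta_shift_holomorphic(4)[OF z \<tau>])
  have "theta_shift (Suc l) \<tau> z \<alpha> \<beta> = (\<integral>p. c * (f p - cnj z * g p) \<partial>?CS)"
    unfolding theta_shift_def infsum_eq_integral_count_space theta_term_Suc[OF z \<tau>] f_def g_def c_def ..
  also have "\<dots> = c * (integral\<^sup>L ?CS f - cnj z * integral\<^sup>L ?CS g)"
    using f(2) g(2) by simp
  finally show ?thesis unfolding f(1) g(1) c_def .
qed

text \<open>The periodic strip estimate in each variable separately. An imaginary part
  \<open>\<delta>\<close> of the first shift moves the linear form by \<open>\<delta> * z\<close>,
  one of the second by \<open>\<delta>\<close>. The strips therefore have half-widths
  \<open>r / cmod z\<close> and \<open>r\<close>, and the first derivative costs the additional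
  factor \<open>cmod z ^ Suc k\<close>.\<close>

lemma norm_theta_shift_Suc_le:
  assumes z: "Im z > 0" and \<tau>: "\<tau> > 0" and r: "r = sqrt (Im z / \<tau>)"
  shows "norm (theta_shift (Suc l) \<tau> z (of_real x) (of_real x'))
     \<le> fact (Suc k) * theta_const l * height z ^ Suc k * (1 / \<tau>) * (r ^ l * (1 + 2 * height z ^ 2 * r) ^ 4) / r ^ Suc k"
proof -
  have r0: "r > 0" using z \<tau> by (simp add: r)
  have z0: "cmod z > 0" using z by auto
  note H = height_ge[OF z]
  define M where "M = theta_const l * r ^ l * (1 + 2 * height z ^ 2 * r) ^ 4"
  have M0: "M \<ge> 0" unfolding M_def using theta_const_nonneg r0 by (intro mult_nonneg_nonneg) auto
  have d1: "norm (deriv (\<lambda>\<alpha>. theta_shift l \<tau> z \<alpha> (of_real x')) (of_real x)) \<le> fact (Suc k) * M / (r / cmod z) ^ Suc k"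
  proof (rule norm_deriv_periodic_strip_le)
    show "(\<lambda>\<alpha>. theta_shift l \<tau> z \<alpha> (of_real x')) holomorphic_on UNIV"
      using theta_shift_holomorphic(1)[OF z \<tau>] by (meson UNIV_I holomorphic_on_open open_UNIV)
    show "theta_shift l \<tau> z (\<alpha> + 1) (of_real x') = theta_shift l \<tau> z \<alpha> (of_real x')" for \<alpha>
      using theta_shift_periodic[of l \<tau> z \<alpha> 1 "of_real x'" 0] by simp
    show "r / cmod z > 0" using r0 z0 by simp
    fix \<alpha> :: complex assume "\<bar>Im \<alpha>\<bar> \<le> r / cmod z"
    then show "norm (theta_shift l \<tau> z \<alpha> (of_real x')) \<le> M"
      unfolding M_def using z0 by (intro norm_theta_shift_le[OF z \<tau> r]) (simp add: norm_mult pos_le_divide_eq)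
  qed
  have d2: "norm (deriv (\<lambda>\<beta>. theta_shift l \<tau> z (of_real x) \<beta>) (of_real x')) \<le> fact (Suc k) * M / r ^ Suc k"
  proof (rule norm_deriv_periodic_strip_le)
    show "(\<lambda>\<beta>. theta_shift l \<tau> z (of_real x) \<beta>) holomorphic_on UNIV"
      using theta_shift_holomorphic(3)[OF z \<tau>] by (meson UNIV_I holomorphic_on_open open_UNIV)
    show "theta_shift l \<tau> z (of_real x) (\<beta> + 1) = theta_shift l \<tau> z (of_real x) \<beta>" for \<beta>
      using theta_shift_periodic[of l \<tau> z "of_real x" 0 \<beta> 1] by simp
    show "r > 0" by (rule r0)
    fix \<beta> :: complex assume "\<bar>Im \<beta>\<bar> \<le> r"
    then show "norm (theta_shift l \<tau> z (of_real x) \<beta>) \<le> M"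
      unfolding M_def by (intro norm_theta_shift_le[OF z \<tau> r]) simp
  qed
  define D where "D = fact (Suc k) * M / r ^ Suc k"
  have D0: "D \<ge> 0" using M0 r0 by (simp add: D_def)
  have "norm (theta_shift (Suc l) \<tau> z (of_real x) (of_real x')) =
      1 / (2 * \<tau>) * norm (deriv (\<lambda>\<alpha>. theta_shift l \<tau> z \<alpha> (of_real x')) (of_real x)
         - cnj z * deriv (\<lambda>\<beta>. theta_shift l \<tau> z (of_real x) \<beta>) (of_real x'))"
    unfolding theta_shift_Suc[OF z \<tau>] norm_mult using z \<tau> by (simp add: norm_divide norm_mult)
  also have "\<dots> \<le> 1 / (2 * \<tau>) * (D * cmod z ^ Suc k + cmod z * D)"
  proof (rule mult_left_mono)
    show "norm (deriv (\<lambda>\<alpha>. theta_shift l \<tau> z \<alpha> (of_real x')) (of_real x)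
         - cnj z * deriv (\<lambda>\<beta>. theta_shift l \<tau> z (of_real x) \<beta>) (of_real x')) \<le> D * cmod z ^ Suc k + cmod z * D"
    proof -
      have "norm (deriv (\<lambda>\<alpha>. theta_shift l \<tau> z \<alpha> (of_real x')) (of_real x)) \<le> D * cmod z ^ Suc k"
        using d1 z0 by (simp add: D_def power_divide)
      moreover have "norm (cnj z * deriv (\<lambda>\<beta>. theta_shift l \<tau> z (of_real x) \<beta>) (of_real x')) \<le> cmod z * D"
        unfolding norm_mult complex_mod_cnj D_def using d2 by (intro mult_left_mono) auto
      ultimately show ?thesis by (intro order_trans[OF norm_triangle_ineq4] add_mono)
    qed
  qed (use \<tau> in auto)
  also have "\<dots> \<le> 1 / (2 * \<tau>) * (D * height z ^ Suc k + height z ^ Suc k * D)"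
  proof (intro mult_left_mono add_mono mult_right_mono)
    show "cmod z ^ Suc k \<le> height z ^ Suc k" using H by (intro power_mono) auto
    have "cmod z \<le> height z ^ 1" using H by simp
    also have "\<dots> \<le> height z ^ Suc k" using H by (intro power_increasing) auto
    finally show "cmod z \<le> height z ^ Suc k" .
  qed (use D0 \<tau> in auto)
  also have "\<dots> = D * height z ^ Suc k * (1 / \<tau>)" using \<tau> by (simp add: field_simps)
  finally show ?thesis by (simp add: D_def M_def mult_ac)
qed

text \<open>
  Decay as \<open>\<tau> \<rightarrow> 0\<close> without Poisson summation: for \<open>l \<ge> 1\<close> the series is a derivative of a
  doubly periodic function of the shift. A derivative of a periodic function is bounded by the
  higher ones, and these are small by Cauchy's estimates on discs of radius about \<open>\<tau>\<close> to the power \<open>-1/2\<close>.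
\<close>

lemma theta_bound_small:
  assumes l: "l \<ge> 1"
  obtains C A where "C \<ge> 0"
    "\<And>z \<tau>. Im z > 0 \<Longrightarrow> 0 < \<tau> \<Longrightarrow> \<tau> \<le> 1 \<Longrightarrow> norm (theta l v z \<tau>) \<le> C * height z ^ A * \<tau> ^ j"
proof -
  obtain l' where l': "l = Suc l'" using l by (cases l) auto
  \<comment> \<open>Balances the powers of \<open>r\<close>: the bound carries \<open>r^l'\<close>
    and a fourth power of order \<open>r\<close>, so this \<open>k\<close> leaves
    \<open>r^(-2 (j + 1))\<close>, where \<open>r^-2 = \<tau> / Im z\<close>. One of the
    \<open>j + 1\<close> powers of \<open>\<tau>\<close> pays for the factor
    \<open>1 / \<tau>\<close>.\<close>
  define k where "k = l' + 3 + 2 * (j + 1)"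
  define C where "C = fact (Suc k) * theta_const l' * 81"
  show ?thesis
  proof
    show "C \<ge> 0" using theta_const_nonneg by (simp add: C_def)
    fix z :: complex and \<tau> :: real assume z: "Im z > 0" and \<tau>: "0 < \<tau>" "\<tau> \<le> 1"
    define r where "r = sqrt (Im z / \<tau>)"
    have r0: "r > 0" using z \<tau> by (simp add: r_def)
    have r2: "(1 / r)\<^sup>2 = \<tau> / Im z" using z \<tau> by (simp add: r_def power_divide)
    note H = height_ge[OF z]
    have "\<tau> / Im z \<le> \<tau> * height z" using mult_left_mono[OF H(3), of \<tau>] \<tau> by simp
    then have r2': "(1 / r)\<^sup>2 \<le> \<tau> * height z" using r2 by simp
    also have "\<dots> \<le> 1 * height z" using \<tau> H by (intro mult_right_mono) auto
    also have "\<dots> \<le> height z ^ 2" using H mult_right_mono[of 1 "height z" "height z"] by (simp add: power2_eq_square)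
    finally have "1 / r \<le> height z" using H by (auto intro: power2_le_imp_le)
    then have "1 / r + 2 * height z ^ 2 \<le> 3 * height z ^ 2"
      using H power_increasing[of 1 2 "height z"] by simp
    then have p4: "(1 / r + 2 * height z ^ 2) ^ 4 \<le> (3 * height z ^ 2) ^ 4"
      using r0 by (intro power_mono) auto
    have pj: "((1 / r)\<^sup>2) ^ (j + 1) \<le> (\<tau> * height z) ^ (j + 1)"
      using r2' by (intro power_mono) auto
    have "(r ^ l' * (1 + 2 * height z ^ 2 * r) ^ 4) / r ^ Suc k = ((1 / r)\<^sup>2) ^ (j + 1) * (1 / r + 2 * height z ^ 2) ^ 4"
    proof -
      have e: "1 + 2 * height z ^ 2 * r = r * (1 / r + 2 * height z ^ 2)" using r0 by (simp add: field_simps)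
      have rk: "r ^ Suc k = r ^ l' * r ^ 4 * (r\<^sup>2) ^ (j + 1)"
        by (simp only: power_add[symmetric] power_mult[symmetric] k_def) (simp add: algebra_simps)
      have alg: "a * (b * c) / (a * b * d) = (1 / d) * c" if "a \<noteq> 0" "b \<noteq> 0" for a b c d :: real
        using that by simp
      have ri: "((1 / r)\<^sup>2) ^ (j + 1) = 1 / (r\<^sup>2) ^ (j + 1)" by (simp only: power_divide power_one)
      show ?thesis unfolding e rk ri power_mult_distrib[of r] by (rule alg) (use r0 in auto)
    qed
    also have "\<dots> \<le> (\<tau> * height z) ^ (j + 1) * (3 * height z ^ 2) ^ 4"
      using pj p4 \<tau> H r0 by (intro mult_mono) auto
    finally have e: "(r ^ l' * (1 + 2 * height z ^ 2 * r) ^ 4) / r ^ Suc k \<le> (\<tau> * height z) ^ (j + 1) * (3 * height z ^ 2) ^ 4" .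
    have "norm (theta l v z \<tau>) \<le> fact (Suc k) * theta_const l' * height z ^ Suc k * (1 / \<tau>) * ((r ^ l' * (1 + 2 * height z ^ 2 * r) ^ 4) / r ^ Suc k)"
      unfolding theta_eq_theta_shift l' using norm_theta_shift_Suc_le[OF z \<tau>(1) r_def] by (simp only: times_divide_eq_right)
    also have "\<dots> \<le> fact (Suc k) * theta_const l' * height z ^ Suc k * (1 / \<tau>) * ((\<tau> * height z) ^ (j + 1) * (3 * height z ^ 2) ^ 4)"
      using \<tau> H theta_const_nonneg by (intro mult_left_mono e) auto
    also have "\<dots> = C * height z ^ (Suc k + (j + 1) + 8) * \<tau> ^ j"
    proof -
      have "height z * (height z * height z ^ 8) = height z ^ 10" by (simp add: numeral_eq_Suc)
      then show ?thesis using \<tau> by (simp add: C_def power_mult_distrib power_add power_mult[symmetric])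
    qed
    finally show "norm (theta l v z \<tau>) \<le> C * height z ^ (Suc k + (j + 1) + 8) * \<tau> ^ j" .
  qed
qed

text \<open>Replacing \<open>exp (- X)\<close> by \<open>j^j / X^j\<close> turns the Gaussian series
  into a power sum of exponent \<open>2 j - l\<close>, for which a polynomial bound in
  \<open>height\<close> is known; \<open>j \<ge> l + 3\<close> keeps this exponent above 2.\<close>

lemma theta_bound_large:
  assumes l: "l \<ge> 1" and j: "j \<ge> l + 3"
  obtains C A where "C \<ge> 0"
    "\<And>z \<tau>. Im z > 0 \<Longrightarrow> 0 < \<tau> \<Longrightarrow> norm (theta l v z \<tau>) \<le> C * height z ^ A / \<tau> ^ j"
    "\<And>z \<tau>. Im z > 0 \<Longrightarrow> 0 < \<tau> \<Longrightarrow> Infinite_Sum.abs_summable_on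
      (\<lambda>p. cnj (lin p z) ^ l * exp (- of_real (\<tau> / Im z * cmod (lin p z) ^ 2))) (vec_coset v)"
proof -
  define n where "n = 2 * j - l"
  have n: "2 * j = n + l" "n > 2" using j by (auto simp: n_def)
  obtain C where C: "C \<ge> 0"
    "\<And>z. Im z > 0 \<Longrightarrow> (\<lambda>p. cmod (lin p z) powr - real n) summable_on (vec_coset v - {(0,0)})"
    "\<And>z. Im z > 0 \<Longrightarrow> (\<Sum>\<^sub>\<infinity>p\<in>vec_coset v - {(0,0)}. cmod (lin p z) powr - real n) \<le> C * height z powr (2 * real n)"
    using lin_power_sum_bound[of "real n" v] n(2) by auto
  have main: "Infinite_Sum.abs_summable_on (\<lambda>p. cnj (lin p z) ^ l * exp (- of_real (\<tau> / Im z * cmod (lin p z) ^ 2))) (vec_coset v) \<and>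
      norm (theta l v z \<tau>) \<le> (real j ^ j * C) * height z ^ (2 * n + j) / \<tau> ^ j" if z: "Im z > 0" and \<tau>: "0 < \<tau>" for z \<tau>
  proof -
    let ?f = "\<lambda>p. cnj (lin p z) ^ l * exp (- complex_of_real (\<tau> / Im z * cmod (lin p z) ^ 2))"
    define K where "K = real j ^ j * (Im z / \<tau>) ^ j"
    have K0: "K \<ge> 0" using z \<tau> by (simp add: K_def)
    note H = height_ge[OF z]
    have bnd: "norm (?f p) \<le> K * cmod (lin p z) powr - real n" if "p \<in> vec_coset v - {(0,0)}" for p
    proof -
      define w where "w = cmod (lin p z)"
      have "0 < \<bar>of_rat (fst p)\<bar> + \<bar>of_rat (snd p) :: real\<bar>"
        using that by (cases p) (auto simp: add_pos_nonneg add_nonneg_pos)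
      then have w0: "w > 0" using norm_lin_ge'[OF z, of p] by (auto simp: w_def)
      define X where "X = \<tau> / Im z * w ^ 2"
      have X0: "X > 0" using z \<tau> w0 by (simp add: X_def)
      have "X ^ j \<le> real j ^ j * exp X" using power_le_power_exp[of X j] X0 j by simp
      then have "exp (- X) \<le> real j ^ j / X ^ j" using X0 by (simp add: exp_minus field_simps)
      also have "\<dots> = K / w ^ (2 * j)"
      proof -
        have "X ^ j = (\<tau> / Im z) ^ j * w ^ (2 * j)" unfolding X_def by (simp only: power_mult_distrib power_mult)
        moreover have "(Im z / \<tau>) ^ j = 1 / (\<tau> / Im z) ^ j" by (simp add: power_divide)
        ultimately show ?thesis by (simp only: K_def) simp
      qed
      finally have "w ^ l * exp (- X) \<le> w ^ l * (K / w ^ (2 * j))" using w0 by (intro mult_left_mono) auto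
      also have "\<dots> = K * w powr - real n" using w0 n(1) by (simp add: powr_minus powr_realpow power_add field_simps)
      finally show ?thesis
        by (simp add: norm_mult norm_power norm_exp_eq_Re w_def X_def del: of_real_mult of_real_divide of_real_power)
    qed
    have sK: "(\<lambda>p. K * cmod (lin p z) powr - real n) summable_on (vec_coset v - {(0,0)})"
      by (rule summable_on_cmult_right[OF C(2)[OF z]])
    have s1: "(\<lambda>p. norm (?f p)) summable_on (vec_coset v - {(0,0)})"
      by (rule summable_on_comparison_test[OF sK bnd]) auto
    \<comment> \<open>For \<open>l \<ge> 1\<close> the zero vector contributes nothing; for
      \<open>l = 0\<close> it would contribute the constant 1 and spoil the decay.\<close>
    have f0: "?f (0, 0) = 0" using l by (simp add: lin_def)
    have s2: "(\<lambda>p. norm (?f p)) summable_on vec_coset v"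
      using s1 by (rule summable_on_cong_neutral[THEN iffD1, rotated -1]) (use f0 in auto)
    have "theta l v z \<tau> = infsum ?f (vec_coset v - {(0,0)})"
      unfolding theta_def by (rule infsum_cong_neutral) (use f0 in auto)
    then have "norm (theta l v z \<tau>) \<le> (\<Sum>\<^sub>\<infinity>p\<in>vec_coset v - {(0,0)}. norm (?f p))"
      using norm_infsum_bound[OF s1] by simp
    also have "\<dots> \<le> (\<Sum>\<^sub>\<infinity>p\<in>vec_coset v - {(0,0)}. K * cmod (lin p z) powr - real n)"
      by (rule infsum_mono[OF s1 sK bnd])
    also have "\<dots> \<le> K * (C * height z powr (2 * real n))"
      unfolding infsum_cmult_right' using C(3)[OF z] K0 by (intro mult_left_mono) auto
    also have "height z powr (2 * real n) = height z ^ (2 * n)"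
      using H powr_realpow[of "height z" "2 * n"] by simp
    also have "K * (C * height z ^ (2 * n)) \<le> (real j ^ j * (height z / \<tau>) ^ j) * (C * height z ^ (2 * n))"
      unfolding K_def using H z \<tau> C(1) by (intro mult_right_mono mult_left_mono power_mono divide_right_mono) auto
    also have "\<dots> = (real j ^ j * C) * height z ^ (2 * n + j) / \<tau> ^ j"
      by (simp add: power_divide power_add)
    finally show ?thesis using s2 by blast
  qed
  show ?thesis
    by (rule that[of "real j ^ j * C" "2 * n + j"]) (use main C(1) in auto)
qed

section \<open>Completed Eisenstein series\<close>

lemma integrable_arctan_deriv: "integrable lborel (\<lambda>x::real. indicator {0..} x * (1 / (1 + x\<^sup>2)))"
proof (rule integrableI_nonneg)
  have "(\<integral>\<^sup>+x. ennreal (1 / (1 + x\<^sup>2)) * indicator {0..} x \<partial>lborel) = ennreal (pi / 2 - arctan 0)"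
  proof (rule nn_integral_FTC_atLeast)
    show "(arctan has_real_derivative 1 / (1 + x\<^sup>2)) (at x)" for x
      using DERIV_arctan[of x] by (simp add: inverse_eq_divide)
    show "(arctan \<longlongrightarrow> pi / 2) at_top" by (rule tendsto_arctan_at_top)
  qed auto
  moreover have "ennreal (indicator {0..} x * (1 / (1 + x\<^sup>2))) = ennreal (1 / (1 + x\<^sup>2)) * indicator {0..} x" for x :: real
    by (auto simp: indicator_def)
  ultimately show "(\<integral>\<^sup>+x. ennreal (indicator {0..} x * (1 / (1 + x\<^sup>2))) \<partial>lborel) < \<infinity>" by simp
qed auto

text \<open>The power of \<open>\<tau>\<close> is written with \<open>exp\<close> and
  \<open>ln\<close> so that it is visibly entire in \<open>s\<close>; the indicator makes the values
  of \<open>ln\<close> at nonpositive arguments irrelevant.\<close>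

definition mellin_integrand :: "nat \<Rightarrow> rat \<times> rat \<Rightarrow> complex \<Rightarrow> complex \<Rightarrow> real \<Rightarrow> complex" where
  "mellin_integrand l v z s \<tau> = indicator {0<..} \<tau> *\<^sub>R (theta l v z \<tau> * exp ((s / 2 + of_nat l - 1) * of_real (ln \<tau>)))"

text \<open>
  The integral converges for every \<open>s\<close> and is the entire continuation of \<open>\<Gamma>(s/2 + l) E\<^sub>l\<^sub>,\<^sub>v(z, s)\<close>.
\<close>

definition completed_eisenstein :: "nat \<Rightarrow> rat \<times> rat \<Rightarrow> complex \<Rightarrow> complex \<Rightarrow> complex" where
  "completed_eisenstein l v z s = of_real (1 / Im z ^ l) * (\<integral>\<tau>. mellin_integrand l v z s \<tau> \<partial>lborel)"

lemma cnj_borel_measurable [measurable]: "cnj \<in> borel_measurable borel"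
  by (intro borel_measurable_continuous_onI continuous_intros)

lemma exp_complex_borel_measurable [measurable]: "(exp :: complex \<Rightarrow> complex) \<in> borel_measurable borel"
  by (intro borel_measurable_continuous_onI continuous_intros)

lemma lin_measurable [measurable]: "lin p \<in> borel_measurable borel"
  unfolding lin_def by measurable

text \<open>Joint measurability in \<open>z\<close> and \<open>\<tau>\<close>, obtained by reading
  the sum as an integral over counting measure, is what makes the completed Eisenstein series Borel
  measurable in \<open>z\<close>.\<close>

lemma theta_measurable [measurable]:
  "(\<lambda>(z, \<tau>). theta l v z \<tau>) \<in> borel_measurable (borel \<Otimes>\<^sub>M borel)"
proof -
  interpret sigma_finite_measure "count_space (vec_coset v)"
    by (rule sigma_finite_measure_count_space_countable) simp
  interpret P: pair_sigma_finite "count_space (vec_coset v)" "lborel :: real measure" by unfold_locales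
  have t: "(\<lambda>x. cnj (lin p (fst x)) ^ l * exp (- complex_of_real (snd x / Im (fst x) * (cmod (lin p (fst x)))\<^sup>2)))
     \<in> borel_measurable (borel \<Otimes>\<^sub>M borel)" for p
    by measurable
  have "(\<lambda>(p, x). cnj (lin p (fst x)) ^ l * exp (- complex_of_real (snd x / Im (fst x) * (cmod (lin p (fst x)))\<^sup>2)))
     \<in> borel_measurable (count_space (vec_coset v) \<Otimes>\<^sub>M (borel \<Otimes>\<^sub>M borel))"
    by (rule measurable_pair_measure_countable1) (auto simp: t)
  then have "(\<lambda>(x, p). cnj (lin p (fst x)) ^ l * exp (- complex_of_real (snd x / Im (fst x) * (cmod (lin p (fst x)))\<^sup>2)))
     \<in> borel_measurable ((borel \<Otimes>\<^sub>M borel) \<Otimes>\<^sub>M count_space (vec_coset v))"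
    by (subst measurable_pair_swap_iff) (simp add: case_prod_unfold)
  from borel_measurable_lebesgue_integral[OF this] show ?thesis
    unfolding theta_def infsum_eq_integral_count_space by (simp add: case_prod_unfold)
qed

lemma mellin_integrand_measurable:
  "(\<lambda>(z, \<tau>). mellin_integrand l v z s \<tau>) \<in> borel_measurable (borel \<Otimes>\<^sub>M borel)"
  "mellin_integrand l v z s \<in> borel_measurable borel"
proof -
  show "(\<lambda>(z, \<tau>). mellin_integrand l v z s \<tau>) \<in> borel_measurable (borel \<Otimes>\<^sub>M borel)"
    unfolding mellin_integrand_def by measurable
  from measurable_Pair2[OF this, of z] show "mellin_integrand l v z s \<in> borel_measurable borel" by simp
qed

lemma completed_eisenstein_measurable [measurable]:
  "(\<lambda>z. completed_eisenstein l v z s) \<in> borel_measurable borel"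
proof -
  have "(\<lambda>(z, \<tau>). mellin_integrand l v z s \<tau>) \<in> borel_measurable (borel \<Otimes>\<^sub>M lborel)"
    using mellin_integrand_measurable(1)
    by (simp add: measurable_cong_sets[OF sets_pair_measure_cong[OF refl sets_lborel] refl])
  from lborel.borel_measurable_lebesgue_integral[OF this]
  have [measurable]: "(\<lambda>z. \<integral>\<tau>. mellin_integrand l v z s \<tau> \<partial>lborel) \<in> borel_measurable borel" .
  show ?thesis unfolding completed_eisenstein_def by measurable
qed

text \<open>For \<open>|s| \<le> S\<close> the exponent of \<open>\<tau>\<close> lies between
  \<open>- S\<close> and \<open>S + l\<close>. Near 0 the decay \<open>\<tau>^j\<close> with
  \<open>j \<ge> S\<close> compensates it; near infinity the decay
  \<open>\<tau>^-(j + l + 3)\<close> leaves \<open>\<tau>^-3\<close>. One majorant thus serves a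
  whole disc in \<open>s\<close> and yields holomorphy and moderate growth together.\<close>

lemma mellin_integrand_bound:
  assumes l: "l \<ge> 1" and S: "S \<ge> 0"
  obtains C A where "C \<ge> 0"
    "\<And>z s \<tau>. Im z > 0 \<Longrightarrow> norm s \<le> S \<Longrightarrow>
       norm (mellin_integrand l v z s \<tau>) \<le> C * height z ^ A * (indicator {0..} \<tau> * (1 / (1 + \<tau>\<^sup>2)))"
proof -
  define j where "j = nat \<lceil>S\<rceil>"
  have jS: "S \<le> real j" using S by (simp add: j_def)
  define j' where "j' = j + l + 3"
  have j'l: "j' \<ge> l + 3" by (simp add: j'_def)
  obtain C1 A1 where C1: "C1 \<ge> 0"
    "\<And>z \<tau>. Im z > 0 \<Longrightarrow> 0 < \<tau> \<Longrightarrow> \<tau> \<le> 1 \<Longrightarrow> norm (theta l v z \<tau>) \<le> C1 * height z ^ A1 * \<tau> ^ j"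
    using theta_bound_small[OF l, of v j] by blast
  have "\<exists>C A. 0 \<le> C \<and> (\<forall>z \<tau>. Im z > 0 \<longrightarrow> 0 < \<tau> \<longrightarrow> norm (theta l v z \<tau>) \<le> C * height z ^ A / \<tau> ^ j')"
    by (rule theta_bound_large[OF l j'l, of v]) blast
  then obtain C2 A2 where C2: "C2 \<ge> 0"
    "\<And>z \<tau>. Im z > 0 \<Longrightarrow> 0 < \<tau> \<Longrightarrow> norm (theta l v z \<tau>) \<le> C2 * height z ^ A2 / \<tau> ^ j'"
    by blast
  show ?thesis
  proof
    show "0 \<le> 2 * (C1 + C2)" using C1 C2 by simp
    fix z s :: complex and \<tau> :: real assume z: "Im z > 0" and s: "norm s \<le> S"
    note H = height_ge[OF z]
    show "norm (mellin_integrand l v z s \<tau>) \<le> 2 * (C1 + C2) * height z ^ (A1 + A2) * (indicator {0..} \<tau> * (1 / (1 + \<tau>\<^sup>2)))"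
    proof (cases "\<tau> > 0")
      case False
      then show ?thesis using C1(1) C2(1) H by (auto simp: mellin_integrand_def)
    next
      case True
      define c where "c = Re s / 2 + real l - 1"
      have "\<bar>Re s\<bar> \<le> S" using s abs_Re_le_cmod[of s] by linarith
      then have c: "- S \<le> c" "c \<le> S + real l" using l S by (auto simp: c_def)
      have n: "norm (mellin_integrand l v z s \<tau>) = norm (theta l v z \<tau>) * \<tau> powr c"
        using True by (simp add: mellin_integrand_def norm_mult powr_def c_def mult.commute norm_exp_eq_Re)
      have hA: "height z ^ A1 \<le> height z ^ (A1 + A2)" "height z ^ A2 \<le> height z ^ (A1 + A2)"
        using H by (auto intro!: power_increasing)
      have "norm (theta l v z \<tau>) * \<tau> powr c \<le> (C1 + C2) * height z ^ (A1 + A2) * (2 * (1 / (1 + \<tau>\<^sup>2)))"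
      proof (cases "\<tau> \<le> 1")
        case le: True
        have "\<tau> powr c \<le> \<tau> powr - S" using True le c by (intro powr_mono') auto
        also have "\<dots> \<le> \<tau> powr - real j" using True le jS by (intro powr_mono') auto
        finally have pc: "\<tau> powr c \<le> 1 / \<tau> ^ j" using True by (simp add: powr_minus powr_realpow divide_inverse)
        have "norm (theta l v z \<tau>) * \<tau> powr c \<le> (C1 * height z ^ A1 * \<tau> ^ j) * (1 / \<tau> ^ j)"
          using C1 pc True le z H by (intro mult_mono) auto
        also have "\<dots> = C1 * height z ^ A1" using True by simp
        also have "\<dots> \<le> (C1 + C2) * height z ^ (A1 + A2)" using C1 C2 H hA by (intro mult_mono) auto
        also have "\<dots> \<le> (C1 + C2) * height z ^ (A1 + A2) * (2 * (1 / (1 + \<tau>\<^sup>2)))"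
        proof -
          have "\<tau>\<^sup>2 \<le> 1" using True le by (simp add: power_le_one)
          then have "1 \<le> 2 * (1 / (1 + \<tau>\<^sup>2))" by (simp add: add_pos_nonneg field_simps)
          moreover have "0 \<le> (C1 + C2) * height z ^ (A1 + A2)" using C1 C2 H by simp
          ultimately show ?thesis by (metis mult_left_mono mult.right_neutral)
        qed
        finally show ?thesis .
      next
        case False
        then have t1: "\<tau> \<ge> 1" by simp
        have "\<tau> powr c \<le> \<tau> powr (real (j + l))" using t1 c jS by (intro powr_mono) auto
        also have "\<dots> = \<tau> ^ (j + l)" using True by (rule powr_realpow)
        finally have pc: "\<tau> powr c \<le> \<tau> ^ (j + l)" .
        have "norm (theta l v z \<tau>) * \<tau> powr c \<le> (C2 * height z ^ A2 / \<tau> ^ j') * \<tau> ^ (j + l)"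
          using C2 pc True z H by (intro mult_mono) auto
        also have "\<dots> = C2 * height z ^ A2 * (1 / \<tau> ^ 3)" using True by (simp add: j'_def power_add)
        also have "\<dots> \<le> ((C1 + C2) * height z ^ (A1 + A2)) * (2 * (1 / (1 + \<tau>\<^sup>2)))"
        proof (rule mult_mono)
          show "C2 * height z ^ A2 \<le> (C1 + C2) * height z ^ (A1 + A2)" using C1 C2 H hA by (intro mult_mono) auto
          have "1 + \<tau>\<^sup>2 \<le> 2 * \<tau> ^ 3"
            using power_increasing[of 2 3 \<tau>, OF _ t1] one_le_power[OF t1, of 3] by simp
          then show "1 / \<tau> ^ 3 \<le> 2 * (1 / (1 + \<tau>\<^sup>2))" using True
            by (simp add: field_simps add_pos_nonneg)
        qed (use C1 C2 H True in auto)
        finally show ?thesis by simp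
      qed
      moreover have "indicator {0..} \<tau> = (1 :: real)" using True by simp
      ultimately show ?thesis unfolding n by (simp only: mult_1 mult_ac)
    qed
  qed
qed

lemma completed_eisenstein_bound:
  assumes l: "l \<ge> 1" and S: "S \<ge> 0"
  obtains C A where "C \<ge> 0"
    "\<And>z s. Im z > 0 \<Longrightarrow> norm s \<le> S \<Longrightarrow> norm (completed_eisenstein l v z s) \<le> C * height z ^ A"
proof -
  obtain C A where C: "C \<ge> 0"
    "\<And>z s \<tau>. Im z > 0 \<Longrightarrow> norm s \<le> S \<Longrightarrow>
       norm (mellin_integrand l v z s \<tau>) \<le> C * height z ^ A * (indicator {0..} \<tau> * (1 / (1 + \<tau>\<^sup>2)))"
    using mellin_integrand_bound[OF l S, of v] by blast
  define D where "D = (\<integral>\<tau>. indicator {0..} \<tau> * (1 / (1 + \<tau>\<^sup>2)) \<partial>(lborel :: real measure))"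
  have D0: "D \<ge> 0" unfolding D_def by (rule integral_nonneg_AE) auto
  show ?thesis
  proof
    show "C * D \<ge> 0" using C D0 by simp
    fix z s :: complex assume z: "Im z > 0" and s: "norm s \<le> S"
    note H = height_ge[OF z]
    have int: "integrable lborel (\<lambda>\<tau>. C * height z ^ A * (indicator {0..} \<tau> * (1 / (1 + \<tau>\<^sup>2))))"
      by (rule integrable_mult_right[OF integrable_arctan_deriv])
    have "integrable lborel (mellin_integrand l v z s)"
      by (rule Bochner_Integration.integrable_bound[OF int])
        (simp add: mellin_integrand_measurable,
         rule AE_I2, rule order_trans[OF C(2)[OF z s]], simp only: real_norm_def abs_ge_self)
    then have "norm (\<integral>\<tau>. mellin_integrand l v z s \<tau> \<partial>lborel) \<le> (\<integral>\<tau>. C * height z ^ A * (indicator {0..} \<tau> * (1 / (1 + \<tau>\<^sup>2))) \<partial>lborel)"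
      by (rule Bochner_Integration.integral_norm_bound_integral[OF _ int]) (rule C(2)[OF z s])
    also have "\<dots> = C * D * height z ^ A" unfolding integral_mult_right_zero D_def by (simp only: mult_ac)
    finally have *: "norm (\<integral>\<tau>. mellin_integrand l v z s \<tau> \<partial>lborel) \<le> C * D * height z ^ A" .
    have "norm (completed_eisenstein l v z s) \<le> (1 / Im z) ^ l * (C * D * height z ^ A)"
      unfolding completed_eisenstein_def norm_mult using z * by (intro mult_mono) (auto simp: norm_divide norm_power power_divide)
    also have "\<dots> \<le> height z ^ l * (C * D * height z ^ A)"
      using H z C D0 by (intro mult_right_mono power_mono) auto
    finally show "norm (completed_eisenstein l v z s) \<le> C * D * height z ^ (A + l)"
      by (simp add: power_add mult_ac)
  qed
qed

lemma completed_eisenstein_holomorphic: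
  assumes l: "l \<ge> 1" and z: "Im z > 0"
  shows "completed_eisenstein l v z holomorphic_on UNIV"
proof -
  have "(\<lambda>s. \<integral>\<tau>. mellin_integrand l v z s \<tau> \<partial>lborel) holomorphic_on UNIV"
    unfolding holomorphic_on_open[OF open_UNIV]
  proof
    fix s0 :: complex
    obtain C A where C: "C \<ge> 0"
      "\<And>z s \<tau>. Im z > 0 \<Longrightarrow> norm s \<le> norm s0 + 1 \<Longrightarrow>
         norm (mellin_integrand l v z s \<tau>) \<le> C * height z ^ A * (indicator {0..} \<tau> * (1 / (1 + \<tau>\<^sup>2)))"
      using mellin_integrand_bound[OF l, of "norm s0 + 1" v] by auto
    have "((\<lambda>s. \<integral>\<tau>. mellin_integrand l v z s \<tau> \<partial>lborel) has_field_derivative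
        (\<integral>\<tau>. deriv (\<lambda>s. mellin_integrand l v z s \<tau>) s0 \<partial>lborel)) (at s0)"
    proof (rule has_field_derivative_lebesgue_integral[OF zero_less_one])
      fix s \<tau> assume "s \<in> ball s0 1"
      then have "norm s \<le> norm s0 + 1"
        using norm_triangle_ineq2[of s s0] by (simp add: dist_norm norm_minus_commute)
      then show "norm (mellin_integrand l v z s \<tau>) \<le> C * height z ^ A * (indicator {0..} \<tau> * (1 / (1 + \<tau>\<^sup>2)))"
        by (rule C(2)[OF z])
    next
      show "(\<lambda>s. mellin_integrand l v z s \<tau>) holomorphic_on ball s0 1" for \<tau>
        unfolding mellin_integrand_def scaleR_conv_of_real by (intro holomorphic_intros) auto
    next
      show "integrable lborel (\<lambda>\<tau>. C * height z ^ A * (indicator {0..} \<tau> * (1 / (1 + \<tau>\<^sup>2))))"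
        by (rule integrable_mult_right[OF integrable_arctan_deriv])
    qed (simp add: mellin_integrand_measurable)
    then show "\<exists>f'. ((\<lambda>s. \<integral>\<tau>. mellin_integrand l v z s \<tau> \<partial>lborel) has_field_derivative f') (at s0)" by blast
  qed
  then show ?thesis
    unfolding completed_eisenstein_def[abs_def] by (intro holomorphic_intros)
qed

section \<open>The Mellin transform of the theta series\<close>

lemma gamma_integral_scaled:
  fixes c :: complex
  assumes a: "a > 0" and c: "Re c > 0"
  shows "integrable lborel (\<lambda>\<tau>::real. indicator {0<..} \<tau> *\<^sub>R (exp (- of_real (a * \<tau>)) * exp ((c - 1) * of_real (ln \<tau>))))"
    and "(\<integral>\<tau>. indicator {0<..} \<tau> *\<^sub>R (exp (- of_real (a * \<tau>)) * exp ((c - 1) * of_real (ln \<tau>))) \<partial>lborel) = Gamma c * exp (- c * of_real (ln a))"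
proof -
  define g where "g = (\<lambda>\<tau>::real. indicator {0<..} \<tau> *\<^sub>R (exp (- of_real \<tau>) * exp ((c - 1) * of_real (ln \<tau>))))"
  have eq: "complex_of_real t powr (c - 1) / of_real (exp t) = exp (- of_real t) * exp ((c - 1) * of_real (ln t))"
    if "t \<in> {0<..}" for t
    using that by (simp add: powr_def Ln_of_real exp_minus exp_of_real divide_inverse mult.commute)
  have m: "g \<in> borel_measurable lborel" unfolding g_def by measurable
  have "(\<lambda>t. complex_of_real t powr (c - 1) / of_real (exp t)) absolutely_integrable_on {0<..}"
    by (rule absolutely_integrable_Gamma_integral'[OF c])
  then have "(\<lambda>t. exp (- complex_of_real t) * exp ((c - 1) * of_real (ln t))) absolutely_integrable_on {0<..}"
    by (rule set_integrable_cong[THEN iffD1, rotated -1]) (auto simp: eq)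
  then have gl: "integrable lebesgue g" by (simp add: g_def set_integrable_def)
  then have g: "integrable lborel g" using m by (simp add: integrable_completion)
  then have si: "set_integrable lborel {0<..} (\<lambda>t. exp (- complex_of_real t) * exp ((c - 1) * of_real (ln t)))"
    by (simp add: g_def set_integrable_def)
  have "((\<lambda>t. exp (- complex_of_real t) * exp ((c - 1) * of_real (ln t))) has_integral Gamma c) {0<..}"
    by (rule has_integral_eq[OF eq Gamma_integral_complex'[OF c]])
  then have gi: "integral\<^sup>L lborel g = Gamma c"
    using set_borel_integral_eq_integral(2)[OF si] by (simp add: integral_unique set_lebesgue_integral_def g_def)
  define K where "K = exp ((c - 1) * complex_of_real (ln a))"
  define X where "X = (\<lambda>\<tau>::real. indicator {0<..} \<tau> *\<^sub>R (exp (- of_real (a * \<tau>)) * exp ((c - 1) * of_real (ln \<tau>))))"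
  have ga: "g (0 + a * \<tau>) = K * X \<tau>" for \<tau>
  proof (cases "\<tau> > 0")
    case True
    then show ?thesis using a by (simp add: g_def K_def X_def ln_mult distrib_left exp_add mult_ac)
  next
    case False
    then have "\<not> 0 < a * \<tau>" using a by (simp add: zero_less_mult_iff)
    then show ?thesis using False by (simp add: g_def X_def)
  qed
  have K0: "K \<noteq> 0" by (simp add: K_def)
  have "integrable lborel (\<lambda>\<tau>. K * X \<tau>)"
    using lborel_integrable_real_affine_iff[of a g 0] a g by (simp add: ga[simplified])
  from integrable_mult_right[OF this, of "inverse K"] have "integrable lborel (\<lambda>\<tau>. inverse K * (K * X \<tau>))" .
  moreover have "(\<lambda>\<tau>. inverse K * (K * X \<tau>)) = X"
    using K0 by (simp add: mult.assoc[symmetric] fun_eq_iff)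
  ultimately show "integrable lborel X" by (simp only:)
  have "Gamma c = of_real a * (\<integral>\<tau>. g (0 + a * \<tau>) \<partial>lborel)"
    using lborel_integral_real_affine[of a g 0] a gi by (simp add: scaleR_conv_of_real)
  also have "\<dots> = of_real a * K * integral\<^sup>L lborel X"
    unfolding ga by (simp add: mult.assoc)
  also have "of_real a * K = exp (c * of_real (ln a))"
    using a by (simp add: K_def left_diff_distrib exp_diff exp_of_real exp_ln)
  finally have G: "Gamma c = exp (c * of_real (ln a)) * integral\<^sup>L lborel X" .
  show "integral\<^sup>L lborel X = Gamma c * exp (- c * of_real (ln a))"
    unfolding G by (simp add: exp_minus)
qed

lemma lin_eq_0_iff: "Im z > 0 \<Longrightarrow> lin p z = 0 \<longleftrightarrow> p = (0, 0)"
proof -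
  assume z: "Im z > 0"
  have h: "x = 0 \<and> y = 0" if "\<bar>x\<bar> + \<bar>y\<bar> \<le> 0" for x y :: real
    using that by linarith
  have "of_rat (fst p) = (0 :: real) \<and> of_rat (snd p) = (0 :: real)" if "lin p z = 0"
    using norm_lin_ge'[OF z, of p] unfolding that by (intro h) (simp only: norm_zero mult_zero_right)
  then show ?thesis by (cases p) (auto simp: lin_def)
qed

text \<open>Termwise Mellin transform. With \<open>c = s / 2 + l\<close>, \<open>w = lin p z\<close>
  and \<open>y = Im z\<close> the vector \<open>p\<close> contributes
  \<open>cnj w ^ l * Gamma c * (|w|^2 / y) powr (- c)\<close>; the prefactor \<open>1 / y^l\<close>
  turns this into \<open>Gamma c * w^-l * |w| powr (- s) * y powr (s / 2)\<close>.\<close>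

lemma completed_eisenstein_eq_series:
  assumes l: "l \<ge> 1" and z: "Im z > 0" and s: "Re s + real l > 2"
  shows "completed_eisenstein l v z s = Gamma (s / 2 + of_nat l) * eisenstein_series l v z s"
proof -
  define c where "c = s / 2 + of_nat l"
  have c0: "Re c > 0" using s l by (simp add: c_def)
  let ?I = "vec_coset v - {(0,0)}"
  define a where "a p = cmod (lin p z) ^ 2 / Im z" for p
  define e where "e c a \<tau> = indicator {0<..} \<tau> *\<^sub>R (exp (- of_real (a * \<tau>)) * exp ((c - 1) * of_real (ln \<tau>)))" for c :: complex and a \<tau> :: real
  define \<phi> where "\<phi> p \<tau> = cnj (lin p z) ^ l * e c (a p) \<tau>" for p \<tau>
  have a0: "a p > 0" if "p \<in> ?I" for p using that z lin_eq_0_iff[OF z, of p] by (auto simp: a_def)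
  have int: "integrable lborel (\<phi> p)" if "p \<in> ?I" for p
    unfolding \<phi>_def e_def by (intro integrable_mult_right gamma_integral_scaled(1) a0 that c0)
  have val: "integral\<^sup>L lborel (\<phi> p) = cnj (lin p z) ^ l * (Gamma c * exp (- c * of_real (ln (a p))))" if "p \<in> ?I" for p
    unfolding \<phi>_def e_def by (subst integral_mult_right_zero, subst gamma_integral_scaled(2)[OF a0[OF that] c0]) simp
  \<comment> \<open>In absolute value \<open>c\<close> may be replaced by its real part, so the
    exchange of sum and integral reduces to the same Gamma integral at a positive real
    argument.\<close>
  have norm\<phi>: "norm (\<phi> p \<tau>) = cmod (lin p z) ^ l * Re (e (of_real (Re c)) (a p) \<tau>)" for p \<tau>
  proof -
    have "norm (e c (a p) \<tau>) = Re (e (of_real (Re c)) (a p) \<tau>)"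
      by (auto simp: e_def norm_mult indicator_def norm_exp_eq_Re Re_exp Im_exp)
    then show ?thesis by (simp add: \<phi>_def norm_mult norm_power)
  qed
  have normint: "(\<integral>\<^sup>+\<tau>. ennreal (norm (\<phi> p \<tau>)) \<partial>lborel) = ennreal (Gamma (Re c) * Im z powr Re c * cmod (lin p z) powr - (Re s + real l))"
    if "p \<in> ?I" for p
  proof -
    have w: "cmod (lin p z) > 0" using that lin_eq_0_iff[OF z, of p] by auto
    have i: "integrable lborel (e (of_real (Re c)) (a p))"
      unfolding e_def by (rule gamma_integral_scaled(1)[OF a0[OF that]]) (use c0 in simp)
    have "(\<integral>\<tau>. Re (e (of_real (Re c)) (a p) \<tau>) \<partial>lborel) = Re (Gamma (of_real (Re c)) * exp (- of_real (Re c) * of_real (ln (a p))))"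
      using integral_Re[OF i] gamma_integral_scaled(2)[OF a0[OF that], of "of_real (Re c)"] c0 unfolding e_def by simp
    also have "\<dots> = Gamma (Re c) * exp (- Re c * ln (a p))"
      by (simp add: Gamma_complex_of_real Re_exp Im_exp)
    also have "exp (- Re c * ln (a p)) = (a p) powr - Re c" using a0[OF that] by (simp add: powr_def)
    also have "\<dots> = Im z powr Re c * cmod (lin p z) powr (- 2 * Re c)"
    proof -
      have "(cmod (lin p z) ^ 2) powr - Re c = cmod (lin p z) powr (- 2 * Re c)"
        using w by (simp add: powr_def ln_realpow)
      moreover have "(cmod (lin p z) ^ 2 / Im z) powr - Re c = (cmod (lin p z) ^ 2) powr - Re c / Im z powr - Re c"
        by (intro powr_divide)
      ultimately show ?thesis unfolding a_def by (simp add: powr_minus divide_inverse)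
    qed
    finally have v: "(\<integral>\<tau>. Re (e (of_real (Re c)) (a p) \<tau>) \<partial>lborel) = Gamma (Re c) * (Im z powr Re c * cmod (lin p z) powr (- 2 * Re c))" .
    have "(\<integral>\<^sup>+\<tau>. ennreal (norm (\<phi> p \<tau>)) \<partial>lborel) = ennreal (\<integral>\<tau>. norm (\<phi> p \<tau>) \<partial>lborel)"
      by (rule nn_integral_eq_integral) (use int[OF that] in auto)
    also have "(\<integral>\<tau>. norm (\<phi> p \<tau>) \<partial>lborel) = cmod (lin p z) ^ l * (Gamma (Re c) * (Im z powr Re c * cmod (lin p z) powr (- 2 * Re c)))"
      unfolding norm\<phi> v[symmetric] by simp
    also have "\<dots> = Gamma (Re c) * Im z powr Re c * (cmod (lin p z) powr real l * cmod (lin p z) powr (- 2 * Re c))"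
      using w by (simp add: powr_realpow)
    also have "cmod (lin p z) powr real l * cmod (lin p z) powr (- 2 * Re c) = cmod (lin p z) powr - (Re s + real l)"
      by (simp add: powr_add[symmetric] c_def algebra_simps)
    finally show ?thesis .
  qed
  have fin: "(\<integral>\<^sup>+\<tau>. (\<integral>\<^sup>+p. ennreal (norm (\<phi> p \<tau>)) \<partial>count_space ?I) \<partial>lborel) < \<infinity>"
  proof -
    obtain C where "(\<lambda>p. cmod (lin p z) powr - (Re s + real l)) summable_on ?I"
      using lin_power_sum_bound[of "Re s + real l" v] s z by metis
    then have "Infinite_Sum.abs_summable_on (\<lambda>p. complex_of_real (Gamma (Re c) * Im z powr Re c * cmod (lin p z) powr - (Re s + real l))) ?I"
      using Gamma_real_pos[OF c0] by (simp add: norm_mult summable_on_cmult_right)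
    then have "integrable (count_space ?I) (\<lambda>p. norm (complex_of_real (Gamma (Re c) * Im z powr Re c * cmod (lin p z) powr - (Re s + real l))))"
      unfolding abs_summable_iff_integrable_count_space by (rule integrable_norm)
    then have I: "integrable (count_space ?I) (\<lambda>p. Gamma (Re c) * Im z powr Re c * cmod (lin p z) powr - (Re s + real l))"
      using Gamma_real_pos[OF c0] by (simp add: norm_mult)
    have "(\<integral>\<^sup>+\<tau>. (\<integral>\<^sup>+p. ennreal (norm (\<phi> p \<tau>)) \<partial>count_space ?I) \<partial>lborel)
       = (\<integral>\<^sup>+p. (\<integral>\<^sup>+\<tau>. ennreal (norm (\<phi> p \<tau>)) \<partial>lborel) \<partial>count_space ?I)"
      by (rule nn_integral_count_space_nn_integral) (use int in \<open>auto intro!: measurable_compose[OF borel_measurable_integrable]\<close>)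
    also have "\<dots> = (\<integral>\<^sup>+p. ennreal (Gamma (Re c) * Im z powr Re c * cmod (lin p z) powr - (Re s + real l)) \<partial>count_space ?I)"
      by (rule nn_integral_cong) (simp add: normint)
    also have "\<dots> < \<infinity>"
      by (subst nn_integral_eq_integral[OF I]) (use Gamma_real_pos[OF c0] in auto)
    finally show ?thesis .
  qed
  have cI: "countable ?I" by simp
  have "mellin_integrand l v z s \<tau> = (\<Sum>\<^sub>\<infinity>p\<in>?I. \<phi> p \<tau>)" for \<tau>
  proof (cases "\<tau> > 0")
    case True
    have "theta l v z \<tau> = (\<Sum>\<^sub>\<infinity>p\<in>?I. cnj (lin p z) ^ l * exp (- of_real (\<tau> / Im z * cmod (lin p z) ^ 2)))"
      unfolding theta_def by (rule infsum_cong_neutral) (use l in \<open>auto simp: lin_def\<close>)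
    then have "mellin_integrand l v z s \<tau> = exp ((s / 2 + of_nat l - 1) * of_real (ln \<tau>)) * (\<Sum>\<^sub>\<infinity>p\<in>?I. cnj (lin p z) ^ l * exp (- of_real (\<tau> / Im z * cmod (lin p z) ^ 2)))"
      using True by (simp add: mellin_integrand_def mult.commute)
    also have "\<dots> = (\<Sum>\<^sub>\<infinity>p\<in>?I. exp ((s / 2 + of_nat l - 1) * of_real (ln \<tau>)) * (cnj (lin p z) ^ l * exp (- of_real (\<tau> / Im z * cmod (lin p z) ^ 2))))"
      by (rule infsum_cmult_right'[symmetric])
    also have "\<dots> = (\<Sum>\<^sub>\<infinity>p\<in>?I. \<phi> p \<tau>)"
      by (rule infsum_cong) (use True in \<open>simp add: \<phi>_def e_def a_def c_def mult_ac\<close>)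
    finally show ?thesis .
  qed (simp add: mellin_integrand_def \<phi>_def e_def)
  then have "(\<integral>\<tau>. mellin_integrand l v z s \<tau> \<partial>lborel) = (\<Sum>\<^sub>\<infinity>p\<in>?I. integral\<^sup>L lborel (\<phi> p))"
    using integral_infsum_fubini[OF lborel.sigma_finite_measure_axioms cI _ fin] int by (simp add: borel_measurable_integrable)
  moreover have "(\<Sum>\<^sub>\<infinity>p\<in>?I. integral\<^sup>L lborel (\<phi> p)) = (\<Sum>\<^sub>\<infinity>p\<in>?I. cnj (lin p z) ^ l * (Gamma c * exp (- c * of_real (ln (a p)))))"
    by (rule infsum_cong) (rule val)
  ultimately have "completed_eisenstein l v z s = of_real (1 / Im z ^ l) * (\<Sum>\<^sub>\<infinity>p\<in>?I. cnj (lin p z) ^ l * (Gamma c * exp (- c * of_real (ln (a p)))))"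
    unfolding completed_eisenstein_def by (simp only:)
  also have "\<dots> = (\<Sum>\<^sub>\<infinity>p\<in>?I. of_real (1 / Im z ^ l) * (cnj (lin p z) ^ l * (Gamma c * exp (- c * of_real (ln (a p))))))"
    by (rule infsum_cmult_right'[symmetric])
  also have "\<dots> = (\<Sum>\<^sub>\<infinity>p\<in>?I. Gamma c * (inverse (lin p z ^ l) * of_real (cmod (lin p z)) powr (- s) * of_real (Im z) powr (s / 2)))"
  proof (rule infsum_cong)
    fix p assume p: "p \<in> ?I"
    define w where "w = lin p z"
    have w: "w \<noteq> 0" using p lin_eq_0_iff[OF z, of p] by (auto simp: w_def)
    have la: "ln (a p) = 2 * ln (cmod w) - ln (Im z)"
      using z w by (simp add: a_def ln_div ln_realpow flip: w_def)
    have 1: "exp (of_nat l * complex_of_real (ln (Im z))) = of_real (Im z ^ l)"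
      using z by (simp add: exp_of_nat_mult exp_of_real)
    have 2: "exp (of_nat l * (2 * complex_of_real (ln (cmod w)))) = (w * cnj w) ^ l"
    proof -
      have "exp (2 * complex_of_real (ln (cmod w))) = exp (of_real (ln (cmod w))) ^ 2"
        by (simp add: exp_double)
      also have "\<dots> = of_real (cmod w ^ 2)" using w by (simp add: exp_of_real)
      also have "\<dots> = w * cnj w" by (rule complex_norm_square)
      finally show ?thesis by (simp add: exp_of_nat_mult)
    qed
    have pw: "of_real (cmod w) powr (- s) * of_real (Im z) powr (s / 2) = exp (- s * of_real (ln (cmod w)) + s / 2 * of_real (ln (Im z)))"
      using z w by (simp add: powr_def Ln_of_real mult_exp_exp)
    have "- c * of_real (ln (a p)) = (- s * of_real (ln (cmod w)) + s / 2 * of_real (ln (Im z))) + of_nat l * of_real (ln (Im z)) - of_nat l * (2 * of_real (ln (cmod w)))"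
      unfolding la c_def by (simp add: algebra_simps)
    then have "exp (- c * of_real (ln (a p))) = of_real (cmod w) powr (- s) * of_real (Im z) powr (s / 2) * of_real (Im z ^ l) / (w * cnj w) ^ l"
      by (simp only: exp_diff exp_add[of _ "of_nat l * _"] 1 2 pw)
    then show "of_real (1 / Im z ^ l) * (cnj (lin p z) ^ l * (Gamma c * exp (- c * of_real (ln (a p)))))
        = Gamma c * (inverse (lin p z ^ l) * of_real (cmod (lin p z)) powr (- s) * of_real (Im z) powr (s / 2))"
      unfolding w_def[symmetric] using z w by (simp add: power_mult_distrib field_simps)
  qed
  also have "\<dots> = Gamma c * (\<Sum>\<^sub>\<infinity>p\<in>?I. inverse (lin p z ^ l) * of_real (cmod (lin p z)) powr (- s) * of_real (Im z) powr (s / 2))"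
    by (rule infsum_cmult_right')
  also have "?I = {p. integral_vector (p - v) \<and> p \<noteq> (0, 0)}" by (auto simp: vec_coset_def)
  finally show ?thesis unfolding eisenstein_series_def c_def lin_def by (simp add: case_prod_unfold)
qed

text \<open>Resolves the definite description: the right-hand side is entire because
  \<open>rGamma\<close> is, it agrees with the series in the half-plane of convergence, and the
  identity theorem makes it the only such function.\<close>

lemma eisenstein_eq_completed:
  assumes l: "l \<ge> 1" and z: "Im z > 0"
  shows "eisenstein l v z s = rGamma (s / 2 + of_nat l) * completed_eisenstein l v z s"
proof -
  let ?g = "\<lambda>s. rGamma (s / 2 + of_nat l) * completed_eisenstein l v z s"
  have holo: "?g holomorphic_on UNIV"
    using completed_eisenstein_holomorphic[OF l z, of v] by (intro holomorphic_intros) auto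
  have ser: "?g s = eisenstein_series l v z s" if "Re s + real l > 2" for s
  proof -
    have pos: "Re (s / 2 + of_nat l) > 0" using that l by simp
    have neg: "Re x \<le> 0" if "x \<in> \<int>\<^sub>\<le>\<^sub>0" for x :: complex
      using that by (auto elim!: nonpos_Ints_cases)
    have "rGamma (s / 2 + of_nat l) \<noteq> 0"
      unfolding rGamma_eq_zero_iff using neg[of "s / 2 + of_nat l"] pos by linarith
    then have "rGamma (s / 2 + of_nat l) * Gamma (s / 2 + of_nat l) = 1"
      by (simp add: Gamma_def)
    then show ?thesis unfolding completed_eisenstein_eq_series[OF l z that] by (simp flip: mult.assoc)
  qed
  have "eisenstein l v z = ?g"
    unfolding eisenstein_def
  proof (rule the_equality)
    show "?g holomorphic_on UNIV \<and> (\<forall>s. Re s + real l > 2 \<longrightarrow> ?g s = eisenstein_series l v z s)"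
      using holo ser by blast
    fix h assume h: "h holomorphic_on UNIV \<and> (\<forall>s. Re s + real l > 2 \<longrightarrow> h s = eisenstein_series l v z s)"
    show "h = ?g"
    proof
      fix s
      show "h s = ?g s"
      proof (rule analytic_continuation_open[of "{s. Re s > 2 - real l}" UNIV h ?g s])
        show "open {s. Re s > 2 - real l}" by (rule open_halfspace_Re_gt)
        have "of_real (3 - real l) \<in> {s. Re s > 2 - real l}" by simp
        then show "{s. Re s > 2 - real l} \<noteq> {}" by blast
      qed (use h holo ser in auto)
    qed
  qed
  then show ?thesis by simp
qed

text \<open>
  The function \<open>L\<close> without the factor \<open>1/\<Gamma>(t + w + 1)\<close>; the other Gamma factors of \<open>1/G\<close> complete the two series.
\<close>

definition L_summand :: "nat \<Rightarrow> rat \<times> rat \<Rightarrow> rat \<times> rat \<Rightarrow> complex \<Rightarrow> complex \<Rightarrow> complex \<Rightarrow> complex \<Rightarrow> complex" where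
  "L_summand w u v a b z t = (\<Sum>l\<le>w. of_nat (w choose l) * cnj a ^ l * cnj b ^ (w - l) *
      (completed_eisenstein (l + 1) u z t * completed_eisenstein (w - l + 1) v z t))"

section \<open>The functions L in terms of completed series\<close>

lemma sum_over_antidiagonal:
  "(\<Sum>(l, m) | l + m = (w::nat). F l m) = (\<Sum>l\<le>w. F l (w - l))"
  by (rule sum.reindex_bij_witness[of _ "\<lambda>l. (l, w - l)" fst]) auto

lemma eventually_Gamma_arg_not_nonpos:
  "eventually (\<lambda>t. t / 2 + c \<notin> \<int>\<^sub>\<le>\<^sub>0) (at (s :: complex))"
proof -
  have ol: "rGamma (t / 2 + c) \<noteq> 0 \<longleftrightarrow> t / 2 + c \<notin> \<int>\<^sub>\<le>\<^sub>0" for t :: complex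
    by (simp add: rGamma_eq_zero_iff)
  have "(\<lambda>t. rGamma (t / 2 + c)) holomorphic_on UNIV" by (intro holomorphic_intros) auto
  \<comment> \<open>At \<open>t = 2 * (1 - c)\<close> the argument is 1, so the function is not
    identically zero and its zeros are isolated.\<close>
  moreover have "rGamma ((2 * (1 - c)) / 2 + c) \<noteq> 0" by (simp add: diff_divide_distrib)
  ultimately have "eventually (\<lambda>t. rGamma (t / 2 + c) \<noteq> 0 \<and> t \<in> UNIV) (at s)"
    by (intro non_zero_neighbour_alt[where \<beta> = "2 * (1 - c)"]) auto
  then have "eventually (\<lambda>t. rGamma (t / 2 + c) \<noteq> 0) (at s)" by simp
  then show ?thesis unfolding ol .
qed

text \<open>Away from the poles the factors \<open>rGamma\<close> of the two Eisenstein series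
  cancel the Gamma factors of \<open>1 / G\<close>, and the result is entire. The literal sum agrees
  with it on a punctured neighbourhood of every point, so \<open>remove_sings\<close> returns its
  value.\<close>

lemma L_fun_eq:
  assumes z: "Im z > 0"
  shows "L_fun w u v a b z s = rGamma (cnj s + of_nat w + 1) * L_summand w u v a b z (cnj s)"
  unfolding L_fun_def sum_over_antidiagonal
proof (rule remove_sings_eqI)
  let ?h = "\<lambda>t. rGamma (t + of_nat w + 1) * L_summand w u v a b z t"
  have "?h holomorphic_on UNIV"
    unfolding L_summand_def using completed_eisenstein_holomorphic[OF _ z]
    by (intro holomorphic_intros) auto
  then have "isCont ?h (cnj s)"
    by (metis holomorphic_on_imp_continuous_on continuous_on_eq_continuous_at open_UNIV UNIV_I)
  then have lim: "(?h \<longlongrightarrow> ?h (cnj s)) (at (cnj s))" by (simp add: isCont_def)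
  have "eventually (\<lambda>t. \<forall>l\<in>{..w}. t / 2 + (of_nat l + 1) \<notin> \<int>\<^sub>\<le>\<^sub>0) (at (cnj s))"
    by (rule eventually_ball_finite) (auto intro: eventually_Gamma_arg_not_nonpos)
  then have "eventually (\<lambda>t. ?h t = (\<Sum>l\<le>w. of_nat (w choose l) * inverse (G_factor w l (w - l) t) * cnj a ^ l * cnj b ^ (w - l) *
        eisenstein (l + 1) u z t * eisenstein (w - l + 1) v z t)) (at (cnj s))"
  proof eventually_elim
    case (elim t)
    have g: "Gamma (t / 2 + of_nat l + 1) * rGamma (t / 2 + of_nat l + 1) = 1" if "l \<le> w" for l
      using elim[rule_format, of l] that rGamma_eq_zero_iff[of "t / 2 + of_nat l + 1"] by (simp add: Gamma_def add_ac)
    show ?case unfolding L_summand_def sum_distrib_left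
    proof (rule sum.cong[OF refl])
      fix l assume "l \<in> {..w}"
      then have l: "l \<le> w" "w - l \<le> w" by auto
      have e: "eisenstein (i + 1) v z t = rGamma (t / 2 + of_nat i + 1) * completed_eisenstein (i + 1) v z t" for i v
        using eisenstein_eq_completed[OF _ z, of "i + 1" v t] by (simp add: add_ac)
      have IG: "inverse (G_factor w l (w - l) t) = rGamma (t + of_nat w + 1) * (Gamma (t / 2 + of_nat l + 1) * Gamma (t / 2 + of_nat (w - l) + 1))"
      proof -
        have "inverse (A / B) = inverse A * B" for A B :: complex by (simp add: divide_inverse)
        then show ?thesis unfolding G_factor_def rGamma_inverse_Gamma .
      qed
      have A: "r * (n * ca * cb * (Cu * Cv)) = n * (r * (G1 * G2)) * ca * cb * (R1 * Cu) * (R2 * Cv)"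
        if "G1 * R1 = 1" "G2 * R2 = 1" for r n ca cb Cu Cv G1 G2 R1 R2 :: complex
      proof -
        have "n * (r * (G1 * G2)) * ca * cb * (R1 * Cu) * (R2 * Cv) = (G1 * R1) * (G2 * R2) * (r * (n * ca * cb * (Cu * Cv)))"
          by (simp only: mult_ac)
        then show ?thesis by (simp only: that mult_1)
      qed
      show "rGamma (t + of_nat w + 1) * (of_nat (w choose l) * cnj a ^ l * cnj b ^ (w - l) *
           (completed_eisenstein (l + 1) u z t * completed_eisenstein (w - l + 1) v z t)) =
         of_nat (w choose l) * inverse (G_factor w l (w - l) t) * cnj a ^ l * cnj b ^ (w - l) *
           eisenstein (l + 1) u z t * eisenstein (w - l + 1) v z t"
        unfolding e IG by (rule A[OF g[OF l(1)] g[OF l(2)]])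
    qed
  qed
  then show "(\<lambda>t. \<Sum>l\<le>w. of_nat (w choose l) * inverse (G_factor w l (w - l) t) * cnj a ^ l * cnj b ^ (w - l) *
        eisenstein (l + 1) u z t * eisenstein (w - l + 1) v z t) \<midarrow>cnj s\<rightarrow> ?h (cnj s)"
    using lim by (rule Lim_transform_eventually[rotated])
qed

text \<open>At 0 all Gamma factors are factorials, and the binomial coefficient divided by
  \<open>fact w\<close> is \<open>1 / (fact l * fact (w - l))\<close>: the binomial weights of
  \<open>L\<close> disappear, and the unweighted sum is exactly the value of \<open>L\<close> at
  \<open>s = 0\<close>.\<close>

lemma L_fun0_eq:
  assumes z: "Im z > 0" and k: "k \<ge> 2"
  shows "L_fun0 k u v a b z = rGamma (of_nat (k - 2) + 1) * L_summand (k - 2) u v a b z 0"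
proof -
  define w where "w = k - 2"
  have kw: "k = w + 2" using k by (simp add: w_def)
  have "L_fun0 k u v a b z = (\<Sum>l\<le>w. cnj a ^ l * cnj b ^ (w - l) * eisenstein0 (l + 1) u z * eisenstein0 (w - l + 1) v z)"
    unfolding L_fun0_def kw sum_over_antidiagonal[symmetric, of "\<lambda>l m. cnj a ^ l * cnj b ^ m * eisenstein0 (l + 1) u z * eisenstein0 (m + 1) v z"]
    by (rule sum.reindex_bij_witness[of _ "\<lambda>(l, m). (l + 1, m + 1)" "\<lambda>(l, m). (l - 1, m - 1)"]) auto
  also have "\<dots> = rGamma (of_nat w + 1) * L_summand w u v a b z 0"
    unfolding L_summand_def sum_distrib_left
  proof (rule sum.cong[OF refl])
    fix l assume "l \<in> {..w}"
    then have l: "l \<le> w" by simp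
    have e: "eisenstein (i + 1) v z 0 = inverse (fact i) * completed_eisenstein (i + 1) v z 0" for i v
      using eisenstein_eq_completed[OF _ z, of "i + 1" v 0] Gamma_fact[of i, where ?'a = complex]
      by (simp add: add_ac rGamma_inverse_Gamma)
    have "rGamma (of_nat w + 1 :: complex) = inverse (fact w)"
      using Gamma_fact[of w, where ?'a = complex] by (simp add: add_ac rGamma_inverse_Gamma)
    moreover have "of_nat (w choose l) = (fact w / (fact l * fact (w - l)) :: complex)"
      by (rule binomial_fact[OF l])
    ultimately show "cnj a ^ l * cnj b ^ (w - l) * eisenstein0 (l + 1) u z * eisenstein0 (w - l + 1) v z
       = rGamma (of_nat w + 1) * (of_nat (w choose l) * cnj a ^ l * cnj b ^ (w - l) *
          (completed_eisenstein (l + 1) u z 0 * completed_eisenstein (w - l + 1) v z 0))"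
    proof -
      assume 1: "rGamma (of_nat w + 1 :: complex) = inverse (fact w)"
        and 2: "of_nat (w choose l) = (fact w / (fact l * fact (w - l)) :: complex)"
      have P: "inverse (fact l) * inverse (fact (w - l)) = rGamma (of_nat w + 1 :: complex) * of_nat (w choose l)"
        unfolding 1 2 by (simp add: field_simps)
      have S: "ca * cb * (i1 * Cu) * (i2 * Cv) = (i1 * i2) * (ca * cb * (Cu * Cv))"
        "(r * n) * (ca * cb * (Cu * Cv)) = r * (n * ca * cb * (Cu * Cv))" for ca cb i1 i2 Cu Cv r n :: complex
        by (simp_all only: mult_ac)
      show ?thesis unfolding e by (rule trans[OF S(1)], rule trans[OF _ S(2)], simp only: P)
    qed
  qed
  finally show ?thesis by (simp add: w_def)
qed

section \<open>The modular group\<close>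

no_notation fps_nth (infixl "$" 75)

lemma SL2Z_iff: "A \<in> SL2Z \<longleftrightarrow> A $ 1 $ 1 * A $ 2 $ 2 - A $ 1 $ 2 * A $ 2 $ 1 = 1"
  by (simp add: SL2Z_def det_2)

lemma matrix_2_eqI:
  assumes "A $ 1 $ 1 = B $ 1 $ 1" "A $ 1 $ 2 = B $ 1 $ 2" "A $ 2 $ 1 = B $ 2 $ 1" "A $ 2 $ 2 = B $ 2 $ 2"
  shows "(A :: 'a ^ 2 ^ 2) = B"
  using assms by (simp add: vec_eq_iff forall_2)

lemma matrix_2_mult:
  fixes A B :: "'a :: semiring_1 ^ 2 ^ 2"
  shows "(A ** B) $ i $ j = A $ i $ 1 * B $ 1 $ j + A $ i $ 2 * B $ 2 $ j"
  by (simp add: matrix_matrix_mult_def sum_2)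

lemma mat_1_2:
  "(mat 1 :: 'a :: semiring_1 ^ 2 ^ 2) $ 1 $ 1 = 1" "(mat 1 :: 'a :: semiring_1 ^ 2 ^ 2) $ 1 $ 2 = 0"
  "(mat 1 :: 'a :: semiring_1 ^ 2 ^ 2) $ 2 $ 1 = 0" "(mat 1 :: 'a :: semiring_1 ^ 2 ^ 2) $ 2 $ 2 = 1"
  by (simp_all add: mat_def)

definition mk2 :: "int \<Rightarrow> int \<Rightarrow> int \<Rightarrow> int \<Rightarrow> int ^ 2 ^ 2" where
  "mk2 a b c d = vector [vector [a, b], vector [c, d]]"

lemma mk2_sel [simp]:
  "mk2 a b c d $ 1 $ 1 = a" "mk2 a b c d $ 1 $ 2 = b" "mk2 a b c d $ 2 $ 1 = c" "mk2 a b c d $ 2 $ 2 = d"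
  by (simp_all add: mk2_def)

definition adj2 :: "int ^ 2 ^ 2 \<Rightarrow> int ^ 2 ^ 2" where
  "adj2 A = mk2 (A $ 2 $ 2) (- (A $ 1 $ 2)) (- (A $ 2 $ 1)) (A $ 1 $ 1)"

lemma SL2Z_one: "mat 1 \<in> SL2Z" by (simp add: SL2Z_iff mat_1_2)

lemma SL2Z_mult: "A \<in> SL2Z \<Longrightarrow> B \<in> SL2Z \<Longrightarrow> A ** B \<in> SL2Z"
  by (simp add: SL2Z_def det_mul)

lemma SL2Z_adj2: "A \<in> SL2Z \<Longrightarrow> adj2 A \<in> SL2Z"
  by (simp add: SL2Z_iff adj2_def mult.commute)

lemma adj2_mult:
  assumes "A \<in> SL2Z"
  shows "adj2 A ** A = mat 1" "A ** adj2 A = mat 1"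
  using assms by (auto intro!: matrix_2_eqI simp: matrix_2_mult adj2_def mat_1_2 SL2Z_iff algebra_simps)

lemma principal_congruence_subgroup_iff:
  "A \<in> principal_congruence_subgroup N \<longleftrightarrow> A \<in> SL2Z \<and> [A $ 1 $ 1 = 1] (mod int N) \<and> [A $ 1 $ 2 = 0] (mod int N)
     \<and> [A $ 2 $ 1 = 0] (mod int N) \<and> [A $ 2 $ 2 = 1] (mod int N)"
  by (auto simp: principal_congruence_subgroup_def forall_2 mat_1_2)

lemma Gamma_N_SL2Z: "A \<in> principal_congruence_subgroup N \<Longrightarrow> A \<in> SL2Z"
  by (simp add: principal_congruence_subgroup_def)

lemma Gamma_N_one: "mat 1 \<in> principal_congruence_subgroup N"
  by (simp add: principal_congruence_subgroup_iff SL2Z_one mat_1_2)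

lemma Gamma_N_mult:
  assumes "A \<in> principal_congruence_subgroup N" "B \<in> principal_congruence_subgroup N"
  shows "A ** B \<in> principal_congruence_subgroup N"
proof -
  have "[a * b + c * d = a' * b' + c' * d'] (mod int N)"
    if "[a = a'] (mod int N)" "[b = b'] (mod int N)" "[c = c'] (mod int N)" "[d = d'] (mod int N)" for a b c d a' b' c' d'
    using that by (intro cong_add cong_mult)
  from this[of _ 1 _ 1 _ 0 _ 0] this[of _ 1 _ 0 _ 0 _ 1] this[of _ 0 _ 1 _ 1 _ 0] this[of _ 0 _ 0 _ 1 _ 1] assms
  show ?thesis
    by (simp add: principal_congruence_subgroup_iff SL2Z_mult matrix_2_mult)
qed

lemma Gamma_N_adj2:
  assumes "A \<in> principal_congruence_subgroup N"
  shows "adj2 A \<in> principal_congruence_subgroup N"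
  using assms SL2Z_adj2[of A] unfolding principal_congruence_subgroup_iff
  by (auto simp: adj2_def cong_0_iff)

section \<open>Automorphy factors and the action on rational vectors\<close>

lemma automorphy_factor_nonzero:
  assumes "A \<in> SL2Z" "Im z > 0"
  shows "automorphy_factor A z \<noteq> 0"
proof
  assume 0: "automorphy_factor A z = 0"
  then have "Im (automorphy_factor A z) = 0" by simp
  then have c: "A $ 2 $ 1 = 0" using assms(2) by (simp add: automorphy_factor_def)
  with 0 have "A $ 2 $ 2 = 0" by (simp add: automorphy_factor_def)
  with c assms(1) show False by (simp add: SL2Z_iff)
qed

lemma Im_moebius:
  assumes "A \<in> SL2Z" "Im z > 0"
  shows "Im (moebius A z) = Im z / cmod (automorphy_factor A z) ^ 2"
proof -
  define j where "j = automorphy_factor A z"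
  have j: "j \<noteq> 0" using automorphy_factor_nonzero[OF assms] by (simp add: j_def)
  have d: "real_of_int (A $ 1 $ 1) * real_of_int (A $ 2 $ 2) - real_of_int (A $ 1 $ 2) * real_of_int (A $ 2 $ 1) = 1"
    using arg_cong[OF assms(1)[unfolded SL2Z_iff], of real_of_int] by simp
  have "moebius A z = (of_int (A $ 1 $ 1) * z + of_int (A $ 1 $ 2)) * cnj j / of_real (cmod j ^ 2)"
    unfolding moebius_def j_def[symmetric] complex_norm_square using j by simp
  then have "Im (moebius A z) = Im ((of_int (A $ 1 $ 1) * z + of_int (A $ 1 $ 2)) * cnj j) / cmod j ^ 2"
    by (simp only: Im_divide_of_real)
  also have "Im ((of_int (A $ 1 $ 1) * z + of_int (A $ 1 $ 2)) * cnj j)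
      = Im z * (real_of_int (A $ 1 $ 1) * real_of_int (A $ 2 $ 2) - real_of_int (A $ 1 $ 2) * real_of_int (A $ 2 $ 1))"
    by (simp add: j_def automorphy_factor_def algebra_simps)
  finally show ?thesis by (simp add: d j_def)
qed

lemma Im_moebius_pos:
  assumes "A \<in> SL2Z" "Im z > 0"
  shows "Im (moebius A z) > 0"
  unfolding Im_moebius[OF assms] using assms automorphy_factor_nonzero[OF assms] by simp

lemma automorphy_factor_mult:
  assumes "B \<in> SL2Z" "Im z > 0"
  shows "automorphy_factor (A ** B) z = automorphy_factor A (moebius B z) * automorphy_factor B z"
proof -
  have "automorphy_factor A (moebius B z) * automorphy_factor B z
     = of_int (A $ 2 $ 1) * (of_int (B $ 1 $ 1) * z + of_int (B $ 1 $ 2)) + of_int (A $ 2 $ 2) * automorphy_factor B z"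
    using automorphy_factor_nonzero[OF assms] by (simp add: automorphy_factor_def[of A] moebius_def distrib_right)
  then show ?thesis by (simp add: automorphy_factor_def matrix_2_mult algebra_simps)
qed

lemma moebius_mult:
  assumes "A \<in> SL2Z" "B \<in> SL2Z" "Im z > 0"
  shows "moebius (A ** B) z = moebius A (moebius B z)"
proof -
  let ?j = "automorphy_factor B z"
  have j: "?j \<noteq> 0" using automorphy_factor_nonzero[OF assms(2,3)] .
  have "(of_int (A $ 1 $ 1) * moebius B z + of_int (A $ 1 $ 2)) * ?j
     = of_int (A $ 1 $ 1) * (of_int (B $ 1 $ 1) * z + of_int (B $ 1 $ 2)) + of_int (A $ 1 $ 2) * ?j"
    using j by (simp add: moebius_def distrib_right)
  also have "\<dots> = of_int ((A ** B) $ 1 $ 1) * z + of_int ((A ** B) $ 1 $ 2)"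
    by (simp add: automorphy_factor_def matrix_2_mult algebra_simps)
  finally have "of_int ((A ** B) $ 1 $ 1) * z + of_int ((A ** B) $ 1 $ 2) = (of_int (A $ 1 $ 1) * moebius B z + of_int (A $ 1 $ 2)) * ?j" ..
  then show ?thesis unfolding moebius_def[of "A ** B"] automorphy_factor_mult[OF assms(2,3)] moebius_def[of A]
    using j by simp
qed

lemma moebius_one [simp]: "moebius (mat 1) z = z" "automorphy_factor (mat 1) z = 1"
  by (simp_all add: moebius_def automorphy_factor_def mat_1_2)

lemma moebius_adj2:
  assumes "A \<in> SL2Z" "Im z > 0"
  shows "moebius (adj2 A) (moebius A z) = z" "moebius A (moebius (adj2 A) z) = z"
  using moebius_mult[OF SL2Z_adj2[OF assms(1)] assms] moebius_mult[OF assms(1) SL2Z_adj2[OF assms(1)] assms(2)]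
    adj2_mult[OF assms(1)] by simp_all

lemma automorphy_factor_adj2:
  assumes "A \<in> SL2Z" "Im z > 0"
  shows "automorphy_factor (adj2 A) (moebius A z) * automorphy_factor A z = 1"
  using automorphy_factor_mult[OF assms, of "adj2 A"] adj2_mult[OF assms(1)] by simp

text \<open>Row vector times matrix, a right action. Acting on the index of a lattice sum and on its
  argument are thereby interchangeable up to a factor:
  \<open>lin (p A) z = j(A, z) * lin p (A z)\<close>.\<close>

definition act :: "rat \<times> rat \<Rightarrow> int ^ 2 ^ 2 \<Rightarrow> rat \<times> rat" where
  "act p A = (fst p * of_int (A $ 1 $ 1) + snd p * of_int (A $ 2 $ 1),
              fst p * of_int (A $ 1 $ 2) + snd p * of_int (A $ 2 $ 2))"

lemma act_mult: "act p (A ** B) = act (act p A) B"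
  by (simp add: act_def matrix_2_mult algebra_simps)

lemma act_one [simp]: "act p (mat 1) = p"
  by (simp add: act_def mat_1_2)

lemma act_diff: "act (p - q) A = act p A - act q A" "act (p + q) A = act p A + act q A" "act (- p) A = - act p A"
  by (simp_all add: act_def algebra_simps)

lemma act_adj2:
  assumes "A \<in> SL2Z"
  shows "act (act p A) (adj2 A) = p" "act (act p (adj2 A)) A = p"
  using act_mult[of p A "adj2 A"] act_mult[of p "adj2 A" A] adj2_mult[OF assms] by simp_all

lemma lin_act:
  assumes "A \<in> SL2Z" "Im z > 0"
  shows "lin (act p A) z = automorphy_factor A z * lin p (moebius A z)"
proof -
  have "automorphy_factor A z * moebius A z = of_int (A $ 1 $ 1) * z + of_int (A $ 1 $ 2)"
    using automorphy_factor_nonzero[OF assms] by (simp add: moebius_def)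
  moreover have "j * (x * m + y) = x * (j * m) + y * j" for j x m y :: complex by (simp add: algebra_simps)
  ultimately have "automorphy_factor A z * lin p (moebius A z)
      = of_rat (fst p) * (of_int (A $ 1 $ 1) * z + of_int (A $ 1 $ 2)) + of_rat (snd p) * automorphy_factor A z"
    unfolding lin_def by presburger
  then show ?thesis by (simp add: lin_def act_def automorphy_factor_def of_rat_add of_rat_mult algebra_simps)
qed

lemma integral_vector_act: "integral_vector p \<Longrightarrow> integral_vector (act p A)"
  by (auto simp: integral_vector_def act_def intro!: Ints_add Ints_mult)

lemma vec_coset_act:
  assumes "A \<in> SL2Z"
  shows "bij_betw (\<lambda>p. act p A) (vec_coset v) (vec_coset (act v A))"
proof (rule bij_betwI[where g = "\<lambda>p. act p (adj2 A)"])
  show "(\<lambda>p. act p A) \<in> vec_coset v \<rightarrow> vec_coset (act v A)"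
    by (auto simp: vec_coset_def act_diff[symmetric] integral_vector_act)
  show "(\<lambda>p. act p (adj2 A)) \<in> vec_coset (act v A) \<rightarrow> vec_coset v"
  proof
    fix p assume "p \<in> vec_coset (act v A)"
    then have "integral_vector (act (p - act v A) (adj2 A))"
      by (simp add: vec_coset_def integral_vector_act)
    then show "act p (adj2 A) \<in> vec_coset v"
      using act_adj2(1)[OF assms] by (simp add: vec_coset_def act_diff)
  qed
qed (simp_all add: act_adj2[OF assms])

lemma integral_vector_add: "integral_vector p \<Longrightarrow> integral_vector q \<Longrightarrow> integral_vector (p + q)"
  by (simp add: integral_vector_def)

lemma integral_vector_uminus: "integral_vector p \<Longrightarrow> integral_vector (- p)"
  by (simp add: integral_vector_def)

lemma vec_coset_eqI:
  assumes "integral_vector (u - v)"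
  shows "vec_coset u = vec_coset v"
proof -
  have "integral_vector (p - v)" if "integral_vector (p - u)" "integral_vector (u - v)" for p u v :: "rat \<times> rat"
    using integral_vector_add[OF that] by simp
  note A = this
  have "integral_vector (v - u)" using integral_vector_uminus[OF assms] by simp
  then show ?thesis unfolding vec_coset_def using A[OF _ assms] A[of _ v u] by blast
qed

text \<open>For \<open>A = 1 + N B\<close> the difference \<open>v A - v\<close> is
  \<open>(N v) B\<close>, and \<open>N v\<close> is integral. This is why the Eisenstein series of
  torsion vectors are modular for the principal congruence subgroup itself.\<close>

lemma vec_coset_act_Gamma_N:
  assumes N: "N \<ge> 1" and v: "v \<in> torsion_vectors N" and A: "A \<in> principal_congruence_subgroup N"
  shows "vec_coset (act v A) = vec_coset v"
proof (rule vec_coset_eqI)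
  have "int N dvd A $ 1 $ 1 - 1" "int N dvd A $ 1 $ 2" "int N dvd A $ 2 $ 1" "int N dvd A $ 2 $ 2 - 1"
    using A by (auto simp: principal_congruence_subgroup_iff cong_iff_dvd_diff)
  then obtain a b c d where e: "A $ 1 $ 1 = 1 + int N * a" "A $ 1 $ 2 = int N * b" "A $ 2 $ 1 = int N * c" "A $ 2 $ 2 = 1 + int N * d"
    unfolding dvd_def by (metis add.commute diff_add_cancel)
  have "integral_vector (of_nat N * fst v, of_nat N * snd v)" using v by (simp add: torsion_vectors_def)
  then have i: "of_nat N * fst v \<in> \<int>" "of_nat N * snd v \<in> \<int>" by (auto simp: integral_vector_def)
  have "act v A - v = ((of_nat N * fst v) * of_int a + (of_nat N * snd v) * of_int c, (of_nat N * fst v) * of_int b + (of_nat N * snd v) * of_int d)"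
    by (simp add: act_def e prod_eq_iff algebra_simps)
  also have "integral_vector \<dots>" unfolding integral_vector_def using i by simp
  finally show "integral_vector (act v A - v)" .
qed

text \<open>The quotient \<open>|lin p z|^2 / Im z\<close> is unchanged when \<open>p\<close> and
  \<open>z\<close> move together, so the exponent is invariant and only
  \<open>cnj (lin p z) ^ l\<close> contributes an automorphy factor.\<close>

lemma theta_moebius:
  assumes A: "A \<in> SL2Z" and z: "Im z > 0"
  shows "theta l v (moebius A z) \<tau> = theta l (act v A) z \<tau> / cnj (automorphy_factor A z) ^ l"
proof -
  define j where "j = automorphy_factor A z"
  have j: "j \<noteq> 0" using automorphy_factor_nonzero[OF A z] by (simp add: j_def)
  have L: "lin p (moebius A z) = lin (act p A) z / j" for p
    using lin_act[OF A z, of p] j by (simp add: j_def)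
  have "theta l v (moebius A z) \<tau> = (\<Sum>\<^sub>\<infinity>p\<in>vec_coset v. inverse (cnj j ^ l) *
     (cnj (lin (act p A) z) ^ l * exp (- of_real (\<tau> / Im z * cmod (lin (act p A) z) ^ 2))))"
    unfolding theta_def
  proof (rule infsum_cong)
    fix p
    have "\<tau> / Im (moebius A z) * cmod (lin p (moebius A z)) ^ 2 = \<tau> / Im z * cmod (lin (act p A) z) ^ 2"
      unfolding Im_moebius[OF A z] L using j z by (simp add: norm_divide power_divide flip: j_def)
    then show "cnj (lin p (moebius A z)) ^ l * exp (- of_real (\<tau> / Im (moebius A z) * cmod (lin p (moebius A z)) ^ 2))
      = inverse (cnj j ^ l) * (cnj (lin (act p A) z) ^ l * exp (- of_real (\<tau> / Im z * cmod (lin (act p A) z) ^ 2)))"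
      by (simp only: L complex_cnj_divide power_divide divide_inverse complex_cnj_mult complex_cnj_inverse power_mult_distrib power_inverse) (simp only: mult_ac)
  qed
  also have "\<dots> = inverse (cnj j ^ l) * (\<Sum>\<^sub>\<infinity>p\<in>vec_coset v. cnj (lin (act p A) z) ^ l * exp (- of_real (\<tau> / Im z * cmod (lin (act p A) z) ^ 2)))"
    by (rule infsum_cmult_right')
  also have "(\<Sum>\<^sub>\<infinity>p\<in>vec_coset v. cnj (lin (act p A) z) ^ l * exp (- of_real (\<tau> / Im z * cmod (lin (act p A) z) ^ 2))) = theta l (act v A) z \<tau>"
    unfolding theta_def using infsum_reindex_bij_betw[OF vec_coset_act[OF A, of v], of "\<lambda>p. cnj (lin p z) ^ l * exp (- of_real (\<tau> / Im z * cmod (lin p z) ^ 2))"] by simp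
  finally show ?thesis by (simp add: j_def divide_inverse mult.commute)
qed

lemma exists_SL2Z_bottom_row:
  assumes "coprime c d"
  obtains A where "A \<in> SL2Z" "A $ 2 $ 1 = c" "A $ 2 $ 2 = d"
proof -
  obtain u v where "u * c + v * d = 1"
    using bezout_int[of c d] assms by (auto simp: coprime_iff_gcd_eq_1)
  then have "mk2 v (- u) c d \<in> SL2Z" by (simp add: SL2Z_iff algebra_simps)
  then show ?thesis by (rule that) auto
qed

text \<open>Clearing denominators and dividing by the gcd gives a coprime row, which Bezout
  completes to a matrix. Then \<open>lin p\<close> is a multiple of the automorphy factor of
  \<open>A\<close>, that is, \<open>A\<close> takes the cusp of \<open>p\<close> to
  infinity.\<close>

lemma rat_pair_primitive:
  assumes "p \<noteq> (0, 0)"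
  obtains \<kappa> :: rat and A where "\<kappa> \<noteq> 0" "A \<in> SL2Z" "p = (\<kappa> * of_int (A $ 2 $ 1), \<kappa> * of_int (A $ 2 $ 2))"
proof -
  obtain a1 b1 where p1: "fst p = Rat.Fract a1 b1" "b1 > 0" by (cases "fst p") auto
  obtain a2 b2 where p2: "snd p = Rat.Fract a2 b2" "b2 > 0" by (cases "snd p") auto
  define c0 d0 where "c0 = a1 * b2" and "d0 = a2 * b1"
  have nz: "c0 \<noteq> 0 \<or> d0 \<noteq> 0"
    using assms p1 p2 by (auto simp: c0_def d0_def prod_eq_iff Fract_of_int_quotient)
  define g where "g = gcd c0 d0"
  have g: "g \<noteq> 0" using nz by (simp add: g_def)
  have cd: "c0 = g * (c0 div g)" "d0 = g * (d0 div g)" by (simp_all add: g_def)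
  have "coprime (c0 div g) (d0 div g)" unfolding g_def by (rule div_gcd_coprime) (use nz in auto)
  then obtain A where A: "A \<in> SL2Z" "A $ 2 $ 1 = c0 div g" "A $ 2 $ 2 = d0 div g"
    by (rule exists_SL2Z_bottom_row)
  define \<kappa> :: rat where "\<kappa> = of_int g / of_int (b1 * b2)"
  have e: "\<kappa> * of_int (x div g) = of_int x / of_int (b1 * b2)" if "x = g * (x div g)" for x
    by (subst (2) that) (simp add: \<kappa>_def)
  have "fst p = \<kappa> * of_int (A $ 2 $ 1)" "snd p = \<kappa> * of_int (A $ 2 $ 2)"
    unfolding A e[OF cd(1)] e[OF cd(2)] using p1 p2 by (simp_all add: c0_def d0_def Fract_of_int_quotient field_simps)
  then show ?thesis using that[of \<kappa> A] A g p1 p2 by (simp add: \<kappa>_def prod_eq_iff)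
qed

section \<open>Cusp forms on Siegel sets\<close>

lemma completed_eisenstein_moebius:
  assumes A: "A \<in> SL2Z" and z: "Im z > 0"
  shows "completed_eisenstein l v (moebius A z) s = automorphy_factor A z ^ l * completed_eisenstein l (act v A) z s"
proof -
  define j where "j = automorphy_factor A z"
  have j: "j \<noteq> 0" using automorphy_factor_nonzero[OF A z] by (simp add: j_def)
  have "mellin_integrand l v (moebius A z) s \<tau> = inverse (cnj j ^ l) * mellin_integrand l (act v A) z s \<tau>" for \<tau>
    unfolding mellin_integrand_def theta_moebius[OF A z] j_def[symmetric] scaleR_conv_of_real divide_inverse
    by (simp only: mult_ac)
  then have "(\<integral>\<tau>. mellin_integrand l v (moebius A z) s \<tau> \<partial>lborel)
      = inverse (cnj j ^ l) * (\<integral>\<tau>. mellin_integrand l (act v A) z s \<tau> \<partial>lborel)"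
    by simp
  moreover have "complex_of_real (1 / Im (moebius A z) ^ l) * inverse (cnj j ^ l) = j ^ l * of_real (1 / Im z ^ l)"
  proof -
    have "complex_of_real (1 / Im (moebius A z) ^ l) = (j * cnj j) ^ l * of_real (1 / Im z ^ l)"
      unfolding Im_moebius[OF A z] complex_norm_square[symmetric] j_def by (simp add: power_divide)
    then show ?thesis using j by (simp add: power_mult_distrib)
  qed
  ultimately show ?thesis unfolding completed_eisenstein_def j_def[symmetric]
    by (simp only: mult.assoc[symmetric])
qed

lemma completed_eisenstein_cong:
  "vec_coset u = vec_coset v \<Longrightarrow> completed_eisenstein l u = completed_eisenstein l v"
  by (simp add: completed_eisenstein_def mellin_integrand_def theta_def fun_eq_iff)

lemma slash_eq:
  assumes "A \<in> SL2Z" "Im z > 0"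
  shows "f (moebius A z) = slash k A f z * automorphy_factor A z ^ k"
  using automorphy_factor_nonzero[OF assms] by (simp add: slash_def)

lemma cusp_form_Gamma_N:
  assumes "cusp_form N k f" "A \<in> principal_congruence_subgroup N" "Im z > 0"
  shows "f (moebius A z) = f z * automorphy_factor A z ^ k"
proof -
  have "slash k A f z = f z" using assms by (auto simp: cusp_form_def upper_half_plane_def)
  then show ?thesis using slash_eq[OF Gamma_N_SL2Z[OF assms(2)] assms(3), of f k] by simp
qed

lemma open_upper_half_plane: "open upper_half_plane"
  unfolding upper_half_plane_def by (rule open_halfspace_Im_gt)

lemma norm_fourier_term:
  assumes "N \<ge> (1::nat)"
  shows "norm (q * exp (2 * of_real pi * \<i> * of_nat n * z / of_nat N)) = norm q * exp (- (2 * pi / real N) * Im z) ^ n"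
proof -
  have e: "2 * of_real pi * \<i> * of_nat n * z / of_nat N = of_nat n * (of_real (2 * pi / real N) * (\<i> * z))"
    by simp
  have "Re (of_real c * (\<i> * z)) = - c * Im z" for c by simp
  then show ?thesis unfolding e exp_of_nat_mult by (simp only: norm_mult norm_power norm_exp_eq_Re)
qed

text \<open>Convergence of the Fourier series at the lower height 1/4 bounds its coefficients
  geometrically. At height at least 1/2 the series from \<open>n = 1\<close> on is then dominated by
  a geometric one of ratio at most \<open>exp (- c / 4)\<close> with \<open>c = 2 * pi / N\<close>,
  and its first term carries the decay \<open>exp (- c * Im z)\<close>.\<close>

lemma cusp_form_slash_bound:
  assumes f: "cusp_form N k f" and N: "N \<ge> 1" and A: "A \<in> SL2Z"
  obtains C where "C \<ge> 0" "\<And>z. Im z \<ge> 1 / 2 \<Longrightarrow> norm (slash k A f z) \<le> C * exp (- (2 * pi / real N) * Im z)"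
proof -
  define c where "c = 2 * pi / real N"
  have c: "c > 0" using N by (simp add: c_def)
  obtain q :: "nat \<Rightarrow> complex" where q: "q 0 = 0"
    "\<And>z. Im z > 0 \<Longrightarrow> (\<lambda>n. q n * exp (2 * of_real pi * \<i> * of_nat n * z / of_nat N)) sums slash k A f z"
    using f A by (auto simp: cusp_form_def upper_half_plane_def)
  define z0 where "z0 = \<i> / 4"
  have "summable (\<lambda>n. q n * exp (2 * of_real pi * \<i> * of_nat n * z0 / of_nat N))"
    using q(2)[of z0] by (auto simp: sums_iff z0_def)
  then have "Bseq (\<lambda>n. q n * exp (2 * of_real pi * \<i> * of_nat n * z0 / of_nat N))"
    by (rule summable_imp_Bseq)
  then obtain M where M: "M > 0" "\<And>n. norm (q n * exp (2 * of_real pi * \<i> * of_nat n * z0 / of_nat N)) \<le> M"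
    by (auto simp: Bseq_def)
  have qn: "norm (q n) \<le> M * exp (c / 4) ^ n" for n
    using M(2)[of n] unfolding norm_fourier_term[OF N]
    by (simp add: z0_def c_def exp_minus field_simps flip: exp_of_nat_mult)
  define r0 where "r0 = exp (- c / 4)"
  have r0: "r0 < 1" "r0 > 0" using c by (auto simp: r0_def)
  show ?thesis
  proof
    show "M * exp (c / 4) / (1 - r0) \<ge> 0" using M r0 by simp
    fix z :: complex assume z: "Im z \<ge> 1 / 2"
    define r where "r = exp (c / 4) * exp (- c * Im z)"
    have r: "r > 0" "r \<le> r0"
    proof -
      show "r > 0" by (simp add: r_def)
      have "c / 4 + - c * Im z \<le> - c / 4" using mult_left_mono[OF z, of c] c by simp
      then show "r \<le> r0" unfolding r_def r0_def by (simp flip: exp_add)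
    qed
    let ?a = "\<lambda>n. q n * exp (2 * of_real pi * \<i> * of_nat n * z / of_nat N)"
    have "?a sums slash k A f z" using q(2) z by simp
    then have s: "(\<lambda>n. ?a (Suc n)) sums slash k A f z" using q(1) by (subst sums_Suc_iff) simp
    have b: "norm (?a (Suc n)) \<le> M * r * r ^ n" for n
    proof -
      have "norm (?a (Suc n)) \<le> (M * exp (c / 4) ^ Suc n) * exp (- c * Im z) ^ Suc n"
        unfolding norm_fourier_term[OF N] c_def[symmetric] by (intro mult_right_mono qn) auto
      also have "\<dots> = M * r * r ^ n" by (simp add: r_def power_mult_distrib)
      finally show ?thesis .
    qed
    have g: "(\<lambda>n. M * r * r ^ n) sums (M * r * (1 / (1 - r)))"
      using geometric_sums[of r] r r0 by (intro sums_mult) auto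
    have "norm (slash k A f z) \<le> M * r * (1 / (1 - r))"
      using s g b by (metis (no_types, lifting) norm_suminf_le sums_iff)
    also have "\<dots> \<le> M * r * (1 / (1 - r0))"
      using M r r0 by (intro mult_left_mono divide_left_mono) auto
    finally show "norm (slash k A f z) \<le> M * exp (c / 4) / (1 - r0) * exp (- (2 * pi / real N) * Im z)"
      by (simp add: r_def c_def)
  qed
qed

text \<open>The mean over one period is the constant Fourier coefficient, which is 0. The interval
  is half-open to match the strip that represents each orbit of translations exactly once.\<close>

lemma cusp_form_slash_zero_mean:
  assumes f: "cusp_form N k f" and N: "N \<ge> 1" and A: "A \<in> SL2Z" and y: "y > 0"
  shows "(\<integral>x. indicator {0..<real N} x *\<^sub>R slash k A f (Complex x y) \<partial>lborel) = 0"
proof -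
  define c where "c = 2 * pi / real N"
  have c: "c > 0" using N by (simp add: c_def)
  obtain q :: "nat \<Rightarrow> complex" where q: "q 0 = 0"
    "\<And>z. Im z > 0 \<Longrightarrow> (\<lambda>n. q n * exp (2 * of_real pi * \<i> * of_nat n * z / of_nat N)) sums slash k A f z"
    using f A by (auto simp: cusp_form_def upper_half_plane_def)
  let ?a = "\<lambda>n z. q n * exp (2 * of_real pi * \<i> * of_nat n * z / of_nat N)"
  \<comment> \<open>Convergence at height \<open>y / 2\<close> is convergence of a power series at a
    larger radius, hence absolute convergence at height \<open>y\<close>.\<close>
  have abs: "summable (\<lambda>n. norm (q n) * exp (- c * y) ^ n)"
  proof -
    have "summable (\<lambda>n. q n * of_real (exp (- c * (y / 2))) ^ n)"
    proof -
      have "exp (2 * of_real pi * \<i> * of_nat n * Complex 0 (y / 2) / of_nat N) = complex_of_real (exp (- c * (y / 2))) ^ n" for n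
      proof -
        have "2 * of_real pi * \<i> * of_nat n * Complex 0 (y / 2) / of_nat N = of_nat n * complex_of_real (- c * (y / 2))"
          by (simp add: c_def complex_eq_iff)
        then show ?thesis by (simp only: exp_of_nat_mult exp_of_real)
      qed
      then show ?thesis using q(2)[of "Complex 0 (y / 2)"] y by (simp add: sums_iff)
    qed
    then have "summable (\<lambda>n. norm (q n * of_real (exp (- c * y)) ^ n))"
      by (rule powser_insidea) (use c y in auto)
    then show ?thesis by (simp add: norm_mult norm_power)
  qed
  have na: "norm (?a n (Complex x y)) = norm (q n) * exp (- c * y) ^ n" for n x
    unfolding norm_fourier_term[OF N] by (simp add: c_def)
  define F where "F n x = indicator {0..<real N} x *\<^sub>R ?a n (Complex x y)" for n x
  have cont: "continuous_on UNIV (\<lambda>x. ?a n (Complex x y))" for n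
  proof -
    have "(\<lambda>x. ?a n (Complex x y)) = (\<lambda>x. ?a n (of_real x + \<i> * of_real y))"
      by (simp add: complex_eq_iff fun_eq_iff Complex_eq)
    then show ?thesis using N by (auto intro!: continuous_intros)
  qed
  have intI: "integrable lborel (\<lambda>x. indicator {0..real N} x *\<^sub>R ?a n (Complex x y))" for n
    using borel_integrable_compact[of "{0..real N}" "\<lambda>x. ?a n (Complex x y)"] continuous_on_subset[OF cont] by simp
  have intF: "integrable lborel (F n)" for n
  proof -
    note intI[of n]
    then have "integrable lborel (\<lambda>x. indicator {0..<real N} x *\<^sub>R (indicator {0..real N} x *\<^sub>R ?a n (Complex x y)))"
      by (rule integrable_mult_indicator[rotated]) simp
    moreover have "F n = (\<lambda>x. indicator {0..<real N} x *\<^sub>R (indicator {0..real N} x *\<^sub>R ?a n (Complex x y)))"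
      by (auto simp: F_def indicator_def)
    ultimately show ?thesis by (simp only:)
  qed
  have F0: "integral\<^sup>L lborel (F n) = 0" for n
  proof (cases "n = 0")
    case True
    then have "F n = (\<lambda>_. 0)" by (auto simp: F_def q(1))
    then show ?thesis by simp
  next
    case False
    define d where "d = 2 * of_real pi * \<i> * of_nat n / complex_of_nat N"
    have d: "d \<noteq> 0" using False N by (simp add: d_def)
    have e: "?a n (Complex x y) = q n * exp (d * \<i> * y) * exp (d * of_real x)" for x
    proof -
      have "2 * of_real pi * \<i> * of_nat n * Complex x y / of_nat N = d * \<i> * y + d * of_real x"
        by (simp add: d_def Complex_eq ring_distribs add_divide_distrib diff_divide_distrib mult_ac)
      then show ?thesis by (simp only: exp_add mult.assoc)
    qed
    define G where "G x = q n * exp (d * \<i> * y) / d * exp (d * of_real x)" for x :: real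
    have "(\<integral>x. indicator {0..real N} x *\<^sub>R ?a n (Complex x y) \<partial>lborel) = G (real N) - G 0"
    proof (rule integral_FTC_atLeastAtMost)
      show "(G has_vector_derivative ?a n (Complex x y)) (at x within {0..real N})" for x
        unfolding e G_def using d
        by (auto intro!: has_vector_derivative_real_field derivative_eq_intros)
      show "continuous_on {0..real N} (\<lambda>x. ?a n (Complex x y))" by (rule continuous_on_subset[OF cont]) auto
    qed auto
    moreover have "exp (d * of_real (real N)) = 1"
    proof -
      have "d * of_real (real N) = of_nat n * (2 * of_real pi * \<i>)"
        using N by (simp add: d_def)
      then show ?thesis by (simp only: exp_of_nat_mult exp_two_pi_i power_one)
    qed
    ultimately have "(\<integral>x. indicator {0..real N} x *\<^sub>R ?a n (Complex x y) \<partial>lborel) = 0"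
      by (simp add: G_def)
    moreover have "(\<integral>x. indicator {0..real N} x *\<^sub>R ?a n (Complex x y) \<partial>lborel) = integral\<^sup>L lborel (F n)"
    proof (rule integral_cong_AE)
      show "AE x in lborel. indicator {0..real N} x *\<^sub>R ?a n (Complex x y) = F n x"
        using AE_lborel_singleton[of "real N"] by eventually_elim (auto simp: F_def indicator_def)
    qed (rule borel_measurable_integrable, rule intI, rule borel_measurable_integrable, rule intF)
    ultimately show ?thesis by simp
  qed
  have Fs: "(\<lambda>n. F n x) sums (indicator {0..<real N} x *\<^sub>R slash k A f (Complex x y))" for x
    unfolding F_def using q(2)[of "Complex x y"] y by (intro sums_scaleR_right) auto
  have nF: "norm (F n x) = indicator {0..<real N} x * (norm (q n) * exp (- c * y) ^ n)" for n x
    by (simp add: F_def na)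
  have "(\<integral>x. (\<Sum>n. F n x) \<partial>lborel) = (\<Sum>n. integral\<^sup>L lborel (F n))"
  proof (rule integral_suminf[OF intF])
    show "AE x in lborel. summable (\<lambda>n. norm (F n x))"
      unfolding nF by (intro AE_I2 summable_mult abs)
    have "(\<integral>x. norm (F n x) \<partial>lborel) = real N * (norm (q n) * exp (- c * y) ^ n)" for n
      unfolding nF by simp
    then show "summable (\<lambda>n. \<integral>x. norm (F n x) \<partial>lborel)"
      by (simp only:) (intro summable_mult abs)
  qed
  then show ?thesis using Fs F0 by (simp add: sums_iff)
qed

section \<open>Reduction theory\<close>

definition siegel_set :: "complex set" where
  "siegel_set = {z. \<bar>Re z\<bar> \<le> 1 / 2 \<and> Im z \<ge> 1 / 2}"

text \<open>Only finitely many nonzero pairs have \<open>|c z + d| \<le> 1\<close>, so the minimum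
  is attained, and by minimality at a primitive pair. With this pair as bottom row of
  \<open>A\<close>, the lattice of \<open>moebius A z\<close> is the one of \<open>z\<close> divided
  by a number whose modulus is the minimum.\<close>

lemma lattice_min:
  assumes z: "Im z > 0"
  obtains A where "A \<in> SL2Z" "\<And>c d :: int. (c, d) \<noteq> (0, 0) \<Longrightarrow> 1 \<le> cmod (of_int c * moebius A z + of_int d)"
proof -
  define w where "w p = cmod (of_int (fst p) * z + of_int (snd p))" for p :: "int \<times> int"
  define T where "T = {p. p \<noteq> (0, 0) \<and> w p \<le> 1}"
  define K where "K = \<lfloor>2 * height z ^ 2\<rfloor>"
  have "T \<subseteq> {-K..K} \<times> {-K..K}"
  proof
    fix p assume "p \<in> T"
    then have "2 * height z ^ 2 * w p \<le> 2 * height z ^ 2"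
      by (auto simp: T_def intro!: mult_left_le)
    then have "\<bar>real_of_int (fst p)\<bar> + \<bar>real_of_int (snd p)\<bar> \<le> 2 * height z ^ 2"
      using norm_lin_ge[OF z, of "of_int (fst p)" "of_int (snd p)"] by (simp add: w_def)
    then have "\<bar>fst p\<bar> + \<bar>snd p\<bar> \<le> K" unfolding K_def le_floor_iff by simp
    then show "p \<in> {-K..K} \<times> {-K..K}" by (cases p) auto
  qed
  then have fin: "finite T" by (rule finite_subset) auto
  \<comment> \<open>The pair \<open>(0, 1)\<close> has value exactly 1, which is why
    \<open>T\<close> is cut off at 1.\<close>
  have "(0, 1) \<in> T" by (auto simp: T_def w_def)
  then have ne: "T \<noteq> {}" by auto
  obtain p where p: "p \<in> T" "\<And>q. q \<in> T \<Longrightarrow> w p \<le> w q"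
    using ex_is_arg_min_if_finite[OF fin ne, of w] by (auto simp: is_arg_min_linorder)
  have min: "w p \<le> w q" if "q \<noteq> (0, 0)" for q
    using p(2)[of q] p(1) that by (cases "w q \<le> 1") (auto simp: T_def)
  have wpos: "w q > 0" if "q \<noteq> (0, 0)" for q
  proof -
    have "0 < \<bar>real_of_int (fst q)\<bar> + \<bar>real_of_int (snd q)\<bar>" using that by (cases q) auto
    then show ?thesis using norm_lin_ge[OF z, of "of_int (fst q)" "of_int (snd q)"] by (auto simp: w_def)
  qed
  have p0: "p \<noteq> (0, 0)" using p by (auto simp: T_def)
  define g where "g = gcd (fst p) (snd p)"
  have g: "g > 0" using p0 by (cases p) (auto simp: g_def)
  define q where "q = (fst p div g, snd p div g)"
  have pq: "fst p = g * fst q" "snd p = g * snd q" by (simp_all add: q_def g_def)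
  have q0: "q \<noteq> (0, 0)" using p0 pq by (cases p) auto
  have "of_int (fst p) * z + of_int (snd p) = of_int g * (of_int (fst q) * z + of_int (snd q))"
    unfolding pq by (simp add: algebra_simps)
  then have "w p = of_int g * w q" using g by (simp add: w_def norm_mult)
  with min[OF q0] wpos[OF q0] have "real_of_int g \<le> 1" by (simp add: mult_le_cancel_right1)
  then have "g = 1" using g by simp
  then have "coprime (fst p) (snd p)" by (simp add: g_def coprime_iff_gcd_eq_1)
  then obtain A where A: "A \<in> SL2Z" "A $ 2 $ 1 = fst p" "A $ 2 $ 2 = snd p"
    by (rule exists_SL2Z_bottom_row)
  have j: "cmod (automorphy_factor A z) = w p" by (simp add: automorphy_factor_def A w_def)
  show ?thesis
  proof (rule that[OF A(1)])
    fix c d :: int assume cd: "(c, d) \<noteq> (0, 0)"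
    define q where "q = (c * A $ 1 $ 1 + d * A $ 2 $ 1, c * A $ 1 $ 2 + d * A $ 2 $ 2)"
    have e: "act (of_int c, of_int d) A = (of_int (fst q), of_int (snd q))" by (simp add: act_def q_def)
    have "q \<noteq> (0, 0)"
    proof
      assume "q = (0, 0)"
      then have "act (act (of_int c, of_int d) A) (adj2 A) = (0, 0)" unfolding e by (simp add: act_def)
      then show False using act_adj2(1)[OF A(1)] cd by simp
    qed
    then have "w p \<le> w q" by (rule min)
    also have "w q = cmod (lin (act (of_int c, of_int d) A) z)" unfolding e by (simp add: lin_def w_def)
    also have "\<dots> = w p * cmod (of_int c * moebius A z + of_int d)"
      unfolding lin_act[OF A(1) z] norm_mult j by (simp add: lin_def)
    finally show "1 \<le> cmod (of_int c * moebius A z + of_int d)"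
      using wpos[OF p0] by (simp add: mult_le_cancel_left1)
  qed
qed

text \<open>After a translation to \<open>|Re| \<le> 1/2\<close>, minimality at the pair
  \<open>(1, n)\<close> puts the point outside the open unit disc. Its height is then at least
  \<open>sqrt 3 / 2\<close>; the Siegel set asks for the weaker bound 1/2.\<close>

lemma SL2Z_reduction:
  assumes z: "Im z > 0"
  obtains A where "A \<in> SL2Z" "moebius A z \<in> siegel_set"
proof -
  obtain A where A: "A \<in> SL2Z" "\<And>c d :: int. (c, d) \<noteq> (0, 0) \<Longrightarrow> 1 \<le> cmod (of_int c * moebius A z + of_int d)"
    using lattice_min[OF z] by blast
  define z' where "z' = moebius A z"
  have z': "Im z' > 0" using Im_moebius_pos[OF A(1) z] by (simp add: z'_def)
  define n where "n = - round (Re z')"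
  define T where "T = mk2 1 n 0 1"
  have T: "T \<in> SL2Z" by (simp add: SL2Z_iff T_def)
  have m: "moebius (T ** A) z = z' + of_int n"
    unfolding moebius_mult[OF T A(1) z] z'_def[symmetric] by (simp add: moebius_def automorphy_factor_def T_def)
  have re: "\<bar>Re (z' + of_int n)\<bar> \<le> 1 / 2"
    using of_int_round_abs_le[of "Re z'"] by (simp add: n_def abs_minus_commute)
  have "1 \<le> cmod (z' + of_int n)" using A(2)[of 1 n] by (simp add: z'_def)
  then have "1 \<le> (Re (z' + of_int n))\<^sup>2 + (Im (z' + of_int n))\<^sup>2"
    unfolding cmod_power2[symmetric] by (simp add: one_le_power)
  moreover have "(Re (z' + of_int n))\<^sup>2 \<le> (1 / 2)\<^sup>2"
    using re by (metis abs_le_square_iff abs_of_nonneg zero_le_divide_1_iff zero_le_numeral)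
  ultimately have "(1 / 2)\<^sup>2 \<le> (Im z')\<^sup>2" by (simp add: power2_eq_square)
  then have "1 / 2 \<le> Im z'" using z' by (auto intro: power2_le_imp_le)
  then show ?thesis using that[OF SL2Z_mult[OF T A(1)]] re m by (simp add: siegel_set_def)
qed

text \<open>The entries modulo \<open>N\<close> take finitely many values, and matrices with the
  same reduction differ by a left factor congruent to 1.\<close>

lemma Gamma_N_finite_index:
  assumes N: "N \<ge> 1"
  obtains R where "finite R" "R \<subseteq> SL2Z"
    "\<And>A. A \<in> SL2Z \<Longrightarrow> \<exists>C \<in> principal_congruence_subgroup N. \<exists>B \<in> R. A = C ** B"
proof -
  define \<rho> where "\<rho> A = (A $ 1 $ 1 mod int N, A $ 1 $ 2 mod int N, A $ 2 $ 1 mod int N, A $ 2 $ 2 mod int N)" for A :: "int ^ 2 ^ 2"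
  define rep where "rep r = (SOME A. A \<in> SL2Z \<and> \<rho> A = r)" for r
  have "\<rho> ` SL2Z \<subseteq> {0..<int N} \<times> {0..<int N} \<times> {0..<int N} \<times> {0..<int N}"
    using N by (auto simp: \<rho>_def)
  then have fin: "finite (\<rho> ` SL2Z)" by (rule finite_subset) auto
  have rep: "rep (\<rho> A) \<in> SL2Z \<and> \<rho> (rep (\<rho> A)) = \<rho> A" if "A \<in> SL2Z" for A
    unfolding rep_def by (rule someI[of _ A]) (use that in auto)
  show ?thesis
  proof
    show "finite (rep ` \<rho> ` SL2Z)" using fin by simp
    show "rep ` \<rho> ` SL2Z \<subseteq> SL2Z" using rep by auto
    fix A assume A: "A \<in> SL2Z"
    define B where "B = rep (\<rho> A)"
    have B: "B \<in> SL2Z" "\<rho> B = \<rho> A" using rep[OF A] by (auto simp: B_def)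
    define C where "C = A ** adj2 B"
    have CB: "A = C ** B"
      unfolding C_def matrix_mul_assoc[symmetric] adj2_mult[OF B(1)] by simp
    have cg: "[A $ 1 $ 1 = B $ 1 $ 1] (mod int N)" "[A $ 1 $ 2 = B $ 1 $ 2] (mod int N)"
      "[A $ 2 $ 1 = B $ 2 $ 1] (mod int N)" "[A $ 2 $ 2 = B $ 2 $ 2] (mod int N)"
      using B(2) by (auto simp: \<rho>_def cong_def)
    have cm: "[x * u + y * v = x' * u + y' * v] (mod int N)" if "[x = x'] (mod int N)" "[y = y'] (mod int N)" for x x' y y' u v
      using that by (intro cong_add cong_mult) auto
    have "\<forall>i j. [(A ** adj2 B) $ i $ j = (B ** adj2 B) $ i $ j] (mod int N)"
      unfolding forall_2 matrix_2_mult by (intro conjI cm cg)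
    then have "C \<in> principal_congruence_subgroup N"
      unfolding principal_congruence_subgroup_def C_def adj2_mult[OF B(1)]
      using SL2Z_mult[OF A SL2Z_adj2[OF B(1)]] by auto
    then show "\<exists>C \<in> principal_congruence_subgroup N. \<exists>B \<in> rep ` \<rho> ` SL2Z. A = C ** B"
      using CB A B_def by blast
  qed
qed

lemma Gamma_N_decomposition:
  assumes N: "N \<ge> 1"
  obtains R where "finite R" "R \<subseteq> SL2Z"
    "\<And>z. Im z > 0 \<Longrightarrow> \<exists>C \<in> principal_congruence_subgroup N. \<exists>B \<in> R. \<exists>z0 \<in> siegel_set. z = moebius C (moebius B z0)"
proof -
  obtain R where R: "finite R" "R \<subseteq> SL2Z"
    "\<And>A. A \<in> SL2Z \<Longrightarrow> \<exists>C \<in> principal_congruence_subgroup N. \<exists>B \<in> R. A = C ** B"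
    using Gamma_N_finite_index[OF N] by blast
  show ?thesis
  proof (rule that[OF R(1,2)])
    fix z :: complex assume z: "Im z > 0"
    obtain A where A: "A \<in> SL2Z" "moebius A z \<in> siegel_set" using SL2Z_reduction[OF z] by blast
    define z0 where "z0 = moebius A z"
    have z0: "Im z0 > 0" using Im_moebius_pos[OF A(1) z] by (simp add: z0_def)
    have "z = moebius (adj2 A) z0" using moebius_adj2(1)[OF A(1) z] by (simp add: z0_def)
    moreover obtain C B where CB: "C \<in> principal_congruence_subgroup N" "B \<in> R" "adj2 A = C ** B"
      using R(3)[OF SL2Z_adj2[OF A(1)]] by blast
    ultimately have "z = moebius C (moebius B z0)"
      using moebius_mult[OF Gamma_N_SL2Z[OF CB(1)] _ z0] R(2) by auto
    then show "\<exists>C \<in> principal_congruence_subgroup N. \<exists>B \<in> R. \<exists>z0 \<in> siegel_set. z = moebius C (moebius B z0)"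
      using CB(1,2) A(2) unfolding z0_def[symmetric] by blast
  qed
qed

text \<open>An invariant function is determined by its values on finitely many translates of the
  Siegel set, so bounds on the translates give a global bound. The parameter \<open>s\<close>
  carries uniformity, which the analytic continuation needs.\<close>

lemma bounded_via_siegel_set:
  fixes \<Omega> :: "'s \<Rightarrow> complex \<Rightarrow> real"
  assumes N: "N \<ge> 1"
    and inv: "\<And>s A z. s \<in> S \<Longrightarrow> A \<in> principal_congruence_subgroup N \<Longrightarrow> Im z > 0 \<Longrightarrow> \<Omega> s (moebius A z) = \<Omega> s z"
    and bd: "\<And>A. A \<in> SL2Z \<Longrightarrow> \<exists>C. \<forall>s \<in> S. \<forall>z \<in> siegel_set. \<Omega> s (moebius A z) \<le> C"
  obtains C where "C \<ge> 0" "\<And>s z. s \<in> S \<Longrightarrow> Im z > 0 \<Longrightarrow> \<Omega> s z \<le> C"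
proof -
  obtain R where R: "finite R" "R \<subseteq> SL2Z"
    "\<And>z. Im z > 0 \<Longrightarrow> \<exists>C \<in> principal_congruence_subgroup N. \<exists>B \<in> R. \<exists>z0 \<in> siegel_set. z = moebius C (moebius B z0)"
    by (rule Gamma_N_decomposition[OF N]) (rule that)
  define c where "c A = (SOME C. \<forall>s \<in> S. \<forall>z \<in> siegel_set. \<Omega> s (moebius A z) \<le> C)" for A
  have c: "\<forall>s \<in> S. \<forall>z \<in> siegel_set. \<Omega> s (moebius A z) \<le> c A" if "A \<in> R" for A
    unfolding c_def by (rule someI_ex[OF bd]) (use that R(2) in auto)
  define K where "K = Max (insert 0 (c ` R))"
  show ?thesis
  proof
    show "K \<ge> 0" using R(1) by (simp add: K_def)
    fix s z assume s: "s \<in> S" and z: "Im z > 0"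
    obtain C B z0 where d: "C \<in> principal_congruence_subgroup N" "B \<in> R" "z0 \<in> siegel_set" "z = moebius C (moebius B z0)"
      using R(3)[OF z] by blast
    have "Im z0 > 0" using d(3) by (simp add: siegel_set_def)
    then have "\<Omega> s z = \<Omega> s (moebius B z0)" unfolding d(4) using d R(2) by (intro inv s Im_moebius_pos) auto
    also have "\<dots> \<le> c B" by (rule c[OF d(2), rule_format, OF s d(3)])
    also have "\<dots> \<le> K" unfolding K_def using R(1) d(2) by (intro Max_ge) auto
    finally show "\<Omega> s z \<le> K" .
  qed
qed

text \<open>On the Siegel set \<open>height z \<le> Im z + 7/2\<close>, and
  \<open>7/2 \<le> 7 * Im z\<close>.\<close>

lemma height_siegel_set: "z \<in> siegel_set \<Longrightarrow> height z \<le> 8 * Im z"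
proof -
  assume z: "z \<in> siegel_set"
  have "cmod z \<le> \<bar>Re z\<bar> + \<bar>Im z\<bar>" by (rule cmod_le)
  moreover have "1 / Im z \<le> 2" using z by (simp add: siegel_set_def field_simps)
  ultimately show ?thesis using z by (simp add: siegel_set_def height_def)
qed

lemma cusp_form_slash_times_height_bounded:
  assumes f: "cusp_form N k f" and N: "N \<ge> 1" and A: "A \<in> SL2Z"
  obtains C where "C \<ge> 0" "\<And>z. z \<in> siegel_set \<Longrightarrow> norm (slash k A f z) * height z ^ n \<le> C"
proof -
  obtain C where C: "C \<ge> 0" "\<And>z. Im z \<ge> 1 / 2 \<Longrightarrow> norm (slash k A f z) \<le> C * exp (- (2 * pi / real N) * Im z)"
    using cusp_form_slash_bound[OF f N A] by blast
  define c where "c = 2 * pi / real N"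
  have c: "c > 0" using N by (simp add: c_def)
  define m where "m = Suc n"
  define K where "K = real m ^ m * (8 / c) ^ m"
  have K: "K \<ge> 0" using c by (simp add: K_def)
  show ?thesis
  proof
    show "C * K \<ge> 0" using C K by simp
    fix z assume z: "z \<in> siegel_set"
    then have y: "Im z \<ge> 1 / 2" by (simp add: siegel_set_def)
    have H: "height z \<ge> 1" using height_ge(1)[of z] y by simp
    have "height z ^ n \<le> height z ^ m" using H by (intro power_increasing) (auto simp: m_def)
    also have "\<dots> \<le> (8 * Im z) ^ m" using height_siegel_set[OF z] H by (intro power_mono) auto
    also have "8 * Im z = (8 / c) * (c * Im z)" using c by simp
    also have "((8 / c) * (c * Im z)) ^ m = (8 / c) ^ m * (c * Im z) ^ m" by (rule power_mult_distrib)
    also have "\<dots> \<le> (8 / c) ^ m * (real m ^ m * exp (c * Im z))"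
      using c y by (intro mult_left_mono power_le_power_exp) (auto simp: m_def)
    finally have h: "height z ^ n \<le> K * exp (c * Im z)" by (simp add: K_def mult_ac)
    have "norm (slash k A f z) * height z ^ n \<le> (C * exp (- c * Im z)) * (K * exp (c * Im z))"
      using C(2)[OF y] h H C(1) by (intro mult_mono) (auto simp: c_def)
    also have "\<dots> = C * K" by (simp add: exp_minus)
    finally show "norm (slash k A f z) * height z ^ n \<le> C * K" .
  qed
qed

section \<open>The invariant measure\<close>

lemma borel_measurable_Complex_comp [measurable]:
  assumes [measurable]: "f \<in> borel_measurable M" "g \<in> borel_measurable M"
  shows "(\<lambda>x. Complex (f x) (g x)) \<in> borel_measurable M"
  unfolding Complex_eq by measurable

lemma borel_measurable_Complex:
  "(\<lambda>(x, y). Complex x y) \<in> borel_measurable (borel \<Otimes>\<^sub>M borel)"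
proof -
  have "(\<lambda>(x, y). Complex x y) = (\<lambda>p. of_real (fst p) + \<i> * of_real (snd p))"
    by (auto simp: fun_eq_iff complex_eq_iff)
  then show ?thesis by simp
qed

lemma lborel_complex_eq_distr: "(lborel :: complex measure) = distr (lborel \<Otimes>\<^sub>M lborel) borel (\<lambda>(x, y). Complex x y)"
proof (rule lborel_eqI)
  fix l u :: complex assume lu: "\<And>b. b \<in> Basis \<Longrightarrow> l \<bullet> b \<le> u \<bullet> b"
  have le: "Re l \<le> Re u" "Im l \<le> Im u"
    using lu[of 1] lu[of \<i>] by (auto simp: Basis_complex_def inner_complex_def)
  have "(\<lambda>(x, y). Complex x y) -` box l u \<inter> space (lborel \<Otimes>\<^sub>M lborel) = {Re l<..<Re u} \<times> {Im l<..<Im u}"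
    by (auto simp: box_complex_eq space_pair_measure in_box_complex_iff)
  then have "emeasure (distr (lborel \<Otimes>\<^sub>M lborel) borel (\<lambda>(x, y). Complex x y)) (box l u)
     = emeasure (lborel \<Otimes>\<^sub>M lborel) ({Re l<..<Re u} \<times> {Im l<..<Im u})"
    by (subst emeasure_distr) (auto simp: borel_measurable_Complex cong: measurable_cong_sets)
  also have "\<dots> = ennreal (Re u - Re l) * ennreal (Im u - Im l)"
    using le by (subst lborel.emeasure_pair_measure_Times) auto
  also have "\<dots> = ennreal (\<Prod>b\<in>Basis. (u - l) \<bullet> b)"
    using le by (simp add: Basis_complex_def ennreal_mult inner_complex_def)
  finally show "emeasure (distr (lborel \<Otimes>\<^sub>M lborel) borel (\<lambda>(x, y). Complex x y)) (box l u) = (\<Prod>b\<in>Basis. (u - l) \<bullet> b)" .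
qed simp

text \<open>The density vanishes outside the upper half-plane. Integrals over the half-plane become
  integrals over the whole type, and \<open>Im z > 0\<close> becomes an almost-everywhere
  statement.\<close>

definition hyp :: "complex measure" where
  "hyp = density lborel (\<lambda>z. indicator {z. Im z > 0} z * ennreal (1 / Im z ^ 2))"

lemma space_hyp [simp]: "space hyp = UNIV" and sets_hyp [simp, measurable_cong]: "sets hyp = sets borel"
  by (simp_all add: hyp_def)

lemma measurable_upper [measurable]: "{z. Im z > 0} \<in> sets borel"
  by (simp add: open_halfspace_Im_gt)

lemma AE_hyp_upper: "AE z in hyp. Im z > 0"
  unfolding hyp_def by (subst AE_density) (auto simp: indicator_def)

lemma AE_hyp_lborel: "AE z in lborel. P z \<Longrightarrow> AE z in hyp. P z"
  unfolding hyp_def by (subst AE_density) auto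

lemma sigma_finite_hyp: "sigma_finite_measure hyp"
  unfolding hyp_def by (subst sigma_finite_measure.sigma_finite_iff_density_finite[OF lborel.sigma_finite_measure_axioms]) (auto simp: indicator_def)

lemma nn_integral_hyp_xy:
  assumes [measurable]: "h \<in> borel_measurable borel"
  shows "(\<integral>\<^sup>+z. h z \<partial>hyp) = (\<integral>\<^sup>+y. (\<integral>\<^sup>+x. indicator {0<..} y * ennreal (1 / y ^ 2) * h (Complex x y) \<partial>lborel) \<partial>lborel)"
proof -
  have m: "(\<lambda>(x, y). indicator {0<..} y * ennreal (1 / y ^ 2) * h (Complex x y)) \<in> borel_measurable (lborel \<Otimes>\<^sub>M lborel)"
    by measurable
  have "(\<integral>\<^sup>+z. h z \<partial>hyp) = (\<integral>\<^sup>+z. indicator {z. Im z > 0} z * ennreal (1 / Im z ^ 2) * h z \<partial>lborel)"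
    unfolding hyp_def by (subst nn_integral_density) auto
  also have "\<dots> = (\<integral>\<^sup>+p. (\<lambda>(x, y). indicator {0<..} y * ennreal (1 / y ^ 2) * h (Complex x y)) p \<partial>(lborel \<Otimes>\<^sub>M lborel))"
    unfolding lborel_complex_eq_distr
    by (subst nn_integral_distr) (auto simp: borel_measurable_Complex case_prod_unfold indicator_def cong: measurable_cong_sets intro!: nn_integral_cong)
  also have "\<dots> = (\<integral>\<^sup>+y. (\<integral>\<^sup>+x. indicator {0<..} y * ennreal (1 / y ^ 2) * h (Complex x y) \<partial>lborel) \<partial>lborel)"
    using lborel_pair.nn_integral_snd[OF m] by simp
  finally show ?thesis .
qed

text \<open>Substitution on compact intervals, which exhaust the positive half-line and the line;
  monotone convergence passes to the limit.\<close>

lemma nn_integral_exp_substitution: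
  fixes K :: "real \<Rightarrow> ennreal"
  assumes [measurable]: "K \<in> borel_measurable borel"
  shows "(\<integral>\<^sup>+y. K y * indicator {0<..} y \<partial>lborel) = (\<integral>\<^sup>+\<rho>. K (exp \<rho>) * ennreal (exp \<rho>) \<partial>lborel)"
proof -
  define A where "A n = {exp (- (real n + 1))..exp (real n + 1)}" for n
  define B where "B n = {- (real n + 1)..real n + 1}" for n
  have UA: "(\<Union>n. A n) = {0<..}"
  proof (intro set_eqI iffI)
    fix x :: real assume "x \<in> {0<..}"
    then have x: "x > 0" by simp
    obtain n where n: "\<bar>ln x\<bar> \<le> real n" using real_arch_simple by blast
    then have "exp (- (real n + 1)) \<le> exp (ln x)" "exp (ln x) \<le> exp (real n + 1)" by auto
    then have "x \<in> A n" unfolding A_def using x by simp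
    then show "x \<in> (\<Union>n. A n)" by blast
  qed (auto simp: A_def intro: less_le_trans[OF exp_gt_zero])
  have UB: "(\<Union>n. B n) = UNIV"
  proof (intro set_eqI iffI)
    fix x :: real
    obtain n where "\<bar>x\<bar> \<le> real n" using real_arch_simple by blast
    then have "x \<in> B n" by (auto simp: B_def)
    then show "x \<in> (\<Union>n. B n)" by blast
  qed auto
  have iA: "incseq A" by (auto simp: incseq_def A_def intro: order_trans[rotated])
  have iB: "incseq B" by (auto simp: incseq_def B_def)
  have "(\<integral>\<^sup>+y. K y * indicator {0<..} y \<partial>lborel) = emeasure (density lborel K) (\<Union>n. A n)"
    by (subst emeasure_density) (auto simp: UA)
  also have "\<dots> = (SUP n. emeasure (density lborel K) (A n))"
    by (rule SUP_emeasure_incseq[symmetric, OF _ iA]) (auto simp: A_def)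
  also have "\<dots> = (SUP n. emeasure (density lborel (\<lambda>\<rho>. K (exp \<rho>) * ennreal (exp \<rho>))) (B n))"
  proof (rule SUP_cong[OF refl])
    fix n
    have "emeasure (density lborel K) (A n) = (\<integral>\<^sup>+y. K y * indicator {exp (- (real n + 1))..exp (real n + 1)} y \<partial>lborel)"
      by (subst emeasure_density) (auto simp: A_def)
    also have "\<dots> = (\<integral>\<^sup>+\<rho>. K (exp \<rho>) * ennreal (exp \<rho>) * indicator {- (real n + 1)..real n + 1} \<rho> \<partial>lborel)"
      by (rule nn_integral_substitution_aux) (auto intro!: continuous_intros DERIV_exp)
    also have "\<dots> = emeasure (density lborel (\<lambda>\<rho>. K (exp \<rho>) * ennreal (exp \<rho>))) (B n)"
      by (subst emeasure_density) (auto simp: B_def)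
    finally show "emeasure (density lborel K) (A n) = emeasure (density lborel (\<lambda>\<rho>. K (exp \<rho>) * ennreal (exp \<rho>))) (B n)" .
  qed
  also have "\<dots> = emeasure (density lborel (\<lambda>\<rho>. K (exp \<rho>) * ennreal (exp \<rho>))) (\<Union>n. B n)"
    by (rule SUP_emeasure_incseq[OF _ iB]) (auto simp: B_def)
  also have "\<dots> = (\<integral>\<^sup>+\<rho>. K (exp \<rho>) * ennreal (exp \<rho>) \<partial>lborel)"
    by (subst emeasure_density) (auto simp: UB)
  finally show ?thesis .
qed

text \<open>
  In these coordinates the measure \<open>y\<^sup>-\<^sup>2 dx dy\<close> becomes \<open>du d\<rho>\<close>, and the curves of constant \<open>u\<close> run from \<open>0\<close> to \<open>\<infinity>\<close>.
\<close>

definition geo :: "real \<Rightarrow> real \<Rightarrow> complex" where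
  "geo u \<rho> = of_real (exp \<rho>) * (of_real u + \<i>)"

lemma geo_eq_Complex: "geo u \<rho> = Complex (exp \<rho> * u) (exp \<rho>)"
  by (simp add: geo_def complex_eq_iff)

lemma Im_geo [simp]: "Im (geo u \<rho>) = exp \<rho>" by (simp add: geo_eq_Complex)

lemma geo_measurable_comp [measurable]:
  assumes [measurable]: "f \<in> borel_measurable M" "g \<in> borel_measurable M"
  shows "(\<lambda>x. geo (f x) (g x)) \<in> borel_measurable M"
  unfolding geo_def by measurable

lemma geo_measurable: "(\<lambda>(u, \<rho>). geo u \<rho>) \<in> borel_measurable (borel \<Otimes>\<^sub>M borel)"
  by measurable

lemma nn_integral_hyp_geo:
  assumes [measurable]: "h \<in> borel_measurable borel"
  shows "(\<integral>\<^sup>+z. h z \<partial>hyp) = (\<integral>\<^sup>+\<rho>. (\<integral>\<^sup>+u. h (geo u \<rho>) \<partial>lborel) \<partial>lborel)"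
proof -
  define K where "K y = ennreal (1 / y) * (\<integral>\<^sup>+u. h (Complex (y * u) y) \<partial>lborel)" for y
  have K[measurable]: "K \<in> borel_measurable borel"
  proof -
    have "(\<lambda>(y, u). h (Complex (y * u) y)) \<in> borel_measurable (borel \<Otimes>\<^sub>M lborel)" by measurable
    from lborel.borel_measurable_nn_integral[OF this] show ?thesis unfolding K_def by measurable
  qed
  have "(\<integral>\<^sup>+x. indicator {0<..} y * ennreal (1 / y ^ 2) * h (Complex x y) \<partial>lborel) = K y * indicator {0<..} y" for y :: real
  proof (cases "y > 0")
    case True
    have "(\<integral>\<^sup>+x. indicator {0<..} y * ennreal (1 / y ^ 2) * h (Complex x y) \<partial>lborel)
        = ennreal (1 / y ^ 2) * (\<integral>\<^sup>+x. h (Complex x y) \<partial>lborel)"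
      using True by (simp add: nn_integral_cmult)
    also have "(\<integral>\<^sup>+x. h (Complex x y) \<partial>lborel) = ennreal \<bar>y\<bar> * (\<integral>\<^sup>+u. h (Complex (0 + y * u) y) \<partial>lborel)"
      by (rule nn_integral_real_affine) (use True in auto)
    also have "ennreal (1 / y ^ 2) * (ennreal \<bar>y\<bar> * (\<integral>\<^sup>+u. h (Complex (0 + y * u) y) \<partial>lborel)) = K y"
      using True by (simp add: K_def mult.assoc[symmetric] ennreal_mult[symmetric] power2_eq_square)
    finally show ?thesis using True by simp
  qed simp
  then have "(\<integral>\<^sup>+z. h z \<partial>hyp) = (\<integral>\<^sup>+y. K y * indicator {0<..} y \<partial>lborel)"
    unfolding nn_integral_hyp_xy[OF assms] by simp
  also have "\<dots> = (\<integral>\<^sup>+\<rho>. K (exp \<rho>) * ennreal (exp \<rho>) \<partial>lborel)" by (rule nn_integral_exp_substitution[OF K])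
  also have "\<dots> = (\<integral>\<^sup>+\<rho>. (\<integral>\<^sup>+u. h (geo u \<rho>) \<partial>lborel) \<partial>lborel)"
  proof (rule nn_integral_cong)
    fix \<rho> :: real
    have "ennreal (1 / exp \<rho>) * I * ennreal (exp \<rho>) = I" for I
    proof -
      have "ennreal (1 / exp \<rho>) * I * ennreal (exp \<rho>) = (ennreal (1 / exp \<rho>) * ennreal (exp \<rho>)) * I"
        by (simp only: mult_ac)
      also have "ennreal (1 / exp \<rho>) * ennreal (exp \<rho>) = 1" by (simp add: ennreal_mult[symmetric])
      finally show ?thesis by simp
    qed
    then show "K (exp \<rho>) * ennreal (exp \<rho>) = (\<integral>\<^sup>+u. h (geo u \<rho>) \<partial>lborel)"
      by (simp add: K_def geo_eq_Complex)
  qed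
  finally show ?thesis .
qed

lemma nn_integral_hyp_geo':
  assumes [measurable]: "h \<in> borel_measurable borel"
  shows "(\<integral>\<^sup>+z. h z \<partial>hyp) = (\<integral>\<^sup>+u. (\<integral>\<^sup>+\<rho>. h (geo u \<rho>) \<partial>lborel) \<partial>lborel)"
proof -
  have "(\<lambda>(u, \<rho>). h (geo u \<rho>)) \<in> borel_measurable (lborel \<Otimes>\<^sub>M lborel)" by measurable
  from lborel_pair.Fubini'[OF this] show ?thesis unfolding nn_integral_hyp_geo[OF assms] by simp
qed

lemma hyp_eq_distr_geo: "hyp = distr (lborel \<Otimes>\<^sub>M lborel) borel (\<lambda>(u, \<rho>). geo u \<rho>)"
proof (rule measure_eqI)
  fix X assume "X \<in> sets hyp"
  then have X[measurable]: "X \<in> sets borel" by simp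
  have "emeasure (distr (lborel \<Otimes>\<^sub>M lborel) borel (\<lambda>(u, \<rho>). geo u \<rho>)) X
      = (\<integral>\<^sup>+z. indicator X z \<partial>distr (lborel \<Otimes>\<^sub>M lborel) borel (\<lambda>(u, \<rho>). geo u \<rho>))"
    by simp
  also have "\<dots> = (\<integral>\<^sup>+p. (\<lambda>(u, \<rho>). indicator X (geo u \<rho>)) p \<partial>(lborel \<Otimes>\<^sub>M lborel))"
    by (subst nn_integral_distr) (auto simp: case_prod_unfold geo_measurable[unfolded case_prod_unfold] cong: measurable_cong_sets)
  also have "\<dots> = (\<integral>\<^sup>+u. (\<integral>\<^sup>+\<rho>. indicator X (geo u \<rho>) \<partial>lborel) \<partial>lborel)"
    by (subst lborel.nn_integral_fst[symmetric]) auto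
  also have "\<dots> = emeasure hyp X" using nn_integral_hyp_geo'[of "indicator X"] by simp
  finally show "emeasure hyp X = emeasure (distr (lborel \<Otimes>\<^sub>M lborel) borel (\<lambda>(u, \<rho>). geo u \<rho>)) X" ..
qed simp

lemma integral_hyp_geo:
  fixes \<phi> :: "complex \<Rightarrow> complex"
  assumes "integrable hyp \<phi>"
  shows "(\<integral>z. \<phi> z \<partial>hyp) = (\<integral>u. (\<integral>\<rho>. \<phi> (geo u \<rho>) \<partial>lborel) \<partial>lborel)"
    and "AE u in lborel. integrable lborel (\<lambda>\<rho>. \<phi> (geo u \<rho>))"
    and "(\<integral>z. \<phi> z \<partial>hyp) = (\<integral>\<rho>. (\<integral>u. \<phi> (geo u \<rho>) \<partial>lborel) \<partial>lborel)"
    and "integrable lborel (\<lambda>u. \<integral>\<rho>. \<phi> (geo u \<rho>) \<partial>lborel)"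
proof -
  have m[measurable]: "\<phi> \<in> borel_measurable borel" using assms by (simp add: borel_measurable_integrable measurable_cong_sets[OF sets_hyp refl, symmetric])
  have g: "(\<lambda>(u, \<rho>). geo u \<rho>) \<in> (lborel \<Otimes>\<^sub>M lborel) \<rightarrow>\<^sub>M borel" by measurable
  have i: "integrable (lborel \<Otimes>\<^sub>M lborel) (\<lambda>(u, \<rho>). \<phi> (geo u \<rho>))"
    using assms unfolding hyp_eq_distr_geo integrable_distr_eq[OF g m] by (simp add: case_prod_unfold)
  have e: "(\<integral>z. \<phi> z \<partial>hyp) = (\<integral>p. (\<lambda>(u, \<rho>). \<phi> (geo u \<rho>)) p \<partial>(lborel \<Otimes>\<^sub>M lborel))"
    unfolding hyp_eq_distr_geo integral_distr[OF g m] by (simp add: case_prod_unfold)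
  show "(\<integral>z. \<phi> z \<partial>hyp) = (\<integral>u. (\<integral>\<rho>. \<phi> (geo u \<rho>) \<partial>lborel) \<partial>lborel)"
    unfolding e using lborel_pair.integral_fst[OF i] by simp
  show "(\<integral>z. \<phi> z \<partial>hyp) = (\<integral>\<rho>. (\<integral>u. \<phi> (geo u \<rho>) \<partial>lborel) \<partial>lborel)"
    unfolding e using lborel_pair.integral_snd[OF i] by simp
  show "AE u in lborel. integrable lborel (\<lambda>\<rho>. \<phi> (geo u \<rho>))"
    using lborel_pair.AE_integrable_fst[OF i] by simp
  show "integrable lborel (\<lambda>u. \<integral>\<rho>. \<phi> (geo u \<rho>) \<partial>lborel)"
    using lborel_pair.integrable_fst[OF i] by simp
qed

section \<open>Invariance under Moebius transformations\<close>

definition hyp_invariant :: "(complex \<Rightarrow> complex) \<Rightarrow> bool" where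
  "hyp_invariant T \<longleftrightarrow> T \<in> borel_measurable borel \<and> distr hyp borel T = hyp"

lemma hyp_invariantI:
  assumes [measurable]: "T \<in> borel_measurable borel"
    and "\<And>h :: complex \<Rightarrow> ennreal. h \<in> borel_measurable borel \<Longrightarrow> (\<integral>\<^sup>+z. h (T z) \<partial>hyp) = (\<integral>\<^sup>+z. h z \<partial>hyp)"
  shows "hyp_invariant T"
  unfolding hyp_invariant_def
proof (intro conjI measure_eqI)
  fix X assume "X \<in> sets (distr hyp borel T)"
  then have [measurable]: "X \<in> sets borel" by simp
  have "emeasure (distr hyp borel T) X = (\<integral>\<^sup>+z. indicator X (T z) \<partial>hyp)"
    by (subst nn_integral_indicator[symmetric], simp, subst nn_integral_distr) auto
  also have "\<dots> = emeasure hyp X" by (subst assms(2)) auto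
  finally show "emeasure (distr hyp borel T) X = emeasure hyp X" .
qed auto

lemma hyp_invariant_nn_integral:
  assumes "hyp_invariant T" "h \<in> borel_measurable borel"
  shows "(\<integral>\<^sup>+z. h (T z) \<partial>hyp) = (\<integral>\<^sup>+z. h z \<partial>hyp)"
proof -
  have "(\<integral>\<^sup>+z. h z \<partial>hyp) = (\<integral>\<^sup>+z. h z \<partial>distr hyp borel T)" using assms(1) by (simp add: hyp_invariant_def)
  also have "\<dots> = (\<integral>\<^sup>+z. h (T z) \<partial>hyp)" by (rule nn_integral_distr) (use assms in \<open>auto simp: hyp_invariant_def cong: measurable_cong_sets\<close>)
  finally show ?thesis ..
qed

lemma hyp_invariant_integral:
  fixes h :: "complex \<Rightarrow> complex"
  assumes T: "hyp_invariant T" and h: "h \<in> borel_measurable borel"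
  shows "(\<integral>z. h (T z) \<partial>hyp) = (\<integral>z. h z \<partial>hyp)"
    and "integrable hyp (\<lambda>z. h (T z)) \<longleftrightarrow> integrable hyp h"
proof -
  have TM: "T \<in> hyp \<rightarrow>\<^sub>M borel" using T by (simp add: hyp_invariant_def cong: measurable_cong_sets)
  have D: "distr hyp borel T = hyp" using T by (simp add: hyp_invariant_def)
  show "(\<integral>z. h (T z) \<partial>hyp) = (\<integral>z. h z \<partial>hyp)" using integral_distr[OF TM h] unfolding D ..
  show "integrable hyp (\<lambda>z. h (T z)) \<longleftrightarrow> integrable hyp h" using integrable_distr_eq[OF TM h] unfolding D ..
qed

lemma hyp_invariant_comp:
  assumes "hyp_invariant S" "hyp_invariant T"
  shows "hyp_invariant (\<lambda>z. S (T z))"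
proof (rule hyp_invariantI)
  have [measurable]: "S \<in> borel_measurable borel" "T \<in> borel_measurable borel" using assms by (auto simp: hyp_invariant_def)
  show "(\<lambda>z. S (T z)) \<in> borel_measurable borel" by measurable
  fix h :: "complex \<Rightarrow> ennreal" assume [measurable]: "h \<in> borel_measurable borel"
  have "(\<integral>\<^sup>+z. h (S (T z)) \<partial>hyp) = (\<integral>\<^sup>+z. h (S z) \<partial>hyp)"
    by (rule hyp_invariant_nn_integral[OF assms(2)]) measurable
  then show "(\<integral>\<^sup>+z. h (S (T z)) \<partial>hyp) = (\<integral>\<^sup>+z. h z \<partial>hyp)"
    using hyp_invariant_nn_integral[OF assms(1)] by simp
qed

lemma hyp_invariant_cong_upper:
  assumes S: "hyp_invariant S" and T: "T \<in> borel_measurable borel" and eq: "\<And>z. Im z > 0 \<Longrightarrow> T z = S z"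
  shows "hyp_invariant T"
proof (rule hyp_invariantI[OF T])
  fix h :: "complex \<Rightarrow> ennreal" assume h: "h \<in> borel_measurable borel"
  have "(\<integral>\<^sup>+z. h (T z) \<partial>hyp) = (\<integral>\<^sup>+z. h (S z) \<partial>hyp)"
    by (rule nn_integral_cong_AE) (use AE_hyp_upper in eventually_elim, simp add: eq)
  then show "(\<integral>\<^sup>+z. h (T z) \<partial>hyp) = (\<integral>\<^sup>+z. h z \<partial>hyp)"
    using hyp_invariant_nn_integral[OF S h] by simp
qed

lemma hyp_invariant_translation: "hyp_invariant (\<lambda>z. z + of_real t)"
proof (rule hyp_invariantI)
  fix h :: "complex \<Rightarrow> ennreal" assume [measurable]: "h \<in> borel_measurable borel"
  have "(\<integral>\<^sup>+u. h (geo u \<rho> + of_real t) \<partial>lborel) = (\<integral>\<^sup>+u. h (geo u \<rho>) \<partial>lborel)" for \<rho>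
  proof -
    have g[measurable]: "(\<lambda>u. geo u \<rho>) \<in> borel_measurable borel" unfolding geo_def by measurable
    have "(\<integral>\<^sup>+u. h (geo u \<rho>) \<partial>lborel) = ennreal \<bar>1\<bar> * (\<integral>\<^sup>+u. h (geo (t * exp (- \<rho>) + 1 * u) \<rho>) \<partial>lborel)"
      by (rule nn_integral_real_affine[of "\<lambda>u. h (geo u \<rho>)"]) auto
    moreover have "geo (t * exp (- \<rho>) + 1 * u) \<rho> = geo u \<rho> + of_real t" for u
      by (simp add: geo_eq_Complex complex_eq_iff algebra_simps exp_minus)
    ultimately show ?thesis by (simp only: abs_one ennreal_1 mult_1)
  qed
  then show "(\<integral>\<^sup>+z. h (z + of_real t) \<partial>hyp) = (\<integral>\<^sup>+z. h z \<partial>hyp)"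
    by (simp add: nn_integral_hyp_geo)
qed measurable

lemma hyp_invariant_scaling:
  assumes r: "r > 0"
  shows "hyp_invariant (\<lambda>z. of_real r * z)"
proof (rule hyp_invariantI)
  fix h :: "complex \<Rightarrow> ennreal" assume [measurable]: "h \<in> borel_measurable borel"
  have "(\<integral>\<^sup>+\<rho>. h (of_real r * geo u \<rho>) \<partial>lborel) = (\<integral>\<^sup>+\<rho>. h (geo u \<rho>) \<partial>lborel)" for u
  proof -
    have g[measurable]: "geo u \<in> borel_measurable borel" unfolding geo_def by measurable
    have "(\<integral>\<^sup>+\<rho>. h (geo u \<rho>) \<partial>lborel) = ennreal \<bar>1\<bar> * (\<integral>\<^sup>+\<rho>. h (geo u (ln r + 1 * \<rho>)) \<partial>lborel)"
      by (rule nn_integral_real_affine[of "\<lambda>\<rho>. h (geo u \<rho>)"]) auto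
    moreover have "geo u (ln r + 1 * \<rho>) = of_real r * geo u \<rho>" for \<rho>
      using r by (simp add: geo_def exp_add)
    ultimately show ?thesis by (simp only: abs_one ennreal_1 mult_1)
  qed
  then show "(\<integral>\<^sup>+z. h (of_real r * z) \<partial>hyp) = (\<integral>\<^sup>+z. h z \<partial>hyp)"
    by (simp add: nn_integral_hyp_geo')
qed measurable

text \<open>Inversion reflects \<open>u\<close> and, for fixed \<open>u\<close>, reflects and shifts
  \<open>\<rho>\<close>; translation and scaling are shifts in one coordinate. Each generator thus
  preserves \<open>du d\<rho>\<close> by the invariance of one-dimensional Lebesgue measure. The
  sign change of \<open>\<rho>\<close> also exchanges the two ends of the curves of constant
  \<open>u\<close>.\<close>

lemma geo_inversion: "- 1 / geo u \<rho> = geo (- u) (- ln (1 + u\<^sup>2) + - 1 * \<rho>)"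
proof -
  have p: "1 + u\<^sup>2 > 0" by (simp add: add_pos_nonneg)
  have "geo u \<rho> * geo (- u) (- ln (1 + u\<^sup>2) + - 1 * \<rho>) = of_real (exp \<rho> * exp (- ln (1 + u\<^sup>2) + - 1 * \<rho>)) * (- of_real (1 + u\<^sup>2))"
    by (simp add: geo_def algebra_simps power2_eq_square)
  also have "exp \<rho> * exp (- ln (1 + u\<^sup>2) + - 1 * \<rho>) = 1 / (1 + u\<^sup>2)"
    using p by (simp add: exp_add[symmetric] exp_minus inverse_eq_divide)
  also have "complex_of_real (1 / (1 + u\<^sup>2)) * (- of_real (1 + u\<^sup>2)) = - 1"
  proof -
    have "of_real x * (- of_real y) = (- 1 :: complex)" if "x * y = 1" for x y :: real
      using that by (metis mult_minus_right of_real_1 of_real_mult)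
    then show ?thesis using p by (metis nonzero_eq_divide_eq order_less_irrefl)
  qed
  finally have "geo u \<rho> * geo (- u) (- ln (1 + u\<^sup>2) + - 1 * \<rho>) = - 1" .
  moreover have "geo u \<rho> \<noteq> 0" by (simp add: geo_eq_Complex complex_eq_iff)
  ultimately show ?thesis by (simp add: field_simps)
qed

lemma hyp_invariant_inversion: "hyp_invariant (\<lambda>z. - 1 / z)"
proof (rule hyp_invariantI)
  fix h :: "complex \<Rightarrow> ennreal" assume [measurable]: "h \<in> borel_measurable borel"
  have "(\<integral>\<^sup>+\<rho>. h (- 1 / geo u \<rho>) \<partial>lborel) = (\<integral>\<^sup>+\<rho>. h (geo (- u) \<rho>) \<partial>lborel)" for u
  proof -
    have g[measurable]: "geo (- u) \<in> borel_measurable borel" unfolding geo_def by measurable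
    have "(\<integral>\<^sup>+\<rho>. h (geo (- u) \<rho>) \<partial>lborel) = ennreal \<bar>-1\<bar> * (\<integral>\<^sup>+\<rho>. h (geo (- u) (- ln (1 + u\<^sup>2) + - 1 * \<rho>)) \<partial>lborel)"
      by (rule nn_integral_real_affine[of "\<lambda>\<rho>. h (geo (- u) \<rho>)"]) auto
    then show ?thesis unfolding geo_inversion by simp
  qed
  then have "(\<integral>\<^sup>+z. h (- 1 / z) \<partial>hyp) = (\<integral>\<^sup>+u. (\<integral>\<^sup>+\<rho>. h (geo (- u) \<rho>) \<partial>lborel) \<partial>lborel)"
    by (subst nn_integral_hyp_geo') auto
  also have "\<dots> = (\<integral>\<^sup>+u. (\<integral>\<^sup>+\<rho>. h (geo u \<rho>) \<partial>lborel) \<partial>lborel)"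
  proof -
    have "(\<lambda>(u, \<rho>). h (geo u \<rho>)) \<in> borel_measurable (borel \<Otimes>\<^sub>M lborel)" by measurable
    from lborel.borel_measurable_nn_integral[OF this]
    have "(\<lambda>u. \<integral>\<^sup>+\<rho>. h (geo u \<rho>) \<partial>lborel) \<in> borel_measurable borel" by simp
    from nn_integral_real_affine[OF this, of "-1" 0] show ?thesis by simp
  qed
  finally show "(\<integral>\<^sup>+z. h (- 1 / z) \<partial>hyp) = (\<integral>\<^sup>+z. h z \<partial>hyp)" by (simp add: nn_integral_hyp_geo')
qed measurable

lemma hyp_invariant_real_moebius:
  fixes a b c d :: real
  assumes D: "a * d - b * c > 0"
  shows "hyp_invariant (\<lambda>z. (of_real a * z + of_real b) / (of_real c * z + of_real d))"
proof (cases "c = 0")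
  case True
  then have ad: "a * d > 0" using D by simp
  then have d: "d \<noteq> 0" "a / d > 0" by (auto simp: zero_less_mult_iff zero_less_divide_iff)
  have "hyp_invariant (\<lambda>z. of_real (a / d) * z + of_real (b / d))"
    by (rule hyp_invariant_comp[OF hyp_invariant_translation hyp_invariant_scaling[OF d(2)]])
  moreover have "of_real (a / d) * z + of_real (b / d) = (of_real a * z + of_real b) / (of_real c * z + of_real d)" for z :: complex
    using True d by (simp add: add_divide_distrib)
  ultimately show ?thesis by simp
next
  case False
  \<comment> \<open>From \<open>(a z + b) / (c z + d) = a / c - (a d - b c) / (c^2 (z + d /
    c))\<close>: a translation, the inversion, a scaling and a translation.\<close>
  define D' where "D' = (a * d - b * c) / c ^ 2"
  have D': "D' > 0" using D False by (simp add: D'_def)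
  have "hyp_invariant (\<lambda>z. of_real D' * (- 1 / (z + of_real (d / c))) + of_real (a / c))"
    by (intro hyp_invariant_comp[OF hyp_invariant_translation] hyp_invariant_comp[OF hyp_invariant_scaling[OF D']]
      hyp_invariant_comp[OF hyp_invariant_inversion] hyp_invariant_translation)
  then show ?thesis
  proof (rule hyp_invariant_cong_upper)
    fix z :: complex assume z: "Im z > 0"
    have nz: "of_real c * z + of_real d \<noteq> 0" using z False by (auto simp: complex_eq_iff)
    have e: "z + of_real (d / c) = (of_real c * z + of_real d) / of_real c" using False by (simp add: field_simps)
    define w where "w = of_real c * z + of_real d"
    have cc: "complex_of_real c \<noteq> 0" using False by simp
    have "X / k ^ 2 * (- 1 / (w / k)) = - X / (k * w)" if "k \<noteq> 0" for X k :: complex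
      using that nz by (simp add: w_def[symmetric] power2_eq_square)
    from this[OF cc, of "of_real (a * d - b * c)"]
    have 1: "of_real D' * (- 1 / (w / of_real c)) = - of_real (a * d - b * c) / (of_real c * w)"
      unfolding D'_def of_real_divide of_real_power .
    have 2: "x / w = - X / (k * w) + y / k" if "x * k = - X + y * w" "k \<noteq> 0" for x X y k :: complex
    proof -
      have "x / w = (x * k) / (k * w)" using that(2) nz by (simp add: w_def[symmetric])
      also have "\<dots> = - X / (k * w) + y * w / (k * w)" unfolding that(1) by (rule add_divide_distrib)
      also have "y * w / (k * w) = y / k" using nz by (simp add: w_def[symmetric])
      finally show ?thesis .
    qed
    show "(of_real a * z + of_real b) / (of_real c * z + of_real d) = of_real D' * (- 1 / (z + of_real (d / c))) + of_real (a / c)"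
      unfolding e unfolding w_def[symmetric] 1 unfolding of_real_divide
      by (rule 2[OF _ cc]) (simp add: w_def algebra_simps)
  qed measurable
qed

lemma emeasure_hyp_strip_finite:
  "emeasure hyp {z. \<bar>Re z\<bar> \<le> 1 / 2 \<and> Im z \<ge> 1 / 2} < \<infinity>"
proof -
  let ?S = "{z :: complex. \<bar>Re z\<bar> \<le> 1 / 2 \<and> Im z \<ge> 1 / 2}"
  have [measurable]: "?S \<in> sets borel" by measurable
  have "emeasure hyp ?S = (\<integral>\<^sup>+z. indicator ?S z \<partial>hyp)" by simp
  also have "\<dots> = (\<integral>\<^sup>+y. (\<integral>\<^sup>+x. indicator {0<..} y * ennreal (1 / y ^ 2) * indicator ?S (Complex x y) \<partial>lborel) \<partial>lborel)"
    by (rule nn_integral_hyp_xy) measurable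
  also have "\<dots> = (\<integral>\<^sup>+y. ennreal (1 / y ^ 2) * indicator {1/2..} y \<partial>lborel)"
  proof (rule nn_integral_cong)
    fix y :: real
    have "(\<integral>\<^sup>+x. indicator {0<..} y * ennreal (1 / y ^ 2) * indicator ?S (Complex x y) \<partial>lborel)
        = (\<integral>\<^sup>+x. (ennreal (1 / y ^ 2) * indicator {1/2..} y) * indicator {-1/2..1/2::real} x \<partial>lborel)"
      by (rule nn_integral_cong) (auto simp: indicator_def abs_le_iff)
    also have "\<dots> = (ennreal (1 / y ^ 2) * indicator {1/2..} y) * emeasure lborel {-1/2..1/2::real}"
      by (subst nn_integral_cmult) auto
    finally show "(\<integral>\<^sup>+x. indicator {0<..} y * ennreal (1 / y ^ 2) * indicator ?S (Complex x y) \<partial>lborel)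
        = ennreal (1 / y ^ 2) * indicator {1/2..} y" by simp
  qed
  also have "\<dots> = ennreal (0 - (- (1 / (1/2))))"
  proof (rule nn_integral_FTC_atLeast)
    show "((\<lambda>y. - (1 / y)) has_real_derivative 1 / y ^ 2) (at y)" if "1/2 \<le> y" for y :: real
      using that by (auto intro!: derivative_eq_intros simp: power2_eq_square)
    show "((\<lambda>y::real. - (1 / y)) \<longlongrightarrow> 0) at_top"
      using tendsto_minus[OF tendsto_divide_0[OF tendsto_const filterlim_at_top_imp_at_infinity[OF filterlim_ident]], of 1] by simp
  qed auto
  finally show ?thesis by simp
qed

section \<open>Unfolding\<close>

lemma moebius_hyp_invariant:
  assumes "A \<in> SL2Z"
  shows "hyp_invariant (moebius A)"
proof -
  have "real_of_int (A $ 1 $ 1) * real_of_int (A $ 2 $ 2) - real_of_int (A $ 1 $ 2) * real_of_int (A $ 2 $ 1) > 0"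
    using arg_cong[OF assms[unfolded SL2Z_iff], of real_of_int] by simp
  from hyp_invariant_real_moebius[OF this] show ?thesis
    by (simp add: moebius_def[abs_def] automorphy_factor_def)
qed

lemma moebius_measurable [measurable]: "moebius A \<in> borel_measurable borel"
  unfolding moebius_def automorphy_factor_def by measurable

lemma countable_matrices: "countable (S :: (int ^ 2 ^ 2) set)"
proof -
  let ?f = "\<lambda>A :: int ^ 2 ^ 2. (A $ 1 $ 1, A $ 1 $ 2, A $ 2 $ 1, A $ 2 $ 2)"
  have "inj_on ?f S" by (auto intro!: inj_onI matrix_2_eqI)
  moreover have "countable (?f ` S)" by simp
  ultimately show ?thesis by (rule countable_image_inj_on[rotated])
qed

lemma moebius_uminus: "moebius (- A) z = moebius A z"
proof -
  have "automorphy_factor (- A) z = - automorphy_factor A z"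
    "of_int ((- A) $ 1 $ 1) * z + of_int ((- A) $ 1 $ 2) = - (of_int (A $ 1 $ 1) * z + of_int (A $ 1 $ 2))"
    by (simp_all add: automorphy_factor_def)
  then show ?thesis unfolding moebius_def by (simp only: minus_divide_divide)
qed

text \<open>
  The number of elements of \<open>\<Gamma>(N)\<close> that act trivially: two for \<open>N \<le> 2\<close>, otherwise one.
\<close>

definition trivial_count :: "nat \<Rightarrow> nat" where
  "trivial_count N = card ({mat 1, - mat 1} \<inter> principal_congruence_subgroup N)"

lemma trivial_count_pos: "trivial_count N \<ge> 1"
proof -
  have "card {mat 1 :: int ^ 2 ^ 2} \<le> trivial_count N"
    unfolding trivial_count_def by (rule card_mono) (auto simp: Gamma_N_one)
  then show ?thesis by simp
qed

lemma neg_matrix_mult: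
  fixes A B :: "int ^ 2 ^ 2"
  shows "- A ** B = - (A ** B)" "- mat 1 ** A = - A"
  by (auto intro!: matrix_2_eqI simp: matrix_2_mult mat_1_2)

context
  fixes N :: nat and F :: "complex set"
  assumes FD: "fundamental_domain (principal_congruence_subgroup N) F"
begin

abbreviation (input) "\<Gamma> \<equiv> principal_congruence_subgroup N"

lemma fd_measurable [measurable]: "F \<in> sets borel"
  using FD by (simp add: fundamental_domain_def)

lemma fd_upper: "z \<in> F \<Longrightarrow> Im z > 0"
  using FD by (auto simp: fundamental_domain_def upper_half_plane_def)

text \<open>If both points lie in \<open>F\<close>, the second one lies in the overlap of
  \<open>F\<close> with its translate by \<open>D C^-1\<close>, an element other than 1 and -1. This
  overlap is null, and pulling it back by \<open>D\<close> keeps it null because the measure is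
  invariant.\<close>

lemma fd_overlap_null:
  assumes C: "C \<in> \<Gamma>" and D: "D \<in> \<Gamma>" and ne: "D \<noteq> C" "D \<noteq> - C"
  shows "AE z in hyp. \<not> (moebius C z \<in> F \<and> moebius D z \<in> F)"
proof -
  define E where "E = D ** adj2 C"
  note C' = Gamma_N_SL2Z[OF C] and D' = Gamma_N_SL2Z[OF D]
  have E: "E \<in> \<Gamma>" unfolding E_def by (intro Gamma_N_mult Gamma_N_adj2 C D)
  have EC: "E ** C = D" unfolding E_def matrix_mul_assoc[symmetric] adj2_mult[OF C'] by simp
  have "E \<noteq> mat 1" "E \<noteq> - mat 1" using EC ne by (auto simp: neg_matrix_mult)
  define X where "X = F \<inter> moebius E ` F"
  have null: "X \<in> null_sets lborel"
    using FD E \<open>E \<noteq> mat 1\<close> \<open>E \<noteq> - mat 1\<close> by (auto simp: fundamental_domain_def X_def)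
  then have [measurable]: "X \<in> sets borel" by auto
  have "AE z in hyp. z \<notin> X" by (rule AE_hyp_lborel[OF AE_not_in[OF null]])
  moreover have "distr hyp borel (moebius D) = hyp"
    using moebius_hyp_invariant[OF D'] by (simp add: hyp_invariant_def)
  ultimately have "AE z in distr hyp borel (moebius D). z \<notin> X" by (simp only:)
  then have "AE z in hyp. moebius D z \<notin> X"
    by (subst (asm) AE_distr_iff) (auto cong: measurable_cong_sets)
  then show ?thesis using AE_hyp_upper
  proof eventually_elim
    case (elim z)
    have "moebius D z = moebius E (moebius C z)"
      unfolding EC[symmetric] by (rule moebius_mult[OF Gamma_N_SL2Z[OF E] C' elim(2)])
    then show ?case using elim(1) by (auto simp: X_def)
  qed
qed

text \<open>Countability of the group collects all overlaps in one null set. Off it, the elements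
  that carry \<open>z\<close> into \<open>F\<close> form one coset of the subgroup acting
  trivially.\<close>

lemma fd_count:
  "AE z in hyp. finite {C \<in> \<Gamma>. moebius C z \<in> F} \<and> card {C \<in> \<Gamma>. moebius C z \<in> F} = trivial_count N"
proof -
  have "AE z in hyp. \<forall>C\<in>\<Gamma>. \<forall>D\<in>\<Gamma>. D \<noteq> C \<longrightarrow> D \<noteq> - C \<longrightarrow> \<not> (moebius C z \<in> F \<and> moebius D z \<in> F)"
    unfolding AE_ball_countable[OF countable_matrices]
    by (intro ballI AE_impI) (rule fd_overlap_null)
  then show ?thesis using AE_hyp_upper
  proof eventually_elim
    case (elim z)
    obtain C where C: "C \<in> \<Gamma>" "moebius C z \<in> F"
      using FD elim(2) by (auto simp: fundamental_domain_def upper_half_plane_def)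
    let ?S = "{C \<in> \<Gamma>. moebius C z \<in> F}"
    have sub: "D = C \<or> D = - C" if "D \<in> ?S" for D using elim(1) C that by blast
    have neg: "- C \<in> \<Gamma>" if "- mat 1 \<in> \<Gamma>"
      using Gamma_N_mult[OF that C(1)] by (simp add: neg_matrix_mult)
    have bij: "bij_betw (\<lambda>A. A ** C) ({mat 1, - mat 1} \<inter> \<Gamma>) ?S"
    proof (rule bij_betwI[where g = "\<lambda>A. A ** adj2 C"])
      show "(\<lambda>A. A ** C) \<in> {mat 1, - mat 1} \<inter> \<Gamma> \<rightarrow> ?S"
        using C neg by (auto simp: neg_matrix_mult moebius_uminus)
      show "(\<lambda>A. A ** adj2 C) \<in> ?S \<rightarrow> {mat 1, - mat 1} \<inter> \<Gamma>"
      proof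
        fix D assume D: "D \<in> ?S"
        have "D ** adj2 C \<in> \<Gamma>" using D C by (auto intro: Gamma_N_mult Gamma_N_adj2)
        moreover have "D ** adj2 C \<in> {mat 1, - mat 1}"
          using sub[OF D] adj2_mult(2)[OF Gamma_N_SL2Z[OF C(1)]] by (auto simp: neg_matrix_mult)
        ultimately show "D ** adj2 C \<in> {mat 1, - mat 1} \<inter> \<Gamma>" by blast
      qed
    qed (simp_all add: matrix_mul_assoc[symmetric] adj2_mult[OF Gamma_N_SL2Z[OF C(1)]])
    show ?case
      using bij_betw_finite[OF bij] bij_betw_same_card[OF bij] by (simp add: trivial_count_def)
  qed
qed

lemma fd_nn_count:
  "AE z in hyp. (\<integral>\<^sup>+C. indicator F (moebius C z) \<partial>count_space \<Gamma>) = ennreal (real (trivial_count N))"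
  using fd_count
proof eventually_elim
  case (elim z)
  have "(\<integral>\<^sup>+C. indicator F (moebius C z) \<partial>count_space \<Gamma>) = (\<integral>\<^sup>+C. indicator {C \<in> \<Gamma>. moebius C z \<in> F} C \<partial>count_space \<Gamma>)"
    by (rule nn_integral_cong) (auto simp: indicator_def)
  also have "\<dots> = emeasure (count_space \<Gamma>) {C \<in> \<Gamma>. moebius C z \<in> F}" by simp
  also have "\<dots> = ennreal (real (trivial_count N))"
    using elim by (subst emeasure_count_space_finite) (auto simp: ennreal_of_nat_eq_real_of_nat)
  finally show ?case .
qed

lemma bij_betw_adj2_Gamma: "bij_betw adj2 \<Gamma> \<Gamma>"
proof (rule bij_betwI[where g = adj2])
  have "adj2 (adj2 A) = A" for A :: "int ^ 2 ^ 2" by (rule matrix_2_eqI) (simp_all add: adj2_def)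
  then show "adj2 (adj2 A) = A" "adj2 (adj2 A) = A" for A by auto
qed (auto intro: Gamma_N_adj2)

text \<open>In the term of \<open>C\<close> the variable is changed by the inverse of
  \<open>C\<close>. This moves the group sum onto the indicator of \<open>F\<close>, where it is
  constant almost everywhere.\<close>

lemma unfold_nn_integral:
  assumes [measurable]: "h \<in> borel_measurable borel"
  shows "(\<integral>\<^sup>+z. indicator F z * (\<integral>\<^sup>+C. h (moebius C z) \<partial>count_space \<Gamma>) \<partial>hyp) = ennreal (real (trivial_count N)) * (\<integral>\<^sup>+z. h z \<partial>hyp)"
proof -
  have sw: "(\<integral>\<^sup>+z. indicator F z * h (moebius C z) \<partial>hyp) = (\<integral>\<^sup>+z. indicator F (moebius (adj2 C) z) * h z \<partial>hyp)" if C: "C \<in> \<Gamma>" for C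
  proof -
    note C' = Gamma_N_SL2Z[OF C]
    have "(\<integral>\<^sup>+z. indicator F z * h (moebius C z) \<partial>hyp) = (\<integral>\<^sup>+z. indicator F (moebius (adj2 C) z) * h (moebius C (moebius (adj2 C) z)) \<partial>hyp)"
      by (rule hyp_invariant_nn_integral[OF moebius_hyp_invariant[OF SL2Z_adj2[OF C']], symmetric]) measurable
    also have "\<dots> = (\<integral>\<^sup>+z. indicator F (moebius (adj2 C) z) * h z \<partial>hyp)"
      by (rule nn_integral_cong_AE) (use AE_hyp_upper in eventually_elim, simp add: moebius_adj2(2)[OF C'])
    finally show ?thesis .
  qed
  have "(\<integral>\<^sup>+z. indicator F z * (\<integral>\<^sup>+C. h (moebius C z) \<partial>count_space \<Gamma>) \<partial>hyp)
      = (\<integral>\<^sup>+z. (\<integral>\<^sup>+C. indicator F z * h (moebius C z) \<partial>count_space \<Gamma>) \<partial>hyp)"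
    by (simp add: nn_integral_cmult)
  also have "\<dots> = (\<integral>\<^sup>+C. (\<integral>\<^sup>+z. indicator F z * h (moebius C z) \<partial>hyp) \<partial>count_space \<Gamma>)"
    by (rule nn_integral_count_space_nn_integral[OF countable_matrices]) measurable
  also have "\<dots> = (\<integral>\<^sup>+C. (\<integral>\<^sup>+z. indicator F (moebius (adj2 C) z) * h z \<partial>hyp) \<partial>count_space \<Gamma>)"
    by (rule nn_integral_cong) (simp add: sw)
  also have "\<dots> = (\<integral>\<^sup>+C. (\<integral>\<^sup>+z. indicator F (moebius C z) * h z \<partial>hyp) \<partial>count_space \<Gamma>)"
    by (rule nn_integral_bij_count_space[OF bij_betw_adj2_Gamma])
  also have "\<dots> = (\<integral>\<^sup>+z. (\<integral>\<^sup>+C. indicator F (moebius C z) * h z \<partial>count_space \<Gamma>) \<partial>hyp)"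
    by (rule nn_integral_count_space_nn_integral[OF countable_matrices, symmetric]) measurable
  also have "\<dots> = (\<integral>\<^sup>+z. ennreal (real (trivial_count N)) * h z \<partial>hyp)"
    by (rule nn_integral_cong_AE) (use fd_nn_count in eventually_elim, simp add: nn_integral_multc)
  also have "\<dots> = ennreal (real (trivial_count N)) * (\<integral>\<^sup>+z. h z \<partial>hyp)"
    by (rule nn_integral_cmult) measurable
  finally show ?thesis .
qed

text \<open>Translates of the Siegel set cover the half-plane, so the orbit sum of \<open>h\<close>
  is at least 1 everywhere. Unfolding then bounds the area of \<open>F\<close> by finitely many
  copies of the area of the Siegel set, for any admissible shape of \<open>F\<close>.\<close>

lemma emeasure_hyp_fd_finite:
  assumes N: "N \<ge> 1"
  shows "emeasure hyp F < \<infinity>"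
proof -
  obtain R where R: "finite R" "R \<subseteq> SL2Z"
    "\<And>z. Im z > 0 \<Longrightarrow> \<exists>C \<in> \<Gamma>. \<exists>B \<in> R. \<exists>z0 \<in> siegel_set. z = moebius C (moebius B z0)"
    by (rule Gamma_N_decomposition[OF N]) (rule that)
  have sm[measurable]: "siegel_set \<in> sets borel" unfolding siegel_set_def by measurable
  define h :: "complex \<Rightarrow> ennreal" where "h z = (\<Sum>B\<in>R. indicator siegel_set (moebius (adj2 B) z))" for z
  have hm[measurable]: "h \<in> borel_measurable borel" unfolding h_def by measurable
  have "1 \<le> (\<integral>\<^sup>+C. h (moebius C z) \<partial>count_space \<Gamma>)" if z: "Im z > 0" for z
  proof -
    obtain C B z0 where d: "C \<in> \<Gamma>" "B \<in> R" "z0 \<in> siegel_set" "z = moebius C (moebius B z0)"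
      using R(3)[OF z] by blast
    have z0: "Im z0 > 0" using d(3) by (simp add: siegel_set_def)
    have B: "B \<in> SL2Z" using d R by auto
    have "moebius (adj2 B) (moebius (adj2 C) z) = z0"
      unfolding d(4) moebius_adj2(1)[OF Gamma_N_SL2Z[OF d(1)] Im_moebius_pos[OF B z0]] by (rule moebius_adj2(1)[OF B z0])
    then have "1 = (indicator siegel_set (moebius (adj2 B) (moebius (adj2 C) z)) :: ennreal)" using d(3) by simp
    also have "\<dots> \<le> h (moebius (adj2 C) z)"
      unfolding h_def by (rule member_le_sum[OF d(2)]) (use R(1) in auto)
    also have "\<dots> \<le> (\<integral>\<^sup>+C. h (moebius C z) \<partial>count_space \<Gamma>)"
      by (rule nn_integral_ge_point) (use Gamma_N_adj2[OF d(1)] in auto)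
    finally show ?thesis .
  qed
  then have "(\<integral>\<^sup>+z. indicator F z \<partial>hyp) \<le> (\<integral>\<^sup>+z. indicator F z * (\<integral>\<^sup>+C. h (moebius C z) \<partial>count_space \<Gamma>) \<partial>hyp)"
    by (intro nn_integral_mono) (auto simp: indicator_def fd_upper)
  also have "\<dots> = ennreal (real (trivial_count N)) * (\<integral>\<^sup>+z. h z \<partial>hyp)" by (rule unfold_nn_integral[OF hm])
  also have "(\<integral>\<^sup>+z. h z \<partial>hyp) = (\<Sum>B\<in>R. \<integral>\<^sup>+z. indicator siegel_set (moebius (adj2 B) z) \<partial>hyp)"
    unfolding h_def by (rule nn_integral_sum) measurable
  also have "\<dots> = (\<Sum>B\<in>R. emeasure hyp siegel_set)"
  proof (rule sum.cong[OF refl])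
    fix B assume "B \<in> R"
    then have B: "adj2 B \<in> SL2Z" using R by (auto intro: SL2Z_adj2)
    show "(\<integral>\<^sup>+z. indicator siegel_set (moebius (adj2 B) z) \<partial>hyp) = emeasure hyp siegel_set"
      using hyp_invariant_nn_integral[OF moebius_hyp_invariant[OF B], of "indicator siegel_set"] by simp
  qed
  also have "ennreal (real (trivial_count N)) * \<dots> < \<infinity>"
    using emeasure_hyp_strip_finite by (simp add: siegel_set_def ennreal_mult_less_top of_nat_less_top)
  finally show ?thesis by simp
qed

text \<open>\<open>B\<close> plays the role of a fundamental domain for the stabilizer of
  \<open>y\<close>: for each \<open>z\<close> the elements \<open>C\<close> with \<open>C z\<close>
  in \<open>B\<close> enumerate the orbit of \<open>y\<close> once. Summing over the orbit and
  integrating over \<open>F\<close> amounts, up to the number of trivially acting elements, to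
  integrating \<open>\<phi> y\<close> over \<open>B\<close>. In absolute values this yields
  integrability over \<open>B\<close>.\<close>

lemma orbit_unfold:
  fixes \<phi> :: "'x \<Rightarrow> complex \<Rightarrow> complex" and xa :: "'x \<Rightarrow> int ^ 2 ^ 2 \<Rightarrow> 'x"
  assumes Om: "\<phi> y \<in> borel_measurable borel"
    and B[measurable]: "B \<in> sets borel"
    and bij: "\<And>z. Im z > 0 \<Longrightarrow> bij_betw (xa y) {C \<in> \<Gamma>. moebius C z \<in> B} Ob"
    and equiv: "\<And>C z. C \<in> \<Gamma> \<Longrightarrow> Im z > 0 \<Longrightarrow> \<phi> y (moebius C z) = \<phi> (xa y C) z"
    and fin: "(\<integral>\<^sup>+z. indicator F z * (\<integral>\<^sup>+x. ennreal (norm (\<phi> x z)) \<partial>count_space Ob) \<partial>hyp) < \<infinity>"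
  shows "integrable hyp (\<lambda>z. indicator B z *\<^sub>R \<phi> y z)"
    and "(\<integral>\<^sup>+z. indicator F z * (\<integral>\<^sup>+C. ennreal (norm (indicator B (moebius C z) *\<^sub>R \<phi> y (moebius C z))) \<partial>count_space \<Gamma>) \<partial>hyp)
      = (\<integral>\<^sup>+z. indicator F z * (\<integral>\<^sup>+x. ennreal (norm (\<phi> x z)) \<partial>count_space Ob) \<partial>hyp)"
    and "ennreal (real (trivial_count N)) * (\<integral>\<^sup>+z. ennreal (norm (indicator B z *\<^sub>R \<phi> y z)) \<partial>hyp) < \<infinity>"
proof -
  have [measurable]: "\<phi> y \<in> borel_measurable borel" by (rule Om)
  define h where "h z = indicator B z *\<^sub>R \<phi> y z" for z
  have hm[measurable]: "h \<in> borel_measurable borel" unfolding h_def by measurable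
  have nn: "(\<integral>\<^sup>+C. ennreal (norm (h (moebius C z))) \<partial>count_space \<Gamma>) = (\<integral>\<^sup>+x. ennreal (norm (\<phi> x z)) \<partial>count_space Ob)"
    if z: "Im z > 0" for z
  proof -
    have "(\<integral>\<^sup>+C. ennreal (norm (h (moebius C z))) \<partial>count_space \<Gamma>)
        = (\<integral>\<^sup>+C. ennreal (norm (\<phi> (xa y C) z)) * indicator {C \<in> \<Gamma>. moebius C z \<in> B} C \<partial>count_space \<Gamma>)"
      by (rule nn_integral_cong) (auto simp: h_def indicator_def equiv z)
    also have "\<dots> = (\<integral>\<^sup>+C. ennreal (norm (\<phi> (xa y C) z)) \<partial>count_space {C \<in> \<Gamma>. moebius C z \<in> B})"
      by (subst nn_integral_restrict_space[symmetric]) (auto simp: restrict_count_space_subset[of _ \<Gamma>] intro!: arg_cong2[where f = nn_integral])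
    also have "\<dots> = (\<integral>\<^sup>+x. ennreal (norm (\<phi> x z)) \<partial>count_space Ob)"
      by (rule nn_integral_bij_count_space[OF bij[OF z]])
    finally show ?thesis .
  qed
  have "ennreal (real (trivial_count N)) * (\<integral>\<^sup>+z. ennreal (norm (h z)) \<partial>hyp)
     = (\<integral>\<^sup>+z. indicator F z * (\<integral>\<^sup>+C. ennreal (norm (h (moebius C z))) \<partial>count_space \<Gamma>) \<partial>hyp)"
    by (rule unfold_nn_integral[symmetric]) measurable
  also have e: "\<dots> = (\<integral>\<^sup>+z. indicator F z * (\<integral>\<^sup>+x. ennreal (norm (\<phi> x z)) \<partial>count_space Ob) \<partial>hyp)"
    by (rule nn_integral_cong) (auto simp: indicator_def fd_upper nn)
  finally have c: "ennreal (real (trivial_count N)) * (\<integral>\<^sup>+z. ennreal (norm (h z)) \<partial>hyp) < \<infinity>" using fin by simp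
  have c1: "1 \<le> ennreal (real (trivial_count N))" using trivial_count_pos[of N] by simp
  have "(\<integral>\<^sup>+z. ennreal (norm (h z)) \<partial>hyp) < \<infinity>"
    using mult_right_mono[OF c1, of "\<integral>\<^sup>+z. ennreal (norm (h z)) \<partial>hyp"] c by (auto intro: le_less_trans)
  then have hI: "integrable hyp h" by (simp add: integrable_iff_bounded cong: measurable_cong_sets)
  show "integrable hyp (\<lambda>z. indicator B z *\<^sub>R \<phi> y z)" using hI by (simp add: h_def[abs_def])
  show "(\<integral>\<^sup>+z. indicator F z * (\<integral>\<^sup>+C. ennreal (norm (indicator B (moebius C z) *\<^sub>R \<phi> y (moebius C z))) \<partial>count_space \<Gamma>) \<partial>hyp)
      = (\<integral>\<^sup>+z. indicator F z * (\<integral>\<^sup>+x. ennreal (norm (\<phi> x z)) \<partial>count_space Ob) \<partial>hyp)"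
    using e by (simp add: h_def)
  show "ennreal (real (trivial_count N)) * (\<integral>\<^sup>+z. ennreal (norm (indicator B z *\<^sub>R \<phi> y z)) \<partial>hyp) < \<infinity>"
    using c by (simp add: h_def)
qed

text \<open>The signed counterpart: the orbit sum of the integrals over \<open>F\<close> is a
  multiple of the integral over \<open>B\<close>. The assumption \<open>zero\<close> may presuppose
  integrability, since the absolute version supplies it.\<close>

lemma orbit_integral_zero:
  fixes \<phi> :: "'x \<Rightarrow> complex \<Rightarrow> complex" and xa :: "'x \<Rightarrow> int ^ 2 ^ 2 \<Rightarrow> 'x"
  assumes Om: "\<And>x. x \<in> Ob \<Longrightarrow> \<phi> x \<in> borel_measurable borel"
    and x0: "x0 \<in> Ob" and B[measurable]: "B \<in> sets borel"
    and bij: "\<And>z. Im z > 0 \<Longrightarrow> bij_betw (xa x0) {C \<in> \<Gamma>. moebius C z \<in> B} Ob"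
    and equiv: "\<And>C z. C \<in> \<Gamma> \<Longrightarrow> Im z > 0 \<Longrightarrow> \<phi> x0 (moebius C z) = \<phi> (xa x0 C) z"
    and cO: "countable Ob"
    and fin: "(\<integral>\<^sup>+z. indicator F z * (\<integral>\<^sup>+x. ennreal (norm (\<phi> x z)) \<partial>count_space Ob) \<partial>hyp) < \<infinity>"
    and zero: "integrable hyp (\<lambda>z. indicator B z *\<^sub>R \<phi> x0 z) \<Longrightarrow> (\<integral>z. indicator B z *\<^sub>R \<phi> x0 z \<partial>hyp) = 0"
  shows "(\<Sum>\<^sub>\<infinity>x\<in>Ob. \<integral>z. indicator F z *\<^sub>R \<phi> x z \<partial>hyp) = 0"
proof -
  have [measurable]: "\<phi> x0 \<in> borel_measurable borel" by (rule Om[OF x0])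
  define h where "h z = indicator B z *\<^sub>R \<phi> x0 z" for z
  have hm[measurable]: "h \<in> borel_measurable borel" unfolding h_def by measurable
  have hI: "integrable hyp h"
    unfolding h_def[abs_def] by (rule orbit_unfold(1)[where \<phi> = \<phi> and y = x0 and xa = xa and B = B and Ob = Ob, OF Om[OF x0] B bij equiv fin])
  have e: "(\<integral>\<^sup>+z. indicator F z * (\<integral>\<^sup>+C. ennreal (norm (h (moebius C z))) \<partial>count_space \<Gamma>) \<partial>hyp)
      = (\<integral>\<^sup>+z. indicator F z * (\<integral>\<^sup>+x. ennreal (norm (\<phi> x z)) \<partial>count_space Ob) \<partial>hyp)"
    unfolding h_def by (rule orbit_unfold(2)[where \<phi> = \<phi> and y = x0 and xa = xa and B = B and Ob = Ob, OF Om[OF x0] B bij equiv fin])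
  have c: "ennreal (real (trivial_count N)) * (\<integral>\<^sup>+z. ennreal (norm (h z)) \<partial>hyp) < \<infinity>"
    unfolding h_def by (rule orbit_unfold(3)[where \<phi> = \<phi> and y = x0 and xa = xa and B = B and Ob = Ob, OF Om[OF x0] B bij equiv fin])
  have h0: "integral\<^sup>L hyp h = 0" using zero[folded h_def, OF hI] .
  have cong: "borel_measurable hyp = borel_measurable borel" by (rule measurable_cong_sets) auto
  define \<psi> where "\<psi> C z = indicator F z *\<^sub>R h (moebius C z)" for C z
  have f1: "(\<integral>\<^sup>+z. (\<integral>\<^sup>+C. ennreal (norm (\<psi> C z)) \<partial>count_space \<Gamma>) \<partial>hyp) < \<infinity>"
  proof -
    have "(\<integral>\<^sup>+z. (\<integral>\<^sup>+C. ennreal (norm (\<psi> C z)) \<partial>count_space \<Gamma>) \<partial>hyp)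
      = (\<integral>\<^sup>+z. indicator F z * (\<integral>\<^sup>+C. ennreal (norm (h (moebius C z))) \<partial>count_space \<Gamma>) \<partial>hyp)"
      by (rule nn_integral_cong) (auto simp: \<psi>_def indicator_def)
    then show ?thesis using e fin by simp
  qed
  have \<psi>m: "\<psi> C \<in> borel_measurable hyp" for C unfolding \<psi>_def cong by measurable
  have f2: "(\<integral>\<^sup>+z. (\<integral>\<^sup>+x. ennreal (norm (indicator F z *\<^sub>R \<phi> x z)) \<partial>count_space Ob) \<partial>hyp) < \<infinity>"
  proof -
    have "(\<integral>\<^sup>+z. (\<integral>\<^sup>+x. ennreal (norm (indicator F z *\<^sub>R \<phi> x z)) \<partial>count_space Ob) \<partial>hyp)
      = (\<integral>\<^sup>+z. indicator F z * (\<integral>\<^sup>+x. ennreal (norm (\<phi> x z)) \<partial>count_space Ob) \<partial>hyp)"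
      by (rule nn_integral_cong) (auto simp: indicator_def)
    then show ?thesis using fin by simp
  qed
  have \<phi>m: "(\<lambda>z. indicator F z *\<^sub>R \<phi> x z) \<in> borel_measurable hyp" if "x \<in> Ob" for x
    unfolding cong using Om[OF that] by measurable
  have "(\<Sum>\<^sub>\<infinity>x\<in>Ob. \<integral>z. indicator F z *\<^sub>R \<phi> x z \<partial>hyp) = (\<integral>z. (\<Sum>\<^sub>\<infinity>x\<in>Ob. indicator F z *\<^sub>R \<phi> x z) \<partial>hyp)"
    by (rule integral_infsum_fubini[OF sigma_finite_hyp cO \<phi>m f2, symmetric])
  also have "\<dots> = (\<integral>z. (\<Sum>\<^sub>\<infinity>C\<in>\<Gamma>. \<psi> C z) \<partial>hyp)"
  proof (rule Bochner_Integration.integral_cong[OF refl])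
    fix z
    show "(\<Sum>\<^sub>\<infinity>x\<in>Ob. indicator F z *\<^sub>R \<phi> x z) = (\<Sum>\<^sub>\<infinity>C\<in>\<Gamma>. \<psi> C z)"
    proof (cases "z \<in> F")
      case True
      then have z: "Im z > 0" by (rule fd_upper)
      have "(\<Sum>\<^sub>\<infinity>x\<in>Ob. \<phi> x z) = (\<Sum>\<^sub>\<infinity>C\<in>{C \<in> \<Gamma>. moebius C z \<in> B}. \<phi> (xa x0 C) z)"
        by (rule infsum_reindex_bij_betw[OF bij[OF z], symmetric])
      also have "\<dots> = (\<Sum>\<^sub>\<infinity>C\<in>\<Gamma>. h (moebius C z))"
        by (rule infsum_cong_neutral) (auto simp: h_def equiv z)
      finally show ?thesis using True by (simp add: \<psi>_def)
    qed (simp add: \<psi>_def)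
  qed
  also have "\<dots> = (\<Sum>\<^sub>\<infinity>C\<in>\<Gamma>. integral\<^sup>L hyp (\<psi> C))"
    by (rule integral_infsum_fubini[OF sigma_finite_hyp countable_matrices \<psi>m f1])
  also have "\<dots> = (\<Sum>\<^sub>\<infinity>C\<in>\<Gamma>. \<integral>z. indicator F (moebius (adj2 C) z) *\<^sub>R h z \<partial>hyp)"
  proof (rule infsum_cong)
    fix C assume C: "C \<in> \<Gamma>"
    note C' = Gamma_N_SL2Z[OF C]
    have "integral\<^sup>L hyp (\<psi> C) = (\<integral>z. \<psi> C (moebius (adj2 C) z) \<partial>hyp)"
      by (rule hyp_invariant_integral(1)[OF moebius_hyp_invariant[OF SL2Z_adj2[OF C']], symmetric]) (use \<psi>m cong in auto)
    also have "\<dots> = (\<integral>z. indicator F (moebius (adj2 C) z) *\<^sub>R h z \<partial>hyp)"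
    proof (rule integral_cong_AE)
      show "AE z in hyp. \<psi> C (moebius (adj2 C) z) = indicator F (moebius (adj2 C) z) *\<^sub>R h z"
        using AE_hyp_upper by eventually_elim (simp add: \<psi>_def moebius_adj2(2)[OF C'])
    qed (auto simp: cong \<psi>_def)
    finally show "integral\<^sup>L hyp (\<psi> C) = (\<integral>z. indicator F (moebius (adj2 C) z) *\<^sub>R h z \<partial>hyp)" .
  qed
  also have "\<dots> = (\<Sum>\<^sub>\<infinity>C\<in>\<Gamma>. \<integral>z. indicator F (moebius C z) *\<^sub>R h z \<partial>hyp)"
    by (rule infsum_reindex_bij_betw[OF bij_betw_adj2_Gamma])
  also have "\<dots> = (\<integral>z. (\<Sum>\<^sub>\<infinity>C\<in>\<Gamma>. indicator F (moebius C z) *\<^sub>R h z) \<partial>hyp)"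
  proof (rule integral_infsum_fubini[OF sigma_finite_hyp countable_matrices, symmetric])
    show "(\<lambda>z. indicator F (moebius C z) *\<^sub>R h z) \<in> borel_measurable hyp" for C unfolding cong by measurable
    have "(\<integral>\<^sup>+z. (\<integral>\<^sup>+C. ennreal (norm (indicator F (moebius C z) *\<^sub>R h z)) \<partial>count_space \<Gamma>) \<partial>hyp)
      = (\<integral>\<^sup>+z. ennreal (real (trivial_count N)) * ennreal (norm (h z)) \<partial>hyp)"
    proof (rule nn_integral_cong_AE)
      show "AE z in hyp. (\<integral>\<^sup>+C. ennreal (norm (indicator F (moebius C z) *\<^sub>R h z)) \<partial>count_space \<Gamma>)
          = ennreal (real (trivial_count N)) * ennreal (norm (h z))"
        using fd_nn_count
      proof eventually_elim
        case (elim z)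
        have "(\<integral>\<^sup>+C. ennreal (norm (indicator F (moebius C z) *\<^sub>R h z)) \<partial>count_space \<Gamma>)
          = (\<integral>\<^sup>+C. indicator F (moebius C z) * ennreal (norm (h z)) \<partial>count_space \<Gamma>)"
          by (rule nn_integral_cong) (auto simp: indicator_def)
        then show ?case using elim by (simp add: nn_integral_multc)
      qed
    qed
    also have "\<dots> = ennreal (real (trivial_count N)) * (\<integral>\<^sup>+z. ennreal (norm (h z)) \<partial>hyp)"
      by (rule nn_integral_cmult) (simp add: cong)
    finally show "(\<integral>\<^sup>+z. (\<integral>\<^sup>+C. ennreal (norm (indicator F (moebius C z) *\<^sub>R h z)) \<partial>count_space \<Gamma>) \<partial>hyp) < \<infinity>"
      using c by simp
  qed
  also have "\<dots> = (\<integral>z. of_nat (trivial_count N) * h z \<partial>hyp)"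
  proof (rule integral_cong_AE)
    show ae: "AE z in hyp. (\<Sum>\<^sub>\<infinity>C\<in>\<Gamma>. indicator F (moebius C z) *\<^sub>R h z) = of_nat (trivial_count N) * h z"
      using fd_count
    proof eventually_elim
      case (elim z)
      let ?S = "{C \<in> \<Gamma>. moebius C z \<in> F}"
      have "(\<Sum>\<^sub>\<infinity>C\<in>\<Gamma>. indicator F (moebius C z) *\<^sub>R h z) = (\<Sum>\<^sub>\<infinity>C\<in>?S. h z)"
        by (rule infsum_cong_neutral) auto
      also have "\<dots> = of_nat (trivial_count N) * h z" using elim by simp
      finally show ?case .
    qed
    show "(\<lambda>z. of_nat (trivial_count N) * h z) \<in> borel_measurable hyp" by (simp add: cong)
    show "(\<lambda>z. \<Sum>\<^sub>\<infinity>C\<in>\<Gamma>. indicator F (moebius C z) *\<^sub>R h z) \<in> borel_measurable hyp"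
    proof -
      interpret sigma_finite_measure "count_space \<Gamma>"
        by (rule sigma_finite_measure_count_space_countable[OF countable_matrices])
      interpret P: pair_sigma_finite "count_space \<Gamma>" "lborel :: complex measure" by unfold_locales
      have "(\<lambda>(C, z). indicator F (moebius C z) *\<^sub>R h z) \<in> borel_measurable (count_space \<Gamma> \<Otimes>\<^sub>M borel)"
        by (rule measurable_pair_measure_countable1[OF countable_matrices]) simp
      then have "(\<lambda>(z, C). indicator F (moebius C z) *\<^sub>R h z) \<in> borel_measurable (borel \<Otimes>\<^sub>M count_space \<Gamma>)"
        by (subst measurable_pair_swap_iff) (simp add: case_prod_unfold)
      from borel_measurable_lebesgue_integral[OF this] show ?thesis
        unfolding infsum_eq_integral_count_space cong by simp
    qed
  qed
  also have "\<dots> = 0" using h0 by simp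
  finally show "(\<Sum>\<^sub>\<infinity>x\<in>Ob. \<integral>z. indicator F z *\<^sub>R \<phi> x z \<partial>hyp) = 0" .
qed

text \<open>Orbits partition \<open>X\<close>, and absolute convergence allows the sum over
  \<open>X\<close> to be grouped by orbits.\<close>

lemma total_integral_zero:
  fixes \<phi> :: "'x \<Rightarrow> complex \<Rightarrow> complex" and xa :: "'x \<Rightarrow> int ^ 2 ^ 2 \<Rightarrow> 'x"
  assumes cX: "countable X"
    and m: "\<And>x. x \<in> X \<Longrightarrow> \<phi> x \<in> borel_measurable borel"
    and xa: "\<And>x C. x \<in> X \<Longrightarrow> C \<in> \<Gamma> \<Longrightarrow> xa x C \<in> X" "\<And>x. xa x (mat 1) = x"
      "\<And>x C D. xa x (C ** D) = xa (xa x C) D"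
    and fin: "(\<integral>\<^sup>+z. indicator F z * (\<integral>\<^sup>+x. ennreal (norm (\<phi> x z)) \<partial>count_space X) \<partial>hyp) < \<infinity>"
    and orb: "\<And>x. x \<in> X \<Longrightarrow> (\<Sum>\<^sub>\<infinity>y\<in>xa x ` \<Gamma>. \<integral>z. indicator F z *\<^sub>R \<phi> y z \<partial>hyp) = 0"
  shows "(\<integral>z. indicator F z *\<^sub>R (\<Sum>\<^sub>\<infinity>x\<in>X. \<phi> x z) \<partial>hyp) = 0"
proof -
  define c where "c x = (\<integral>z. indicator F z *\<^sub>R \<phi> x z \<partial>hyp)" for x
  have cong: "borel_measurable hyp = borel_measurable borel" by (rule measurable_cong_sets) auto
  have fin': "(\<integral>\<^sup>+z. (\<integral>\<^sup>+x. ennreal (norm (indicator F z *\<^sub>R \<phi> x z)) \<partial>count_space X) \<partial>hyp) < \<infinity>"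
  proof -
    have "(\<integral>\<^sup>+z. (\<integral>\<^sup>+x. ennreal (norm (indicator F z *\<^sub>R \<phi> x z)) \<partial>count_space X) \<partial>hyp)
      = (\<integral>\<^sup>+z. indicator F z * (\<integral>\<^sup>+x. ennreal (norm (\<phi> x z)) \<partial>count_space X) \<partial>hyp)"
      by (rule nn_integral_cong) (auto simp: indicator_def)
    then show ?thesis using fin by simp
  qed
  have m': "(\<lambda>z. indicator F z *\<^sub>R \<phi> x z) \<in> borel_measurable hyp" if "x \<in> X" for x
    unfolding cong using m[OF that] by measurable
  note fub = integral_infsum_fubini[OF sigma_finite_hyp cX m' fin'] abs_summable_integrals_fubini[OF sigma_finite_hyp cX m' fin']
  have cs: "c summable_on X" unfolding c_def by (rule abs_summable_summable[OF fub(2)])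
  define Q where "Q = (\<lambda>x. xa x ` \<Gamma>) ` X"
  have inv: "x \<in> xa y ` \<Gamma>" if y: "y \<in> xa x ` \<Gamma>" for x y
  proof -
    obtain C where C: "C \<in> \<Gamma>" "y = xa x C" using y by blast
    have "xa y (adj2 C) = x" unfolding C(2) xa(3)[symmetric] adj2_mult[OF Gamma_N_SL2Z[OF C(1)]] by (rule xa(2))
    then show ?thesis using Gamma_N_adj2[OF C(1)] by (metis imageI)
  qed
  have tr: "z \<in> xa x ` \<Gamma>" if "y \<in> xa x ` \<Gamma>" "z \<in> xa y ` \<Gamma>" for x y z
    using that by (auto simp: xa(3)[symmetric] intro!: imageI Gamma_N_mult)
  have self: "x \<in> xa x ` \<Gamma>" for x using xa(2)[of x] Gamma_N_one by (metis imageI)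
  \<comment> \<open>The pairs consist of an orbit and one of its members. Every element of
    \<open>X\<close> lies in exactly one orbit, so the second projection is a bijection.\<close>
  have bij: "bij_betw snd (Sigma Q (\<lambda>Ob. Ob)) X"
  proof (rule bij_betw_imageI)
    show "inj_on snd (Sigma Q (\<lambda>Ob. Ob))"
    proof (rule inj_onI)
      fix p q assume p: "p \<in> Sigma Q (\<lambda>Ob. Ob)" and q: "q \<in> Sigma Q (\<lambda>Ob. Ob)" and e: "snd p = snd q"
      obtain x y where xy: "fst p = xa x ` \<Gamma>" "fst q = xa y ` \<Gamma>" using p q by (auto simp: Q_def)
      have s: "snd p \<in> xa x ` \<Gamma>" "snd p \<in> xa y ` \<Gamma>" using p q e xy by auto
      have "xa x ` \<Gamma> = xa y ` \<Gamma>" using tr inv s by (meson set_eqI)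
      then show "p = q" using e xy by (simp add: prod_eq_iff)
    qed
    show "snd ` Sigma Q (\<lambda>Ob. Ob) = X"
    proof (intro set_eqI iffI)
      fix x assume "x \<in> X"
      then have "(xa x ` \<Gamma>, x) \<in> Sigma Q (\<lambda>Ob. Ob)" using self by (auto simp: Q_def)
      then show "x \<in> snd ` Sigma Q (\<lambda>Ob. Ob)" by force
    qed (auto simp: Q_def xa(1))
  qed
  have "(\<Sum>\<^sub>\<infinity>x\<in>X. c x) = (\<Sum>\<^sub>\<infinity>p\<in>Sigma Q (\<lambda>Ob. Ob). c (snd p))"
    by (rule infsum_reindex_bij_betw[OF bij, symmetric])
  also have "\<dots> = (\<Sum>\<^sub>\<infinity>Ob\<in>Q. \<Sum>\<^sub>\<infinity>x\<in>Ob. c x)"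
    using infsum_Sigma_banach[of "\<lambda>p. c (snd p)" Q "\<lambda>Ob. Ob"] summable_on_reindex_bij_betw[OF bij, of c] cs by simp
  also have "\<dots> = (\<Sum>\<^sub>\<infinity>Ob\<in>Q. 0)"
    by (rule infsum_cong) (auto simp: Q_def c_def orb)
  finally have "(\<Sum>\<^sub>\<infinity>x\<in>X. c x) = 0" by simp
  then have z: "(\<integral>z. (\<Sum>\<^sub>\<infinity>x\<in>X. indicator F z *\<^sub>R \<phi> x z) \<partial>hyp) = 0" using fub(1) by (simp add: c_def)
  have "(\<Sum>\<^sub>\<infinity>x\<in>X. indicator F z *\<^sub>R \<phi> x z) = indicator F z *\<^sub>R (\<Sum>\<^sub>\<infinity>x\<in>X. \<phi> x z)" for z
    by (cases "z \<in> F") auto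
  then show ?thesis using z by simp
qed

end

section \<open>Primitives of cusp forms\<close>

text \<open>
  The nontangential limit at \<open>\<infinity>\<close>.
\<close>

definition nt_lim :: "(complex \<Rightarrow> complex) \<Rightarrow> complex \<Rightarrow> bool" where
  "nt_lim Q L \<longleftrightarrow> (\<forall>K e. e > 0 \<longrightarrow> (\<exists>Y. \<forall>z. Im z \<ge> Y \<and> \<bar>Re z\<bar> \<le> K * Im z \<longrightarrow> norm (Q z - L) < e))"

text \<open>In a cone \<open>|Re z| \<le> K * Im z\<close> half of the exponential decay absorbs the
  polynomial factor. The values of \<open>Q\<close> along the imaginary axis therefore form a Cauchy
  sequence, and any other point of the cone is compared with an axis point of nearly the same
  height.\<close>

lemma nt_lim_exists:
  assumes Q: "\<And>z. Im z > 0 \<Longrightarrow> (Q has_field_derivative Q' z) (at z)"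
    and c: "c > 0" and C: "C \<ge> 0"
    and bd: "\<And>z. Im z \<ge> 1 / 2 \<Longrightarrow> norm (Q' z) \<le> C * exp (- c * Im z) * (1 + cmod z) ^ w"
  obtains L where "nt_lim Q L"
proof -
  define M where "M K = C * (real (Suc w) ^ Suc w * (2 * (K + 2) / c) ^ Suc w)" for K
  have M: "norm (Q' z) \<le> M K * exp (- (c / 2) * Im z)" if z: "Im z \<ge> 1" "\<bar>Re z\<bar> \<le> K * Im z" "K \<ge> 0" for z K
  proof -
    have "1 + cmod z \<le> 1 + (\<bar>Re z\<bar> + \<bar>Im z\<bar>)" using cmod_le[of z] by simp
    also have "\<dots> \<le> (K + 2) * Im z" using z by (simp add: algebra_simps)
    finally have le: "1 + cmod z \<le> (K + 2) * Im z" .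
    have "(1 + cmod z) ^ w \<le> (1 + cmod z) ^ Suc w" by (intro power_increasing) auto
    also have "\<dots> \<le> ((K + 2) * Im z) ^ Suc w" by (intro power_mono le) auto
    also have "(K + 2) * Im z = (2 * (K + 2) / c) * (c / 2 * Im z)" using c by simp
    also have "((2 * (K + 2) / c) * (c / 2 * Im z)) ^ Suc w = (2 * (K + 2) / c) ^ Suc w * (c / 2 * Im z) ^ Suc w"
      by (rule power_mult_distrib)
    also have "\<dots> \<le> (2 * (K + 2) / c) ^ Suc w * (real (Suc w) ^ Suc w * exp (c / 2 * Im z))"
      using c z by (intro mult_left_mono power_le_power_exp) auto
    finally have p: "(1 + cmod z) ^ w \<le> (2 * (K + 2) / c) ^ Suc w * (real (Suc w) ^ Suc w * exp (c / 2 * Im z))" .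
    have "norm (Q' z) \<le> C * exp (- c * Im z) * (1 + cmod z) ^ w" using z by (intro bd) auto
    also have "\<dots> \<le> C * exp (- c * Im z) * ((2 * (K + 2) / c) ^ Suc w * (real (Suc w) ^ Suc w * exp (c / 2 * Im z)))"
      using C by (intro mult_left_mono p) auto
    also have "\<dots> = M K * (exp (- c * Im z) * exp (c / 2 * Im z))" by (simp add: M_def mult_ac)
    also have "exp (- c * Im z) * exp (c / 2 * Im z) = exp (- (c / 2) * Im z)" by (simp add: mult_exp_exp)
    finally show ?thesis .
  qed
  have M0: "M K \<ge> 0" if "K \<ge> 0" for K using that C c by (simp add: M_def)
  have lip: "norm (Q z - Q z') \<le> M K * exp (- (c / 2) * y) * norm (z - z')"
    if y: "y \<ge> 1" "K \<ge> 0" and z: "Im z \<ge> y" "\<bar>Re z\<bar> \<le> K * y" and z': "Im z' \<ge> y" "\<bar>Re z'\<bar> \<le> K * y" for z z' y K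
  proof (rule field_differentiable_bound[where S = "{x. Im x \<ge> y} \<inter> {x. Re x \<le> K * y} \<inter> {x. Re x \<ge> - (K * y)}" and f' = Q'])
    show "convex ({x. Im x \<ge> y} \<inter> {x. Re x \<le> K * y} \<inter> {x. Re x \<ge> - (K * y)})"
      by (intro convex_Int convex_halfspace_Im_ge convex_halfspace_Re_le convex_halfspace_Re_ge)
    fix x assume x: "x \<in> {x. Im x \<ge> y} \<inter> {x. Re x \<le> K * y} \<inter> {x. Re x \<ge> - (K * y)}"
    then have "Im x > 0" using y by auto
    then show "(Q has_field_derivative Q' x) (at x within {x. Im x \<ge> y} \<inter> {x. Re x \<le> K * y} \<inter> {x. Re x \<ge> - (K * y)})"
      by (rule has_field_derivative_at_within[OF Q])
    have "K * y \<le> K * Im x" using x y by (intro mult_left_mono) auto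
    then have "\<bar>Re x\<bar> \<le> K * Im x" using x by auto
    then have "norm (Q' x) \<le> M K * exp (- (c / 2) * Im x)" by (intro M) (use x y in auto)
    also have "\<dots> \<le> M K * exp (- (c / 2) * y)" using x c M0[OF y(2)] by (intro mult_left_mono) auto
    finally show "norm (Q' x) \<le> M K * exp (- (c / 2) * y)" .
  qed (use z z' in auto)
  define S where "S n = Q (Complex 0 (real n + 1))" for n
  have "convergent S"
  proof -
    have d: "norm (S (Suc n) - S n) \<le> M 0 * exp (- (c / 2)) ^ (n + 1)" for n
    proof -
      have "norm (S (Suc n) - S n) \<le> M 0 * exp (- (c / 2) * (real n + 1)) * norm (Complex 0 (real (Suc n) + 1) - Complex 0 (real n + 1))"
        unfolding S_def by (rule lip) auto
      also have "Complex 0 (real (Suc n) + 1) - Complex 0 (real n + 1) = \<i>" by (simp add: complex_eq_iff)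
      also have "exp (- (c / 2) * (real n + 1)) = exp (- (c / 2)) ^ (n + 1)"
        by (subst exp_of_nat_mult[symmetric]) (simp add: mult.commute)
      finally show ?thesis by simp
    qed
    have "summable (\<lambda>n. exp (- (c / 2)) ^ n)" by (rule summable_geometric) (use c in auto)
    then have "summable (\<lambda>n. M 0 * exp (- (c / 2)) ^ (n + 1))"
      by (intro summable_mult) (simp add: summable_Suc_iff)
    then have "summable (\<lambda>n. S (Suc n) - S n)"
      by (rule summable_comparison_test'[where N = 0]) (rule d)
    then have "convergent (\<lambda>n. \<Sum>k<n. S (Suc k) - S k)" by (simp add: summable_iff_convergent)
    then have "convergent (\<lambda>n. S n - S 0)" by (simp add: sum_lessThan_telescope)
    then show ?thesis using convergent_add[OF _ convergent_const[of "S 0"]] by force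
  qed
  then obtain L where L: "S \<longlonglongrightarrow> L" by (auto simp: convergent_def)
  have "nt_lim Q L"
    unfolding nt_lim_def
  proof (intro allI impI)
    fix K e :: real assume e: "e > 0"
    define K' where "K' = max K 0"
    have K': "K' \<ge> 0" "K \<le> K'" by (auto simp: K'_def)
    \<comment> \<open>Bounds the difference to the value at the axis point of height
      \<open>n + 1\<close>, which lies between \<open>Im z - 1\<close> and \<open>Im z\<close>:
      hence \<open>y - 1\<close> in the exponent. Since \<open>Im z \<le> 2 * (n + 1)\<close>, the
      box at height \<open>n + 1\<close> needs the doubled slope \<open>2 * K'\<close>.\<close>
    define g where "g y = M (2 * K') * exp (- (c / 2) * (y - 1)) * (1 + K' * y)" for y
    have "(g \<longlongrightarrow> 0) at_top" unfolding g_def using c by real_asymp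
    then have "eventually (\<lambda>y. g y < e / 2) at_top" using e by (intro order_tendstoD(2)) auto
    then obtain Y1 where Y1: "\<And>y. y \<ge> Y1 \<Longrightarrow> g y < e / 2" by (auto simp: eventually_at_top_linorder)
    obtain n0 where n0: "\<And>n. n \<ge> n0 \<Longrightarrow> norm (S n - L) < e / 2"
      using LIMSEQ_D[OF L, of "e/2"] e by auto
    show "\<exists>Y. \<forall>z. Y \<le> Im z \<and> \<bar>Re z\<bar> \<le> K * Im z \<longrightarrow> norm (Q z - L) < e"
    proof (intro exI allI impI)
      fix z assume z: "max (max 2 Y1) (real n0 + 2) \<le> Im z \<and> \<bar>Re z\<bar> \<le> K * Im z"
      define n where "n = nat \<lfloor>Im z - 1\<rfloor>"
      have n: "real n \<le> Im z - 1" "Im z - 1 < real n + 1" using z by (auto simp: n_def)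
      have "n \<ge> n0" using z n(2) by linarith
      have "K * Im z \<le> K' * Im z" by (rule mult_right_mono[OF K'(2)]) (use z in linarith)
      then have re: "\<bar>Re z\<bar> \<le> K' * Im z" using z by linarith
      have rn: "K' * Im z \<le> 2 * K' * (real n + 1)"
      proof -
        have "Im z \<le> 2 * (real n + 1)" using n by simp
        from mult_left_mono[OF this K'(1)] show ?thesis by (simp only: mult_ac)
      qed
      have "norm (Q z - S n) \<le> M (2 * K') * exp (- (c / 2) * (real n + 1)) * norm (z - Complex 0 (real n + 1))"
        unfolding S_def by (rule lip) (use K' n re rn in auto)
      also have "\<dots> \<le> M (2 * K') * exp (- (c / 2) * (Im z - 1)) * (1 + K' * Im z)"
      proof (intro mult_mono mult_left_mono)
        show "exp (- (c / 2) * (real n + 1)) \<le> exp (- (c / 2) * (Im z - 1))"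
          using n c by (simp add: mult_left_mono)
        have "norm (z - Complex 0 (real n + 1)) \<le> \<bar>Re z\<bar> + \<bar>Im z - (real n + 1)\<bar>"
          using cmod_le[of "z - Complex 0 (real n + 1)"] by simp
        also have "\<dots> \<le> K' * Im z + 1" using re n by simp
        finally show "norm (z - Complex 0 (real n + 1)) \<le> 1 + K' * Im z" by simp
      qed (use M0 K' in auto)
      also have "\<dots> < e / 2" using Y1[of "Im z"] z by (simp add: g_def)
      finally have "norm (Q z - S n) < e / 2" .
      moreover have "norm (S n - L) < e / 2" by (rule n0) fact
      ultimately show "norm (Q z - L) < e" using norm_triangle_lt[of "Q z - S n" "S n - L" e] by simp
    qed
  qed
  then show ?thesis by (rule that)
qed

section \<open>Charts adapted to a pair of cusps, and limits at cusps\<close>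

definition det2 :: "rat \<times> rat \<Rightarrow> rat \<times> rat \<Rightarrow> real" where
  "det2 p q = of_rat (fst p * snd q - fst q * snd p)"

lemma det2_eq: "det2 p q = of_rat (fst p) * of_rat (snd q) - of_rat (fst q) * of_rat (snd p)"
  by (simp add: det2_def of_rat_diff of_rat_mult)

text \<open>
  The real Moebius transformation that takes \<open>\<infinity>\<close> to the cusp of \<open>p\<close>, the zero of \<open>lin p\<close>, and \<open>0\<close>
  to the cusp of \<open>q\<close>; the sign makes its determinant positive.
\<close>

definition chart :: "rat \<times> rat \<Rightarrow> rat \<times> rat \<Rightarrow> complex \<Rightarrow> complex" where
  "chart p q \<zeta> = (of_real (- of_rat (snd p)) * \<zeta> + of_real (- (sgn (det2 p q) * of_rat (snd q)))) /
     (of_real (of_rat (fst p)) * \<zeta> + of_real (sgn (det2 p q) * of_rat (fst q)))"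

definition chart_den :: "rat \<times> rat \<Rightarrow> rat \<times> rat \<Rightarrow> complex \<Rightarrow> complex" where
  "chart_den p q \<zeta> = of_real (of_rat (fst p)) * \<zeta> + of_real (sgn (det2 p q) * of_rat (fst q))"

lemma chart_hyp_invariant:
  assumes "det2 p q \<noteq> 0"
  shows "hyp_invariant (chart p q)"
  unfolding chart_def
proof (rule hyp_invariant_real_moebius)
  have "- of_rat (snd p) * (sgn (det2 p q) * of_rat (fst q)) - - (sgn (det2 p q) * of_rat (snd q)) * of_rat (fst p)
     = sgn (det2 p q) * det2 p q" by (simp add: det2_eq algebra_simps)
  also have "\<dots> = \<bar>det2 p q\<bar>" by (simp add: abs_sgn mult.commute)
  finally show "0 < - of_rat (snd p) * (sgn (det2 p q) * of_rat (fst q)) - - (sgn (det2 p q) * of_rat (snd q)) * of_rat (fst p)"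
    using assms by simp
qed

text \<open>The chart inverts the map from \<open>z\<close> to
  \<open>- e * lin q z / lin p z\<close>, where \<open>e\<close> is the sign of the determinant; all
  formulas are read off after multiplying by the denominator. The height of \<open>z\<close> is, up
  to the determinant, \<open>Im \<zeta> * |p(z)|^2\<close>, which is what lets the kernel
  separate.\<close>

lemma chart_facts:
  assumes D: "det2 p q \<noteq> 0" and \<zeta>: "Im \<zeta> > 0"
  shows "chart_den p q \<zeta> \<noteq> 0"
    and "lin p (chart p q \<zeta>) = - of_real \<bar>det2 p q\<bar> / chart_den p q \<zeta>"
    and "lin q (chart p q \<zeta>) = - of_real (sgn (det2 p q)) * \<zeta> * lin p (chart p q \<zeta>)"
    and "Im (chart p q \<zeta>) = Im \<zeta> * cmod (lin p (chart p q \<zeta>)) ^ 2 / \<bar>det2 p q\<bar>"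
    and "(chart p q has_field_derivative lin p (chart p q \<zeta>) ^ 2 / of_real \<bar>det2 p q\<bar>) (at \<zeta>)"
proof -
  define e where "e = sgn (det2 p q)"
  define a1 b1 a2 b2 where "a1 = (of_rat (fst p) :: real)" and "b1 = (of_rat (snd p) :: real)"
    and "a2 = (of_rat (fst q) :: real)" and "b2 = (of_rat (snd q) :: real)"
  define s where "s = chart_den p q \<zeta>"
  have D': "det2 p q = a1 * b2 - a2 * b1" by (simp add: det2_eq a1_def a2_def b1_def b2_def)
  have ee: "e * e = 1" using D by (simp add: e_def sgn_if)
  have eD: "e * (a1 * b2 - a2 * b1) = \<bar>det2 p q\<bar>" unfolding D'[symmetric] e_def by (simp add: abs_sgn mult.commute)
  have s: "s = of_real a1 * \<zeta> + of_real (e * a2)" by (simp add: s_def chart_den_def a1_def a2_def e_def)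
  show s0: "chart_den p q \<zeta> \<noteq> 0"
  proof
    assume "chart_den p q \<zeta> = 0"
    then have z: "s = 0" by (simp add: s_def)
    then have "Im s = 0" by simp
    then have "a1 = 0" using \<zeta> by (simp add: s)
    with z have "e * a2 = 0" by (simp add: s flip: of_real_mult)
    then have "a2 = 0" using ee by auto
    then show False using D D' \<open>a1 = 0\<close> by simp
  qed
  then have s0': "s \<noteq> 0" by (simp add: s_def)
  have m: "chart p q \<zeta> * s = of_real (- b1) * \<zeta> + of_real (- (e * b2))"
    using s0 unfolding s_def chart_def chart_den_def b1_def b2_def e_def by simp
  have lp: "lin p z = of_real a1 * z + of_real b1" and lq: "lin q z = of_real a2 * z + of_real b2" for z
    by (simp_all add: lin_def of_rat_eq_of_real_of_rat a1_def b1_def a2_def b2_def)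
  have "lin p (chart p q \<zeta>) * s = of_real a1 * (chart p q \<zeta> * s) + of_real b1 * s" by (simp add: lp algebra_simps)
  also have "\<dots> = - of_real (e * (a1 * b2 - a2 * b1))" unfolding m unfolding s by (simp add: algebra_simps)
  finally have wp: "lin p (chart p q \<zeta>) * s = - of_real \<bar>det2 p q\<bar>" unfolding eD .
  then show 2: "lin p (chart p q \<zeta>) = - of_real \<bar>det2 p q\<bar> / chart_den p q \<zeta>"
    using s0' by (metis nonzero_eq_divide_eq s_def)
  have "lin q (chart p q \<zeta>) * s = of_real a2 * (chart p q \<zeta> * s) + of_real b2 * s" by (simp add: lq algebra_simps)
  also have "\<dots> = of_real (a1 * b2 - a2 * b1) * \<zeta>" unfolding m unfolding s by (simp add: algebra_simps)
  also have "\<dots> = (- of_real e * \<zeta>) * (- of_real (e * (a1 * b2 - a2 * b1)))"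
  proof -
    have "(- of_real e * \<zeta>) * (- of_real (e * (a1 * b2 - a2 * b1))) = of_real (e * e) * (of_real (a1 * b2 - a2 * b1) * \<zeta>)"
      by (simp add: algebra_simps)
    then show ?thesis by (simp only: ee of_real_1 mult_1)
  qed
  also have "\<dots> = (- of_real e * \<zeta>) * (lin p (chart p q \<zeta>) * s)" unfolding wp eD ..
  finally have "lin q (chart p q \<zeta>) * s = (- of_real e * \<zeta> * lin p (chart p q \<zeta>)) * s" by (simp only: mult.assoc)
  then show "lin q (chart p q \<zeta>) = - of_real (sgn (det2 p q)) * \<zeta> * lin p (chart p q \<zeta>)"
    unfolding e_def mult_right_cancel[OF s0'] .
  have "chart p q \<zeta> = (of_real (- b1) * \<zeta> + of_real (- (e * b2))) * cnj s / of_real (cmod s ^ 2)"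
    unfolding m[symmetric] complex_norm_square using s0' by simp
  then have "Im (chart p q \<zeta>) = Im ((of_real (- b1) * \<zeta> + of_real (- (e * b2))) * cnj s) / cmod s ^ 2"
    by (simp only: Im_divide_of_real)
  also have "Im ((of_real (- b1) * \<zeta> + of_real (- (e * b2))) * cnj s) = Im \<zeta> * (e * (a1 * b2 - a2 * b1))"
    unfolding s by (simp add: algebra_simps)
  finally have im: "Im (chart p q \<zeta>) = Im \<zeta> * \<bar>det2 p q\<bar> / cmod s ^ 2" unfolding eD .
  have n: "cmod (lin p (chart p q \<zeta>)) ^ 2 = \<bar>det2 p q\<bar> ^ 2 / cmod s ^ 2"
    unfolding 2 s_def[symmetric] by (simp add: norm_divide power_divide)
  show "Im (chart p q \<zeta>) = Im \<zeta> * cmod (lin p (chart p q \<zeta>)) ^ 2 / \<bar>det2 p q\<bar>"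
  proof -
    have "x * \<Delta> / y = x * (\<Delta> ^ 2 / y) / \<Delta>" if "\<Delta> \<noteq> 0" for x y \<Delta> :: real
      using that by (simp add: power2_eq_square)
    from this[of "\<bar>det2 p q\<bar>"] show ?thesis unfolding im n using D by simp
  qed
  have "(chart p q has_field_derivative (of_real (- b1) * s - (of_real (- b1) * \<zeta> + of_real (- (e * b2))) * of_real a1) / (s * s)) (at \<zeta>)"
    unfolding chart_def[abs_def] s a1_def[symmetric] b1_def[symmetric] a2_def[symmetric] b2_def[symmetric] e_def[symmetric]
    using s0' by (auto intro!: derivative_eq_intros simp: s)
  also have "of_real (- b1) * s - (of_real (- b1) * \<zeta> + of_real (- (e * b2))) * of_real a1 = of_real (e * (a1 * b2 - a2 * b1))"
    unfolding s by (simp add: algebra_simps)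
  also have "of_real (e * (a1 * b2 - a2 * b1)) / (s * s) = lin p (chart p q \<zeta>) ^ 2 / of_real \<bar>det2 p q\<bar>"
    unfolding 2 eD s_def[symmetric] using D by (simp add: power2_eq_square)
  finally show "(chart p q has_field_derivative lin p (chart p q \<zeta>) ^ 2 / of_real \<bar>det2 p q\<bar>) (at \<zeta>)" .
qed

lemma lin_chart_nonzero:
  assumes D: "det2 p q \<noteq> 0" and \<zeta>: "Im \<zeta> > 0"
  shows "lin p (chart p q \<zeta>) \<noteq> 0"
  unfolding chart_facts(2)[OF assms] using D chart_facts(1)[OF assms] by simp

lemma Im_chart_pos:
  assumes D: "det2 p q \<noteq> 0" and \<zeta>: "Im \<zeta> > 0"
  shows "Im (chart p q \<zeta>) > 0"
  unfolding chart_facts(4)[OF assms] using D \<zeta> lin_chart_nonzero[OF assms] by simp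

lemma det2_swap: "det2 q p = - det2 p q" by (simp add: det2_eq)

text \<open>Exchanging the two vectors exchanges 0 and infinity. The behaviour at the cusp of
  \<open>q\<close>, where \<open>\<rho>\<close> tends to minus infinity, becomes a limit at plus
  infinity in the swapped chart.\<close>

lemma chart_swap:
  assumes D: "det2 p q \<noteq> 0" and \<zeta>: "Im \<zeta> > 0"
  shows "chart p q \<zeta> = chart q p (- 1 / \<zeta>)"
proof -
  define e where "e = complex_of_real (sgn (det2 p q))"
  have ee: "e * e = 1" using D by (simp add: e_def sgn_if)
  have e0: "e \<noteq> 0" using ee by auto
  have z: "\<zeta> \<noteq> 0" using \<zeta> by auto
  define a1 b1 a2 b2 where "a1 = complex_of_real (of_rat (fst p))" and "b1 = complex_of_real (of_rat (snd p))"
    and "a2 = complex_of_real (of_rat (fst q))" and "b2 = complex_of_real (of_rat (snd q))"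
  have "chart q p (- 1 / \<zeta>) = (- b2 * (- 1 / \<zeta>) + e * b1) / (a2 * (- 1 / \<zeta>) - e * a1)"
    unfolding chart_def det2_swap[where p = p and q = q] by (simp add: e_def a1_def b1_def a2_def b2_def sgn_minus)
  also have "\<dots> = ((- b2 * (- 1 / \<zeta>) + e * b1) * (- e * \<zeta>)) / ((a2 * (- 1 / \<zeta>) - e * a1) * (- e * \<zeta>))"
    using z e0 by simp
  also have "(- b2 * (- 1 / \<zeta>) + e * b1) * (- e * \<zeta>) = - e * b2 - (e * e) * b1 * \<zeta>"
    using z by (simp add: algebra_simps)
  also have "(a2 * (- 1 / \<zeta>) - e * a1) * (- e * \<zeta>) = e * a2 + (e * e) * a1 * \<zeta>"
    using z by (simp add: algebra_simps)
  also have "(- e * b2 - (e * e) * b1 * \<zeta>) / (e * a2 + (e * e) * a1 * \<zeta>) = chart p q \<zeta>"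
    unfolding chart_def ee by (simp add: e_def a1_def b1_def a2_def b2_def add_ac)
  finally show ?thesis ..
qed

text \<open>One \<open>L\<close> is required for every second vector \<open>q\<close> and every
  \<open>u\<close>: in a triple each cusp is approached in two different charts, and telescoping
  needs equal limits there.\<close>

definition cusp_lim :: "rat \<times> rat \<Rightarrow> (complex \<Rightarrow> complex) \<Rightarrow> complex \<Rightarrow> bool" where
  "cusp_lim p P L \<longleftrightarrow> (\<forall>q u. det2 p q \<noteq> 0 \<longrightarrow> ((\<lambda>\<rho>. P (chart p q (geo u \<rho>))) \<longlongrightarrow> L) at_top)"

lemma cusp_lim_at_bot:
  assumes D: "det2 p q \<noteq> 0" and L: "cusp_lim q P L"
  shows "((\<lambda>\<rho>. P (chart p q (geo u \<rho>))) \<longlongrightarrow> L) at_bot"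
proof -
  have D': "det2 q p \<noteq> 0" using D by (simp add: det2_swap[where p = p and q = q])
  have e: "chart p q (geo u \<rho>) = chart q p (geo (- u) (- ln (1 + u\<^sup>2) + - 1 * \<rho>))" for \<rho>
    using chart_swap[OF D, of "geo u \<rho>"] unfolding geo_inversion by simp
  have "filterlim (\<lambda>\<rho>. - ln (1 + u\<^sup>2) + - 1 * \<rho>) at_top at_bot"
    by (intro filterlim_tendsto_add_at_top[OF tendsto_const]) (simp add: filterlim_uminus_at_top_at_bot)
  moreover have "((\<lambda>\<rho>. P (chart q p (geo (- u) \<rho>))) \<longlongrightarrow> L) at_top" by (rule L[unfolded cusp_lim_def, rule_format, OF D'])
  ultimately show ?thesis unfolding e by (rule filterlim_compose[rotated])
qed

text \<open>The chart takes infinity to the cusp of \<open>p\<close> and \<open>A\<close> takes that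
  cusp to infinity, so the composite is affine. It keeps the curves of constant \<open>u\<close>
  inside cones, where nontangential limits apply.\<close>

lemma chart_SL2Z:
  assumes A: "A \<in> SL2Z" and p: "p = (\<kappa> * of_int (A $ 2 $ 1), \<kappa> * of_int (A $ 2 $ 2))" and \<kappa>: "\<kappa> \<noteq> 0"
    and D: "det2 p q \<noteq> 0"
  obtains e1 e0 :: real where "e1 > 0" "\<And>\<zeta>. Im \<zeta> > 0 \<Longrightarrow> moebius A (chart p q \<zeta>) = of_real e1 * \<zeta> + of_real e0"
proof -
  define e where "e = sgn (det2 p q)"
  have ee: "e * e = 1" using D by (simp add: e_def sgn_if)
  define k where "k = (of_rat \<kappa> :: real)"
  have k: "k \<noteq> 0" using \<kappa> by (simp add: k_def)
  define c d a b where "c = real_of_int (A $ 2 $ 1)" and "d = real_of_int (A $ 2 $ 2)"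
    and "a = real_of_int (A $ 1 $ 1)" and "b = real_of_int (A $ 1 $ 2)"
  have det: "a * d - b * c = 1"
    using arg_cong[OF A[unfolded SL2Z_iff], of real_of_int] by (simp add: a_def b_def c_def d_def)
  define a2 b2 where "a2 = (of_rat (fst q) :: real)" and "b2 = (of_rat (snd q) :: real)"
  have p1: "of_rat (fst p) = k * c" "of_rat (snd p) = k * d" by (simp_all add: p k_def c_def d_def of_rat_mult)
  have D': "det2 p q = k * (c * b2 - d * a2)" by (simp add: det2_eq p1 a2_def b2_def algebra_simps)
  have bot0: "c * b2 - d * a2 \<noteq> 0" using D D' by auto
  define t where "t = e * (b * a2 - a * b2)"
  define e1 where "e1 = k * k / \<bar>det2 p q\<bar>"
  define e0 where "e0 = - (e * t) / (c * b2 - d * a2)"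
  have adet: "\<bar>det2 p q\<bar> = e * (k * (c * b2 - d * a2))" unfolding D'[symmetric] e_def by (simp add: abs_sgn mult.commute)
  show ?thesis
  proof
    show "e1 > 0" using k D by (simp add: e1_def flip: power2_eq_square)
    fix \<zeta> :: complex assume \<zeta>: "Im \<zeta> > 0"
    define s where "s = chart_den p q \<zeta>"
    have s0: "s \<noteq> 0" using chart_facts(1)[OF D \<zeta>] by (simp add: s_def)
    have s: "s = of_real (k * c) * \<zeta> + of_real (e * a2)" by (simp add: s_def chart_den_def p1 e_def a2_def)
    define z where "z = chart p q \<zeta>"
    have m: "z * s = of_real (- (k * d)) * \<zeta> + of_real (- (e * b2))"
      using s0 unfolding z_def s_def chart_def chart_den_def p1 b2_def e_def by simp
    have "(of_real a * z + of_real b) * s = of_real a * (z * s) + of_real b * s" by (simp add: algebra_simps)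
    also have "\<dots> = - of_real (k * (a * d - b * c)) * \<zeta> + of_real t"
      unfolding m unfolding s t_def by (simp add: algebra_simps)
    finally have top: "(of_real a * z + of_real b) * s = - of_real k * \<zeta> + of_real t" unfolding det by simp
    have "(of_real c * z + of_real d) * s = of_real c * (z * s) + of_real d * s" by (simp add: algebra_simps)
    also have "\<dots> = - of_real (e * (c * b2 - d * a2))" unfolding m unfolding s by (simp add: algebra_simps)
    finally have bot: "(of_real c * z + of_real d) * s = - of_real (e * (c * b2 - d * a2))" .
    have "moebius A z = (of_real a * z + of_real b) / (of_real c * z + of_real d)"
      by (simp add: moebius_def automorphy_factor_def a_def b_def c_def d_def)
    also have "\<dots> = ((of_real a * z + of_real b) * s) / ((of_real c * z + of_real d) * s)" using s0 by simp
    also have "\<dots> = (- of_real k * \<zeta> + of_real t) / (- of_real (e * (c * b2 - d * a2)))" unfolding top bot ..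
    also have "\<dots> = of_real (k / (e * (c * b2 - d * a2))) * \<zeta> + of_real (- t / (e * (c * b2 - d * a2)))"
      by (simp add: add_divide_distrib diff_divide_distrib minus_divide_divide)
    also have "k / (e * (c * b2 - d * a2)) = e1" unfolding e1_def adet using k by simp
    also have "- t / (e * (c * b2 - d * a2)) = e0"
    proof -
      have "e \<noteq> 0" using ee by auto
      then have "x / (e * y) = (e * x) / (e * (e * y))" for x y by simp
      from this[of "- t" "c * b2 - d * a2"] show ?thesis unfolding mult.assoc[symmetric] ee e0_def by simp
    qed
    finally show "moebius A (chart p q \<zeta>) = of_real e1 * \<zeta> + of_real e0" by (simp add: z_def)
  qed
qed

lemma moebius_has_field_derivative:
  assumes A: "A \<in> SL2Z" and z: "Im z > 0"
  shows "(moebius A has_field_derivative 1 / automorphy_factor A z ^ 2) (at z)"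
proof -
  define j where "j = automorphy_factor A z"
  have j: "j \<noteq> 0" using automorphy_factor_nonzero[OF A z] by (simp add: j_def)
  have det: "complex_of_int (A $ 1 $ 1) * of_int (A $ 2 $ 2) - of_int (A $ 1 $ 2) * of_int (A $ 2 $ 1) = 1"
    using arg_cong[OF A[unfolded SL2Z_iff], of complex_of_int] by simp
  have "(moebius A has_field_derivative (of_int (A $ 1 $ 1) * j - (of_int (A $ 1 $ 1) * z + of_int (A $ 1 $ 2)) * of_int (A $ 2 $ 1)) / (j * j)) (at z)"
    using j unfolding moebius_def[abs_def] automorphy_factor_def[abs_def] j_def
    by (auto intro!: derivative_eq_intros)
  also have "of_int (A $ 1 $ 1) * j - (of_int (A $ 1 $ 1) * z + of_int (A $ 1 $ 2)) * of_int (A $ 2 $ 1)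
    = complex_of_int (A $ 1 $ 1) * of_int (A $ 2 $ 2) - of_int (A $ 1 $ 2) * of_int (A $ 2 $ 1)"
    by (simp add: j_def automorphy_factor_def algebra_simps)
  finally show ?thesis unfolding det j_def power2_eq_square .
qed

text \<open>In the coordinate that puts the cusp of \<open>p\<close> at infinity, the automorphy
  factors of \<open>f\<close>, of the \<open>m + l\<close> linear factors and of \<open>dz\<close>
  cancel because \<open>k = m + l + 2\<close>; the integrand becomes a slash of \<open>f\<close>
  times a polynomial. Two powers of linear forms with arbitrary coefficients cover the monomials in
  \<open>p\<close>, \<open>q\<close> as well as the power of \<open>b p - a q\<close>.\<close>

lemma cusp_lim_exists:
  assumes f: "cusp_form N k f" and N: "N \<ge> 1" and k: "k = m + l + 2" and p: "p \<noteq> (0, 0)"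
    and P: "\<And>z. Im z > 0 \<Longrightarrow> (P has_field_derivative f z * (\<alpha>1 * z + \<beta>1) ^ m * (\<alpha>2 * z + \<beta>2) ^ l) (at z)"
  obtains L where "cusp_lim p P L"
proof -
  obtain \<kappa> :: rat and A where A: "\<kappa> \<noteq> 0" "A \<in> SL2Z" "p = (\<kappa> * of_int (A $ 2 $ 1), \<kappa> * of_int (A $ 2 $ 2))"
    using rat_pair_primitive[OF p] by blast
  define B where "B = adj2 A"
  have B: "B \<in> SL2Z" unfolding B_def by (rule SL2Z_adj2[OF A(2)])
  obtain C where C: "C \<ge> 0" "\<And>z. Im z \<ge> 1 / 2 \<Longrightarrow> norm (slash k B f z) \<le> C * exp (- (2 * pi / real N) * Im z)"
    using cusp_form_slash_bound[OF f N B] by blast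
  define g where "g \<alpha> \<beta> z = \<alpha> * (of_int (B $ 1 $ 1) * z + of_int (B $ 1 $ 2)) + \<beta> * automorphy_factor B z" for \<alpha> \<beta> z :: complex
  define G where "G \<alpha> \<beta> = cmod \<alpha> * (cmod (of_int (B $ 1 $ 1)) + cmod (of_int (B $ 1 $ 2))) + cmod \<beta> * (cmod (of_int (B $ 2 $ 1)) + cmod (of_int (B $ 2 $ 2)))" for \<alpha> \<beta>
  have G0: "G \<alpha> \<beta> \<ge> 0" for \<alpha> \<beta> by (simp add: G_def)
  have gb: "cmod (g \<alpha> \<beta> z) \<le> G \<alpha> \<beta> * (1 + cmod z)" for \<alpha> \<beta> z
  proof -
    have li: "cmod (x * z + y) \<le> (cmod x + cmod y) * (1 + cmod z)" for x y :: complex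
    proof -
      have "cmod (x * z + y) \<le> cmod x * cmod z + cmod y" using norm_triangle_ineq[of "x * z" y] by (simp add: norm_mult)
      also have "\<dots> \<le> (cmod x + cmod y) * (1 + cmod z)" by (simp add: algebra_simps)
      finally show ?thesis .
    qed
    have "cmod (g \<alpha> \<beta> z) \<le> cmod \<alpha> * cmod (of_int (B $ 1 $ 1) * z + of_int (B $ 1 $ 2)) + cmod \<beta> * cmod (automorphy_factor B z)"
      unfolding g_def
      using norm_triangle_ineq[of "\<alpha> * (of_int (B $ 1 $ 1) * z + of_int (B $ 1 $ 2))" "\<beta> * automorphy_factor B z"]
      by (simp only: norm_mult)
    also have "\<dots> \<le> cmod \<alpha> * ((cmod (of_int (B $ 1 $ 1)) + cmod (of_int (B $ 1 $ 2))) * (1 + cmod z)) + cmod \<beta> * ((cmod (of_int (B $ 2 $ 1)) + cmod (of_int (B $ 2 $ 2))) * (1 + cmod z))"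
      unfolding automorphy_factor_def by (intro add_mono mult_left_mono li) auto
    also have "\<dots> = G \<alpha> \<beta> * (1 + cmod z)" unfolding G_def by (simp only: distrib_right mult.assoc)
    finally show ?thesis .
  qed
  have gj: "(\<alpha> * moebius B z + \<beta>) * automorphy_factor B z = g \<alpha> \<beta> z" if z: "Im z > 0" for \<alpha> \<beta> z
  proof -
    have "moebius B z * automorphy_factor B z = of_int (B $ 1 $ 1) * z + of_int (B $ 1 $ 2)"
      using automorphy_factor_nonzero[OF B z] by (simp add: moebius_def)
    moreover have "(\<alpha> * x + \<beta>) * j = \<alpha> * (x * j) + \<beta> * j" for x j :: complex by (simp add: algebra_simps)
    ultimately show ?thesis unfolding g_def by presburger
  qed
  define Q where "Q z = P (moebius B z)" for z
  define Q' where "Q' z = slash k B f z * g \<alpha>1 \<beta>1 z ^ m * g \<alpha>2 \<beta>2 z ^ l" for z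
  have Qd: "(Q has_field_derivative Q' z) (at z)" if z: "Im z > 0" for z
  proof -
    define j where "j = automorphy_factor B z"
    have j: "j \<noteq> 0" using automorphy_factor_nonzero[OF B z] by (simp add: j_def)
    have "(Q has_field_derivative (f (moebius B z) * (\<alpha>1 * moebius B z + \<beta>1) ^ m * (\<alpha>2 * moebius B z + \<beta>2) ^ l) * (1 / j ^ 2)) (at z)"
      unfolding Q_def[abs_def] j_def by (rule DERIV_chain2[OF P[OF Im_moebius_pos[OF B z]] moebius_has_field_derivative[OF B z]])
    moreover have "(f (moebius B z) * (\<alpha>1 * moebius B z + \<beta>1) ^ m * (\<alpha>2 * moebius B z + \<beta>2) ^ l) * (1 / j ^ 2) = Q' z"
    proof -
      have "F * X ^ m * Y ^ l * (1 / j ^ 2) = (F / j ^ k) * (X * j) ^ m * (Y * j) ^ l" for F X Y :: complex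
        unfolding k power_mult_distrib power_add using j by (simp add: field_simps)
      then show ?thesis unfolding Q'_def slash_def gj[OF z, symmetric] j_def by blast
    qed
    ultimately show ?thesis by simp
  qed
  define C' where "C' = C * G \<alpha>1 \<beta>1 ^ m * G \<alpha>2 \<beta>2 ^ l"
  have "norm (Q' z) \<le> C' * exp (- (2 * pi / real N) * Im z) * (1 + cmod z) ^ (m + l)" if z: "Im z \<ge> 1 / 2" for z
  proof -
    have "norm (Q' z) \<le> (C * exp (- (2 * pi / real N) * Im z)) * (G \<alpha>1 \<beta>1 * (1 + cmod z)) ^ m * (G \<alpha>2 \<beta>2 * (1 + cmod z)) ^ l"
      unfolding Q'_def norm_mult norm_power using C(1) G0
      by (intro mult_mono power_mono C(2)[OF z] gb) auto
    also have "\<dots> = C' * exp (- (2 * pi / real N) * Im z) * (1 + cmod z) ^ (m + l)"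
      by (simp add: C'_def power_mult_distrib power_add)
    finally show ?thesis .
  qed
  moreover have "C' \<ge> 0" "2 * pi / real N > 0" using C(1) G0 N by (simp_all add: C'_def)
  ultimately obtain L where L: "nt_lim Q L" using nt_lim_exists[OF Qd] by blast
  show ?thesis
  proof (rule that)
    show "cusp_lim p P L"
      unfolding cusp_lim_def
    proof (intro allI impI)
      fix q u assume D: "det2 p q \<noteq> 0"
      obtain e1 e0 :: real where e: "e1 > 0" "\<And>\<zeta>. Im \<zeta> > 0 \<Longrightarrow> moebius A (chart p q \<zeta>) = of_real e1 * \<zeta> + of_real e0"
        using chart_SL2Z[OF A(2,3,1) D] by blast
      define \<gamma> where "\<gamma> \<rho> = of_real e1 * geo u \<rho> + of_real e0" for \<rho>
      have PQ: "P (chart p q (geo u \<rho>)) = Q (\<gamma> \<rho>)" for \<rho>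
        unfolding Q_def \<gamma>_def using e(2)[of "geo u \<rho>"] moebius_adj2(1)[OF A(2) Im_chart_pos[OF D, of "geo u \<rho>"]]
        by (simp add: B_def)
      have im: "Im (\<gamma> \<rho>) = e1 * exp \<rho>" and re: "Re (\<gamma> \<rho>) = e1 * exp \<rho> * u + e0" for \<rho>
        by (simp_all add: \<gamma>_def geo_eq_Complex)
      have lim: "filterlim (\<lambda>\<rho>. Im (\<gamma> \<rho>)) at_top at_top"
        unfolding im using e(1) by real_asymp
      show "((\<lambda>\<rho>. P (chart p q (geo u \<rho>))) \<longlongrightarrow> L) at_top"
        unfolding PQ tendsto_iff
      proof (intro allI impI)
        fix \<epsilon> :: real assume "\<epsilon> > 0"
        \<comment> \<open>The real part of the curve is \<open>u\<close> times its height plus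
          \<open>e0\<close>, so above height 1 it stays in the cone of this slope.\<close>
        then obtain Y where Y: "\<And>z. Im z \<ge> Y \<Longrightarrow> \<bar>Re z\<bar> \<le> (\<bar>u\<bar> + \<bar>e0\<bar>) * Im z \<Longrightarrow> norm (Q z - L) < \<epsilon>"
          using L unfolding nt_lim_def by blast
        have "eventually (\<lambda>\<rho>. Im (\<gamma> \<rho>) \<ge> max Y 1) at_top" using lim unfolding filterlim_at_top by blast
        then show "eventually (\<lambda>\<rho>. dist (Q (\<gamma> \<rho>)) L < \<epsilon>) at_top"
        proof eventually_elim
          case (elim \<rho>)
          have "\<bar>Re (\<gamma> \<rho>)\<bar> \<le> \<bar>Im (\<gamma> \<rho>) * u\<bar> + \<bar>e0\<bar> * 1" unfolding re im[symmetric] by simp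
          also have "\<dots> \<le> \<bar>u\<bar> * Im (\<gamma> \<rho>) + \<bar>e0\<bar> * Im (\<gamma> \<rho>)"
            using elim by (intro add_mono mult_left_mono) (auto simp: abs_mult)
          finally have "\<bar>Re (\<gamma> \<rho>)\<bar> \<le> (\<bar>u\<bar> + \<bar>e0\<bar>) * Im (\<gamma> \<rho>)" by (simp add: algebra_simps)
          then show ?case using Y elim by (simp add: dist_norm)
        qed
      qed
    qed
  qed
qed

lemma cusp_lim_unique:
  assumes "cusp_lim p P L" "cusp_lim p P L'" "det2 p q \<noteq> 0"
  shows "L = L'"
proof -
  have "((\<lambda>\<rho>. P (chart p q (geo 0 \<rho>))) \<longlongrightarrow> L) at_top" "((\<lambda>\<rho>. P (chart p q (geo 0 \<rho>))) \<longlongrightarrow> L') at_top"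
    by (rule assms(1)[unfolded cusp_lim_def, rule_format, OF assms(3)],
        rule assms(2)[unfolded cusp_lim_def, rule_format, OF assms(3)])
  then show ?thesis by (rule tendsto_unique[rotated]) simp
qed

section \<open>Orbits of independent pairs\<close>

lemma integrable_inverse_1_plus_square: "integrable lborel (\<lambda>u::real. 1 / (1 + u\<^sup>2))"
proof -
  have 1: "integrable lborel (\<lambda>x::real. indicator {0..} x * (1 / (1 + x\<^sup>2)))" by (rule integrable_arctan_deriv)
  have 2: "integrable lborel (\<lambda>x::real. indicator {0..} (0 + - 1 * x) * (1 / (1 + (0 + - 1 * x)\<^sup>2)))"
    using lborel_integrable_real_affine_iff[of "- 1" "\<lambda>x::real. indicator {0..} x * (1 / (1 + x\<^sup>2))" 0] 1 by simp
  show ?thesis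
  proof (rule Bochner_Integration.integrable_bound[OF Bochner_Integration.integrable_add[OF 1 2]])
    show "AE x in lborel. norm (1 / (1 + x\<^sup>2)) \<le> norm (indicator {0..} x * (1 / (1 + x\<^sup>2)) + indicator {0..} (0 + - 1 * x) * (1 / (1 + (0 + - 1 * x)\<^sup>2)) :: real)"
      by (rule AE_I2) (auto simp: indicator_def)
  qed simp
qed

lemma integral_FTC_UNIV:
  fixes F f :: "real \<Rightarrow> complex"
  assumes F: "\<And>x. (F has_vector_derivative f x) (at x)" and f: "\<And>x. isCont f x"
    and i: "integrable lborel f" and A: "(F \<longlongrightarrow> A) at_bot" and B: "(F \<longlongrightarrow> B) at_top"
  shows "(\<integral>x. f x \<partial>lborel) = B - A"
proof -
  have "(LBINT x=-\<infinity>..\<infinity>. f x) = B - A"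
    by (rule interval_integral_FTC_integrable)
      (use F f i A B in \<open>auto simp: ereal_tendsto_simps set_integrable_def\<close>)
  then show ?thesis by (simp add: interval_lebesgue_integral_def set_lebesgue_integral_def)
qed

text \<open>The part of the Petersson integrand that depends on \<open>u\<close> alone in the chart
  of two cusps; its integral is a beta integral of Cauchy's type. Instead of a closed form, the
  argument compares its values for different \<open>l\<close>, \<open>m\<close> of the same
  sum.\<close>

definition beta_kernel :: "nat \<Rightarrow> nat \<Rightarrow> real \<Rightarrow> real \<Rightarrow> complex" where
  "beta_kernel l m t u = inverse (of_real u + \<i>) ^ (l + 1) * inverse (of_real u - \<i>) ^ (m + 1) * of_real ((1 + u\<^sup>2) powr (- t / 2))"

definition beta_int :: "nat \<Rightarrow> nat \<Rightarrow> real \<Rightarrow> complex" where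
  "beta_int l m t = (\<integral>u. beta_kernel l m t u \<partial>lborel)"

lemma real_pm_i_nonzero: "complex_of_real u + \<i> \<noteq> 0" "complex_of_real u - \<i> \<noteq> 0" "complex_of_real u \<noteq> \<i>"
  by (auto simp: complex_eq_iff)

lemma cmod_real_pm_i: "cmod (of_real u + \<i>) = sqrt (1 + u\<^sup>2)" "cmod (of_real u - \<i>) = sqrt (1 + u\<^sup>2)"
  by (simp_all add: cmod_def add.commute)

lemma norm_beta_kernel_le:
  assumes t: "t \<ge> 0"
  shows "norm (beta_kernel l m t u) \<le> 1 / (1 + u\<^sup>2)"
proof -
  define s where "s = inverse (sqrt (1 + u\<^sup>2))"
  have s: "0 \<le> s" "s \<le> 1" by (auto simp: s_def inverse_le_1_iff)
  have p: "1 + u\<^sup>2 > 0" by (simp add: add_pos_nonneg)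
  have "(1 + u\<^sup>2) powr (- t / 2) \<le> (1 + u\<^sup>2) powr 0" using t by (intro powr_mono) auto
  then have R: "(1 + u\<^sup>2) powr (- t / 2) \<le> 1" using p by (simp only: powr_zero_eq_one split: if_splits)
  have "norm (beta_kernel l m t u) = s ^ (l + 1) * s ^ (m + 1) * (1 + u\<^sup>2) powr (- t / 2)"
    by (simp add: beta_kernel_def norm_mult norm_power norm_inverse cmod_real_pm_i s_def)
  also have "\<dots> \<le> s ^ 1 * s ^ 1 * 1"
    using s R by (intro mult_mono power_decreasing) auto
  also have "\<dots> = 1 / (1 + u\<^sup>2)"
    by (simp add: s_def inverse_eq_divide power_divide add_nonneg_nonneg flip: power2_eq_square)
  finally show ?thesis .
qed

lemma beta_kernel_continuous: "isCont (beta_kernel l m t) u"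
proof -
  have p: "1 + u\<^sup>2 \<noteq> 0" using zero_le_power2[of u] by linarith
  show ?thesis
    unfolding beta_kernel_def[abs_def] by (intro continuous_intros) (use p in \<open>simp_all add: real_pm_i_nonzero\<close>)
qed

lemma beta_kernel_integrable:
  assumes "t \<ge> 0"
  shows "integrable lborel (beta_kernel l m t)"
proof (rule Bochner_Integration.integrable_bound[OF integrable_inverse_1_plus_square])
  show "beta_kernel l m t \<in> borel_measurable lborel"
    using beta_kernel_continuous by (simp add: borel_measurable_continuous_onI continuous_at_imp_continuous_on)
qed (use norm_beta_kernel_le[OF assms] in \<open>auto intro: order_trans\<close>)

lemma beta_kernel_nonzero: "beta_kernel l m t u \<noteq> 0"
proof -
  have "1 + u\<^sup>2 > 0" by (simp add: add_pos_nonneg)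
  then show ?thesis using real_pm_i_nonzero[of u] by (simp add: beta_kernel_def)
qed

text \<open>With \<open>A = 1 / (u + i)\<close> and \<open>B = 1 / (u - i)\<close> the factor
  \<open>(1 + u^2) powr (- t / 2)\<close> has logarithmic derivative
  \<open>- (t / 2) * (A + B)\<close>. It adds \<open>t / 2\<close> to the two coefficients that come
  from the powers of \<open>A\<close> and \<open>B\<close>.\<close>

lemma beta_kernel_deriv:
  "(beta_kernel l m t has_vector_derivative
     (- of_real (real l + 1 + t / 2) * beta_kernel (l + 1) m t u - of_real (real m + 1 + t / 2) * beta_kernel l (m + 1) t u)) (at u)"
proof -
  have p: "1 + u\<^sup>2 > 0" by (simp add: add_pos_nonneg)
  define A where "A = inverse (complex_of_real u + \<i>)"
  define B where "B = inverse (complex_of_real u - \<i>)"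
  define R where "R = complex_of_real ((1 + u\<^sup>2) powr (- t / 2))"
  note nz = real_pm_i_nonzero[of u]
  have AB: "A + B = complex_of_real (2 * u / (1 + u\<^sup>2))"
  proof -
    have "(complex_of_real u + \<i>) * (of_real u - \<i>) = of_real (1 + u\<^sup>2)" by (simp add: algebra_simps power2_eq_square)
    then have "A + B = (2 * of_real u) / of_real (1 + u\<^sup>2)"
      using nz by (simp add: A_def B_def field_simps)
    then show ?thesis by simp
  qed
  have inv: "((\<lambda>u. inverse (g (of_real u))) has_vector_derivative - (inverse (g (of_real u)) * inverse (g (of_real u)))) (at u)"
    if "(g has_field_derivative 1) (at (of_real u))" "g (of_real u) \<noteq> 0" for g :: "complex \<Rightarrow> complex"
    using has_vector_derivative_real_field[of "\<lambda>z. inverse (g z)" _ u UNIV, OF has_field_derivative_at_within[OF DERIV_inverse_fun[OF that]]]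
    by simp
  have dA: "((\<lambda>u. inverse (complex_of_real u + \<i>)) has_vector_derivative - (A * A)) (at u)"
    unfolding A_def by (rule inv) (auto intro!: derivative_eq_intros simp: nz)
  have dB: "((\<lambda>u. inverse (complex_of_real u - \<i>)) has_vector_derivative - (B * B)) (at u)"
    unfolding B_def by (rule inv) (auto intro!: derivative_eq_intros simp: nz)
  have pow: "((\<lambda>u. g u ^ Suc n) has_vector_derivative of_nat (Suc n) * g u ^ n * g') (at u)"
    if "(g has_vector_derivative g') (at u)" for g :: "real \<Rightarrow> complex" and g' n
  proof -
    have "((\<lambda>x::complex. x ^ Suc n) has_field_derivative of_nat (Suc n) * g u ^ n) (at (g u))"
      using DERIV_power[where n = "Suc n", OF DERIV_ident[of "at (g u)"]] by simp
    from field_vector_diff_chain_at[OF that this] show ?thesis by (simp only: o_def mult_ac)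
  qed
  have dR: "((\<lambda>u. complex_of_real ((1 + u\<^sup>2) powr (- t / 2))) has_vector_derivative - (of_real (t / 2) * (A + B) * R)) (at u)"
  proof -
    have "((\<lambda>u. (1 + u\<^sup>2) powr (- t / 2)) has_real_derivative (- t / 2) * (1 + u\<^sup>2) powr (- t / 2 - 1) * (2 * u)) (at u)"
      using p by (auto intro!: derivative_eq_intros)
    moreover have "(- t / 2) * (1 + u\<^sup>2) powr (- t / 2 - 1) * (2 * u) = - (t / 2 * (2 * u / (1 + u\<^sup>2)) * (1 + u\<^sup>2) powr (- t / 2))"
    proof -
      have "(1 + u\<^sup>2) powr (- t / 2 - 1) = (1 + u\<^sup>2) powr (- t / 2) / (1 + u\<^sup>2)"
        using p by (simp add: powr_diff)
      moreover have "(- t / 2) * (x / y) * (2 * u) = - (t / 2 * (2 * u / y) * x)" for x y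
        by (simp only: divide_inverse mult_minus_left mult_minus_right mult_ac)
      ultimately show ?thesis by metis
    qed
    ultimately have "((\<lambda>u. (1 + u\<^sup>2) powr (- t / 2)) has_real_derivative - (t / 2 * (2 * u / (1 + u\<^sup>2)) * (1 + u\<^sup>2) powr (- t / 2))) (at u)"
      by simp
    from has_vector_derivative_of_real[OF this] show ?thesis
      unfolding AB R_def by (simp only: of_real_minus of_real_mult)
  qed
  have "((\<lambda>u. inverse (of_real u + \<i>) ^ Suc l * inverse (of_real u - \<i>) ^ Suc m * of_real ((1 + u\<^sup>2) powr (- t / 2))) has_vector_derivative
      A ^ Suc l * B ^ Suc m * - (of_real (t / 2) * (A + B) * R)
      + (A ^ Suc l * (of_nat (Suc m) * B ^ m * - (B * B)) + (of_nat (Suc l) * A ^ l * - (A * A)) * B ^ Suc m) * R) (at u)"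
    using has_vector_derivative_mult[OF has_vector_derivative_mult[OF pow[OF dA, of l] pow[OF dB, of m]] dR]
    unfolding A_def[symmetric] B_def[symmetric] R_def[symmetric] .
  also have "A ^ Suc l * B ^ Suc m * - (of_real (t / 2) * (A + B) * R)
      + (A ^ Suc l * (of_nat (Suc m) * B ^ m * - (B * B)) + (of_nat (Suc l) * A ^ l * - (A * A)) * B ^ Suc m) * R
      = - of_real (real l + 1 + t / 2) * (A ^ (l + 2) * B ^ (m + 1) * R) - of_real (real m + 1 + t / 2) * (A ^ (l + 1) * B ^ (m + 2) * R)"
    by (simp add: algebra_simps)
  finally show ?thesis
    by (simp add: beta_kernel_def[abs_def] A_def B_def R_def)
qed

text \<open>The kernel vanishes at both ends of the line, so its derivative has integral 0. This
  moves one unit between \<open>l\<close> and \<open>m\<close> at the price of a sign and of exactly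
  the factors in the functional equation of \<open>Gamma\<close>.\<close>

lemma beta_int_rec:
  assumes t: "t \<ge> 0"
  shows "of_real (real l + 1 + t / 2) * beta_int (l + 1) m t = - (of_real (real m + 1 + t / 2) * beta_int l (m + 1) t)"
proof -
  let ?f = "\<lambda>u. - of_real (real l + 1 + t / 2) * beta_kernel (l + 1) m t u - of_real (real m + 1 + t / 2) * beta_kernel l (m + 1) t u"
  have lim: "((\<lambda>u::real. 1 / (1 + u\<^sup>2)) \<longlongrightarrow> 0) at_top" "((\<lambda>u::real. 1 / (1 + u\<^sup>2)) \<longlongrightarrow> 0) at_bot"
    by real_asymp+
  have "integral\<^sup>L lborel ?f = 0 - 0"
  proof (rule integral_FTC_UNIV[OF beta_kernel_deriv])
    show "isCont ?f u" for u by (intro continuous_intros beta_kernel_continuous)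
    show "integrable lborel ?f" using beta_kernel_integrable[OF t] by simp
    show "(beta_kernel l m t \<longlongrightarrow> 0) at_bot"
      by (rule Lim_null_comparison[OF _ lim(2)]) (use norm_beta_kernel_le[OF t] in simp)
    show "(beta_kernel l m t \<longlongrightarrow> 0) at_top"
      by (rule Lim_null_comparison[OF _ lim(1)]) (use norm_beta_kernel_le[OF t] in simp)
  qed
  moreover have "integral\<^sup>L lborel ?f = - of_real (real l + 1 + t / 2) * beta_int (l + 1) m t - of_real (real m + 1 + t / 2) * beta_int l (m + 1) t"
    unfolding beta_int_def using beta_kernel_integrable[OF t] by (subst Bochner_Integration.integral_diff) auto
  ultimately have "- of_real (real l + 1 + t / 2) * beta_int (l + 1) m t - of_real (real m + 1 + t / 2) * beta_int l (m + 1) t = 0" by simp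
  moreover have "X * B = - (Y * C)" if "- X * B - Y * C = 0" for X B Y C :: complex
    using that by (metis add.inverse_inverse eq_iff_diff_eq_0 minus_mult_left)
  ultimately show ?thesis by blast
qed

text \<open>
  With the Gamma factors of \<open>L\<close> the beta integrals agree up to sign. This is what allows the
  binomial theorem to be applied to the line integrals.
\<close>

lemma beta_int_Gamma:
  assumes t: "t > 0"
  shows "of_real (Gamma (t / 2 + real l + 1) * Gamma (t / 2 + real m + 1)) * beta_int l m t
     = (- 1) ^ l * (of_real (Gamma (t / 2 + 1) * Gamma (t / 2 + real (l + m) + 1)) * beta_int 0 (l + m) t)"
proof (induction l arbitrary: m)
  case 0 then show ?case by simp
next
  case (Suc l)
  have g: "Gamma (x + 1) = x * Gamma x" if "x > 0" for x :: real
    using that by (intro Gamma_plus1) (auto elim!: nonpos_Ints_cases)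
  have g1: "Gamma (t / 2 + real (Suc l) + 1) = (real l + 1 + t / 2) * Gamma (t / 2 + real l + 1)"
    using g[of "t / 2 + real l + 1"] t by (simp add: add_ac)
  have g2: "Gamma (t / 2 + real (Suc m) + 1) = (real m + 1 + t / 2) * Gamma (t / 2 + real m + 1)"
    using g[of "t / 2 + real m + 1"] t by (simp add: add_ac)
  have "of_real (Gamma (t / 2 + real (Suc l) + 1) * Gamma (t / 2 + real m + 1)) * beta_int (Suc l) m t
     = of_real (Gamma (t / 2 + real l + 1) * Gamma (t / 2 + real m + 1)) * (of_real (real l + 1 + t / 2) * beta_int (l + 1) m t)"
    unfolding g1 of_real_mult by (simp only: mult_ac Suc_eq_plus1)
  also have "\<dots> = - (of_real (Gamma (t / 2 + real l + 1) * Gamma (t / 2 + real (Suc m) + 1)) * beta_int l (Suc m) t)"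
    unfolding beta_int_rec[OF less_imp_le[OF t]] g2 of_real_mult mult_minus_right by (simp only: mult_ac Suc_eq_plus1)
  also have "\<dots> = - ((- 1) ^ l * (of_real (Gamma (t / 2 + 1) * Gamma (t / 2 + real (l + Suc m) + 1)) * beta_int 0 (l + Suc m) t))"
    unfolding Suc.IH ..
  also have "\<dots> = (- 1) ^ Suc l * (of_real (Gamma (t / 2 + 1) * Gamma (t / 2 + real (Suc l + m) + 1)) * beta_int 0 (Suc l + m) t)"
    by simp
  finally show ?case .
qed

text \<open>
  For a zero vector the value is \<open>0\<close>, because \<open>inverse 0 = 0\<close>; hence the sums below may run over entire cosets.
\<close>

definition kern :: "nat \<Rightarrow> nat \<Rightarrow> real \<Rightarrow> rat \<times> rat \<Rightarrow> rat \<times> rat \<Rightarrow> complex \<Rightarrow> complex" where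
  "kern l m t p q z = inverse (lin p z) ^ (l + 1) * inverse (lin q z) ^ (m + 1) *
     of_real ((cmod (lin p z) * cmod (lin q z)) powr - t * Im z powr t)"

text \<open>It depends on the pair only through the determinant, which is the same for the three
  pairs of a triple.\<close>

definition chart_const :: "nat \<Rightarrow> real \<Rightarrow> rat \<times> rat \<Rightarrow> rat \<times> rat \<Rightarrow> complex" where
  "chart_const w t p q = of_real (\<bar>det2 p q\<bar> powr - t * \<bar>det2 p q\<bar> * inverse \<bar>det2 p q\<bar> ^ (w + 2)) * of_real (- sgn (det2 p q)) ^ (w + 1)"

text \<open>Substituting \<open>q(z) = - e * \<zeta> * p(z)\<close> and
  \<open>y = Im \<zeta> * |p(z)|^2 / |det|\<close> cancels the conjugates of \<open>p(z)\<close>,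
  and \<open>\<zeta> = exp \<rho> * (u + i)\<close> splits off the powers of \<open>u + i\<close>
  and \<open>u - i\<close>. What remains is \<open>F * p^m * q^l\<close> times the derivative of the
  curve in \<open>\<rho>\<close>, which is the product of the last two factors. The exponents
  \<open>l\<close> and \<open>m\<close> have changed places.\<close>

lemma kern_chart:
  assumes D: "det2 p q \<noteq> 0" and k: "k = l + m + 2"
  defines "z \<equiv> \<lambda>u \<rho>. chart p q (geo u \<rho>)"
  shows "F * cnj (kern l m t p q (z u \<rho>)) * of_real (Im (z u \<rho>) ^ k) =
     chart_const (l + m) t p q * beta_kernel l m t u *
     (F * lin p (z u \<rho>) ^ m * lin q (z u \<rho>) ^ l * (lin p (z u \<rho>) ^ 2 / of_real \<bar>det2 p q\<bar>) * geo u \<rho>)"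
proof -
  define \<eta> where "\<eta> = exp \<rho>"
  define X where "X = complex_of_real u + \<i>"
  define \<Delta> where "\<Delta> = \<bar>det2 p q\<bar>"
  define w where "w = lin p (z u \<rho>)"
  define E where "E = complex_of_real (- sgn (det2 p q))"
  have \<zeta>: "Im (geo u \<rho>) > 0" by simp
  note cf = chart_facts[OF D \<zeta>, folded z_def]
  have \<eta>: "\<eta> > 0" by (simp add: \<eta>_def)
  have \<Delta>: "\<Delta> > 0" using D by (simp add: \<Delta>_def)
  have X0: "X \<noteq> 0" "cnj X \<noteq> 0" using real_pm_i_nonzero[of u] by (auto simp: X_def)
  have Xc: "cnj X = of_real u - \<i>" by (simp add: X_def)
  have EE: "E * E = 1" using D by (simp add: E_def sgn_if)
  have E0: "E \<noteq> 0" using EE by auto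
  have Ei: "inverse E = E" using EE by (metis inverse_unique)
  have cE: "cnj E = E" by (simp add: E_def)
  have w0: "w \<noteq> 0" "cnj w \<noteq> 0" using lin_chart_nonzero[OF D \<zeta>] by (auto simp: w_def z_def)
  have g: "geo u \<rho> = of_real \<eta> * X" by (simp add: geo_def \<eta>_def X_def)
  have wq: "lin q (z u \<rho>) = E * (of_real \<eta> * X) * w" unfolding E_def w_def g[symmetric] z_def using chart_facts(3)[OF D \<zeta>] by simp
  have y: "Im (z u \<rho>) = \<eta> * cmod w ^ 2 / \<Delta>" unfolding z_def w_def \<Delta>_def \<eta>_def using chart_facts(4)[OF D \<zeta>] by simp
  have cX: "cmod X = (1 + u\<^sup>2) powr (1 / 2)" by (simp add: X_def cmod_real_pm_i powr_half_sqrt)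
  \<comment> \<open>The whole dependence on \<open>t\<close>: the powers of
    \<open>exp \<rho>\<close> and of \<open>|p(z)|\<close> cancel, and only \<open>u\<close> and the
    determinant are left.\<close>
  have real: "(cmod w * cmod (E * (of_real \<eta> * X) * w)) powr - t * (\<eta> * cmod w ^ 2 / \<Delta>) powr t = (1 + u\<^sup>2) powr (- t / 2) * \<Delta> powr - t"
  proof -
    have "cmod E = 1" using D by (cases "det2 p q > 0") (simp_all add: E_def)
    then have "cmod w * cmod (E * (of_real \<eta> * X) * w) = (\<eta> * cmod w ^ 2) * cmod X"
      using \<eta> by (simp add: norm_mult power2_eq_square)
    moreover have "((\<eta> * cmod w ^ 2) * cmod X) powr - t = (\<eta> * cmod w ^ 2) powr - t * cmod X powr - t"
      using \<eta> by (simp add: powr_mult)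
    moreover have "(\<eta> * cmod w ^ 2 / \<Delta>) powr t = (\<eta> * cmod w ^ 2) powr t * \<Delta> powr - t"
      using \<eta> \<Delta> by (simp add: powr_divide powr_minus_divide)
    moreover have "(\<eta> * cmod w ^ 2) powr - t * (\<eta> * cmod w ^ 2) powr t = 1"
      using \<eta> w0 by (simp add: powr_add[symmetric])
    moreover have "cmod X powr - t = (1 + u\<^sup>2) powr (- t / 2)" unfolding cX powr_powr by simp
    moreover have "(a * x) * (b * d) = (a * b) * (x * d)" for a x b d :: real by (simp only: mult_ac)
    ultimately show ?thesis by simp
  qed
  define R where "R = complex_of_real ((1 + u\<^sup>2) powr (- t / 2))"
  define T where "T = complex_of_real (\<Delta> powr - t)"
  have ck: "cnj (kern l m t p q (z u \<rho>)) = inverse (cnj w) ^ (l + 1) * inverse (E * (of_real \<eta> * cnj X) * cnj w) ^ (m + 1) * (R * T)"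
    unfolding kern_def wq y w_def[symmetric] real R_def T_def by (simp add: cE)
  have iy: "complex_of_real (Im (z u \<rho>) ^ k) = (of_real \<eta> * (w * cnj w) / of_real \<Delta>) ^ k"
    unfolding y by (simp add: complex_norm_square[symmetric])
  have cc: "chart_const (l + m) t p q = T * of_real \<Delta> * inverse (of_real \<Delta>) ^ k * E ^ (l + m + 1)"
    by (simp add: chart_const_def T_def \<Delta>_def E_def k)
  have bk: "beta_kernel l m t u = inverse X ^ (l + 1) * inverse (cnj X) ^ (m + 1) * R"
    by (simp add: beta_kernel_def X_def R_def)
  have alg: "F * (inverse wc ^ (l + 1) * inverse (E * (H * Xc) * wc) ^ (m + 1) * (R * T)) * (H * (w * wc) / d) ^ k
     = (T * d * inverse d ^ k * E ^ (l + m + 1)) * (inverse X ^ (l + 1) * inverse Xc ^ (m + 1) * R) *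
       (F * w ^ m * (E * (H * X) * w) ^ l * (w ^ 2 / d) * (H * X))"
    if nz: "wc \<noteq> 0" "H \<noteq> 0" "Xc \<noteq> 0" "d \<noteq> 0" for wc H Xc d :: complex
  proof -
    have e1: "E ^ (l + m + 1) * E ^ l = E ^ (m + 1)"
    proof -
      have "E ^ (l + m + 1) * E ^ l = (E * E) ^ l * E ^ (m + 1)" by (simp add: power_mult_distrib power_add)
      then show ?thesis by (simp add: EE)
    qed
    have i1: "inverse (E * (H * Xc) * wc) ^ (m + 1) = E ^ (m + 1) * inverse H ^ (m + 1) * inverse Xc ^ (m + 1) * inverse wc ^ (m + 1)"
      by (simp only: inverse_mult_distrib power_mult_distrib Ei mult_ac)
    have "F * (inverse wc ^ (l + 1) * inverse (E * (H * Xc) * wc) ^ (m + 1) * (R * T)) * (H * (w * wc) / d) ^ k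
      = F * R * T * E ^ (m + 1) * inverse Xc ^ (m + 1) * inverse d ^ k * w ^ k * (inverse H ^ (m + 1) * H ^ k) * (inverse wc ^ (l + 1) * inverse wc ^ (m + 1) * wc ^ k)"
      unfolding i1 divide_inverse power_mult_distrib by (simp only: mult_ac)
    also have "inverse wc ^ (l + 1) * inverse wc ^ (m + 1) * wc ^ k = 1"
      using nz by (simp add: k power_add power_inverse field_simps power2_eq_square)
    also have "inverse H ^ (m + 1) * H ^ k = H ^ (l + 1)"
      using nz by (simp add: k power_add power_inverse field_simps power2_eq_square)
    finally have L: "F * (inverse wc ^ (l + 1) * inverse (E * (H * Xc) * wc) ^ (m + 1) * (R * T)) * (H * (w * wc) / d) ^ k
      = F * R * T * E ^ (m + 1) * inverse Xc ^ (m + 1) * inverse d ^ k * w ^ k * H ^ (l + 1)" by simp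
    have "(T * d * inverse d ^ k * E ^ (l + m + 1)) * (inverse X ^ (l + 1) * inverse Xc ^ (m + 1) * R) *
       (F * w ^ m * (E * (H * X) * w) ^ l * (w ^ 2 / d) * (H * X))
      = F * R * T * (E ^ (l + m + 1) * E ^ l) * inverse Xc ^ (m + 1) * inverse d ^ k * (w ^ m * w ^ l * w ^ 2) * (H ^ l * H) * (inverse X ^ (l + 1) * (X ^ l * X)) * (d * inverse d)"
      unfolding divide_inverse power_mult_distrib by (simp only: mult_ac)
    also have "inverse X ^ (l + 1) * (X ^ l * X) = 1" using X0 by (simp add: power_inverse field_simps)
    also have "d * inverse d = 1" using nz by simp
    also have "w ^ m * w ^ l * w ^ 2 = w ^ k" by (simp add: k power_add power2_eq_square mult_ac)
    also have "H ^ l * H = H ^ (l + 1)" by simp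
    finally show ?thesis unfolding L e1 by simp
  qed
  show ?thesis
    unfolding ck iy cc bk wq w_def[symmetric] g \<Delta>_def[symmetric]
    by (rule alg) (use w0 \<eta> X0 \<Delta> in auto)
qed

section \<open>Line integrals between cusps\<close>

lemma convex_upper_half_plane: "convex upper_half_plane"
  unfolding upper_half_plane_def by (rule convex_halfspace_Im_gt)

lemma upper_primitive_exists:
  assumes "g holomorphic_on upper_half_plane"
  obtains P where "\<And>z. Im z > 0 \<Longrightarrow> (P has_field_derivative g z) (at z)"
  using holomorphic_convex_primitive'[OF convex_upper_half_plane open_upper_half_plane assms]
  by (metis at_within_open mem_Collect_eq open_upper_half_plane upper_half_plane_def)

lemma cusp_form_isCont:
  assumes "cusp_form N k f" "Im z > 0"
  shows "isCont f z"
  using assms holomorphic_on_imp_continuous_on[of f upper_half_plane] open_upper_half_plane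
  by (auto simp: cusp_form_def continuous_on_eq_continuous_at upper_half_plane_def)

text \<open>For almost every \<open>u\<close> the inner integral over \<open>\<rho>\<close> is that
  of a derivative along a curve from the cusp of \<open>q\<close> to the cusp of \<open>p\<close>.
  Its value does not depend on \<open>u\<close>, so the outer integral is the beta integral.\<close>

lemma nondeg_monomial:
  assumes f: "cusp_form N k f" and k: "k = l + m + 2" and D: "det2 p q \<noteq> 0" and t: "t \<ge> 0"
    and fm: "f \<in> borel_measurable borel"
    and P: "\<And>z. Im z > 0 \<Longrightarrow> (P has_field_derivative f z * lin p z ^ m * lin q z ^ l) (at z)"
    and Lp: "cusp_lim p P Lp" and Lq: "cusp_lim q P Lq"
    and int: "integrable hyp (\<lambda>z. f z * cnj (kern l m t p q z) * of_real (Im z ^ k))"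
  shows "(\<integral>z. f z * cnj (kern l m t p q z) * of_real (Im z ^ k) \<partial>hyp) = chart_const (l + m) t p q * beta_int l m t * (Lp - Lq)"
proof -
  note [measurable] = fm
  define h where "h z = f z * cnj (kern l m t p q z) * of_real (Im z ^ k)" for z
  have hm: "h \<in> borel_measurable borel" unfolding h_def kern_def by measurable
  note inv = chart_hyp_invariant[OF D]
  have hi: "integrable hyp (\<lambda>z. h (chart p q z))"
    using int[folded h_def] hyp_invariant_integral(2)[OF inv hm] by blast
  define G where "G u \<rho> = f (chart p q (geo u \<rho>)) * lin p (chart p q (geo u \<rho>)) ^ m * lin q (chart p q (geo u \<rho>)) ^ l * (lin p (chart p q (geo u \<rho>)) ^ 2 / of_real \<bar>det2 p q\<bar>) * geo u \<rho>" for u \<rho>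
  define c where "c = chart_const (l + m) t p q"
  have c0: "c \<noteq> 0" using D by (simp add: c_def chart_const_def sgn_zero_iff)
  have hG: "h (chart p q (geo u \<rho>)) = c * beta_kernel l m t u * G u \<rho>" for u \<rho>
    unfolding h_def G_def c_def by (rule kern_chart[OF D k])
  have GI: "(\<integral>\<rho>. G u \<rho> \<partial>lborel) = Lp - Lq" if "integrable lborel (\<lambda>\<rho>. h (chart p q (geo u \<rho>)))" for u
  proof (rule integral_FTC_UNIV)
    fix \<rho>
    have dg: "((\<lambda>\<rho>. geo u \<rho>) has_vector_derivative geo u \<rho>) (at \<rho>)"
    proof -
      have "((\<lambda>\<rho>. complex_of_real (exp \<rho>)) has_vector_derivative of_real (exp \<rho>)) (at \<rho>)"
        by (rule has_vector_derivative_of_real) (simp add: has_real_derivative_iff_has_vector_derivative[symmetric] DERIV_exp)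
      then show ?thesis unfolding geo_def[abs_def] by (rule has_vector_derivative_mult_left)
    qed
    have i: "Im (geo u \<rho>) > 0" by simp
    have "((P \<circ> (chart p q \<circ> geo u)) has_vector_derivative
        geo u \<rho> * (lin p (chart p q (geo u \<rho>)) ^ 2 / of_real \<bar>det2 p q\<bar>) * (f (chart p q (geo u \<rho>)) * lin p (chart p q (geo u \<rho>)) ^ m * lin q (chart p q (geo u \<rho>)) ^ l)) (at \<rho>)"
      by (intro field_vector_diff_chain_at dg chart_facts(5)[OF D i]) (use P[OF Im_chart_pos[OF D i]] in \<open>simp add: o_def\<close>)
    then show "((\<lambda>\<rho>. P (chart p q (geo u \<rho>))) has_vector_derivative G u \<rho>) (at \<rho>)"
      unfolding G_def o_def by (simp only: mult_ac)
    have cg: "isCont (\<lambda>\<rho>. geo u \<rho>) \<rho>" unfolding geo_def by (intro continuous_intros)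
    have cc: "isCont (\<lambda>\<rho>. chart p q (geo u \<rho>)) \<rho>"
      by (rule isCont_o2[OF cg DERIV_isCont[OF chart_facts(5)[OF D i]]])
    have cf: "isCont (\<lambda>\<rho>. f (chart p q (geo u \<rho>))) \<rho>"
      by (rule isCont_o2[OF cc cusp_form_isCont[OF f Im_chart_pos[OF D i]]])
    show "isCont (G u) \<rho>"
      unfolding G_def[abs_def] lin_def using D by (intro continuous_intros cg cc cf) auto
  next
    \<comment> \<open>The beta kernel has no zeros, so integrability passes from the full integrand
      to the line integrand by division.\<close>
    have "integrable lborel (\<lambda>\<rho>. inverse (c * beta_kernel l m t u) * h (chart p q (geo u \<rho>)))"
      by (rule integrable_mult_right[OF that])
    moreover have "inverse (c * beta_kernel l m t u) * h (chart p q (geo u \<rho>)) = G u \<rho>" for \<rho>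
    proof -
      have "inverse x * (x * y) = y" if "x \<noteq> 0" for x y :: complex using that by simp
      then show ?thesis unfolding hG using c0 beta_kernel_nonzero[of l m t u] by (metis mult_eq_0_iff)
    qed
    ultimately show "integrable lborel (G u)" by simp
    show "((\<lambda>\<rho>. P (chart p q (geo u \<rho>))) \<longlongrightarrow> Lq) at_bot" by (rule cusp_lim_at_bot[OF D Lq])
    show "((\<lambda>\<rho>. P (chart p q (geo u \<rho>))) \<longlongrightarrow> Lp) at_top" by (rule Lp[unfolded cusp_lim_def, rule_format, OF D])
  qed
  have "(\<integral>z. h z \<partial>hyp) = (\<integral>z. h (chart p q z) \<partial>hyp)" by (rule hyp_invariant_integral(1)[OF inv hm, symmetric])
  also have "\<dots> = (\<integral>u. (\<integral>\<rho>. h (chart p q (geo u \<rho>)) \<partial>lborel) \<partial>lborel)" by (rule integral_hyp_geo(1)[OF hi])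
  also have "\<dots> = (\<integral>u. c * beta_kernel l m t u * (Lp - Lq) \<partial>lborel)"
  proof (rule integral_cong_AE)
    show "AE u in lborel. (\<integral>\<rho>. h (chart p q (geo u \<rho>)) \<partial>lborel) = c * beta_kernel l m t u * (Lp - Lq)"
      using integral_hyp_geo(2)[OF hi]
    proof eventually_elim
      case (elim u)
      show ?case unfolding GI[OF elim, symmetric] unfolding hG by (simp add: mult.assoc)
    qed
    show "(\<lambda>u. \<integral>\<rho>. h (chart p q (geo u \<rho>)) \<partial>lborel) \<in> borel_measurable lborel"
      using integral_hyp_geo(4)[OF hi] by (rule borel_measurable_integrable)
    show "(\<lambda>u. c * beta_kernel l m t u * (Lp - Lq)) \<in> borel_measurable lborel"
      using borel_measurable_integrable[OF beta_kernel_integrable[OF t]] by simp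
  qed
  also have "\<dots> = c * beta_int l m t * (Lp - Lq)" unfolding beta_int_def by simp
  finally show ?thesis by (simp add: h_def c_def)
qed

text \<open>The Gamma factors are at once those that complete the two Eisenstein series and those
  that make the beta integrals agree up to sign.\<close>

definition pair_kern :: "nat \<Rightarrow> complex \<Rightarrow> complex \<Rightarrow> real \<Rightarrow> rat \<times> rat \<Rightarrow> rat \<times> rat \<Rightarrow> complex \<Rightarrow> complex" where
  "pair_kern w a b t p q z = (\<Sum>l\<le>w. of_nat (w choose l) * cnj a ^ l * cnj b ^ (w - l) *
     of_real (Gamma (t / 2 + real l + 1) * Gamma (t / 2 + real (w - l) + 1)) * kern l (w - l) t p q z)"

lemma holomorphic_lin: "lin p holomorphic_on S"
  unfolding lin_def by (intro holomorphic_intros)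

lemma det2_nonzeroD:
  assumes "det2 p q \<noteq> 0"
  shows "p \<noteq> (0, 0)" "q \<noteq> (0, 0)"
  using assms by (auto simp: det2_def)

text \<open>The sign \<open>(- 1)^l\<close> of the beta integrals turns \<open>a^l\<close> into
  \<open>(- a)^l\<close>, as the expansion of \<open>(b p - a q)^w\<close> requires. Primitives of
  the monomials are chosen independently; their combination differs from \<open>P\<close> by a
  constant, which drops out of \<open>Lp - Lq\<close>.\<close>

lemma nondeg_pair:
  assumes f: "cusp_form N k f" and N: "N \<ge> 1" and k: "k = w + 2" and D: "det2 p q \<noteq> 0" and t: "t > 0"
    and fm: "f \<in> borel_measurable borel"
    and P: "\<And>z. Im z > 0 \<Longrightarrow> (P has_field_derivative f z * (b * lin p z - a * lin q z) ^ w) (at z)"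
    and Lp: "cusp_lim p P Lp" and Lq: "cusp_lim q P Lq"
    and int: "\<And>l. l \<le> w \<Longrightarrow> integrable hyp (\<lambda>z. f z * cnj (kern l (w - l) t p q z) * of_real (Im z ^ k))"
  shows "(\<integral>z. f z * cnj (pair_kern w a b t p q z) * of_real (Im z ^ k) \<partial>hyp)
    = chart_const w t p q * (of_real (Gamma (t / 2 + 1) * Gamma (t / 2 + real w + 1)) * beta_int 0 w t) * (Lp - Lq)"
proof -
  define \<beta> where "\<beta> = of_real (Gamma (t / 2 + 1) * Gamma (t / 2 + real w + 1)) * beta_int 0 w t"
  define c where "c = chart_const w t p q"
  note pq = det2_nonzeroD[OF D]
  have fh: "f holomorphic_on upper_half_plane" using f by (simp add: cusp_form_def)
  have "\<exists>Pl Lpl Lql. (\<forall>z. Im z > 0 \<longrightarrow> (Pl has_field_derivative f z * lin p z ^ (w - l) * lin q z ^ l) (at z)) \<and> cusp_lim p Pl Lpl \<and> cusp_lim q Pl Lql"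
    if l: "l \<le> w" for l
  proof -
    obtain Pl where Pl: "\<And>z. Im z > 0 \<Longrightarrow> (Pl has_field_derivative f z * lin p z ^ (w - l) * lin q z ^ l) (at z)"
      by (rule upper_primitive_exists[of "\<lambda>z. f z * lin p z ^ (w - l) * lin q z ^ l"])
        (auto intro!: holomorphic_intros fh holomorphic_lin)
    have k': "k = (w - l) + l + 2" using k l by simp
    obtain L1 where "cusp_lim p Pl L1"
      by (rule cusp_lim_exists[OF f N k' pq(1) Pl[unfolded lin_def]])
    moreover obtain L2 where "cusp_lim q Pl L2"
      by (rule cusp_lim_exists[OF f N k' pq(2) Pl[unfolded lin_def]])
    ultimately show ?thesis using Pl by blast
  qed
  then obtain Pl Lpl Lql where Pl: "\<And>l z. l \<le> w \<Longrightarrow> Im z > 0 \<Longrightarrow> (Pl l has_field_derivative f z * lin p z ^ (w - l) * lin q z ^ l) (at z)"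
    and Ll: "\<And>l. l \<le> w \<Longrightarrow> cusp_lim p (Pl l) (Lpl l)" "\<And>l. l \<le> w \<Longrightarrow> cusp_lim q (Pl l) (Lql l)"
    by metis
  define co where "co l = of_nat (w choose l) * (- a) ^ l * b ^ (w - l)" for l
  define S where "S z = (\<Sum>l\<le>w. co l * Pl l z)" for z
  have Sd: "(S has_field_derivative f z * (b * lin p z - a * lin q z) ^ w) (at z)" if z: "Im z > 0" for z
  proof -
    have "(S has_field_derivative (\<Sum>l\<le>w. co l * (f z * lin p z ^ (w - l) * lin q z ^ l))) (at z)"
      unfolding S_def[abs_def] by (intro DERIV_sum DERIV_cmult Pl z) auto
    also have "(\<Sum>l\<le>w. co l * (f z * lin p z ^ (w - l) * lin q z ^ l)) = f z * (\<Sum>l\<le>w. of_nat (w choose l) * (- a * lin q z) ^ l * (b * lin p z) ^ (w - l))"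
      unfolding sum_distrib_left co_def power_mult_distrib by (rule sum.cong) (simp_all only: mult_ac)
    also have "(\<Sum>l\<le>w. of_nat (w choose l) * (- a * lin q z) ^ l * (b * lin p z) ^ (w - l)) = (- a * lin q z + b * lin p z) ^ w"
      by (rule binomial_ring[symmetric])
    also have "- a * lin q z + b * lin p z = b * lin p z - a * lin q z" by simp
    finally show ?thesis .
  qed
  obtain K where K: "\<And>z. Im z > 0 \<Longrightarrow> S z = P z + K"
  proof -
    have "\<exists>K. \<forall>z\<in>upper_half_plane. S z - P z = K"
    proof (rule has_field_derivative_zero_constant[OF convex_upper_half_plane])
      fix z assume "z \<in> upper_half_plane"
      then have z: "Im z > 0" by (simp add: upper_half_plane_def)
      show "((\<lambda>z. S z - P z) has_field_derivative 0) (at z within upper_half_plane)"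
        using DERIV_diff[OF Sd[OF z] P[OF z]] by (auto intro: has_field_derivative_at_within)
    qed
    then obtain K where "\<And>z. Im z > 0 \<Longrightarrow> S z - P z = K" by (auto simp: upper_half_plane_def)
    then show ?thesis by (intro that[of K]) (simp add: algebra_simps eq_diff_eq[symmetric])
  qed
  have lims: "cusp_lim r S (\<Sum>l\<le>w. co l * Ll' l)" if "\<And>l. l \<le> w \<Longrightarrow> cusp_lim r (Pl l) (Ll' l)" for r Ll'
    unfolding cusp_lim_def S_def
  proof (intro allI impI tendsto_sum tendsto_mult tendsto_const)
    fix q u l assume "det2 r q \<noteq> 0" "l \<in> {..w}"
    then show "((\<lambda>\<rho>. Pl l (chart r q (geo u \<rho>))) \<longlongrightarrow> Ll' l) at_top"
      using that[of l, unfolded cusp_lim_def, rule_format] by simp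
  qed
  have limP: "cusp_lim r S (L + K)" if "cusp_lim r P L" for r L
    unfolding cusp_lim_def
  proof (intro allI impI)
    fix q u assume D': "det2 r q \<noteq> 0"
    have "((\<lambda>\<rho>. P (chart r q (geo u \<rho>)) + K) \<longlongrightarrow> L + K) at_top"
      using that[unfolded cusp_lim_def, rule_format, OF D'] by (intro tendsto_intros)
    then show "((\<lambda>\<rho>. S (chart r q (geo u \<rho>))) \<longlongrightarrow> L + K) at_top"
      using K[OF Im_chart_pos[OF D']] by simp
  qed
  have D'': "det2 q p \<noteq> 0" using D by (simp add: det2_swap[where p = p and q = q])
  have s1: "(\<Sum>l\<le>w. co l * Lpl l) = Lp + K"
    by (rule cusp_lim_unique[OF lims[of p Lpl, OF Ll(1)] limP[OF Lp] D])
  have s2: "(\<Sum>l\<le>w. co l * Lql l) = Lq + K"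
    by (rule cusp_lim_unique[OF lims[of q Lql, OF Ll(2)] limP[OF Lq] D''])
  define g where "g l = (Gamma (t / 2 + real l + 1) * Gamma (t / 2 + real (w - l) + 1))" for l
  have eq: "f z * cnj (pair_kern w a b t p q z) * of_real (Im z ^ k)
     = (\<Sum>l\<le>w. (of_nat (w choose l) * a ^ l * b ^ (w - l) * complex_of_real (g l)) * (f z * cnj (kern l (w - l) t p q z) * of_real (Im z ^ k)))" for z
    unfolding pair_kern_def cnj_sum sum_distrib_left sum_distrib_right g_def
    by (rule sum.cong) (simp_all add: mult_ac)
  have "(\<integral>z. f z * cnj (pair_kern w a b t p q z) * of_real (Im z ^ k) \<partial>hyp)
     = (\<Sum>l\<le>w. (of_nat (w choose l) * a ^ l * b ^ (w - l) * complex_of_real (g l)) * (\<integral>z. f z * cnj (kern l (w - l) t p q z) * of_real (Im z ^ k) \<partial>hyp))"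
    unfolding eq using int by (subst Bochner_Integration.integral_sum) auto
  also have "\<dots> = (\<Sum>l\<le>w. c * \<beta> * (co l * Lpl l - co l * Lql l))"
  proof (rule sum.cong[OF refl])
    fix l assume "l \<in> {..w}"
    then have l: "l \<le> w" by simp
    have k': "k = l + (w - l) + 2" and lw: "l + (w - l) = w" using k l by simp_all
    have m: "(\<integral>z. f z * cnj (kern l (w - l) t p q z) * of_real (Im z ^ k) \<partial>hyp) = c * beta_int l (w - l) t * (Lpl l - Lql l)"
      using nondeg_monomial[OF f k' D less_imp_le[OF t] fm Pl[OF l] Ll(1)[OF l] Ll(2)[OF l] int[OF l]]
      unfolding lw c_def .
    have B: "complex_of_real (g l) * beta_int l (w - l) t = (- 1) ^ l * \<beta>"
      using beta_int_Gamma[OF t, of l "w - l"] unfolding lw g_def \<beta>_def by simp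
    have "(of_nat (w choose l) * a ^ l * b ^ (w - l) * complex_of_real (g l)) * (c * beta_int l (w - l) t * (Lpl l - Lql l))
      = of_nat (w choose l) * a ^ l * b ^ (w - l) * c * (complex_of_real (g l) * beta_int l (w - l) t) * (Lpl l - Lql l)"
      by (simp only: mult_ac)
    also have "\<dots> = c * \<beta> * ((of_nat (w choose l) * ((- 1) ^ l * a ^ l) * b ^ (w - l)) * (Lpl l - Lql l))"
      unfolding B by (simp only: mult_ac)
    also have "(- 1) ^ l * a ^ l = (- a) ^ l" by (simp flip: power_mult_distrib)
    also have "(of_nat (w choose l) * (- a) ^ l * b ^ (w - l)) * (Lpl l - Lql l) = co l * Lpl l - co l * Lql l"
      by (simp only: co_def right_diff_distrib)
    finally show "(of_nat (w choose l) * a ^ l * b ^ (w - l) * complex_of_real (g l)) * (\<integral>z. f z * cnj (kern l (w - l) t p q z) * of_real (Im z ^ k) \<partial>hyp)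
       = c * \<beta> * (co l * Lpl l - co l * Lql l)" unfolding m .
  qed
  also have "\<dots> = c * \<beta> * ((Lp + K) - (Lq + K))"
    unfolding sum_distrib_left[symmetric] sum_subtractf s1 s2 ..
  also have "\<dots> = c * \<beta> * (Lp - Lq)" by simp
  finally show ?thesis by (simp add: c_def \<beta>_def)
qed

lemma lin_add: "lin (p + q) z = lin p z + lin q z"
  by (simp add: lin_def of_rat_add distrib_right)

lemma lin_uminus: "lin (- p) z = - lin p z"
  by (simp add: lin_def of_rat_minus)

text \<open>
  The three integrals share the primitive of \<open>f(z) (b p(z) - a q(z))\<^sup>w\<close>, and its values at the
  cusps of \<open>p\<close>, \<open>q\<close>, \<open>r\<close> telescope.
\<close>

lemma nondeg_triple:
  assumes f: "cusp_form N k f" and N: "N \<ge> 1" and k: "k = w + 2" and D: "det2 p q \<noteq> 0" and t: "t > 0"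
    and fm: "f \<in> borel_measurable borel" and abc: "a + b + c = 0" and r: "r = - p - q"
    and int: "\<And>l. l \<le> w \<Longrightarrow> integrable hyp (\<lambda>z. f z * cnj (kern l (w - l) t p q z) * of_real (Im z ^ k))"
      "\<And>l. l \<le> w \<Longrightarrow> integrable hyp (\<lambda>z. f z * cnj (kern l (w - l) t q r z) * of_real (Im z ^ k))"
      "\<And>l. l \<le> w \<Longrightarrow> integrable hyp (\<lambda>z. f z * cnj (kern l (w - l) t r p z) * of_real (Im z ^ k))"
  shows "(\<integral>z. f z * cnj (pair_kern w a b t p q z) * of_real (Im z ^ k) \<partial>hyp)
    + (\<integral>z. f z * cnj (pair_kern w b c t q r z) * of_real (Im z ^ k) \<partial>hyp)
    + (\<integral>z. f z * cnj (pair_kern w c a t r p z) * of_real (Im z ^ k) \<partial>hyp) = 0"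
proof -
  have d1: "det2 q r = det2 p q" and d2: "det2 r p = det2 p q"
  proof -
    have "of_rat (fst r) = - of_rat (fst p) - (of_rat (fst q) :: real)" "of_rat (snd r) = - of_rat (snd p) - (of_rat (snd q) :: real)"
      by (simp_all only: r fst_diff snd_diff fst_uminus snd_uminus of_rat_diff of_rat_minus)
    then show "det2 q r = det2 p q" "det2 r p = det2 p q"
      by (simp_all only: det2_eq left_diff_distrib right_diff_distrib mult_minus_left mult_minus_right)
  qed
  have D1: "det2 q r \<noteq> 0" and D2: "det2 r p \<noteq> 0" using D d1 d2 by auto
  have lr: "lin r z = - lin p z - lin q z" for z
    unfolding r using lin_add[of "- p" "- q" z] by (simp add: lin_uminus)
  have c: "c = - a - b" using abc by (simp add: eq_neg_iff_add_eq_0 algebra_simps)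
  \<comment> \<open>The cyclic invariance: with \<open>c = - a - b\<close> and
    \<open>r = - p - q\<close> the three linear forms coincide identically.\<close>
  have e1: "c * lin q z - b * lin r z = b * lin p z - a * lin q z" for z unfolding lr c by (simp add: algebra_simps)
  have e2: "a * lin r z - c * lin p z = b * lin p z - a * lin q z" for z unfolding lr c by (simp add: algebra_simps)
  have fh: "f holomorphic_on upper_half_plane" using f by (simp add: cusp_form_def)
  obtain P where P: "\<And>z. Im z > 0 \<Longrightarrow> (P has_field_derivative f z * (b * lin p z - a * lin q z) ^ w) (at z)"
    by (rule upper_primitive_exists[of "\<lambda>z. f z * (b * lin p z - a * lin q z) ^ w"])
      (auto intro!: holomorphic_intros fh holomorphic_lin)
  \<comment> \<open>Brought to the shape of \<open>cusp_lim_exists\<close> with a trivial second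
    factor, whose value is \<open>0 ^ 0 = 1\<close>.\<close>
  have P': "(P has_field_derivative f z * ((b * of_rat (fst p) - a * of_rat (fst q)) * z + (b * of_rat (snd p) - a * of_rat (snd q))) ^ w * (0 * z + 0) ^ 0) (at z)" if "Im z > 0" for z
    using P[OF that] by (simp add: lin_def algebra_simps)
  have k': "k = w + 0 + 2" using k by simp
  obtain Lp where Lp: "cusp_lim p P Lp" by (rule cusp_lim_exists[OF f N k' det2_nonzeroD(1)[OF D] P'])
  obtain Lq where Lq: "cusp_lim q P Lq" by (rule cusp_lim_exists[OF f N k' det2_nonzeroD(2)[OF D] P'])
  obtain Lr where Lr: "cusp_lim r P Lr" by (rule cusp_lim_exists[OF f N k' det2_nonzeroD(2)[OF D1] P'])
  have cc: "chart_const w t q r = chart_const w t p q" "chart_const w t r p = chart_const w t p q"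
    by (simp_all add: chart_const_def d1 d2)
  note n1 = nondeg_pair[OF f N k D t fm P Lp Lq int(1)]
  note n2 = nondeg_pair[OF f N k D1 t fm P[folded e1] Lq Lr int(2), unfolded cc]
  note n3 = nondeg_pair[OF f N k D2 t fm P[folded e2] Lr Lp int(3), unfolded cc]
  have "X * (Lp - Lq) + X * (Lq - Lr) + X * (Lr - Lp) = 0" for X by (simp add: algebra_simps)
  then show ?thesis by (simp only: n1 n2 n3)
qed

section \<open>Orbits of collinear pairs\<close>

definition upper_unip :: "int \<Rightarrow> int ^ 2 ^ 2" where
  "upper_unip n = mk2 1 n 0 1"

lemma upper_unip_SL2Z: "upper_unip n \<in> SL2Z"
  by (simp add: SL2Z_iff upper_unip_def)

lemma upper_unip_0: "upper_unip 0 = mat 1"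
  by (rule matrix_2_eqI) (simp_all add: upper_unip_def mat_1_2)

lemma moebius_upper_unip: "moebius (upper_unip n) z = z + of_int n"
  by (simp add: moebius_def automorphy_factor_def upper_unip_def)

text \<open>The conjugate is \<open>1 + n X\<close> with an integral nilpotent matrix
  \<open>X\<close>, hence congruent to 1 modulo \<open>N\<close>, whatever the cusp.\<close>

lemma stabilizer_in_Gamma_N:
  assumes A: "A \<in> SL2Z" and n: "int N dvd n"
  shows "adj2 A ** (upper_unip n ** A) \<in> principal_congruence_subgroup N"
proof -
  obtain m where m: "n = int N * m" using n by blast
  have det: "A $ 1 $ 1 * A $ 2 $ 2 = 1 + A $ 1 $ 2 * A $ 2 $ 1" using A by (simp add: SL2Z_iff)
  have S: "adj2 A ** (upper_unip n ** A) \<in> SL2Z" by (intro SL2Z_mult SL2Z_adj2 A upper_unip_SL2Z)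
  have e: "(adj2 A ** (upper_unip n ** A)) $ 1 $ 1 - 1 = int N * (m * (A $ 2 $ 1 * A $ 2 $ 2))"
    "(adj2 A ** (upper_unip n ** A)) $ 1 $ 2 - 0 = int N * (m * (A $ 2 $ 2 * A $ 2 $ 2))"
    "(adj2 A ** (upper_unip n ** A)) $ 2 $ 1 - 0 = int N * (- m * (A $ 2 $ 1 * A $ 2 $ 1))"
    "(adj2 A ** (upper_unip n ** A)) $ 2 $ 2 - 1 = int N * (- m * (A $ 2 $ 1 * A $ 2 $ 2))"
    using det by (simp_all add: matrix_2_mult adj2_def upper_unip_def m algebra_simps)
  show ?thesis
    unfolding principal_congruence_subgroup_iff cong_iff_dvd_diff e using S by simp
qed

lemma act_stabilizer:
  assumes A: "A \<in> SL2Z" and p: "p = (\<kappa> * of_int (A $ 2 $ 1), \<kappa> * of_int (A $ 2 $ 2))"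
  shows "act p (adj2 A ** (upper_unip n ** A)) = p"
proof -
  have "p = act (0, \<kappa>) A" by (simp add: p act_def)
  then have "act p (adj2 A) = (0, \<kappa>)" by (simp add: act_adj2[OF A])
  moreover have "act (0, \<kappa>) (upper_unip n) = (0, \<kappa>)" by (simp add: act_def upper_unip_def)
  ultimately show ?thesis unfolding act_mult using \<open>p = act (0, \<kappa>) A\<close> by simp
qed

text \<open>Fixing \<open>p\<close> means that \<open>A E\<close> and \<open>A\<close> have the same
  bottom row. Both have determinant 1, so their top rows differ by a multiple \<open>n\<close> of
  the bottom row, and \<open>n\<close> is divisible by \<open>N\<close> because \<open>E\<close> is
  congruent to 1.\<close>

lemma stabilizer_Gamma_N:
  assumes A: "A \<in> SL2Z" and p: "p = (\<kappa> * of_int (A $ 2 $ 1), \<kappa> * of_int (A $ 2 $ 2))" and \<kappa>: "\<kappa> \<noteq> 0"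
    and E: "E \<in> principal_congruence_subgroup N" and fix_p: "act p E = p"
  obtains n where "int N dvd n" "A ** E = upper_unip n ** A"
proof -
  define a b c d where "a = A $ 1 $ 1" and "b = A $ 1 $ 2" and "c = A $ 2 $ 1" and "d = A $ 2 $ 2"
  have det: "a * d - b * c = 1" using A by (simp add: SL2Z_iff a_def b_def c_def d_def)
  have ES: "E $ 1 $ 1 * E $ 2 $ 2 - E $ 1 $ 2 * E $ 2 $ 1 = 1" using Gamma_N_SL2Z[OF E] by (simp add: SL2Z_iff)
  have "\<kappa> * of_int (c * E $ 1 $ 1 + d * E $ 2 $ 1) = \<kappa> * of_int c" "\<kappa> * of_int (c * E $ 1 $ 2 + d * E $ 2 $ 2) = \<kappa> * of_int d"
    using fix_p by (simp_all add: act_def p c_def d_def algebra_simps)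
  then have "(of_int (c * E $ 1 $ 1 + d * E $ 2 $ 1) :: rat) = of_int c" "(of_int (c * E $ 1 $ 2 + d * E $ 2 $ 2) :: rat) = of_int d"
    using \<kappa> by simp_all
  then have r: "c * E $ 1 $ 1 + d * E $ 2 $ 1 = c" "c * E $ 1 $ 2 + d * E $ 2 $ 2 = d"
    by (simp_all only: of_int_eq_iff)
  define v1 where "v1 = a * E $ 1 $ 1 + b * E $ 2 $ 1 - a"
  define v2 where "v2 = a * E $ 1 $ 2 + b * E $ 2 $ 2 - b"
  have "(v1 + a) * (c * E $ 1 $ 2 + d * E $ 2 $ 2) - (v2 + b) * (c * E $ 1 $ 1 + d * E $ 2 $ 1)
      = (a * d - b * c) * (E $ 1 $ 1 * E $ 2 $ 2 - E $ 1 $ 2 * E $ 2 $ 1)"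
    unfolding v1_def v2_def by (simp add: algebra_simps)
  then have "(v1 + a) * d - (v2 + b) * c = 1" unfolding r det ES by simp
  then have par: "v1 * d = v2 * c" using det by (simp add: algebra_simps)
  \<comment> \<open>For \<open>(v1, v2) = n (c, d)\<close> the Bezout relation
    \<open>a d - b c = 1\<close> recovers the factor without a division.\<close>
  define n where "n = a * v2 - b * v1"
  have "n * c = a * (v2 * c) - b * c * v1" by (simp add: n_def algebra_simps)
  also have "\<dots> = (a * d - b * c) * v1" unfolding par[symmetric] by (simp add: algebra_simps)
  finally have n1: "n * c = v1" unfolding det by simp
  have "n * d = a * d * v2 - b * (v1 * d)" by (simp add: n_def algebra_simps)
  also have "\<dots> = (a * d - b * c) * v2" unfolding par by (simp add: algebra_simps)
  finally have n2: "n * d = v2" unfolding det by simp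
  have dv: "int N dvd E $ 1 $ 1 - 1" "int N dvd E $ 1 $ 2" "int N dvd E $ 2 $ 1" "int N dvd E $ 2 $ 2 - 1"
    using E by (auto simp: principal_congruence_subgroup_iff cong_iff_dvd_diff)
  have "v1 = a * (E $ 1 $ 1 - 1) + b * E $ 2 $ 1" "v2 = a * E $ 1 $ 2 + b * (E $ 2 $ 2 - 1)"
    by (simp_all add: v1_def v2_def algebra_simps)
  then have "int N dvd v1" "int N dvd v2" using dv by (simp_all add: dvd_add dvd_mult)
  then have "int N dvd n" unfolding n_def by (simp add: dvd_diff dvd_mult)
  moreover have "A ** E = upper_unip n ** A"
  proof (rule matrix_2_eqI)
    show "(A ** E) $ 1 $ 1 = (upper_unip n ** A) $ 1 $ 1"
      using n1 by (simp add: matrix_2_mult upper_unip_def v1_def a_def b_def c_def)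
    show "(A ** E) $ 1 $ 2 = (upper_unip n ** A) $ 1 $ 2"
      using n2 by (simp add: matrix_2_mult upper_unip_def v2_def a_def b_def d_def)
  qed (use r in \<open>simp_all add: matrix_2_mult upper_unip_def c_def d_def\<close>)
  ultimately show ?thesis by (rule that)
qed

text \<open>
  The stabilizer of a collinear pair is conjugate to the translations by \<open>N\<int>\<close>, for which the strip is a fundamental domain.
\<close>

lemma cusp_strip_bij_betw:
  assumes N: "N \<ge> 1" and A: "A \<in> SL2Z" and z: "Im z > 0"
    and hit: "\<And>n. int N dvd n \<Longrightarrow> xa (adj2 A ** (upper_unip n ** A)) = xa (mat 1)"
    and stab: "\<And>E. E \<in> principal_congruence_subgroup N \<Longrightarrow> xa E = xa (mat 1) \<Longrightarrow> \<exists>n. int N dvd n \<and> A ** E = upper_unip n ** A"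
    and mult: "\<And>C D E. xa C = xa D \<Longrightarrow> xa (C ** E) = xa (D ** E)"
  shows "bij_betw xa {C \<in> principal_congruence_subgroup N. moebius C z \<in> {z. 0 \<le> Re (moebius A z) \<and> Re (moebius A z) < real N}}
    (xa ` principal_congruence_subgroup N)"
proof (rule bij_betw_imageI)
  let ?S = "{C \<in> principal_congruence_subgroup N. moebius C z \<in> {z. 0 \<le> Re (moebius A z) \<and> Re (moebius A z) < real N}}"
  show "inj_on xa ?S"
  proof (rule inj_onI)
    fix C D assume C: "C \<in> ?S" and D: "D \<in> ?S" and e: "xa C = xa D"
    define E where "E = C ** adj2 D"
    have CG: "C \<in> principal_congruence_subgroup N" and DG: "D \<in> principal_congruence_subgroup N" using C D by auto
    note Ds = Gamma_N_SL2Z[OF DG]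
    have E: "E \<in> principal_congruence_subgroup N" unfolding E_def by (intro Gamma_N_mult Gamma_N_adj2 CG DG)
    have ED: "E ** D = C" unfolding E_def matrix_mul_assoc[symmetric] adj2_mult[OF Ds] by simp
    have "xa E = xa (D ** adj2 D)" unfolding E_def by (rule mult[OF e])
    then have "xa E = xa (mat 1)" unfolding adj2_mult[OF Ds] .
    from stab[OF E this] obtain n where n: "int N dvd n" "A ** E = upper_unip n ** A" by blast
    have "moebius A (moebius C z) = moebius (A ** E) (moebius D z)"
      unfolding ED[symmetric] moebius_mult[OF Gamma_N_SL2Z[OF E] Ds z] moebius_mult[OF A Gamma_N_SL2Z[OF E] Im_moebius_pos[OF Ds z]] ..
    also have "\<dots> = moebius A (moebius D z) + of_int n"
      unfolding n(2) moebius_mult[OF upper_unip_SL2Z A Im_moebius_pos[OF Ds z]] moebius_upper_unip ..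
    finally have re: "Re (moebius A (moebius C z)) = Re (moebius A (moebius D z)) + of_int n" by simp
    \<comment> \<open>Two points of a half-open interval of length \<open>N\<close> that differ by a
      multiple of \<open>N\<close> coincide.\<close>
    have "real_of_int \<bar>n\<bar> < real_of_int (int N)" using re C D by auto
    then have "\<bar>n\<bar> < int N" by (simp only: of_int_less_iff)
    then have "n = 0" using n(1) dvd_imp_le_int[of n "int N"] by auto
    then have "A ** E = A" using n(2) by (simp add: upper_unip_0)
    then have "adj2 A ** (A ** E) = adj2 A ** A" by simp
    then have "E = mat 1" unfolding matrix_mul_assoc adj2_mult[OF A] by simp
    then show "C = D" using ED by simp
  qed
  show "xa ` ?S = xa ` principal_congruence_subgroup N"
  proof
    show "xa ` principal_congruence_subgroup N \<subseteq> xa ` ?S"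
    proof
      fix y assume "y \<in> xa ` principal_congruence_subgroup N"
      then obtain C0 where C0: "C0 \<in> principal_congruence_subgroup N" "y = xa C0" by blast
      note C0s = Gamma_N_SL2Z[OF C0(1)]
      define m where "m = \<lfloor>Re (moebius A (moebius C0 z)) / real N\<rfloor>"
      define n where "n = int N * (- m)"
      have dn: "int N dvd n" by (simp add: n_def)
      define S where "S = adj2 A ** (upper_unip n ** A)"
      have S: "S \<in> principal_congruence_subgroup N" unfolding S_def by (rule stabilizer_in_Gamma_N[OF A dn])
      have AS: "A ** S = upper_unip n ** A" unfolding S_def matrix_mul_assoc adj2_mult[OF A] by simp
      have C: "S ** C0 \<in> principal_congruence_subgroup N" by (rule Gamma_N_mult[OF S C0(1)])
      have "moebius A (moebius (S ** C0) z) = moebius (A ** S) (moebius C0 z)"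
        unfolding moebius_mult[OF Gamma_N_SL2Z[OF S] C0s z] moebius_mult[OF A Gamma_N_SL2Z[OF S] Im_moebius_pos[OF C0s z]] ..
      also have "\<dots> = moebius A (moebius C0 z) + of_int n"
        unfolding AS moebius_mult[OF upper_unip_SL2Z A Im_moebius_pos[OF C0s z]] moebius_upper_unip ..
      finally have re: "Re (moebius A (moebius (S ** C0) z)) = Re (moebius A (moebius C0 z)) - real N * of_int m"
        by (simp add: n_def)
      have Np: "real N > 0" using N by simp
      have "of_int m \<le> Re (moebius A (moebius C0 z)) / real N" "Re (moebius A (moebius C0 z)) / real N < of_int m + 1"
        by (auto simp: m_def)
      then have "of_int m * real N \<le> Re (moebius A (moebius C0 z))" "Re (moebius A (moebius C0 z)) < (of_int m + 1) * real N"
        using Np by (simp_all only: pos_le_divide_eq pos_divide_less_eq)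
      then have "S ** C0 \<in> ?S" using C re by (simp add: algebra_simps)
      moreover have "xa (S ** C0) = y"
        unfolding C0(2) using mult[OF hit[OF dn], of C0] by (simp add: S_def)
      ultimately show "y \<in> xa ` ?S" by blast
    qed
  qed auto
qed

text \<open>The horizontal integration is carried out first: at every height it is the integral of
  the slash over one period, and the remaining factors depend on the height only.\<close>

lemma cusp_strip_integral_zero:
  assumes f: "cusp_form N k f" and N: "N \<ge> 1" and A: "A \<in> SL2Z"
    and int: "integrable hyp (\<lambda>z. indicator {z. 0 \<le> Re z \<and> Re z < real N} z *\<^sub>R (c * (slash k A f z * of_real (g (Im z)))))"
  shows "(\<integral>z. indicator {z. 0 \<le> Re z \<and> Re z < real N} z *\<^sub>R (c * (slash k A f z * of_real (g (Im z)))) \<partial>hyp) = 0"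
proof -
  have "(\<integral>u. indicator {z. 0 \<le> Re z \<and> Re z < real N} (geo u \<rho>) *\<^sub>R (c * (slash k A f (geo u \<rho>) * of_real (g (Im (geo u \<rho>))))) \<partial>lborel) = 0" for \<rho>
  proof -
    define y where "y = exp \<rho>"
    have y: "y > 0" by (simp add: y_def)
    have e: "indicator {z. 0 \<le> Re z \<and> Re z < real N} (geo u \<rho>) *\<^sub>R (c * (slash k A f (geo u \<rho>) * of_real (g (Im (geo u \<rho>)))))
      = (c * of_real (g y)) * (indicator {0..<real N} (0 + y * u) *\<^sub>R slash k A f (Complex (0 + y * u) y))" for u
      by (simp add: geo_eq_Complex y_def indicator_def)
    have "(\<integral>u. indicator {0..<real N} (0 + y * u) *\<^sub>R slash k A f (Complex (0 + y * u) y) \<partial>lborel) = 0"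
      using lborel_integral_real_affine[of y "\<lambda>x. indicator {0..<real N} x *\<^sub>R slash k A f (Complex x y)" 0] y
        cusp_form_slash_zero_mean[OF f N A y] by simp
    then show ?thesis unfolding e by (simp only: integral_mult_right_zero mult_zero_right)
  qed
  then show ?thesis unfolding integral_hyp_geo(3)[OF int] by simp
qed

section \<open>Kernels of collinear pairs\<close>

lemma kern_collinear:
  assumes p: "\<And>z. lin p z = \<kappa> * automorphy_factor A z" and q: "\<And>z. lin q z = \<kappa>' * automorphy_factor A z"
    and k: "k = l + m + 2" and A: "A \<in> SL2Z" and z: "Im z > 0"
  shows "kern l m t p q z = (inverse \<kappa> ^ (l + 1) * inverse \<kappa>' ^ (m + 1) * of_real ((cmod \<kappa> * cmod \<kappa>') powr - t))
     * (inverse (automorphy_factor A z) ^ k * of_real (Im (moebius A z) powr t))"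
proof -
  define j where "j = automorphy_factor A z"
  have j: "j \<noteq> 0" using automorphy_factor_nonzero[OF A z] by (simp add: j_def)
  have "(cmod (\<kappa> * j) * cmod (\<kappa>' * j)) powr - t * Im z powr t = (cmod \<kappa> * cmod \<kappa>') powr - t * (Im z / cmod j ^ 2) powr t"
  proof -
    have "(cmod (\<kappa> * j) * cmod (\<kappa>' * j)) = (cmod \<kappa> * cmod \<kappa>') * cmod j ^ 2"
      by (simp add: norm_mult power2_eq_square)
    moreover have "((cmod \<kappa> * cmod \<kappa>') * cmod j ^ 2) powr - t = (cmod \<kappa> * cmod \<kappa>') powr - t * (cmod j ^ 2) powr - t"
      by (rule powr_mult)
    moreover have "(Im z / cmod j ^ 2) powr t = Im z powr t * (cmod j ^ 2) powr - t"
      using z by (simp add: powr_divide powr_minus_divide)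
    ultimately show ?thesis by simp
  qed
  then show ?thesis
    unfolding kern_def p q Im_moebius[OF A z] j_def[symmetric]
    by (simp add: power_mult_distrib k power_add power2_eq_square mult_ac)
qed

lemma pair_kern_collinear:
  assumes p: "\<And>z. lin p z = \<kappa> * automorphy_factor A z" and q: "\<And>z. lin q z = \<kappa>' * automorphy_factor A z"
    and k: "k = w + 2" and A: "A \<in> SL2Z"
  obtains c where "\<And>z. Im z > 0 \<Longrightarrow> pair_kern w a b t p q z = c * (inverse (automorphy_factor A z) ^ k * of_real (Im (moebius A z) powr t))"
proof (rule that)
  fix z :: complex assume z: "Im z > 0"
  have k': "k = l + (w - l) + 2" if "l \<in> {..w}" for l using k that by simp
  show "pair_kern w a b t p q z = (\<Sum>l\<le>w. of_nat (w choose l) * cnj a ^ l * cnj b ^ (w - l) *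
     of_real (Gamma (t / 2 + real l + 1) * Gamma (t / 2 + real (w - l) + 1)) *
      (inverse \<kappa> ^ (l + 1) * inverse \<kappa>' ^ (w - l + 1) * of_real ((cmod \<kappa> * cmod \<kappa>') powr - t)))
       * (inverse (automorphy_factor A z) ^ k * of_real (Im (moebius A z) powr t))"
    unfolding pair_kern_def sum_distrib_right
    by (intro sum.cong refl) (simp only: kern_collinear[OF p q k' A z] mult.assoc)
qed

text \<open>The kernel of a collinear pair involves only the automorphy factor and the height
  belonging to \<open>A\<close>. Passing to the coordinate \<open>A z\<close> leaves a slash of
  \<open>f\<close> times a function of the height.\<close>

lemma collinear_integrand:
  assumes A: "A \<in> SL2Z" and z: "Im z > 0"
  shows "f z * cnj (c * (inverse (automorphy_factor A z) ^ k * of_real (Im (moebius A z) powr t))) * of_real (Im z ^ k)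
    = cnj c * (slash k (adj2 A) f (moebius A z) * of_real (Im (moebius A z) powr t * Im (moebius A z) ^ k))"
proof -
  define j where "j = automorphy_factor A z"
  have j: "j \<noteq> 0" using automorphy_factor_nonzero[OF A z] by (simp add: j_def)
  have "automorphy_factor (adj2 A) (moebius A z) = inverse j"
    using automorphy_factor_adj2[OF A z] j by (simp add: j_def[symmetric] field_simps)
  then have s: "slash k (adj2 A) f (moebius A z) = f z * j ^ k"
    unfolding slash_def moebius_adj2(1)[OF A z] by (simp add: power_inverse divide_inverse)
  have "complex_of_real (Im (moebius A z)) = of_real (Im z) / (j * cnj j)"
    unfolding Im_moebius[OF A z] j_def[symmetric] by (simp add: complex_norm_square[symmetric])
  then have y: "complex_of_real (Im (moebius A z) ^ k) = of_real (Im z ^ k) * (inverse j ^ k * inverse (cnj j) ^ k)"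
    by (simp add: divide_inverse power_mult_distrib)
  have "j ^ k * inverse j ^ k = 1" using j by (simp add: power_mult_distrib[symmetric])
  then show ?thesis
    unfolding s of_real_mult y j_def[symmetric] by (simp add: mult_ac)
qed

section \<open>Absolute convergence\<close>

lemma abs_summable_Times_mult:
  fixes g :: "'a \<Rightarrow> complex" and h :: "'b \<Rightarrow> complex"
  assumes g: "Infinite_Sum.abs_summable_on g U" and h: "Infinite_Sum.abs_summable_on h V"
  shows "Infinite_Sum.abs_summable_on (\<lambda>x. g (fst x) * h (snd x)) (U \<times> V)"
    and "(\<Sum>\<^sub>\<infinity>x\<in>U \<times> V. g (fst x) * h (snd x)) = infsum g U * infsum h V"
proof -
  show s: "Infinite_Sum.abs_summable_on (\<lambda>x. g (fst x) * h (snd x)) (U \<times> V)"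
    unfolding Infinite_Sum.abs_summable_on_Sigma_iff
  proof
    show "\<forall>x\<in>U. Infinite_Sum.abs_summable_on (\<lambda>y. g (fst (x, y)) * h (snd (x, y))) V"
      using h by (auto simp: norm_mult intro!: summable_on_cmult_right)
    have "(\<lambda>x. norm (g x) * (\<Sum>\<^sub>\<infinity>y\<in>V. norm (h y))) summable_on U"
      by (rule summable_on_cmult_left[OF g])
    moreover have "norm (\<Sum>\<^sub>\<infinity>y\<in>V. norm (g (fst (x, y)) * h (snd (x, y)))) = norm (g x) * (\<Sum>\<^sub>\<infinity>y\<in>V. norm (h y))" for x
      by (simp add: norm_mult infsum_cmult_right' infsum_nonneg)
    ultimately show "Infinite_Sum.abs_summable_on (\<lambda>x. \<Sum>\<^sub>\<infinity>y\<in>V. norm (g (fst (x, y)) * h (snd (x, y)))) U"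
      by simp
  qed
  have "(\<Sum>\<^sub>\<infinity>x\<in>U \<times> V. g (fst x) * h (snd x)) = (\<Sum>\<^sub>\<infinity>x\<in>U. \<Sum>\<^sub>\<infinity>y\<in>V. g x * h y)"
    using infsum_Sigma_banach[OF abs_summable_summable[OF s]] by simp
  then show "(\<Sum>\<^sub>\<infinity>x\<in>U \<times> V. g (fst x) * h (snd x)) = infsum g U * infsum h V"
    by (simp add: infsum_cmult_right' infsum_cmult_left')
qed

lemma infsum_complex_of_real: "(\<Sum>\<^sub>\<infinity>x\<in>A. complex_of_real (g x)) = of_real (\<Sum>\<^sub>\<infinity>x\<in>A. g x)"
proof (cases "g summable_on A")
  case True
  then show ?thesis by (intro infsumI) (simp add: has_sum_of_real_iff)
next
  case False
  then have "\<not> (\<lambda>x. complex_of_real (g x)) summable_on A"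
    using summable_on_Re[of "\<lambda>x. complex_of_real (g x)" A] by auto
  with False show ?thesis by (simp add: infsum_not_exists)
qed

lemma nn_integral_count_space_infsum:
  fixes g :: "'a \<Rightarrow> complex"
  assumes "Infinite_Sum.abs_summable_on g U"
  shows "(\<integral>\<^sup>+x. ennreal (norm (g x)) \<partial>count_space U) = ennreal (\<Sum>\<^sub>\<infinity>x\<in>U. norm (g x))"
proof -
  have s: "Infinite_Set_Sum.abs_summable_on (\<lambda>x. norm (g x)) U"
    using assms by (simp add: abs_summable_equivalent[symmetric])
  then have "integrable (count_space U) (\<lambda>x. norm (g x))" by (simp add: Infinite_Set_Sum.abs_summable_on_def)
  then have "(\<integral>\<^sup>+x. ennreal (norm (g x)) \<partial>count_space U) = ennreal (\<integral>x. norm (g x) \<partial>count_space U)"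
    by (rule nn_integral_eq_integral) simp
  also have "(\<integral>x. norm (g x) \<partial>count_space U) = (\<Sum>\<^sub>\<infinity>x\<in>U. norm (g x))"
    using infsetsum_infsum[OF s] by (simp add: infsetsum_def)
  finally show ?thesis .
qed

text \<open>
  The zero vector contributes \<open>0 powr - \<sigma> = 0\<close>.
\<close>

definition power_sum :: "rat \<times> rat \<Rightarrow> real \<Rightarrow> complex \<Rightarrow> real" where
  "power_sum v \<sigma> z = (\<Sum>\<^sub>\<infinity>p\<in>vec_coset v. cmod (lin p z) powr - \<sigma>)"

lemma lin_zero [simp]: "lin (0, 0) z = 0"
  by (simp add: lin_def)

lemma power_sum_bound:
  assumes "\<sigma> > 2"
  obtains C where "C \<ge> 0" "\<And>z. Im z > 0 \<Longrightarrow> (\<lambda>p. cmod (lin p z) powr - \<sigma>) summable_on vec_coset v"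
    "\<And>z. Im z > 0 \<Longrightarrow> 0 \<le> power_sum v \<sigma> z" "\<And>z. Im z > 0 \<Longrightarrow> power_sum v \<sigma> z \<le> C * height z powr (2 * \<sigma>)"
proof -
  obtain C where C: "C \<ge> 0" "\<And>z. Im z > 0 \<Longrightarrow> (\<lambda>p. cmod (lin p z) powr - \<sigma>) summable_on (vec_coset v - {(0,0)})"
    "\<And>z. Im z > 0 \<Longrightarrow> (\<Sum>\<^sub>\<infinity>p\<in>vec_coset v - {(0,0)}. cmod (lin p z) powr - \<sigma>) \<le> C * height z powr (2 * \<sigma>)"
    by (rule lin_power_sum_bound[OF assms, of v]) (rule that)
  have s: "(\<lambda>p. cmod (lin p z) powr - \<sigma>) summable_on vec_coset v \<longleftrightarrow> (\<lambda>p. cmod (lin p z) powr - \<sigma>) summable_on (vec_coset v - {(0,0)})" for z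
    by (rule summable_on_cong_neutral) auto
  have e: "power_sum v \<sigma> z = (\<Sum>\<^sub>\<infinity>p\<in>vec_coset v - {(0,0)}. cmod (lin p z) powr - \<sigma>)" for z
    unfolding power_sum_def by (rule infsum_cong_neutral) auto
  show ?thesis
    by (rule that[OF C(1)]) (use C(2,3) s in \<open>auto simp: e intro!: infsum_nonneg\<close>)
qed

lemma power_sum_moebius:
  assumes A: "A \<in> SL2Z" and z: "Im z > 0"
  shows "power_sum v \<sigma> (moebius A z) = cmod (automorphy_factor A z) powr \<sigma> * power_sum (act v A) \<sigma> z"
proof -
  define j where "j = automorphy_factor A z"
  have j: "j \<noteq> 0" using automorphy_factor_nonzero[OF A z] by (simp add: j_def)
  have "cmod (lin p (moebius A z)) powr - \<sigma> = cmod j powr \<sigma> * cmod (lin (act p A) z) powr - \<sigma>" for p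
  proof -
    have "cmod j powr \<sigma> * cmod j powr - \<sigma> = 1" using j by (simp add: powr_add[symmetric])
    moreover have "cmod (lin (act p A) z) powr - \<sigma> = cmod j powr - \<sigma> * cmod (lin p (moebius A z)) powr - \<sigma>"
      unfolding lin_act[OF A z] norm_mult j_def by (rule powr_mult)
    ultimately show ?thesis by simp
  qed
  then have "power_sum v \<sigma> (moebius A z) = cmod j powr \<sigma> * (\<Sum>\<^sub>\<infinity>p\<in>vec_coset v. cmod (lin (act p A) z) powr - \<sigma>)"
    unfolding power_sum_def by (simp add: infsum_cmult_right')
  also have "(\<Sum>\<^sub>\<infinity>p\<in>vec_coset v. cmod (lin (act p A) z) powr - \<sigma>) = power_sum (act v A) \<sigma> z"
    unfolding power_sum_def by (rule infsum_reindex_bij_betw[OF vec_coset_act[OF A]])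
  finally show ?thesis by (simp add: j_def)
qed

lemma powr_le_power_nat_ceiling:
  assumes "x \<ge> (1::real)"
  shows "x powr a \<le> x ^ nat \<lceil>a\<rceil>"
proof -
  have "x powr a \<le> x powr real (nat \<lceil>a\<rceil>)" using assms by (intro powr_mono) linarith+
  then show ?thesis using assms by (simp add: powr_realpow)
qed

text \<open>The condition \<open>\<sigma> + \<tau> = k + 2 t\<close> balances the automorphy
  factors, \<open>k - 2 k - 2 t + \<sigma> + \<tau> = 0\<close>, so the product is invariant under
  the group. At each cusp the power sums grow polynomially and the cusp form decays
  exponentially.\<close>

lemma cusp_form_times_power_sums_bounded:
  assumes f: "cusp_form N k f" and N: "N \<ge> 1" and u: "u \<in> torsion_vectors N" and v: "v \<in> torsion_vectors N"
    and s: "\<sigma> > 2" "\<tau> > 2" "\<sigma> + \<tau> = real k + 2 * t" and t: "t \<ge> 0"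
  obtains C where "C \<ge> 0"
    "\<And>z. Im z > 0 \<Longrightarrow> norm (f z) * Im z ^ k * Im z powr t * (power_sum u \<sigma> z * power_sum v \<tau> z) \<le> C"
proof -
  define \<Omega> where "\<Omega> = (\<lambda>_::unit. \<lambda>z. norm (f z) * Im z ^ k * Im z powr t * (power_sum u \<sigma> z * power_sum v \<tau> z))"
  have tr: "\<Omega> i (moebius A z) = norm (slash k A f z) * Im z ^ k * Im z powr t * (power_sum (act u A) \<sigma> z * power_sum (act v A) \<tau> z)"
    if A: "A \<in> SL2Z" and z: "Im z > 0" for i A z
  proof -
    define j where "j = cmod (automorphy_factor A z)"
    have j: "j > 0" using automorphy_factor_nonzero[OF A z] by (simp add: j_def)
    have 1: "norm (f (moebius A z)) = norm (slash k A f z) * j ^ k"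
      unfolding slash_eq[OF A z, of f k] norm_mult norm_power j_def ..
    have 2: "Im (moebius A z) ^ k = Im z ^ k / j ^ (2 * k)"
      unfolding Im_moebius[OF A z] j_def by (simp add: power_divide power_mult)
    have 3: "Im (moebius A z) powr t = Im z powr t * j powr (- 2 * t)"
    proof -
      have "j ^ 2 = j powr 2" using j by (simp add: powr_numeral)
      then have "(j ^ 2) powr t = j powr (2 * t)" by (simp only: powr_powr)
      moreover have "(Im z / j ^ 2) powr t = Im z powr t / (j ^ 2) powr t"
        using z by (simp add: powr_divide)
      moreover have "j powr (- 2 * t) = 1 / j powr (2 * t)"
        unfolding mult_minus_left by (rule powr_minus_divide)
      ultimately show ?thesis unfolding Im_moebius[OF A z] j_def[symmetric] by simp
    qed
    have 4: "j ^ k * (1 / j ^ (2 * k)) * j powr (- 2 * t) * (j powr \<sigma> * j powr \<tau>) = 1"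
    proof -
      have "1 / j ^ (2 * k) = j powr (- real (2 * k))" unfolding powr_minus_divide powr_realpow[OF j] ..
      then have "j ^ k * (1 / j ^ (2 * k)) * j powr (- 2 * t) * (j powr \<sigma> * j powr \<tau>)
        = j powr (real k + - real (2 * k) + - 2 * t + (\<sigma> + \<tau>))"
        by (simp only: powr_add powr_realpow[OF j])
      also have "real k + - real (2 * k) + - 2 * t + (\<sigma> + \<tau>) = 0" using s(3) by simp
      finally show ?thesis using j by simp
    qed
    have "\<Omega> i (moebius A z) = norm (slash k A f z) * Im z ^ k * Im z powr t * (power_sum (act u A) \<sigma> z * power_sum (act v A) \<tau> z)
       * (j ^ k * (1 / j ^ (2 * k)) * j powr (- 2 * t) * (j powr \<sigma> * j powr \<tau>))"
      unfolding \<Omega>_def 1 2 3 power_sum_moebius[OF A z] j_def[symmetric] divide_inverse by (simp only: mult_ac mult_1)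
    then show ?thesis unfolding 4 by simp
  qed
  have bd: "\<exists>C. \<forall>i\<in>{()}. \<forall>z\<in>siegel_set. \<Omega> i (moebius A z) \<le> C" if A: "A \<in> SL2Z" for A
  proof -
    obtain C1 where C1: "C1 \<ge> 0" "\<And>z. Im z > 0 \<Longrightarrow> 0 \<le> power_sum (act u A) \<sigma> z" "\<And>z. Im z > 0 \<Longrightarrow> power_sum (act u A) \<sigma> z \<le> C1 * height z powr (2 * \<sigma>)"
      by (rule power_sum_bound[OF s(1), of "act u A"]) (rule that)
    obtain C2 where C2: "C2 \<ge> 0" "\<And>z. Im z > 0 \<Longrightarrow> 0 \<le> power_sum (act v A) \<tau> z" "\<And>z. Im z > 0 \<Longrightarrow> power_sum (act v A) \<tau> z \<le> C2 * height z powr (2 * \<tau>)"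
      by (rule power_sum_bound[OF s(2), of "act v A"]) (rule that)
    define a b c where "a = nat \<lceil>t\<rceil>" and "b = nat \<lceil>2 * \<sigma>\<rceil>" and "c = nat \<lceil>2 * \<tau>\<rceil>"
    obtain C where C: "C \<ge> 0" "\<And>z. z \<in> siegel_set \<Longrightarrow> norm (slash k A f z) * height z ^ (k + a + b + c) \<le> C"
      by (rule cusp_form_slash_times_height_bounded[OF f N A]) (rule that)
    have "\<Omega> i (moebius A z) \<le> C * (C1 * C2)" if z: "z \<in> siegel_set" for i z
    proof -
      have z0: "Im z > 0" using z by (simp add: siegel_set_def)
      note h = height_ge[OF z0]
      have "Im z powr t \<le> height z powr t" using h z0 t by (intro powr_mono2) auto
      also have "\<dots> \<le> height z ^ a" unfolding a_def by (rule powr_le_power_nat_ceiling[OF h(1)])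
      finally have y: "Im z powr t \<le> height z ^ a" .
      have p1: "power_sum (act u A) \<sigma> z \<le> C1 * height z ^ b"
        using C1(3)[OF z0] mult_left_mono[OF powr_le_power_nat_ceiling[OF h(1), of "2 * \<sigma>"] C1(1)] by (simp add: b_def)
      have p2: "power_sum (act v A) \<tau> z \<le> C2 * height z ^ c"
        using C2(3)[OF z0] mult_left_mono[OF powr_le_power_nat_ceiling[OF h(1), of "2 * \<tau>"] C2(1)] by (simp add: c_def)
      have "\<Omega> i (moebius A z) \<le> norm (slash k A f z) * height z ^ k * height z ^ a * ((C1 * height z ^ b) * (C2 * height z ^ c))"
        unfolding tr[OF A z0]
        by (intro mult_mono power_mono y p1 p2 mult_nonneg_nonneg) (use h z0 C1 C2 in auto)
      also have "\<dots> = (norm (slash k A f z) * height z ^ (k + a + b + c)) * (C1 * C2)"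
        by (simp add: power_add mult_ac)
      also have "\<dots> \<le> C * (C1 * C2)" using C1 C2 by (intro mult_right_mono C(2) z) auto
      finally show ?thesis .
    qed
    then show ?thesis by blast
  qed
  have inv: "\<Omega> i (moebius A z) = \<Omega> i z" if "i \<in> {()}" and A: "A \<in> principal_congruence_subgroup N" and z: "Im z > 0" for i A z
  proof -
    note A' = Gamma_N_SL2Z[OF A]
    have "slash k A f z = f z"
      unfolding slash_def cusp_form_Gamma_N[OF f A z] using automorphy_factor_nonzero[OF A' z] by simp
    moreover have "power_sum (act u A) \<sigma> z = power_sum u \<sigma> z" "power_sum (act v A) \<tau> z = power_sum v \<tau> z"
      unfolding power_sum_def vec_coset_act_Gamma_N[OF N u A] vec_coset_act_Gamma_N[OF N v A] by simp_all
    ultimately show ?thesis unfolding tr[OF A' z] by (simp add: \<Omega>_def)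
  qed
  obtain C where "C \<ge> 0" "\<And>i z. i \<in> {()} \<Longrightarrow> Im z > 0 \<Longrightarrow> \<Omega> i z \<le> C"
    by (rule bounded_via_siegel_set[where \<Omega> = \<Omega> and S = "{()}", OF N inv bd]) (blast intro: that)+
  then show ?thesis by (intro that[of C]) (auto simp: \<Omega>_def)
qed

section \<open>Double sums of kernels\<close>

definition kern_factor :: "nat \<Rightarrow> real \<Rightarrow> complex \<Rightarrow> rat \<times> rat \<Rightarrow> complex" where
  "kern_factor l t z p = inverse (lin p z) ^ (l + 1) * of_real (cmod (lin p z) powr - t * Im z powr (t / 2))"

lemma kern_eq_factors:
  assumes "Im z > 0"
  shows "kern l m t p q z = kern_factor l t z p * kern_factor m t z q"
proof -
  have "Im z powr t = Im z powr (t / 2) * Im z powr (t / 2)" by (simp add: powr_add[symmetric])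
  moreover have "(cmod (lin p z) * cmod (lin q z)) powr - t = cmod (lin p z) powr - t * cmod (lin q z) powr - t"
    by (rule powr_mult)
  ultimately show ?thesis by (simp add: kern_def kern_factor_def mult_ac)
qed

lemma norm_kern_factor: "norm (kern_factor l t z p) = Im z powr (t / 2) * cmod (lin p z) powr - (real l + 1 + t)"
proof (cases "lin p z = 0")
  case False
  then have "inverse (cmod (lin p z)) ^ (l + 1) = cmod (lin p z) powr - (real l + 1)"
    using powr_realpow[of "cmod (lin p z)" "l + 1"] unfolding powr_minus power_inverse by (simp add: add.commute)
  moreover have "cmod (lin p z) powr - (real l + 1 + t) = cmod (lin p z) powr - (real l + 1) * cmod (lin p z) powr - t"
    by (simp add: powr_add[symmetric])
  ultimately show ?thesis
    by (simp only: kern_factor_def norm_mult norm_power norm_inverse norm_of_real abs_mult) (simp add: mult_ac)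
qed (simp add: kern_factor_def)

lemma kern_factor_summable:
  assumes t: "t > 2" and z: "Im z > 0"
  shows "Infinite_Sum.abs_summable_on (kern_factor l t z) (vec_coset v)"
    and "(\<Sum>\<^sub>\<infinity>p\<in>vec_coset v. norm (kern_factor l t z p)) = Im z powr (t / 2) * power_sum v (real l + 1 + t) z"
    and "of_real (Gamma (t / 2 + real l + 1)) * (\<Sum>\<^sub>\<infinity>p\<in>vec_coset v. kern_factor l t z p) = completed_eisenstein (l + 1) v z (of_real t)"
proof -
  have s: "real l + 1 + t > 2" using t by simp
  have "(\<lambda>p. cmod (lin p z) powr - (real l + 1 + t)) summable_on vec_coset v"
    by (rule power_sum_bound[OF s, of v]) (use z in blast)
  then show "Infinite_Sum.abs_summable_on (kern_factor l t z) (vec_coset v)"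
    unfolding norm_kern_factor by (rule summable_on_cmult_right)
  show "(\<Sum>\<^sub>\<infinity>p\<in>vec_coset v. norm (kern_factor l t z p)) = Im z powr (t / 2) * power_sum v (real l + 1 + t) z"
    unfolding norm_kern_factor power_sum_def by (rule infsum_cmult_right')
  have "eisenstein_series (l + 1) v z (of_real t) = (\<Sum>\<^sub>\<infinity>p\<in>vec_coset v. kern_factor l t z p)"
    unfolding eisenstein_series_def
  proof (rule infsum_cong_neutral)
    fix p assume "p \<in> {p. integral_vector (p - v) \<and> p \<noteq> (0, 0)} \<inter> vec_coset v"
    have "of_real (cmod (lin p z)) powr - complex_of_real t = of_real (cmod (lin p z) powr - t)"
      using powr_of_real[of "cmod (lin p z)" "- t"] by simp
    moreover have "of_real (Im z) powr (complex_of_real t / 2) = of_real (Im z powr (t / 2))"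
      using powr_of_real[of "Im z" "t / 2"] z by simp
    ultimately show "(case p of (a, b) \<Rightarrow> inverse ((of_rat a * z + of_rat b) ^ (l + 1)) *
        of_real (cmod (of_rat a * z + of_rat b)) powr - complex_of_real t * of_real (Im z) powr (complex_of_real t / 2))
      = kern_factor l t z p"
      by (simp add: kern_factor_def lin_def case_prod_unfold power_inverse)
  qed (auto simp: vec_coset_def kern_factor_def)
  moreover have "Gamma (complex_of_real t / 2 + of_nat (l + 1)) = of_real (Gamma (t / 2 + real l + 1))"
    using Gamma_complex_of_real[of "t / 2 + real l + 1"] by (simp add: add_ac)
  moreover have "Re (complex_of_real t) + real (l + 1) > 2" using t by simp
  ultimately show "of_real (Gamma (t / 2 + real l + 1)) * (\<Sum>\<^sub>\<infinity>p\<in>vec_coset v. kern_factor l t z p) = completed_eisenstein (l + 1) v z (of_real t)"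
    using completed_eisenstein_eq_series[OF _ z, of "l + 1" "of_real t" v] by simp
qed

lemma kern_summable:
  assumes t: "t > 2" and z: "Im z > 0"
  shows "Infinite_Sum.abs_summable_on (\<lambda>x. kern l m t (fst x) (snd x) z) (vec_coset u \<times> vec_coset v)"
    and "(\<Sum>\<^sub>\<infinity>x\<in>vec_coset u \<times> vec_coset v. norm (kern l m t (fst x) (snd x) z))
      = Im z powr t * (power_sum u (real l + 1 + t) z * power_sum v (real m + 1 + t) z)"
    and "of_real (Gamma (t / 2 + real l + 1) * Gamma (t / 2 + real m + 1)) * (\<Sum>\<^sub>\<infinity>x\<in>vec_coset u \<times> vec_coset v. kern l m t (fst x) (snd x) z)
      = completed_eisenstein (l + 1) u z (of_real t) * completed_eisenstein (m + 1) v z (of_real t)"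
proof -
  note F = kern_factor_summable[OF t z]
  show "Infinite_Sum.abs_summable_on (\<lambda>x. kern l m t (fst x) (snd x) z) (vec_coset u \<times> vec_coset v)"
    unfolding kern_eq_factors[OF z] by (rule abs_summable_Times_mult(1)[OF F(1) F(1)])
  have n: "Infinite_Sum.abs_summable_on (\<lambda>p. complex_of_real (norm (kern_factor l t z p))) (vec_coset v)" for l v
    using F(1)[of l v] by simp
  have "complex_of_real (\<Sum>\<^sub>\<infinity>x\<in>vec_coset u \<times> vec_coset v. norm (kern l m t (fst x) (snd x) z))
    = (\<Sum>\<^sub>\<infinity>x\<in>vec_coset u \<times> vec_coset v. complex_of_real (norm (kern_factor l t z (fst x))) * complex_of_real (norm (kern_factor m t z (snd x))))"
    unfolding kern_eq_factors[OF z] norm_mult infsum_complex_of_real[symmetric] of_real_mult ..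
  also have "\<dots> = complex_of_real ((\<Sum>\<^sub>\<infinity>p\<in>vec_coset u. norm (kern_factor l t z p)) * (\<Sum>\<^sub>\<infinity>p\<in>vec_coset v. norm (kern_factor m t z p)))"
    unfolding abs_summable_Times_mult(2)[OF n n] infsum_complex_of_real of_real_mult ..
  also have "(\<Sum>\<^sub>\<infinity>p\<in>vec_coset u. norm (kern_factor l t z p)) * (\<Sum>\<^sub>\<infinity>p\<in>vec_coset v. norm (kern_factor m t z p))
    = (Im z powr (t / 2) * Im z powr (t / 2)) * (power_sum u (real l + 1 + t) z * power_sum v (real m + 1 + t) z)"
    unfolding F(2) by (simp only: mult_ac)
  also have "Im z powr (t / 2) * Im z powr (t / 2) = Im z powr t" by (simp add: powr_add[symmetric])
  finally show "(\<Sum>\<^sub>\<infinity>x\<in>vec_coset u \<times> vec_coset v. norm (kern l m t (fst x) (snd x) z))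
      = Im z powr t * (power_sum u (real l + 1 + t) z * power_sum v (real m + 1 + t) z)"
    by (simp only: of_real_eq_iff)
  show "of_real (Gamma (t / 2 + real l + 1) * Gamma (t / 2 + real m + 1)) * (\<Sum>\<^sub>\<infinity>x\<in>vec_coset u \<times> vec_coset v. kern l m t (fst x) (snd x) z)
      = completed_eisenstein (l + 1) u z (of_real t) * completed_eisenstein (m + 1) v z (of_real t)"
    unfolding kern_eq_factors[OF z] abs_summable_Times_mult(2)[OF F(1) F(1)] F(3)[symmetric] of_real_mult by (simp only: mult_ac)
qed

lemma has_sum_sum_index:
  fixes g :: "'a \<Rightarrow> 'b \<Rightarrow> complex"
  assumes "finite I" "\<And>i. i \<in> I \<Longrightarrow> (g i has_sum S i) A"
  shows "((\<lambda>x. \<Sum>i\<in>I. g i x) has_sum (\<Sum>i\<in>I. S i)) A"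
  using assms by (induction I rule: finite_induct) (auto intro!: has_sum_add)

lemma pair_kern_infsum:
  assumes t: "t > 2" and z: "Im z > 0"
  shows "((\<lambda>x. pair_kern w a b t (fst x) (snd x) z) has_sum L_summand w u v a b z (of_real t)) (vec_coset u \<times> vec_coset v)"
  unfolding pair_kern_def L_summand_def
proof (rule has_sum_sum_index)
  fix l assume "l \<in> {..w}"
  have "((\<lambda>x. kern l (w - l) t (fst x) (snd x) z) has_sum (\<Sum>\<^sub>\<infinity>x\<in>vec_coset u \<times> vec_coset v. kern l (w - l) t (fst x) (snd x) z)) (vec_coset u \<times> vec_coset v)"
    using abs_summable_summable[OF kern_summable(1)[OF t z]] by (simp add: summable_iff_has_sum_infsum)
  from has_sum_cmult_right[OF this, of "of_nat (w choose l) * cnj a ^ l * cnj b ^ (w - l) * of_real (Gamma (t / 2 + real l + 1) * Gamma (t / 2 + real (w - l) + 1))"]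
  show "((\<lambda>x. of_nat (w choose l) * cnj a ^ l * cnj b ^ (w - l) *
     of_real (Gamma (t / 2 + real l + 1) * Gamma (t / 2 + real (w - l) + 1)) * kern l (w - l) t (fst x) (snd x) z) has_sum
     of_nat (w choose l) * cnj a ^ l * cnj b ^ (w - l) * (completed_eisenstein (l + 1) u z (of_real t) * completed_eisenstein (w - l + 1) v z (of_real t)))
     (vec_coset u \<times> vec_coset v)"
    unfolding kern_summable(3)[OF t z, symmetric] by (simp only: mult.assoc)
qed simp

text \<open>The absolute double sum against \<open>f\<close> is bounded uniformly in
  \<open>z\<close>. Together with the finite area of \<open>F\<close> this justifies the later
  exchanges of summation over pairs and integration over \<open>F\<close>.\<close>

lemma pair_kern_nn_bound:
  assumes f: "cusp_form N k f" and N: "N \<ge> 1" and k: "k = w + 2" and u: "u \<in> torsion_vectors N" and v: "v \<in> torsion_vectors N"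
    and t: "t > 2"
  obtains C where "C \<ge> 0" "\<And>z. Im z > 0 \<Longrightarrow>
    (\<integral>\<^sup>+x. ennreal (norm (f z * cnj (pair_kern w a b t (fst x) (snd x) z) * of_real (Im z ^ k))) \<partial>count_space (vec_coset u \<times> vec_coset v)) \<le> ennreal C"
proof -
  define co where "co l = norm (of_nat (w choose l) * cnj a ^ l * cnj b ^ (w - l) * of_real (Gamma (t / 2 + real l + 1) * Gamma (t / 2 + real (w - l) + 1)))" for l
  have "\<exists>C. C \<ge> 0 \<and> (\<forall>z. Im z > 0 \<longrightarrow> norm (f z) * Im z ^ k * Im z powr t * (power_sum u (real l + 1 + t) z * power_sum v (real (w - l) + 1 + t) z) \<le> C)"
    if l: "l \<le> w" for l
  proof -
    have "real l + 1 + t + (real (w - l) + 1 + t) = real k + 2 * t" using l by (simp add: k of_nat_diff)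
    moreover have "real l + 1 + t > 2" "real (w - l) + 1 + t > 2" "t \<ge> 0" using t by simp_all
    ultimately obtain C where "C \<ge> 0"
      "\<And>z. Im z > 0 \<Longrightarrow> norm (f z) * Im z ^ k * Im z powr t * (power_sum u (real l + 1 + t) z * power_sum v (real (w - l) + 1 + t) z) \<le> C"
      using cusp_form_times_power_sums_bounded[OF f N u v, of "real l + 1 + t" "real (w - l) + 1 + t" t] by blast
    then show ?thesis by blast
  qed
  then obtain C where C: "\<And>l. l \<le> w \<Longrightarrow> C l \<ge> 0"
    "\<And>l z. l \<le> w \<Longrightarrow> Im z > 0 \<Longrightarrow> norm (f z) * Im z ^ k * Im z powr t * (power_sum u (real l + 1 + t) z * power_sum v (real (w - l) + 1 + t) z) \<le> C l"
    by metis
  have co0: "co l \<ge> 0" for l by (simp add: co_def)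
  show ?thesis
  proof (rule that)
    show "(\<Sum>l\<le>w. co l * C l) \<ge> 0" using C(1) co0 by (intro sum_nonneg mult_nonneg_nonneg) auto
    fix z :: complex assume z: "Im z > 0"
    let ?X = "vec_coset u \<times> vec_coset v"
    have "(\<integral>\<^sup>+x. ennreal (norm (f z * cnj (pair_kern w a b t (fst x) (snd x) z) * of_real (Im z ^ k))) \<partial>count_space ?X)
      \<le> (\<integral>\<^sup>+x. (\<Sum>l\<le>w. ennreal (co l * (norm (f z) * Im z ^ k)) * ennreal (norm (kern l (w - l) t (fst x) (snd x) z))) \<partial>count_space ?X)"
    proof (rule nn_integral_mono)
      fix x
      have "norm (pair_kern w a b t (fst x) (snd x) z) \<le> (\<Sum>l\<le>w. co l * norm (kern l (w - l) t (fst x) (snd x) z))"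
        unfolding pair_kern_def co_def norm_mult[symmetric] by (rule norm_sum)
      then have "norm (f z * cnj (pair_kern w a b t (fst x) (snd x) z) * of_real (Im z ^ k))
        \<le> norm (f z) * (\<Sum>l\<le>w. co l * norm (kern l (w - l) t (fst x) (snd x) z)) * Im z ^ k"
      proof -
        have "norm (complex_of_real (Im z ^ k)) = Im z ^ k" using z by (simp add: norm_power)
        then show ?thesis
          unfolding norm_mult complex_mod_cnj
          using z \<open>norm (pair_kern w a b t (fst x) (snd x) z) \<le> _\<close> by (simp only: mult_left_mono mult_right_mono norm_ge_zero zero_le_power less_imp_le)
      qed
      also have "\<dots> = (\<Sum>l\<le>w. co l * (norm (f z) * Im z ^ k) * norm (kern l (w - l) t (fst x) (snd x) z))"
        unfolding sum_distrib_left sum_distrib_right by (rule sum.cong) (simp_all only: mult_ac)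
      finally have "norm (f z * cnj (pair_kern w a b t (fst x) (snd x) z) * of_real (Im z ^ k))
        \<le> (\<Sum>l\<le>w. co l * (norm (f z) * Im z ^ k) * norm (kern l (w - l) t (fst x) (snd x) z))" .
      then have "ennreal (norm (f z * cnj (pair_kern w a b t (fst x) (snd x) z) * of_real (Im z ^ k)))
        \<le> ennreal (\<Sum>l\<le>w. co l * (norm (f z) * Im z ^ k) * norm (kern l (w - l) t (fst x) (snd x) z))" by (rule ennreal_leI)
      also have "\<dots> = (\<Sum>l\<le>w. ennreal (co l * (norm (f z) * Im z ^ k)) * ennreal (norm (kern l (w - l) t (fst x) (snd x) z)))"
        using z co0 by (subst sum_ennreal[symmetric]) (auto simp: ennreal_mult intro!: mult_nonneg_nonneg)
      finally show "ennreal (norm (f z * cnj (pair_kern w a b t (fst x) (snd x) z) * of_real (Im z ^ k)))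
        \<le> (\<Sum>l\<le>w. ennreal (co l * (norm (f z) * Im z ^ k)) * ennreal (norm (kern l (w - l) t (fst x) (snd x) z)))" .
    qed
    also have "\<dots> = (\<Sum>l\<le>w. ennreal (co l * (norm (f z) * Im z ^ k)) * (\<integral>\<^sup>+x. ennreal (norm (kern l (w - l) t (fst x) (snd x) z)) \<partial>count_space ?X))"
      by (subst nn_integral_sum) (simp_all add: nn_integral_cmult)
    also have "\<dots> = (\<Sum>l\<le>w. ennreal (co l * (norm (f z) * Im z ^ k * Im z powr t * (power_sum u (real l + 1 + t) z * power_sum v (real (w - l) + 1 + t) z))))"
    proof (rule sum.cong[OF refl])
      fix l assume "l \<in> {..w}"
      show "ennreal (co l * (norm (f z) * Im z ^ k)) * (\<integral>\<^sup>+x. ennreal (norm (kern l (w - l) t (fst x) (snd x) z)) \<partial>count_space ?X)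
        = ennreal (co l * (norm (f z) * Im z ^ k * Im z powr t * (power_sum u (real l + 1 + t) z * power_sum v (real (w - l) + 1 + t) z)))"
        unfolding nn_integral_count_space_infsum[OF kern_summable(1)[OF t z]] kern_summable(2)[OF t z]
        using co0[of l] z by (subst ennreal_mult'[symmetric]) (simp_all add: mult_ac)
    qed
    also have "\<dots> \<le> (\<Sum>l\<le>w. ennreal (co l * C l))"
      using C(2)[OF _ z] co0 by (intro sum_mono ennreal_leI mult_left_mono) auto
    also have "\<dots> = ennreal (\<Sum>l\<le>w. co l * C l)"
      using C(1) co0 by (intro sum_ennreal) auto
    finally show "(\<integral>\<^sup>+x. ennreal (norm (f z * cnj (pair_kern w a b t (fst x) (snd x) z) * of_real (Im z ^ k))) \<partial>count_space ?X) \<le> ennreal (\<Sum>l\<le>w. co l * C l)" .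
  qed
qed

section \<open>The cyclic kernel\<close>

text \<open>
  A pair \<open>(p, q)\<close> stands for the triple \<open>(p, q, - p - q)\<close>, of which this is the cyclic shift.
\<close>

definition rot :: "(rat \<times> rat) \<times> (rat \<times> rat) \<Rightarrow> (rat \<times> rat) \<times> (rat \<times> rat)" where
  "rot x = (snd x, - fst x - snd x)"

definition pact :: "(rat \<times> rat) \<times> (rat \<times> rat) \<Rightarrow> int ^ 2 ^ 2 \<Rightarrow> (rat \<times> rat) \<times> (rat \<times> rat)" where
  "pact x A = (act (fst x) A, act (snd x) A)"

text \<open>The three double sums run over three different products of cosets. Indexing all of them
  by the first one brings the contributions that cancel into a single term.\<close>

definition triple_kern :: "nat \<Rightarrow> complex \<Rightarrow> complex \<Rightarrow> complex \<Rightarrow> real \<Rightarrow> (rat \<times> rat) \<times> (rat \<times> rat) \<Rightarrow> complex \<Rightarrow> complex" where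
  "triple_kern w a b c t x z = pair_kern w a b t (fst x) (snd x) z
     + pair_kern w b c t (fst (rot x)) (snd (rot x)) z + pair_kern w c a t (fst (rot (rot x))) (snd (rot (rot x))) z"

lemma rot_rot: "rot (rot x) = (- fst x - snd x, fst x)" and rot_rot_rot: "rot (rot (rot x)) = x"
  by (simp_all add: rot_def prod_eq_iff)

lemma pact_one: "pact x (mat 1) = x" and pact_mult: "pact x (A ** B) = pact (pact x A) B"
  by (simp_all add: pact_def act_mult)

lemma rot_pact: "rot (pact x A) = pact (rot x) A"
  by (simp add: rot_def pact_def act_diff)

lemma rot_mem:
  assumes "integral_vector (u + v + w)" "x \<in> vec_coset u \<times> vec_coset v"
  shows "rot x \<in> vec_coset v \<times> vec_coset w"
proof -
  have "integral_vector (- ((fst x - u) + (snd x - v) + (u + v + w)))"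
    by (rule integral_vector_uminus, rule integral_vector_add, rule integral_vector_add)
      (use assms in \<open>auto simp: vec_coset_def\<close>)
  also have "- ((fst x - u) + (snd x - v) + (u + v + w)) = (- fst x - snd x) - w" by (simp add: algebra_simps)
  finally show ?thesis using assms by (auto simp: rot_def vec_coset_def)
qed

lemma rot_bij_betw:
  assumes "integral_vector (u + v + w)"
  shows "bij_betw rot (vec_coset u \<times> vec_coset v) (vec_coset v \<times> vec_coset w)"
proof -
  have "integral_vector (v + w + u)" "integral_vector (w + u + v)" using assms by (simp_all add: add_ac)
  then show ?thesis using assms
    by (intro bij_betwI[where g = "\<lambda>x. rot (rot x)"]) (auto simp: rot_rot_rot intro: rot_mem)
qed

lemma kern_moebius:
  assumes A: "A \<in> SL2Z" and z: "Im z > 0" and k: "k = l + m + 2"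
  shows "kern l m t p q (moebius A z) = automorphy_factor A z ^ k * kern l m t (act p A) (act q A) z"
proof -
  define j where "j = automorphy_factor A z"
  have j: "j \<noteq> 0" using automorphy_factor_nonzero[OF A z] by (simp add: j_def)
  have l: "lin p (moebius A z) = lin (act p A) z * inverse j" for p
    unfolding lin_act[OF A z] j_def[symmetric] using j by (simp add: field_simps)
  define X where "X = lin (act p A) z"
  define Y where "Y = lin (act q A) z"
  have "(cmod (X * inverse j) * cmod (Y * inverse j)) powr - t * (Im z / cmod j ^ 2) powr t = (cmod X * cmod Y) powr - t * Im z powr t"
  proof -
    have "cmod (X * inverse j) * cmod (Y * inverse j) = (cmod X * cmod Y) * inverse (cmod j ^ 2)"
      by (simp add: norm_mult norm_inverse power2_eq_square)
    moreover have "((cmod X * cmod Y) * inverse (cmod j ^ 2)) powr - t = (cmod X * cmod Y) powr - t * inverse (cmod j ^ 2) powr - t"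
      by (rule powr_mult)
    moreover have "(Im z / cmod j ^ 2) powr t = Im z powr t * inverse (cmod j ^ 2) powr t"
      unfolding divide_inverse by (rule powr_mult)
    moreover have "inverse (cmod j ^ 2) powr - t * inverse (cmod j ^ 2) powr t = 1"
      using j by (simp add: powr_add[symmetric])
    moreover have "(x * y) * (v * y') = (x * v) * (y * y')" for x y v y' :: real by simp
    ultimately show ?thesis by (simp only: mult_1_right)
  qed
  moreover have "inverse (X * inverse j) ^ (l + 1) * inverse (Y * inverse j) ^ (m + 1) = j ^ k * (inverse X ^ (l + 1) * inverse Y ^ (m + 1))"
    by (simp add: power_mult_distrib k power_add power2_eq_square mult_ac)
  ultimately show ?thesis
    unfolding kern_def l Im_moebius[OF A z] j_def[symmetric] X_def[symmetric] Y_def[symmetric] by (simp only: mult.assoc)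
qed

lemma pair_kern_moebius:
  assumes A: "A \<in> SL2Z" and z: "Im z > 0" and k: "k = w + 2"
  shows "pair_kern w a b t p q (moebius A z) = automorphy_factor A z ^ k * pair_kern w a b t (act p A) (act q A) z"
proof -
  have k': "k = l + (w - l) + 2" if "l \<in> {..w}" for l using k that by simp
  show ?thesis
    unfolding pair_kern_def sum_distrib_left
    by (intro sum.cong refl) (simp only: kern_moebius[OF A z k'] mult_ac)
qed

lemma triple_kern_moebius:
  assumes A: "A \<in> SL2Z" and z: "Im z > 0" and k: "k = w + 2"
  shows "triple_kern w a b c t x (moebius A z) = automorphy_factor A z ^ k * triple_kern w a b c t (pact x A) z"
  unfolding triple_kern_def pair_kern_moebius[OF A z k] rot_pact by (simp add: pact_def distrib_left)

text \<open>The form contributes \<open>j^k\<close>, the conjugated kernel \<open>cnj j ^ k\<close>,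
  and the power of the height the inverse of their product.\<close>

lemma cusp_form_kernel_equivariant:
  assumes f: "cusp_form N k f" and A: "A \<in> principal_congruence_subgroup N" and z: "Im z > 0"
    and K: "K = automorphy_factor A z ^ k * K'"
  shows "f (moebius A z) * cnj K * of_real (Im (moebius A z) ^ k) = f z * cnj K' * of_real (Im z ^ k)"
proof -
  define j where "j = automorphy_factor A z"
  have j: "j \<noteq> 0" using automorphy_factor_nonzero[OF Gamma_N_SL2Z[OF A] z] by (simp add: j_def)
  have "complex_of_real (Im (moebius A z)) = of_real (Im z) * (inverse j * inverse (cnj j))"
    unfolding Im_moebius[OF Gamma_N_SL2Z[OF A] z] j_def[symmetric]
    by (simp add: complex_norm_square[symmetric] divide_inverse flip: inverse_mult_distrib)
  then have y: "complex_of_real (Im (moebius A z) ^ k) = of_real (Im z ^ k) * (inverse j ^ k * inverse (cnj j) ^ k)"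
    by (simp add: power_mult_distrib)
  have "j ^ k * inverse j ^ k = 1" "cnj j ^ k * inverse (cnj j) ^ k = 1" using j by (simp_all add: power_mult_distrib[symmetric])
  moreover have "f z * j ^ k * (cnj j ^ k * cnj K') * (Y * (inverse j ^ k * inverse (cnj j) ^ k))
     = f z * cnj K' * Y * (j ^ k * inverse j ^ k) * (cnj j ^ k * inverse (cnj j) ^ k)" for Y by (simp only: mult_ac)
  ultimately show ?thesis
    unfolding cusp_form_Gamma_N[OF f A z] K y j_def[symmetric] complex_cnj_mult complex_cnj_power by (simp only: mult_1_right)
qed

lemma kern_measurable [measurable]: "kern l m t p q \<in> borel_measurable borel"
  unfolding kern_def[abs_def] by measurable

lemma pair_kern_measurable [measurable]: "pair_kern w a b t p q \<in> borel_measurable borel"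
  unfolding pair_kern_def[abs_def] by measurable

lemma triple_kern_measurable [measurable]: "triple_kern w a b c t x \<in> borel_measurable borel"
  unfolding triple_kern_def[abs_def] by measurable

lemma nn_integral_count_space_subset_le:
  assumes "A \<subseteq> B"
  shows "(\<integral>\<^sup>+x. g x \<partial>count_space A) \<le> (\<integral>\<^sup>+x. g x \<partial>count_space B)"
proof -
  have "(\<integral>\<^sup>+x. g x * indicator A x \<partial>count_space UNIV) \<le> (\<integral>\<^sup>+x. g x * indicator B x \<partial>count_space UNIV)"
    using assms by (intro nn_integral_mono) (auto simp: indicator_def)
  moreover have "(\<integral>\<^sup>+x. g x \<partial>count_space S) = (\<integral>\<^sup>+x. g x * indicator S x \<partial>count_space UNIV)" for S
    by (rule nn_integral_count_space_indicator) simp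
  ultimately show ?thesis by (metis (no_types))
qed

lemma fd_nn_integral_finite:
  assumes FD: "fundamental_domain (principal_congruence_subgroup N) F" and N: "N \<ge> 1"
    and bd: "\<And>z. Im z > 0 \<Longrightarrow> g z \<le> ennreal C"
  shows "(\<integral>\<^sup>+z. indicator F z * g z \<partial>hyp) < \<infinity>"
proof -
  have [measurable]: "F \<in> sets borel" by (rule fd_measurable[OF FD])
  have "(\<integral>\<^sup>+z. indicator F z * g z \<partial>hyp) \<le> (\<integral>\<^sup>+z. ennreal C * indicator F z \<partial>hyp)"
    using bd fd_upper[OF FD] by (intro nn_integral_mono) (auto simp: indicator_def)
  also have "\<dots> = ennreal C * emeasure hyp F" by (simp add: nn_integral_cmult)
  also have "\<dots> < \<infinity>" using emeasure_hyp_fd_finite[OF FD N] by (simp add: ennreal_mult_less_top)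
  finally show ?thesis .
qed

text \<open>A matrix is determined by its action on two independent rows. Even \<open>-1\<close>
  moves such a pair, so stabilizers are trivial and the whole plane can serve as the set
  \<open>B\<close> of the unfolding.\<close>

lemma pact_inj_on:
  assumes D: "det2 (fst x) (snd x) \<noteq> 0"
  shows "inj (pact x)"
proof (rule injI)
  fix A B :: "int ^ 2 ^ 2" assume e: "pact x A = pact x B"
  obtain p1 p2 q1 q2 where x: "x = ((p1, p2), (q1, q2))" by (metis prod.exhaust)
  have d: "p1 * q2 - q1 * p2 \<noteq> 0" using D by (simp add: det2_def x)
  have col: "i = i' \<and> j = j'" if "p1 * i + p2 * j = p1 * i' + p2 * j'" "q1 * i + q2 * j = q1 * i' + q2 * j'" for i j i' j' :: rat
  proof -
    have "(p1 * q2 - q1 * p2) * (i - i') = q2 * ((p1 * i + p2 * j) - (p1 * i' + p2 * j')) - p2 * ((q1 * i + q2 * j) - (q1 * i' + q2 * j'))"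
      "(p1 * q2 - q1 * p2) * (j - j') = p1 * ((q1 * i + q2 * j) - (q1 * i' + q2 * j')) - q1 * ((p1 * i + p2 * j) - (p1 * i' + p2 * j'))"
      by (simp_all add: algebra_simps)
    then have "(p1 * q2 - q1 * p2) * (i - i') = 0" "(p1 * q2 - q1 * p2) * (j - j') = 0"
      unfolding that by simp_all
    then show ?thesis using d by simp
  qed
  show "A = B"
    using e col[of "of_int (A $ 1 $ 1)" "of_int (A $ 2 $ 1)" "of_int (B $ 1 $ 1)" "of_int (B $ 2 $ 1)"]
      col[of "of_int (A $ 1 $ 2)" "of_int (A $ 2 $ 2)" "of_int (B $ 1 $ 2)" "of_int (B $ 2 $ 2)"]
    by (intro matrix_2_eqI) (auto simp: x pact_def act_def)
qed

lemma pact_mem: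
  assumes "N \<ge> 1" "u \<in> torsion_vectors N" "v \<in> torsion_vectors N" "C \<in> principal_congruence_subgroup N" "x \<in> vec_coset u \<times> vec_coset v"
  shows "pact x C \<in> vec_coset u \<times> vec_coset v"
  using bij_betwE[OF vec_coset_act[OF Gamma_N_SL2Z[OF assms(4)], of u]] bij_betwE[OF vec_coset_act[OF Gamma_N_SL2Z[OF assms(4)], of v]]
    vec_coset_act_Gamma_N[OF assms(1,2,4)] vec_coset_act_Gamma_N[OF assms(1,3,4)] assms(5)
  by (auto simp: pact_def)

text \<open>Absolute unfolding over the orbit of \<open>x\<close>: integrability over the whole
  half-plane follows from the bounded orbit sum on \<open>F\<close>, without estimating the kernel
  near the boundary.\<close>

lemma kern_monomial_integrable:
  assumes f: "cusp_form N k f" and N: "N \<ge> 1" and k: "k = l + m + 2" and u: "u \<in> torsion_vectors N" and v: "v \<in> torsion_vectors N"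
    and t: "t > 2" and fm: "f \<in> borel_measurable borel" and FD: "fundamental_domain (principal_congruence_subgroup N) F"
    and x: "x \<in> vec_coset u \<times> vec_coset v" and D: "det2 (fst x) (snd x) \<noteq> 0"
  shows "integrable hyp (\<lambda>z. f z * cnj (kern l m t (fst x) (snd x) z) * of_real (Im z ^ k))"
proof -
  note [measurable] = fm
  define \<phi> where "\<phi> = (\<lambda>x z. f z * cnj (kern l m t (fst x) (snd x) z) * of_real (Im z ^ k))"
  let ?Ob = "pact x ` principal_congruence_subgroup N"
  have "real l + 1 + t > 2" "real m + 1 + t > 2" "real l + 1 + t + (real m + 1 + t) = real k + 2 * t" "t \<ge> 0"
    using t k by simp_all
  then obtain C where C: "C \<ge> 0"
    "\<And>z. Im z > 0 \<Longrightarrow> norm (f z) * Im z ^ k * Im z powr t * (power_sum u (real l + 1 + t) z * power_sum v (real m + 1 + t) z) \<le> C"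
    using cusp_form_times_power_sums_bounded[OF f N u v, of "real l + 1 + t" "real m + 1 + t" t] by blast
  have bd: "(\<integral>\<^sup>+y. ennreal (norm (\<phi> y z)) \<partial>count_space ?Ob) \<le> ennreal C" if z: "Im z > 0" for z
  proof -
    have "(\<integral>\<^sup>+y. ennreal (norm (\<phi> y z)) \<partial>count_space ?Ob) \<le> (\<integral>\<^sup>+y. ennreal (norm (\<phi> y z)) \<partial>count_space (vec_coset u \<times> vec_coset v))"
      by (rule nn_integral_count_space_subset_le) (use pact_mem[OF N u v _ x] in blast)
    also have "\<dots> = (\<integral>\<^sup>+y. ennreal (norm (f z) * Im z ^ k) * ennreal (norm (kern l m t (fst y) (snd y) z)) \<partial>count_space (vec_coset u \<times> vec_coset v))"
      using z by (intro nn_integral_cong) (simp add: \<phi>_def norm_mult norm_power ennreal_mult'[symmetric] mult_ac)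
    also have "\<dots> = ennreal (norm (f z) * Im z ^ k) * ennreal (Im z powr t * (power_sum u (real l + 1 + t) z * power_sum v (real m + 1 + t) z))"
      unfolding nn_integral_cmult[OF borel_measurable_count_space] nn_integral_count_space_infsum[OF kern_summable(1)[OF t z]] kern_summable(2)[OF t z] ..
    also have "\<dots> = ennreal (norm (f z) * Im z ^ k * (Im z powr t * (power_sum u (real l + 1 + t) z * power_sum v (real m + 1 + t) z)))"
      using z by (intro ennreal_mult'[symmetric]) auto
    also have "\<dots> \<le> ennreal C" using C(2)[OF z] by (intro ennreal_leI) (simp add: mult.assoc)
    finally show ?thesis .
  qed
  have "integrable hyp (\<lambda>z. indicator UNIV z *\<^sub>R \<phi> x z)"
  proof (rule orbit_unfold(1)[OF FD, where \<phi> = \<phi> and y = x and xa = pact and Ob = ?Ob])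
    show "\<phi> x \<in> borel_measurable borel" unfolding \<phi>_def by measurable
    show "bij_betw (pact x) {C \<in> principal_congruence_subgroup N. moebius C z \<in> UNIV} ?Ob" for z
      using pact_inj_on[OF D] by (auto simp: bij_betw_def inj_on_def)
    show "\<phi> x (moebius C z) = \<phi> (pact x C) z" if "C \<in> principal_congruence_subgroup N" "Im z > 0" for C z
      unfolding \<phi>_def using cusp_form_kernel_equivariant[OF f that kern_moebius[OF Gamma_N_SL2Z[OF that(1)] that(2) k]] by (simp add: pact_def)
    show "(\<integral>\<^sup>+z. indicator F z * (\<integral>\<^sup>+y. ennreal (norm (\<phi> y z)) \<partial>count_space ?Ob) \<partial>hyp) < \<infinity>"
      by (rule fd_nn_integral_finite[OF FD N bd])
  qed simp
  then show ?thesis by (simp add: \<phi>_def)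
qed

lemma pair_kern_expand:
  "f z * cnj (pair_kern w a b t p q z) * of_real (Im z ^ k)
     = (\<Sum>l\<le>w. (of_nat (w choose l) * a ^ l * b ^ (w - l) * complex_of_real (Gamma (t / 2 + real l + 1) * Gamma (t / 2 + real (w - l) + 1)))
         * (f z * cnj (kern l (w - l) t p q z) * of_real (Im z ^ k)))"
  unfolding pair_kern_def cnj_sum sum_distrib_left sum_distrib_right
  by (rule sum.cong) (simp_all add: mult_ac)

lemma pair_kern_integrable:
  assumes "\<And>l. l \<le> w \<Longrightarrow> integrable hyp (\<lambda>z. f z * cnj (kern l (w - l) t p q z) * of_real (Im z ^ k))"
  shows "integrable hyp (\<lambda>z. f z * cnj (pair_kern w a b t p q z) * of_real (Im z ^ k))"
  unfolding pair_kern_expand using assms by (intro Bochner_Integration.integrable_sum integrable_mult_right) auto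

lemma triple_kern_nondegenerate:
  assumes f: "cusp_form N k f" and N: "N \<ge> 1" and k: "k = w + 2"
    and lam: "lam \<in> torsion_vectors N" and mu: "mu \<in> torsion_vectors N" and nu: "nu \<in> torsion_vectors N"
    and lmn: "integral_vector (lam + mu + nu)" and abc: "a + b + c = 0"
    and t: "t > 2" and fm: "f \<in> borel_measurable borel" and FD: "fundamental_domain (principal_congruence_subgroup N) F"
    and x: "x \<in> vec_coset lam \<times> vec_coset mu" and D: "det2 (fst x) (snd x) \<noteq> 0"
  shows "(\<integral>z. f z * cnj (triple_kern w a b c t x z) * of_real (Im z ^ k) \<partial>hyp) = 0"
proof -
  have k': "k = l + (w - l) + 2" if "l \<le> w" for l using k that by simp
  have x1: "rot x \<in> vec_coset mu \<times> vec_coset nu" by (rule rot_mem[OF lmn x])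
  have x2: "rot (rot x) \<in> vec_coset nu \<times> vec_coset lam" by (rule rot_mem[OF _ x1]) (use lmn in \<open>simp add: add_ac\<close>)
  have D1: "det2 (fst (rot x)) (snd (rot x)) \<noteq> 0" and D2: "det2 (fst (rot (rot x))) (snd (rot (rot x))) \<noteq> 0"
    using D by (simp_all add: rot_def det2_def algebra_simps)
  define p q r where "p = fst x" and "q = snd x" and "r = - fst x - snd x"
  have e: "fst (rot x) = q" "snd (rot x) = r" "fst (rot (rot x)) = r" "snd (rot (rot x)) = p"
    by (simp_all add: rot_rot p_def q_def r_def) (simp_all add: rot_def)
  have i1: "integrable hyp (\<lambda>z. f z * cnj (kern l (w - l) t p q z) * of_real (Im z ^ k))" if "l \<le> w" for l
    using kern_monomial_integrable[OF f N k'[OF that] lam mu t fm FD x D] by (simp add: p_def q_def)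
  have i2: "integrable hyp (\<lambda>z. f z * cnj (kern l (w - l) t q r z) * of_real (Im z ^ k))" if "l \<le> w" for l
    using kern_monomial_integrable[OF f N k'[OF that] mu nu t fm FD x1 D1] by (simp add: e)
  have i3: "integrable hyp (\<lambda>z. f z * cnj (kern l (w - l) t r p z) * of_real (Im z ^ k))" if "l \<le> w" for l
    using kern_monomial_integrable[OF f N k'[OF that] nu lam t fm FD x2 D2] by (simp add: e)
  have t0: "t > 0" and Dpq: "det2 p q \<noteq> 0" and r: "r = - p - q" using t D by (simp_all add: p_def q_def r_def)
  have s: "f z * cnj (triple_kern w a b c t x z) * of_real (Im z ^ k) = f z * cnj (pair_kern w a b t p q z) * of_real (Im z ^ k)
     + f z * cnj (pair_kern w b c t q r z) * of_real (Im z ^ k) + f z * cnj (pair_kern w c a t r p z) * of_real (Im z ^ k)" for z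
    unfolding triple_kern_def e p_def[symmetric] q_def[symmetric] by (simp add: distrib_left distrib_right)
  note j1 = pair_kern_integrable[OF i1] and j2 = pair_kern_integrable[OF i2] and j3 = pair_kern_integrable[OF i3]
  show ?thesis
    unfolding s using nondeg_triple[OF f N k Dpq t0 fm abc r i1 i2 i3]
    by (simp only: Bochner_Integration.integral_add[OF Bochner_Integration.integrable_add[OF j1 j2] j3] Bochner_Integration.integral_add[OF j1 j2])
qed

text \<open>A nonzero vector of the pair provides \<open>A\<close>; the other one is then a multiple
  of the same bottom row, possibly 0.\<close>

lemma collinear_primitive:
  assumes D: "det2 p q = 0" and nz: "p \<noteq> (0, 0) \<or> q \<noteq> (0, 0)"
  obtains A \<kappa> \<kappa>' where "A \<in> SL2Z" "p = (\<kappa> * of_int (A $ 2 $ 1), \<kappa> * of_int (A $ 2 $ 2))"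
    "q = (\<kappa>' * of_int (A $ 2 $ 1), \<kappa>' * of_int (A $ 2 $ 2))" "\<kappa> \<noteq> 0 \<or> \<kappa>' \<noteq> 0"
proof -
  have Dr: "fst p * snd q = fst q * snd p" using D by (simp add: det2_def)
  have par: "\<exists>\<kappa>. q = (\<kappa> * of_int (A $ 2 $ 1), \<kappa> * of_int (A $ 2 $ 2))"
    if A: "A \<in> SL2Z" and e: "of_int (A $ 2 $ 1) * snd q = fst q * of_int (A $ 2 $ 2)" for A and q :: "rat \<times> rat"
  proof -
    define a b c d :: rat where "a = of_int (A $ 1 $ 1)" and "b = of_int (A $ 1 $ 2)" and "c = of_int (A $ 2 $ 1)" and "d = of_int (A $ 2 $ 2)"
    have det: "a * d - b * c = 1"
      using arg_cong[OF A[unfolded SL2Z_iff], of "of_int :: int \<Rightarrow> rat"] by (simp add: a_def b_def c_def d_def)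
    have e': "c * snd q = fst q * d" using e by (simp add: c_def d_def)
    have "(a * snd q - b * fst q) * c = a * (c * snd q) - b * c * fst q" by (simp add: algebra_simps)
    also have "\<dots> = (a * d - b * c) * fst q" unfolding e' by (simp add: algebra_simps)
    finally have 1: "(a * snd q - b * fst q) * c = fst q" unfolding det by simp
    have "(a * snd q - b * fst q) * d = a * d * snd q - b * (fst q * d)" by (simp add: algebra_simps)
    also have "\<dots> = (a * d - b * c) * snd q" unfolding e'[symmetric] by (simp add: algebra_simps)
    finally have 2: "(a * snd q - b * fst q) * d = snd q" unfolding det by simp
    show ?thesis using 1 2 by (intro exI[of _ "a * snd q - b * fst q"]) (simp add: prod_eq_iff c_def d_def)
  qed
  show ?thesis
  proof (cases "p = (0, 0)")
    case False
    obtain \<kappa> A where A: "\<kappa> \<noteq> 0" "A \<in> SL2Z" "p = (\<kappa> * of_int (A $ 2 $ 1), \<kappa> * of_int (A $ 2 $ 2))"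
      using rat_pair_primitive[OF False] by blast
    have "\<kappa> * (of_int (A $ 2 $ 1) * snd q) = \<kappa> * (fst q * of_int (A $ 2 $ 2))" using Dr by (simp add: A(3) mult_ac)
    then have "of_int (A $ 2 $ 1) * snd q = fst q * of_int (A $ 2 $ 2)" using A(1) by simp
    from par[OF A(2) this] show ?thesis using A that by blast
  next
    case True
    with nz have "q \<noteq> (0, 0)" by blast
    then obtain \<kappa> A where A: "\<kappa> \<noteq> 0" "A \<in> SL2Z" "q = (\<kappa> * of_int (A $ 2 $ 1), \<kappa> * of_int (A $ 2 $ 2))"
      using rat_pair_primitive by blast
    have "p = (0 * of_int (A $ 2 $ 1), 0 * of_int (A $ 2 $ 2))" using True by simp
    then show ?thesis using A that by blast
  qed
qed

lemma lin_multiple: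
  assumes "p = (\<kappa> * of_int (A $ 2 $ 1), \<kappa> * of_int (A $ 2 $ 2))"
  shows "lin p z = of_rat \<kappa> * automorphy_factor A z"
  by (simp add: assms lin_def automorphy_factor_def of_rat_mult algebra_simps)

lemma triple_kern_collinear:
  assumes A: "A \<in> SL2Z" and p: "fst x = (\<kappa> * of_int (A $ 2 $ 1), \<kappa> * of_int (A $ 2 $ 2))"
    and q: "snd x = (\<kappa>' * of_int (A $ 2 $ 1), \<kappa>' * of_int (A $ 2 $ 2))" and k: "k = w + 2"
  obtains C where "\<And>z. Im z > 0 \<Longrightarrow> triple_kern w a b c t x z = C * (inverse (automorphy_factor A z) ^ k * of_real (Im (moebius A z) powr t))"
proof -
  note lp = lin_multiple[OF p] and lq = lin_multiple[OF q]
  have lr: "lin (- fst x - snd x) z = of_rat (- \<kappa> - \<kappa>') * automorphy_factor A z" for z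
    by (rule lin_multiple) (simp add: p q algebra_simps)
  obtain c1 where c1: "\<And>z. Im z > 0 \<Longrightarrow> pair_kern w a b t (fst x) (snd x) z = c1 * (inverse (automorphy_factor A z) ^ k * of_real (Im (moebius A z) powr t))"
    by (rule pair_kern_collinear[OF lp lq k A]) (rule that)
  obtain c2 where c2: "\<And>z. Im z > 0 \<Longrightarrow> pair_kern w b c t (snd x) (- fst x - snd x) z = c2 * (inverse (automorphy_factor A z) ^ k * of_real (Im (moebius A z) powr t))"
    by (rule pair_kern_collinear[OF lq lr k A]) (rule that)
  obtain c3 where c3: "\<And>z. Im z > 0 \<Longrightarrow> pair_kern w c a t (- fst x - snd x) (fst x) z = c3 * (inverse (automorphy_factor A z) ^ k * of_real (Im (moebius A z) powr t))"
    by (rule pair_kern_collinear[OF lr lp k A]) (rule that)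
  show ?thesis
    by (rule that[of "c1 + c2 + c3"])
      (simp only: triple_kern_def rot_rot, simp only: rot_def fst_conv snd_conv c1 c2 c3 distrib_right)
qed

text \<open>The substitution by \<open>A\<close> moves the common cusp to infinity, where the
  integral is a strip integral of the slash of \<open>f\<close> by the inverse of
  \<open>A\<close>.\<close>

lemma triple_kern_degenerate:
  assumes f: "cusp_form N k f" and N: "N \<ge> 1" and k: "k = w + 2" and fm: "f \<in> borel_measurable borel"
    and A: "A \<in> SL2Z" and p: "fst x = (\<kappa> * of_int (A $ 2 $ 1), \<kappa> * of_int (A $ 2 $ 2))"
    and q: "snd x = (\<kappa>' * of_int (A $ 2 $ 1), \<kappa>' * of_int (A $ 2 $ 2))"
    and int: "integrable hyp (\<lambda>z. indicator {z. 0 \<le> Re (moebius A z) \<and> Re (moebius A z) < real N} z *\<^sub>R (f z * cnj (triple_kern w a b c t x z) * of_real (Im z ^ k)))"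
  shows "(\<integral>z. indicator {z. 0 \<le> Re (moebius A z) \<and> Re (moebius A z) < real N} z *\<^sub>R (f z * cnj (triple_kern w a b c t x z) * of_real (Im z ^ k)) \<partial>hyp) = 0"
proof -
  note [measurable] = fm
  obtain C where C: "\<And>z. Im z > 0 \<Longrightarrow> triple_kern w a b c t x z = C * (inverse (automorphy_factor A z) ^ k * of_real (Im (moebius A z) powr t))"
    by (rule triple_kern_collinear[OF A p q k]) (rule that)
  define h where "h z = indicator {z. 0 \<le> Re z \<and> Re z < real N} z *\<^sub>R (cnj C * (slash k (adj2 A) f z * of_real (Im z powr t * Im z ^ k)))" for z
  have hm[measurable]: "h \<in> borel_measurable borel"
    unfolding h_def slash_def automorphy_factor_def by measurable
  have Bm[measurable]: "{z. 0 \<le> Re (moebius A z) \<and> Re (moebius A z) < real N} \<in> sets borel" by measurable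
  have ae: "AE z in hyp. indicator {z. 0 \<le> Re (moebius A z) \<and> Re (moebius A z) < real N} z *\<^sub>R (f z * cnj (triple_kern w a b c t x z) * of_real (Im z ^ k)) = h (moebius A z)"
    using AE_hyp_upper
  proof eventually_elim
    case (elim z)
    show ?case unfolding C[OF elim] collinear_integrand[OF A elim] h_def by (simp add: indicator_def)
  qed
  have cong: "borel_measurable hyp = borel_measurable borel" by (rule measurable_cong_sets) auto
  have m1: "(\<lambda>z. indicator {z. 0 \<le> Re (moebius A z) \<and> Re (moebius A z) < real N} z *\<^sub>R (f z * cnj (triple_kern w a b c t x z) * of_real (Im z ^ k))) \<in> borel_measurable hyp"
    unfolding cong by measurable
  have m2: "(\<lambda>z. h (moebius A z)) \<in> borel_measurable hyp" unfolding cong by measurable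
  note inv = moebius_hyp_invariant[OF A]
  have "integrable hyp (\<lambda>z. h (moebius A z))"
    using int integrable_cong_AE[OF m1 m2 ae] by blast
  then have hi: "integrable hyp h" using hyp_invariant_integral(2)[OF inv hm] by blast
  have "(\<integral>z. indicator {z. 0 \<le> Re (moebius A z) \<and> Re (moebius A z) < real N} z *\<^sub>R (f z * cnj (triple_kern w a b c t x z) * of_real (Im z ^ k)) \<partial>hyp) = (\<integral>z. h (moebius A z) \<partial>hyp)"
    by (rule integral_cong_AE[OF m1 m2 ae])
  also have "\<dots> = (\<integral>z. h z \<partial>hyp)" by (rule hyp_invariant_integral(1)[OF inv hm])
  also have "\<dots> = 0"
    unfolding h_def by (rule cusp_strip_integral_zero[OF f N SL2Z_adj2[OF A]]) (rule hi[unfolded h_def])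
  finally show ?thesis .
qed

section \<open>Analytic continuation\<close>

definition triple_L :: "nat \<Rightarrow> rat \<times> rat \<Rightarrow> rat \<times> rat \<Rightarrow> rat \<times> rat \<Rightarrow> complex \<Rightarrow> complex \<Rightarrow> complex \<Rightarrow> complex \<Rightarrow> complex \<Rightarrow> complex" where
  "triple_L w lam mu nu a b c t z = L_summand w lam mu a b z t + L_summand w mu nu b c z t + L_summand w nu lam c a z t"

lemma L_summand_measurable [measurable]: "(\<lambda>z. L_summand w' u v a' b' z t) \<in> borel_measurable borel"
  unfolding L_summand_def by measurable

lemma triple_L_measurable [measurable]: "triple_L w lam mu nu a b c t \<in> borel_measurable borel"
  unfolding triple_L_def[abs_def] by measurable

lemma triple_L_holomorphic:
  assumes "Im z > 0"
  shows "(\<lambda>t. triple_L w lam mu nu a b c t z) holomorphic_on S"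
proof -
  have "completed_eisenstein (l + 1) v z holomorphic_on S" for l v
    using completed_eisenstein_holomorphic[of "l + 1" z v] assms by (auto intro: holomorphic_on_subset)
  then show ?thesis unfolding triple_L_def L_summand_def by (intro holomorphic_intros)
qed

context
  fixes N k w :: nat and lam mu nu :: "rat \<times> rat" and a b c :: complex and f :: "complex \<Rightarrow> complex" and F :: "complex set"
  assumes f: "cusp_form N k f" and N: "N \<ge> 1" and k: "k = w + 2"
    and lam: "lam \<in> torsion_vectors N" and mu: "mu \<in> torsion_vectors N" and nu: "nu \<in> torsion_vectors N"
    and lmn: "integral_vector (lam + mu + nu)" and abc: "a + b + c = 0"
    and fm [measurable]: "f \<in> borel_measurable borel" and FD: "fundamental_domain (principal_congruence_subgroup N) F"
begin

lemma fundamental_domain_borel [measurable]: "F \<in> sets borel"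
  by (rule fd_measurable[OF FD])

lemma rot_bijs:
  "bij_betw rot (vec_coset lam \<times> vec_coset mu) (vec_coset mu \<times> vec_coset nu)"
  "bij_betw (\<lambda>x. rot (rot x)) (vec_coset lam \<times> vec_coset mu) (vec_coset nu \<times> vec_coset lam)"
proof -
  show 1: "bij_betw rot (vec_coset lam \<times> vec_coset mu) (vec_coset mu \<times> vec_coset nu)"
    by (rule rot_bij_betw[OF lmn])
  have "integral_vector (mu + nu + lam)" using lmn by (simp add: add_ac)
  from bij_betw_trans[OF 1 rot_bij_betw[OF this]]
  show "bij_betw (\<lambda>x. rot (rot x)) (vec_coset lam \<times> vec_coset mu) (vec_coset nu \<times> vec_coset lam)"
    by (simp add: o_def)
qed

lemma triple_kern_nn_bound:
  assumes t: "t > 2"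
  obtains C where "\<And>z. Im z > 0 \<Longrightarrow>
    (\<integral>\<^sup>+x. ennreal (norm (f z * cnj (triple_kern w a b c t x z) * of_real (Im z ^ k))) \<partial>count_space (vec_coset lam \<times> vec_coset mu)) \<le> ennreal C"
proof -
  define g where "g a b z x = ennreal (norm (f z * cnj (pair_kern w a b t (fst x) (snd x) z) * of_real (Im z ^ k)))" for a b z x
  obtain C1 where C1: "C1 \<ge> 0" "\<And>z. Im z > 0 \<Longrightarrow> (\<integral>\<^sup>+x. g a b z x \<partial>count_space (vec_coset lam \<times> vec_coset mu)) \<le> ennreal C1"
    unfolding g_def by (rule pair_kern_nn_bound[OF f N k lam mu t, where a = a and b = b]) (rule that[unfolded g_def])
  obtain C2 where C2: "C2 \<ge> 0" "\<And>z. Im z > 0 \<Longrightarrow> (\<integral>\<^sup>+x. g b c z x \<partial>count_space (vec_coset mu \<times> vec_coset nu)) \<le> ennreal C2"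
    unfolding g_def by (rule pair_kern_nn_bound[OF f N k mu nu t, where a = b and b = c]) (rule that[unfolded g_def])
  obtain C3 where C3: "C3 \<ge> 0" "\<And>z. Im z > 0 \<Longrightarrow> (\<integral>\<^sup>+x. g c a z x \<partial>count_space (vec_coset nu \<times> vec_coset lam)) \<le> ennreal C3"
    unfolding g_def by (rule pair_kern_nn_bound[OF f N k nu lam t, where a = c and b = a]) (rule that[unfolded g_def])
  show ?thesis
  proof (rule that)
    fix z :: complex assume z: "Im z > 0"
    let ?X = "vec_coset lam \<times> vec_coset mu"
    have "(\<integral>\<^sup>+x. ennreal (norm (f z * cnj (triple_kern w a b c t x z) * of_real (Im z ^ k))) \<partial>count_space ?X)
      \<le> (\<integral>\<^sup>+x. (g a b z x + g b c z (rot x)) + g c a z (rot (rot x)) \<partial>count_space ?X)"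
    proof (rule nn_integral_mono)
      fix x
      have "norm (F * cnj (X + Y + Z) * H) \<le> norm (F * cnj X * H) + norm (F * cnj Y * H) + norm (F * cnj Z * H)" for F X Y Z H :: complex
        unfolding complex_cnj_add distrib_left distrib_right
        by (intro norm_triangle_le add_right_mono norm_triangle_ineq)
      then show "ennreal (norm (f z * cnj (triple_kern w a b c t x z) * of_real (Im z ^ k))) \<le> (g a b z x + g b c z (rot x)) + g c a z (rot (rot x))"
        unfolding g_def triple_kern_def by (simp add: ennreal_leI flip: ennreal_plus)
    qed
    also have "\<dots> = (\<integral>\<^sup>+x. g a b z x \<partial>count_space ?X) + (\<integral>\<^sup>+x. g b c z (rot x) \<partial>count_space ?X) + (\<integral>\<^sup>+x. g c a z (rot (rot x)) \<partial>count_space ?X)"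
      by (simp add: nn_integral_add)
    also have "\<dots> = (\<integral>\<^sup>+x. g a b z x \<partial>count_space ?X) + (\<integral>\<^sup>+x. g b c z x \<partial>count_space (vec_coset mu \<times> vec_coset nu)) + (\<integral>\<^sup>+x. g c a z x \<partial>count_space (vec_coset nu \<times> vec_coset lam))"
      by (simp only: nn_integral_bij_count_space[OF rot_bijs(1)] nn_integral_bij_count_space[OF rot_bijs(2)])
    also have "\<dots> \<le> ennreal C1 + ennreal C2 + ennreal C3" by (intro add_mono C1(2) C2(2) C3(2) z)
    also have "\<dots> = ennreal (C1 + C2 + C3)" using C1(1) C2(1) C3(1) by simp
    finally show "(\<integral>\<^sup>+x. ennreal (norm (f z * cnj (triple_kern w a b c t x z) * of_real (Im z ^ k))) \<partial>count_space ?X) \<le> ennreal (C1 + C2 + C3)" .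
  qed
qed

lemma triple_kern_has_sum:
  assumes t: "t > 2" and z: "Im z > 0"
  shows "((\<lambda>x. triple_kern w a b c t x z) has_sum triple_L w lam mu nu a b c (of_real t) z) (vec_coset lam \<times> vec_coset mu)"
  unfolding triple_kern_def triple_L_def
  by (intro has_sum_add pair_kern_infsum[OF t z]
      has_sum_reindex_bij_betw[OF rot_bijs(1), of "\<lambda>x. pair_kern w b c t (fst x) (snd x) z", THEN iffD2]
      has_sum_reindex_bij_betw[OF rot_bijs(2), of "\<lambda>x. pair_kern w c a t (fst x) (snd x) z", THEN iffD2])

lemma triple_orbit_zero:
  assumes t: "t > 2" and x: "x \<in> vec_coset lam \<times> vec_coset mu"
  shows "(\<Sum>\<^sub>\<infinity>y\<in>pact x ` principal_congruence_subgroup N. \<integral>z. indicator F z *\<^sub>R (f z * cnj (triple_kern w a b c t y z) * of_real (Im z ^ k)) \<partial>hyp) = 0"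
proof -
  define \<phi> where "\<phi> = (\<lambda>x z. f z * cnj (triple_kern w a b c t x z) * of_real (Im z ^ k))"
  let ?Ob = "pact x ` principal_congruence_subgroup N"
  obtain C where C: "\<And>z. Im z > 0 \<Longrightarrow> (\<integral>\<^sup>+x. ennreal (norm (\<phi> x z)) \<partial>count_space (vec_coset lam \<times> vec_coset mu)) \<le> ennreal C"
    unfolding \<phi>_def by (rule triple_kern_nn_bound[OF t]) (rule that[unfolded \<phi>_def])
  have sub: "?Ob \<subseteq> vec_coset lam \<times> vec_coset mu" using pact_mem[OF N lam mu _ x] by blast
  have bd: "(\<integral>\<^sup>+y. ennreal (norm (\<phi> y z)) \<partial>count_space ?Ob) \<le> ennreal C" if "Im z > 0" for z
    using nn_integral_count_space_subset_le[OF sub] C[OF that] by (rule order_trans)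
  have m: "\<phi> y \<in> borel_measurable borel" for y unfolding \<phi>_def by measurable
  have xO: "x \<in> ?Ob" using pact_one[of x] Gamma_N_one by (metis imageI)
  have eq: "\<phi> x (moebius C z) = \<phi> (pact x C) z" if "C \<in> principal_congruence_subgroup N" "Im z > 0" for C z
    unfolding \<phi>_def by (rule cusp_form_kernel_equivariant[OF f that triple_kern_moebius[OF Gamma_N_SL2Z[OF that(1)] that(2) k]])
  have cO: "countable ?Ob" by (intro countable_image countable_matrices)
  have fin: "(\<integral>\<^sup>+z. indicator F z * (\<integral>\<^sup>+y. ennreal (norm (\<phi> y z)) \<partial>count_space ?Ob) \<partial>hyp) < \<infinity>"
    by (rule fd_nn_integral_finite[OF FD N bd])
  have "(\<Sum>\<^sub>\<infinity>y\<in>?Ob. \<integral>z. indicator F z *\<^sub>R \<phi> y z \<partial>hyp) = 0"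
  proof (cases "det2 (fst x) (snd x) = 0")
    case False
    show ?thesis
    proof (rule orbit_integral_zero[OF FD, where \<phi> = \<phi> and xa = pact and Ob = ?Ob and B = UNIV, OF m xO _ _ eq cO fin])
      show "bij_betw (pact x) {C \<in> principal_congruence_subgroup N. moebius C z \<in> UNIV} ?Ob" for z
        using pact_inj_on[OF False] by (auto simp: bij_betw_def inj_on_def)
      show "(\<integral>z. indicator UNIV z *\<^sub>R \<phi> x z \<partial>hyp) = 0"
        using triple_kern_nondegenerate[OF f N k lam mu nu lmn abc t fm FD x False] by (simp add: \<phi>_def)
    qed simp_all
  next
    case D: True
    show ?thesis
    proof (cases "fst x = (0, 0) \<and> snd x = (0, 0)")
      case True
      \<comment> \<open>The zero pair is fixed by the whole group, and all its kernels vanish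
        because \<open>inverse 0 = 0\<close>.\<close>
      have "\<phi> y z = 0" if "y \<in> ?Ob" for y z
      proof -
        have "act (0, 0) C = (0, 0)" for C by (simp add: act_def)
        then have "y = ((0, 0), (0, 0))" using that True by (auto simp: pact_def)
        then show ?thesis by (simp add: \<phi>_def triple_kern_def pair_kern_def kern_def rot_def)
      qed
      then show ?thesis by (intro infsum_0) simp
    next
      case False
      obtain A \<kappa> \<kappa>' where A: "A \<in> SL2Z" "fst x = (\<kappa> * of_int (A $ 2 $ 1), \<kappa> * of_int (A $ 2 $ 2))"
        "snd x = (\<kappa>' * of_int (A $ 2 $ 1), \<kappa>' * of_int (A $ 2 $ 2))" "\<kappa> \<noteq> 0 \<or> \<kappa>' \<noteq> 0"
        by (rule collinear_primitive[OF D]) (use False in blast, rule that)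
      show ?thesis
      proof (rule orbit_integral_zero[OF FD, where \<phi> = \<phi> and xa = pact and Ob = ?Ob
            and B = "{z. 0 \<le> Re (moebius A z) \<and> Re (moebius A z) < real N}", OF m xO _ _ eq cO fin])
        show "{z. 0 \<le> Re (moebius A z) \<and> Re (moebius A z) < real N} \<in> sets borel" by measurable
        show "bij_betw (pact x) {C \<in> principal_congruence_subgroup N. moebius C z \<in> {z. 0 \<le> Re (moebius A z) \<and> Re (moebius A z) < real N}} ?Ob"
          if z: "Im z > 0" for z
        proof (rule cusp_strip_bij_betw[OF N A(1) z])
          show "pact x (adj2 A ** (upper_unip n ** A)) = pact x (mat 1)" for n
            unfolding pact_one by (simp add: pact_def act_stabilizer[OF A(1,2)] act_stabilizer[OF A(1,3)])
          show "\<exists>n. int N dvd n \<and> A ** E = upper_unip n ** A" if E: "E \<in> principal_congruence_subgroup N" "pact x E = pact x (mat 1)" for E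
          proof -
            have e: "act (fst x) E = fst x" "act (snd x) E = snd x" using E(2) by (auto simp: pact_def prod_eq_iff)
            show ?thesis
            \<comment> \<open>The stabilizer of the pair is read off from whichever vector is
              nonzero.\<close>
            proof (cases "\<kappa> = 0")
              case False
              then show ?thesis by (rule stabilizer_Gamma_N[OF A(1,2) _ E(1) e(1)]) blast
            next
              case True
              with A(4) have "\<kappa>' \<noteq> 0" by simp
              then show ?thesis by (rule stabilizer_Gamma_N[OF A(1,3) _ E(1) e(2)]) blast
            qed
          qed
          show "pact x (C ** E) = pact x (D ** E)" if "pact x C = pact x D" for C D E
            unfolding pact_mult that ..
        qed
        show "(\<integral>z. indicator {z. 0 \<le> Re (moebius A z) \<and> Re (moebius A z) < real N} z *\<^sub>R \<phi> x z \<partial>hyp) = 0"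
          if "integrable hyp (\<lambda>z. indicator {z. 0 \<le> Re (moebius A z) \<and> Re (moebius A z) < real N} z *\<^sub>R \<phi> x z)"
          using triple_kern_degenerate[OF f N k fm A(1-3)] that unfolding \<phi>_def by blast
      qed
    qed
  qed
  then show ?thesis by (simp only: \<phi>_def)
qed

lemma triple_integral_zero_real:
  assumes t: "t > 2"
  shows "(\<integral>z. indicator F z *\<^sub>R (f z * cnj (triple_L w lam mu nu a b c (of_real t) z) * of_real (Im z ^ k)) \<partial>hyp) = 0"
proof -
  let ?X = "vec_coset lam \<times> vec_coset mu"
  define \<phi> where "\<phi> = (\<lambda>x z. f z * cnj (triple_kern w a b c t x z) * of_real (Im z ^ k))"
  obtain C where C: "\<And>z. Im z > 0 \<Longrightarrow> (\<integral>\<^sup>+x. ennreal (norm (\<phi> x z)) \<partial>count_space ?X) \<le> ennreal C"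
    unfolding \<phi>_def by (rule triple_kern_nn_bound[OF t]) (rule that[unfolded \<phi>_def])
  have "(\<integral>z. indicator F z *\<^sub>R (\<Sum>\<^sub>\<infinity>x\<in>?X. \<phi> x z) \<partial>hyp) = 0"
  proof (rule total_integral_zero[OF FD, where \<phi> = \<phi> and xa = pact and X = ?X])
    show "countable ?X" by simp
    show "\<phi> x \<in> borel_measurable borel" for x unfolding \<phi>_def by measurable
    show "pact x C \<in> ?X" if "x \<in> ?X" "C \<in> principal_congruence_subgroup N" for x C by (rule pact_mem[OF N lam mu that(2,1)])
    show "pact x (mat 1) = x" for x by (rule pact_one)
    show "pact x (C ** D) = pact (pact x C) D" for x C D by (rule pact_mult)
    show "(\<integral>\<^sup>+z. indicator F z * (\<integral>\<^sup>+x. ennreal (norm (\<phi> x z)) \<partial>count_space ?X) \<partial>hyp) < \<infinity>"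
      by (rule fd_nn_integral_finite[OF FD N C])
    show "(\<Sum>\<^sub>\<infinity>y\<in>pact x ` principal_congruence_subgroup N. \<integral>z. indicator F z *\<^sub>R \<phi> y z \<partial>hyp) = 0" if "x \<in> ?X" for x
      unfolding \<phi>_def by (rule triple_orbit_zero[OF t that])
  qed
  moreover have "indicator F z *\<^sub>R (\<Sum>\<^sub>\<infinity>x\<in>?X. \<phi> x z) = indicator F z *\<^sub>R (f z * cnj (triple_L w lam mu nu a b c (of_real t) z) * of_real (Im z ^ k))" for z
  proof (cases "z \<in> F")
    case True
    then have z: "Im z > 0" by (rule fd_upper[OF FD])
    have "((\<lambda>x. \<phi> x z) has_sum (f z * cnj (triple_L w lam mu nu a b c (of_real t) z) * of_real (Im z ^ k))) ?X"
      unfolding \<phi>_def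
      by (intro has_sum_cmult_left has_sum_cmult_right) (use triple_kern_has_sum[OF t z] in simp)
    then show ?thesis by (simp only: infsumI)
  qed simp
  ultimately show ?thesis by simp
qed

text \<open>The weights \<open>l + 1\<close> and \<open>w - l + 1\<close> add up to
  \<open>k\<close>, so the product is invariant. Uniformity for \<open>|t| \<le> R\<close> comes
  from the bound for the completed series on discs and supplies the majorant for differentiation
  under the integral.\<close>

lemma L_summand_term_bounded:
  assumes u: "u \<in> torsion_vectors N" and v: "v \<in> torsion_vectors N" and l: "l \<le> w" and R: "R \<ge> 0"
  obtains C where "C \<ge> 0" "\<And>t z. norm t \<le> R \<Longrightarrow> Im z > 0 \<Longrightarrow>
    norm (f z) * (norm (completed_eisenstein (l + 1) u z t) * norm (completed_eisenstein (w - l + 1) v z t)) * Im z ^ k \<le> C"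
proof -
  define \<Omega> where "\<Omega> t z = norm (f z) * (norm (completed_eisenstein (l + 1) u z t) * norm (completed_eisenstein (w - l + 1) v z t)) * Im z ^ k" for t z
  have tr: "\<Omega> t (moebius A z) = norm (slash k A f z) * (norm (completed_eisenstein (l + 1) (act u A) z t) * norm (completed_eisenstein (w - l + 1) (act v A) z t)) * Im z ^ k"
    if A: "A \<in> SL2Z" and z: "Im z > 0" for A z t
  proof -
    define j where "j = cmod (automorphy_factor A z)"
    have j: "j > 0" using automorphy_factor_nonzero[OF A z] by (simp add: j_def)
    have 1: "norm (f (moebius A z)) = norm (slash k A f z) * j ^ k"
      unfolding slash_eq[OF A z, of f k] norm_mult norm_power j_def ..
    have 2: "Im (moebius A z) ^ k = Im z ^ k * (inverse j ^ k * inverse j ^ k)"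
      unfolding Im_moebius[OF A z] j_def divide_inverse power2_eq_square by (simp add: power_mult_distrib)
    have 3: "j ^ (l + 1) * j ^ (w - l + 1) = j ^ k" using l by (simp add: k flip: power_add)
    have "j ^ k * inverse j ^ k = 1" using j by (simp flip: power_mult_distrib)
    moreover have "(S * j ^ k) * ((j ^ (l + 1) * X) * (j ^ (w - l + 1) * Y)) * (Z * (inverse j ^ k * inverse j ^ k))
      = S * (X * Y) * Z * ((j ^ k * inverse j ^ k) * ((j ^ (l + 1) * j ^ (w - l + 1)) * inverse j ^ k))" for S X Y Z by (simp only: mult_ac)
    ultimately show ?thesis
      unfolding \<Omega>_def 1 2 completed_eisenstein_moebius[OF A z] norm_mult norm_power j_def[symmetric] by (simp only: 3 mult_1_right)
  qed
  have inv: "\<Omega> t (moebius A z) = \<Omega> t z" if "t \<in> cball 0 R" and A: "A \<in> principal_congruence_subgroup N" and z: "Im z > 0" for t A z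
  proof -
    note A' = Gamma_N_SL2Z[OF A]
    have "slash k A f z = f z"
      unfolding slash_def cusp_form_Gamma_N[OF f A z] using automorphy_factor_nonzero[OF A' z] by simp
    then show ?thesis
      unfolding tr[OF A' z] unfolding \<Omega>_def completed_eisenstein_cong[OF vec_coset_act_Gamma_N[OF N u A]] completed_eisenstein_cong[OF vec_coset_act_Gamma_N[OF N v A]]
      by simp
  qed
  have bd: "\<exists>C. \<forall>t\<in>cball 0 R. \<forall>z\<in>siegel_set. \<Omega> t (moebius A z) \<le> C" if A: "A \<in> SL2Z" for A
  proof -
    have l1: "l + 1 \<ge> 1" "w - l + 1 \<ge> 1" by simp_all
    obtain C1 a1 where C1: "C1 \<ge> 0" "\<And>z s. Im z > 0 \<Longrightarrow> norm s \<le> R \<Longrightarrow> norm (completed_eisenstein (l + 1) (act u A) z s) \<le> C1 * height z ^ a1"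
      by (rule completed_eisenstein_bound[OF l1(1) R]) (rule that)
    obtain C2 a2 where C2: "C2 \<ge> 0" "\<And>z s. Im z > 0 \<Longrightarrow> norm s \<le> R \<Longrightarrow> norm (completed_eisenstein (w - l + 1) (act v A) z s) \<le> C2 * height z ^ a2"
      by (rule completed_eisenstein_bound[OF l1(2) R]) (rule that)
    obtain C where C: "C \<ge> 0" "\<And>z. z \<in> siegel_set \<Longrightarrow> norm (slash k A f z) * height z ^ (a1 + a2 + k) \<le> C"
      by (rule cusp_form_slash_times_height_bounded[OF f N A]) (rule that)
    have "\<Omega> t (moebius A z) \<le> C * (C1 * C2)" if t: "t \<in> cball 0 R" and z: "z \<in> siegel_set" for t z
    proof -
      have z0: "Im z > 0" using z by (simp add: siegel_set_def)
      have t': "norm t \<le> R" using t by simp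
      note h = height_ge[OF z0]
      have "\<Omega> t (moebius A z) \<le> norm (slash k A f z) * ((C1 * height z ^ a1) * (C2 * height z ^ a2)) * height z ^ k"
        unfolding tr[OF A z0]
        by (intro mult_mono power_mono C1(2)[OF z0 t'] C2(2)[OF z0 t'] mult_nonneg_nonneg) (use h z0 C1(1) C2(1) in auto)
      also have "\<dots> = (norm (slash k A f z) * height z ^ (a1 + a2 + k)) * (C1 * C2)"
        by (simp add: power_add mult_ac)
      also have "\<dots> \<le> C * (C1 * C2)" using C1(1) C2(1) by (intro mult_right_mono C(2) z) auto
      finally show ?thesis .
    qed
    then show ?thesis by blast
  qed
  obtain C where "C \<ge> 0" "\<And>t z. t \<in> cball 0 R \<Longrightarrow> Im z > 0 \<Longrightarrow> \<Omega> t z \<le> C"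
    by (rule bounded_via_siegel_set[where \<Omega> = \<Omega> and S = "cball 0 R", OF N inv bd]) (blast intro: that)+
  then show ?thesis by (intro that[of C]) (auto simp: \<Omega>_def)
qed

lemma L_summand_bounded:
  assumes u: "u \<in> torsion_vectors N" and v: "v \<in> torsion_vectors N" and R: "R \<ge> 0"
  obtains C where "\<And>t z. norm t \<le> R \<Longrightarrow> Im z > 0 \<Longrightarrow> norm (f z) * norm (L_summand w u v a' b' z t) * Im z ^ k \<le> C"
proof -
  have "\<exists>C. \<forall>t z. norm t \<le> R \<longrightarrow> Im z > 0 \<longrightarrow>
    norm (f z) * (norm (completed_eisenstein (l + 1) u z t) * norm (completed_eisenstein (w - l + 1) v z t)) * Im z ^ k \<le> C" if "l \<le> w" for l
    by (rule L_summand_term_bounded[OF u v that R]) blast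
  then obtain C where C: "\<And>l t z. l \<le> w \<Longrightarrow> norm t \<le> R \<Longrightarrow> Im z > 0 \<Longrightarrow>
    norm (f z) * (norm (completed_eisenstein (l + 1) u z t) * norm (completed_eisenstein (w - l + 1) v z t)) * Im z ^ k \<le> C l" by metis
  define co where "co l = norm (of_nat (w choose l) * cnj a' ^ l * cnj b' ^ (w - l))" for l
  show ?thesis
  proof (rule that)
    fix t z :: complex assume t: "norm t \<le> R" and z: "Im z > 0"
    have "norm (L_summand w u v a' b' z t) \<le> (\<Sum>l\<le>w. co l * (norm (completed_eisenstein (l + 1) u z t) * norm (completed_eisenstein (w - l + 1) v z t)))"
      unfolding L_summand_def co_def norm_mult[symmetric] by (rule norm_sum)
    then have "norm (f z) * norm (L_summand w u v a' b' z t) * Im z ^ k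
      \<le> norm (f z) * (\<Sum>l\<le>w. co l * (norm (completed_eisenstein (l + 1) u z t) * norm (completed_eisenstein (w - l + 1) v z t))) * Im z ^ k"
      using z by (intro mult_right_mono mult_left_mono) auto
    also have "\<dots> = (\<Sum>l\<le>w. co l * (norm (f z) * (norm (completed_eisenstein (l + 1) u z t) * norm (completed_eisenstein (w - l + 1) v z t)) * Im z ^ k))"
      unfolding sum_distrib_left sum_distrib_right by (rule sum.cong) (simp_all only: mult_ac)
    also have "\<dots> \<le> (\<Sum>l\<le>w. co l * C l)"
      using C[OF _ t z] by (intro sum_mono mult_left_mono) (auto simp: co_def)
    finally show "norm (f z) * norm (L_summand w u v a' b' z t) * Im z ^ k \<le> (\<Sum>l\<le>w. co l * C l)" .
  qed
qed

lemma triple_L_bounded: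
  assumes R: "R \<ge> 0"
  obtains C where "\<And>t z. norm t \<le> R \<Longrightarrow> Im z > 0 \<Longrightarrow> norm (f z) * norm (triple_L w lam mu nu a b c t z) * Im z ^ k \<le> C"
proof -
  obtain C1 where C1: "\<And>t z. norm t \<le> R \<Longrightarrow> Im z > 0 \<Longrightarrow> norm (f z) * norm (L_summand w lam mu a b z t) * Im z ^ k \<le> C1"
    by (rule L_summand_bounded[OF lam mu R]) (rule that)
  obtain C2 where C2: "\<And>t z. norm t \<le> R \<Longrightarrow> Im z > 0 \<Longrightarrow> norm (f z) * norm (L_summand w mu nu b c z t) * Im z ^ k \<le> C2"
    by (rule L_summand_bounded[OF mu nu R]) (rule that)
  obtain C3 where C3: "\<And>t z. norm t \<le> R \<Longrightarrow> Im z > 0 \<Longrightarrow> norm (f z) * norm (L_summand w nu lam c a z t) * Im z ^ k \<le> C3"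
    by (rule L_summand_bounded[OF nu lam R]) (rule that)
  show ?thesis
  proof (rule that)
    fix t z :: complex assume t: "norm t \<le> R" and z: "Im z > 0"
    have "norm (f z) * norm (triple_L w lam mu nu a b c t z) * Im z ^ k
      \<le> norm (f z) * (norm (L_summand w lam mu a b z t) + norm (L_summand w mu nu b c z t) + norm (L_summand w nu lam c a z t)) * Im z ^ k"
      unfolding triple_L_def using z
      by (intro mult_right_mono mult_left_mono norm_triangle_le add_right_mono norm_triangle_ineq) auto
    also have "\<dots> \<le> C1 + C2 + C3"
      unfolding distrib_left distrib_right by (intro add_mono C1 C2 C3 t z)
    finally show "norm (f z) * norm (triple_L w lam mu nu a b c t z) * Im z ^ k \<le> C1 + C2 + C3" .
  qed
qed

text \<open>The integrand is the conjugate of the Petersson integrand: \<open>f * cnj L\<close>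
  would be antiholomorphic in \<open>t\<close>, while \<open>cnj f * L\<close> is holomorphic. The
  integral is then entire and vanishes for real \<open>t > 2\<close>, hence everywhere.\<close>

lemma triple_L_integrand:
  shows "integrable hyp (\<lambda>z. indicator F z *\<^sub>R (cnj (f z) * triple_L w lam mu nu a b c t z * of_real (Im z ^ k)))"
    and "(\<integral>z. indicator F z *\<^sub>R (cnj (f z) * triple_L w lam mu nu a b c t z * of_real (Im z ^ k)) \<partial>hyp) = 0"
proof -
  define \<phi> where "\<phi> t z = indicator F z *\<^sub>R (cnj (f z) * triple_L w lam mu nu a b c t z * of_real (Im z ^ k))" for t z
  have cong: "borel_measurable hyp = borel_measurable borel" by (rule measurable_cong_sets) auto
  have m: "\<phi> t \<in> borel_measurable hyp" for t unfolding \<phi>_def[abs_def] cong by measurable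
  have bd: "\<exists>C. \<forall>t z. norm t \<le> R \<longrightarrow> norm (\<phi> t z) \<le> C * indicator F z" if "R \<ge> 0" for R
  proof -
    obtain C where C: "\<And>t z. norm t \<le> R \<Longrightarrow> Im z > 0 \<Longrightarrow> norm (f z) * norm (triple_L w lam mu nu a b c t z) * Im z ^ k \<le> C"
      by (rule triple_L_bounded[OF \<open>R \<ge> 0\<close>]) (rule that)
    have "norm (\<phi> t z) \<le> C * indicator F z" if t: "norm t \<le> R" for t z
    proof (cases "z \<in> F")
      case True
      then have z: "Im z > 0" by (rule fd_upper[OF FD])
      then show ?thesis using C[OF t z] True by (simp add: \<phi>_def norm_mult norm_power)
    qed (simp add: \<phi>_def)
    then show ?thesis by blast
  qed
  have iF: "integrable hyp (\<lambda>z. C * indicator F z :: real)" for C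
    using emeasure_hyp_fd_finite[OF FD N] by (intro integrable_mult_right integrable_real_indicator) auto
  have int: "integrable hyp (\<phi> t)" for t
  proof -
    obtain C where "\<And>z. norm (\<phi> t z) \<le> C * indicator F z" using bd[of "norm t"] by auto
    then show ?thesis
      by (intro Bochner_Integration.integrable_bound[OF iF[of C] m]) (auto intro!: AE_I2 intro: order_trans[OF _ abs_ge_self])
  qed
  have hol: "(\<lambda>t. \<integral>z. \<phi> t z \<partial>hyp) holomorphic_on UNIV"
    unfolding holomorphic_on_open[OF open_UNIV]
  proof
    fix s0 :: complex
    obtain C where C: "\<And>t z. norm t \<le> norm s0 + 1 \<Longrightarrow> norm (\<phi> t z) \<le> C * indicator F z"
      using bd[of "norm s0 + 1"] by auto
    have "((\<lambda>s. \<integral>z. \<phi> s z \<partial>hyp) has_field_derivative (\<integral>z. deriv (\<lambda>s. \<phi> s z) s0 \<partial>hyp)) (at s0)"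
    proof (rule has_field_derivative_lebesgue_integral[where r = 1 and B = "\<lambda>z. C * indicator F z"])
      show "(\<lambda>s. \<phi> s z) holomorphic_on ball s0 1" for z
      proof (cases "z \<in> F")
        case True
        then have "Im z > 0" by (rule fd_upper[OF FD])
        then show ?thesis using True by (auto simp: \<phi>_def intro!: holomorphic_intros triple_L_holomorphic)
      qed (simp add: \<phi>_def)
      show "norm (\<phi> s z) \<le> C * indicator F z" if "s \<in> ball s0 1" for s z
      proof (rule C)
        show "norm s \<le> norm s0 + 1" using that norm_triangle_ineq2[of s s0] by (simp add: dist_norm norm_minus_commute)
      qed
    qed (use m iF in auto)
    then show "\<exists>f'. ((\<lambda>s. \<integral>z. \<phi> s z \<partial>hyp) has_field_derivative f') (at s0)" by blast
  qed
  have real0: "(\<integral>z. \<phi> s z \<partial>hyp) = 0" if s: "s \<in> complex_of_real ` {2<..}" for s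
  proof -
    obtain t where t: "t > 2" "s = of_real t" using s by auto
    have "(\<integral>z. \<phi> s z \<partial>hyp) = (\<integral>z. cnj (indicator F z *\<^sub>R (f z * cnj (triple_L w lam mu nu a b c (of_real t) z) * of_real (Im z ^ k))) \<partial>hyp)"
      unfolding \<phi>_def t(2) by simp
    also have "\<dots> = cnj (\<integral>z. indicator F z *\<^sub>R (f z * cnj (triple_L w lam mu nu a b c (of_real t) z) * of_real (Im z ^ k)) \<partial>hyp)"
      by (rule Bochner_Integration.integral_cnj)
    also have "\<dots> = 0" unfolding triple_integral_zero_real[OF t(1)] by simp
    finally show ?thesis .
  qed
  \<comment> \<open>The zeros fill a real half-line, and any of its points, here 3, is an
    accumulation point.\<close>
  have lim: "(3 :: complex) islimpt complex_of_real ` {2<..}"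
    unfolding islimpt_approachable
  proof (intro allI impI)
    fix e :: real assume e: "e > 0"
    then have "complex_of_real (3 + e / 2) \<in> complex_of_real ` {2<..}" by (intro imageI) simp
    then show "\<exists>x'\<in>complex_of_real ` {2<..}. x' \<noteq> 3 \<and> dist x' 3 < e"
      by (rule bexI[rotated]) (use e in \<open>simp add: dist_norm\<close>)
  qed
  have "(\<integral>z. \<phi> t z \<partial>hyp) = 0"
    by (rule analytic_continuation[OF hol open_UNIV connected_UNIV _ _ lim real0]) auto
  then show "(\<integral>z. indicator F z *\<^sub>R (cnj (f z) * triple_L w lam mu nu a b c t z * of_real (Im z ^ k)) \<partial>hyp) = 0"
    by (simp add: \<phi>_def)
  show "integrable hyp (\<lambda>z. indicator F z *\<^sub>R (cnj (f z) * triple_L w lam mu nu a b c t z * of_real (Im z ^ k)))"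
    using int[of t] by (simp add: \<phi>_def[abs_def])
qed

end

section \<open>Transfer to the Petersson product\<close>

lemma integral_hyp_density:
  fixes h :: "complex \<Rightarrow> complex"
  assumes [measurable]: "h \<in> borel_measurable borel"
  shows "integrable hyp h \<longleftrightarrow> integrable lborel (\<lambda>z. (indicator {z. Im z > 0} z / Im z ^ 2) *\<^sub>R h z)"
    and "(\<integral>z. h z \<partial>hyp) = (\<integral>z. (indicator {z. Im z > 0} z / Im z ^ 2) *\<^sub>R h z \<partial>lborel)"
proof -
  have e: "hyp = density lborel (\<lambda>z. ennreal (indicator {z. Im z > 0} z / Im z ^ 2))"
    unfolding hyp_def by (rule arg_cong[where f = "density lborel"]) (auto simp: indicator_def)
  show "integrable hyp h \<longleftrightarrow> integrable lborel (\<lambda>z. (indicator {z. Im z > 0} z / Im z ^ 2) *\<^sub>R h z)"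
    unfolding e by (rule integrable_density) auto
  show "(\<integral>z. h z \<partial>hyp) = (\<integral>z. (indicator {z. Im z > 0} z / Im z ^ 2) *\<^sub>R h z \<partial>lborel)"
    unfolding e by (rule integral_density) auto
qed

text \<open>
  Outside the half-plane \<open>f\<close> is arbitrary; setting it to \<open>0\<close> there makes it Borel measurable.
\<close>

lemma cusp_form_restrict:
  assumes f: "cusp_form N k f"
  defines "f0 \<equiv> \<lambda>z. indicator upper_half_plane z *\<^sub>R f z"
  shows "cusp_form N k f0" and "f0 \<in> borel_measurable borel"
proof -
  have fh: "f holomorphic_on upper_half_plane" using f by (simp add: cusp_form_def)
  have "f0 holomorphic_on upper_half_plane"
    by (rule holomorphic_transform[OF fh]) (simp add: f0_def)
  moreover have "slash k A f0 z = slash k A f z" if "A \<in> SL2Z" "z \<in> upper_half_plane" for A z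
    using Im_moebius_pos[OF that(1), of z] that(2) by (simp add: slash_def f0_def upper_half_plane_def)
  moreover have "f0 z = f z" if "z \<in> upper_half_plane" for z using that by (simp add: f0_def)
  ultimately show "cusp_form N k f0" using f by (simp add: cusp_form_def Gamma_N_SL2Z)
  show "f0 \<in> borel_measurable borel"
    unfolding f0_def
    by (rule borel_measurable_continuous_on_indicator[OF _ holomorphic_on_imp_continuous_on[OF fh]])
      (simp add: open_upper_half_plane borel_open)
qed

text \<open>The scalar \<open>\<kappa>\<close> is constant in \<open>z\<close> and stands for the
  reciprocal Gamma value that separates \<open>L\<close> from the combination of completed series.
  One statement thus covers the family in \<open>s\<close> and the special function.\<close>

lemma petersson_triple_L_zero:
  assumes f: "cusp_form N k f" and N: "N \<ge> 1" and k: "k = w + 2"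
    and lam: "lam \<in> torsion_vectors N" and mu: "mu \<in> torsion_vectors N" and nu: "nu \<in> torsion_vectors N"
    and lmn: "integral_vector (lam + mu + nu)" and abc: "a + b + c = 0"
    and FD: "fundamental_domain (principal_congruence_subgroup N) F"
    and g: "\<And>z. Im z > 0 \<Longrightarrow> g z = \<kappa> * triple_L w lam mu nu a b c t z"
  shows "petersson_converges F k f g \<and> petersson F k f g = 0"
proof -
  define f0 where "f0 = (\<lambda>z. indicator upper_half_plane z *\<^sub>R f z)"
  note f0 = cusp_form_restrict[OF f, folded f0_def]
  note [measurable] = f0(2) fd_measurable[OF FD] triple_L_measurable
  define h where "h z = indicator F z *\<^sub>R (cnj (f0 z) * triple_L w lam mu nu a b c t z * of_real (Im z ^ k))" for z
  have hm: "h \<in> borel_measurable borel" unfolding h_def using fd_measurable[OF FD] by measurable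
  note h = triple_L_integrand[OF f0(1) N k lam mu nu lmn abc f0(2) FD, where t = t, folded h_def]
  have hm': "(\<lambda>z. cnj \<kappa> * cnj (h z)) \<in> borel_measurable borel" using hm by measurable
  have 1: "integrable hyp (\<lambda>z. cnj \<kappa> * cnj (h z))" using h(1) by (intro integrable_mult_right) simp
  have 2: "(\<integral>z. cnj \<kappa> * cnj (h z) \<partial>hyp) = 0" using h(2) by (simp add: integral_cnj)
  have e: "(indicator {z. Im z > 0} z / Im z ^ 2) *\<^sub>R (cnj \<kappa> * cnj (h z)) = indicator F z *\<^sub>R petersson_integrand k f g z" for z
  proof (cases "z \<in> F")
    case True
    then have z: "Im z > 0" by (rule fd_upper[OF FD])
    have "f0 z = f z" using z by (simp add: f0_def upper_half_plane_def)
    then show ?thesis using True z by (simp add: h_def petersson_integrand_def g scaleR_conv_of_real field_simps)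
  qed (simp add: h_def)
  show ?thesis
    using 1 2 unfolding integral_hyp_density[OF hm'] e
    by (simp add: petersson_converges_def petersson_def set_integrable_def set_lebesgue_integral_def)
qed

theorem theorem2p8:
  fixes N k :: nat
    and lam mu nu :: "rat \<times> rat"
    and a b c :: complex
    and f :: "complex \<Rightarrow> complex"
    and F :: "complex set"
  assumes "N \<ge> 1" and "k \<ge> 2"
    and "lam \<in> torsion_vectors N" and "mu \<in> torsion_vectors N" and "nu \<in> torsion_vectors N"
    and "integral_vector (lam + mu + nu)"
    and "a + b + c = 0"
    and "fundamental_domain (principal_congruence_subgroup N) F"
    and "cusp_form N k f"
  shows "(\<forall>s :: complex.
            let g = (\<lambda>z. L_fun (k - 2) lam mu a b z s
                       + L_fun (k - 2) mu nu b c z s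
                       + L_fun (k - 2) nu lam c a z s)
            in petersson_converges F k f g \<and> petersson F k f g = 0)
       \<and> (let g = (\<lambda>z. L_fun0 k lam mu a b z + L_fun0 k mu nu b c z + L_fun0 k nu lam c a z)
            in petersson_converges F k f g \<and> petersson F k f g = 0)"
proof -
  have k: "k = (k - 2) + 2" using assms(2) by simp
  note main = petersson_triple_L_zero[OF assms(9,1) k assms(3-8)]
  show ?thesis
    unfolding Let_def
  proof (intro conjI[of "\<forall>s. _ s"] allI)
    fix s :: complex
    show "petersson_converges F k f (\<lambda>z. L_fun (k - 2) lam mu a b z s + L_fun (k - 2) mu nu b c z s + L_fun (k - 2) nu lam c a z s)
      \<and> petersson F k f (\<lambda>z. L_fun (k - 2) lam mu a b z s + L_fun (k - 2) mu nu b c z s + L_fun (k - 2) nu lam c a z s) = 0"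
      by (rule main[where t = "cnj s" and \<kappa> = "rGamma (cnj s + of_nat (k - 2) + 1)"])
        (simp only: L_fun_eq triple_L_def distrib_left)
  next
    show "petersson_converges F k f (\<lambda>z. L_fun0 k lam mu a b z + L_fun0 k mu nu b c z + L_fun0 k nu lam c a z)
      \<and> petersson F k f (\<lambda>z. L_fun0 k lam mu a b z + L_fun0 k mu nu b c z + L_fun0 k nu lam c a z) = 0"
      by (rule main[where t = 0 and \<kappa> = "rGamma (of_nat (k - 2) + 1)"])
        (simp only: L_fun0_eq[OF _ assms(2)] triple_L_def distrib_left)
  qed
qed

end
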